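(* Let $d\in\{2,3\}$, $s\in[0,\frac d2+1)$, let $\mathcal D\subset\mathbb R^d$ be a bounded domain, let $a\in C_0^\infty(\mathbb R^d)$ be real-valued with $\mathrm{supp}(a)\subset\mathcal D$, and let $h^s=(-\Delta)^{-\frac s2}\dot W$ be the fractional Gaussian field on $\mathbb R^d$ with parameter $s$. Then the random field $$f(x,\omega):=a(x)h^s(x,\omega),\qquad x\in\mathbb R^d,\ \omega\in\Omega,$$ has compact support contained in $\mathcal D$, and its covariance operator $Q_f$ is a classical pseudo-differential operator with principal symbol $\mu(x)|\xi|^{-2s}$, where $\mu=a^2\in C_0^\infty(\mathcal D)$, $\mu\ge 0$.
   Context: White noise: $\dot W$ is the centered Gaussian random distribution on $\mathbb R^d$ (on a complete probability space $(\Omega,\mathcal F,\mathbb P)$) with $\mathbb E[\langle\dot W,\varphi\rangle\langle\dot W,\psi\rangle]=(\varphi,\psi)_{L^2}$ for all $\varphi,\psi\in L^2(\mathbb R^d)$. Fractional Laplacian: $(-\Delta)^{\alpha}u=\mathcal F^{-1}[|\xi|^{2\alpha}\mathcal F[u](\xi)]$, $\alpha\in\mathbb R$, with $\hat\psi(\xi)=\mathcal F[\psi](\xi)=\int_{\mathbb R^d}e^{-\mathrm i x\cdot\xi}\psi(x)\,dx$. Fractional Gaussian field: for $r\ge0$ let $\mathcal S_r$ be the set of Schwartz functions $\varphi$ with $\int x^\alpha\varphi(x)\,dx=0$ for all $|\alpha|\le r$, and $\mathcal S_r=\mathcal S$ for $r<0$. Let $T_s$ be the closure of $\mathcal S_{s-\frac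 d2}$ with respect to the norm $\||\xi|^{-s}\hat\varphi\|_{L^2}$. Then $\langle h^s,\varphi\rangle:=\langle\dot W,(-\Delta)^{-\frac s2}\varphi\rangle$ for $\varphi\in T_s$. Kernel of the covariance of $h^s$: with $H=s-\frac d2$, one has $\mathbb E[\langle h^s,\varphi\rangle\langle h^s,\psi\rangle]=\iint K_{h^s}(x,y)\varphi(x)\psi(y)\,dx\,dy$ for $\varphi,\psi\in C_0^\infty\cap T_s$, where $K_{h^s}(x,y)=\delta(x-y)$ if $s=0$; $K_{h^s}(x,y)=2^{-2s}\pi^{-\frac d2}\frac{\Gamma(\frac d2-s)}{\Gamma(s)}|x-y|^{2H}$ if $s>0$ and $H\ne0$; $K_{h^s}(x,y)=-\frac{2^{-2s+1}\pi^{-\frac d2}}{\Gamma(s)}\ln|x-y|$ if $H=0$. Covariance operator of $f=ah^s$: the pairing is $\langle f,\varphi\rangle=\langle h^s,a\varphi\rangle$, and $Q_f:C_0^\infty\to\mathcal S'$, $\langle\varphi,Q_f\psi\rangle=\mathbb E[\langle f,\varphi\rangle\langle f,\psi\rangle]$, is understood as the operator with Schwartz kernel $K_f(x,y)=a(x)a(y)K_{h^s}(x,y)$ (which represents this expectation whenever $a\varphi,a\psi\in T_s$; for $s<\frac d2$ this is no restriction). "$Q_f$ is a classical pseudo-differential operator with principal symbol $\mu(x)|\xi|^{-2s}$" means $(Q_f\psi)(x)=\frac1{(2\pi)^d}\int_{\mathbb R^d}e^{\mathrm i x\cdot\xi}c(x,\xi)\hat\psi(\xi)\,d\xi$ for $\psi\in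 C_0^\infty$, where $c$ is a classical symbol of order $-2s$ whose leading term (for large $|\xi|$) is $\mu(x)|\xi|^{-2s}$; equivalently $K_f(x,y)=\frac1{(2\pi)^d}\int e^{\mathrm i(x-y)\cdot\xi}c(x,\xi)\,d\xi$. *)

theory Defs
  imports "HOL-Probability.Probability"
begin

section \<open>Smooth functions, test functions, Schwartz functions\<close>

primrec iter_deriv ::
  "'a::euclidean_space list \<Rightarrow> ('a \<Rightarrow> 'b::real_normed_vector) \<Rightarrow> 'a \<Rightarrow> 'b" where
  "iter_deriv [] f = f"
| "iter_deriv (v # vs) f = (\<lambda>x. frechet_derivative (iter_deriv vs f) (at x) v)"

text \<open>Multi-indices are encoded as lists of basis vectors: the list gives the directions in which
  one differentiates, and its length is the order of the derivative.\<close>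

definition smooth :: "('a::euclidean_space \<Rightarrow> 'b::real_normed_vector) \<Rightarrow> bool" where
  "smooth f \<longleftrightarrow> (\<forall>vs. set vs \<subseteq> Basis \<longrightarrow> iter_deriv vs f differentiable_on UNIV)"

definition supp :: "('a::topological_space \<Rightarrow> 'b::zero) \<Rightarrow> 'a set" where
  "supp f = closure {x. f x \<noteq> 0}"

definition test_functions :: "'a::euclidean_space set \<Rightarrow> ('a \<Rightarrow> 'b::real_normed_vector) set" where
  "test_functions U = {\<phi>. smooth \<phi> \<and> compact (supp \<phi>) \<and> supp \<phi> \<subseteq> U}"

definition schwartz :: "('a::euclidean_space \<Rightarrow> 'b::real_normed_vector) set" where
  "schwartz = {\<phi>. smooth \<phi> \<and>
     (\<forall>vs k. set vs \<subseteq> Basis \<longrightarrow> bounded (range (\<lambda>x. norm x ^ k *\<^sub>R iter_deriv vs \<phi> x)))}"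

definition L2 :: "('a::euclidean_space \<Rightarrow> 'b::{real_normed_vector, second_countable_topology}) set" where
  "L2 = {g. g \<in> borel_measurable lborel \<and> integrable lborel (\<lambda>x. (norm (g x))\<^sup>2)}"


section \<open>Fourier transform and fractional Laplacian\<close>

definition fourier :: "('a::euclidean_space \<Rightarrow> complex) \<Rightarrow> 'a \<Rightarrow> complex" where
  "fourier \<psi> \<xi> = (LINT x|lborel. cis (- (x \<bullet> \<xi>)) * \<psi> x)"

definition inv_fourier :: "('a::euclidean_space \<Rightarrow> complex) \<Rightarrow> 'a \<Rightarrow> complex" where
  "inv_fourier \<theta> x =
     complex_of_real (1 / (2 * pi) ^ DIM('a)) * (LINT \<xi>|lborel. cis (x \<bullet> \<xi>) * \<theta> \<xi>)"

text \<open>A distribution is a functional of which only the values on the Schwartz functions matter.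
  Linearity and continuity there are not imposed, since every distribution occurring below
  is given by a function or is the inverse Fourier transform of one, so that both are automatic.\<close>

type_synonym 'a distribution = "('a \<Rightarrow> complex) \<Rightarrow> complex"

definition distr_of :: "('a::euclidean_space \<Rightarrow> complex) \<Rightarrow> 'a distribution" where
  "distr_of v \<theta> = (LINT x|lborel. v x * \<theta> x)"

definition represents :: "('a::euclidean_space \<Rightarrow> complex) \<Rightarrow> 'a distribution \<Rightarrow> bool" where
  "represents v u \<longleftrightarrow> v \<in> borel_measurable lborel \<and>
     (\<forall>\<theta>\<in>schwartz. integrable lborel (\<lambda>x. v x * \<theta> x) \<and> u \<theta> = distr_of v \<theta>)"

definition distr_fourier :: "'a::euclidean_space distribution \<Rightarrow> 'a distribution" where
  "distr_fourier u \<theta> = u (fourier \<theta>)"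

definition distr_inv_fourier :: "'a::euclidean_space distribution \<Rightarrow> 'a distribution" where
  "distr_inv_fourier u \<theta> = u (inv_fourier \<theta>)"

text \<open>Meaningful for distributions whose Fourier transform is a function; that function is
  determined up to a null set.\<close>

definition frac_laplacian :: "real \<Rightarrow> 'a::euclidean_space distribution \<Rightarrow> 'a distribution" where
  "frac_laplacian \<alpha> u = distr_inv_fourier (distr_of
     (\<lambda>\<xi>. complex_of_real (norm \<xi> powr (2 * \<alpha>)) * (SOME v. represents v (distr_fourier u)) \<xi>))"


section \<open>White noise and the fractional Gaussian field\<close>

definition centered_gaussian :: "'w measure \<Rightarrow> ('w \<Rightarrow> real) \<Rightarrow> bool" where
  "centered_gaussian M X \<longleftrightarrow> X \<in> borel_measurable M \<and>
     ((AE \<omega> in M. X \<omega> = 0) \<or> (\<exists>\<sigma>>0. distributed M lborel X (normal_density 0 \<sigma>)))"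

text \<open>Joint Gaussianity of finitely many values follows from linearity.\<close>

definition white_noise ::
  "'w measure \<Rightarrow> (('a::euclidean_space \<Rightarrow> real) \<Rightarrow> 'w \<Rightarrow> real) \<Rightarrow> bool" where
  "white_noise M W \<longleftrightarrow>
     (\<forall>\<phi>\<in>L2. centered_gaussian M (W \<phi>)) \<and>
     (\<forall>\<phi>\<in>L2. \<forall>\<psi>\<in>L2. \<forall>c. AE \<omega> in M. W (\<lambda>x. c * \<phi> x + \<psi> x) \<omega> = c * W \<phi> \<omega> + W \<psi> \<omega>) \<and>
     (\<forall>\<phi>\<in>L2. \<forall>\<psi>\<in>L2. (LINT \<omega>|M. W \<phi> \<omega> * W \<psi> \<omega>) = (LINT x|lborel. \<phi> x * \<psi> x))"

text \<open>For negative \<open>r\<close> no multi-index satisfies the bound, and one gets all Schwartz functions.\<close>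

definition schwartz_moments :: "real \<Rightarrow> (real ^ 'd \<Rightarrow> real) set" where
  "schwartz_moments r = {\<phi> \<in> schwartz. \<forall>\<alpha> :: 'd \<Rightarrow> nat. real (\<Sum>i\<in>UNIV. \<alpha> i) \<le> r \<longrightarrow>
     (LINT x|lborel. (\<Prod>i\<in>UNIV. (x $ i) ^ \<alpha> i) * \<phi> x) = 0}"

text \<open>The closure is taken among the distributions \<open>u\<close> whose Fourier transform is a
  function \<open>v\<close>; this is the concrete model of the completion.\<close>

definition T_space :: "real \<Rightarrow> (real ^ 'd) distribution set" where
  "T_space s = {u. \<exists>v. represents v (distr_fourier u) \<and>
     (\<forall>\<epsilon>>0. \<exists>\<phi> \<in> schwartz_moments (s - real CARD('d) / 2).
        (\<integral>\<^sup>+\<xi>. ennreal ((norm \<xi> powr (- s) *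
            norm (v \<xi> - fourier (\<lambda>x. complex_of_real (\<phi> x)) \<xi>))\<^sup>2) \<partial>lborel) < ennreal (\<epsilon>\<^sup>2))}"

text \<open>\<open>\<langle>h\<^sup>s, u\<rangle>\<close> for \<open>u \<in> T_space s\<close>: the argument of the white noise is the real \<open>L\<^sup>2\<close> function
  (unique up to a null set) representing \<open>(-\<Delta>)\<close> to the power \<open>-s/2\<close> applied to \<open>u\<close>.\<close>

definition fgf :: "((real ^ 'd \<Rightarrow> real) \<Rightarrow> 'w \<Rightarrow> real) \<Rightarrow> real \<Rightarrow>
    (real ^ 'd) distribution \<Rightarrow> 'w \<Rightarrow> real" where
  "fgf W s u = W (SOME g. g \<in> L2 \<and>
     represents (\<lambda>x. complex_of_real (g x)) (frac_laplacian (- s / 2) u))"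


section \<open>Generalized random fields\<close>

definition mult_field :: "(real ^ 'd \<Rightarrow> real) \<Rightarrow> ((real ^ 'd) distribution \<Rightarrow> 'w \<Rightarrow> real) \<Rightarrow>
    (real ^ 'd \<Rightarrow> real) \<Rightarrow> 'w \<Rightarrow> real" where
  "mult_field a h \<phi> = h (distr_of (\<lambda>x. complex_of_real (a x * \<phi> x)))"

definition mult_field_dom :: "(real ^ 'd \<Rightarrow> real) \<Rightarrow> (real ^ 'd) distribution set \<Rightarrow>
    (real ^ 'd \<Rightarrow> real) set" where
  "mult_field_dom a T =
     {\<phi> \<in> test_functions UNIV. distr_of (\<lambda>x. complex_of_real (a x * \<phi> x)) \<in> T}"

text \<open>The support of a functional \<open>F\<close> defined on the test functions in \<open>A\<close>: the complement
  of the union of all open sets on which \<open>F\<close> is defined and vanishes.\<close>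

definition field_support :: "(real ^ 'd \<Rightarrow> real) set \<Rightarrow> ((real ^ 'd \<Rightarrow> real) \<Rightarrow> real) \<Rightarrow>
    (real ^ 'd) set" where
  "field_support A F = - \<Union>{U. open U \<and> (\<forall>\<phi>\<in>test_functions U. \<phi> \<in> A \<and> F \<phi> = 0)}"

definition covariance_operator :: "'w measure \<Rightarrow> (real ^ 'd \<Rightarrow> real) set \<Rightarrow>
    ((real ^ 'd \<Rightarrow> real) \<Rightarrow> 'w \<Rightarrow> real) \<Rightarrow>
    ((real ^ 'd \<Rightarrow> complex) \<Rightarrow> real ^ 'd \<Rightarrow> complex) \<Rightarrow> bool" where
  "covariance_operator M A f Q \<longleftrightarrow> (\<forall>\<phi>\<in>A. \<forall>\<psi>\<in>A.
     let \<psi>' = (\<lambda>y. complex_of_real (\<psi> y)) in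
     integrable M (\<lambda>\<omega>. f \<phi> \<omega> * f \<psi> \<omega>) \<and>
     integrable lborel (\<lambda>x. complex_of_real (\<phi> x) * Q \<psi>' x) \<and>
     complex_of_real (LINT \<omega>|M. f \<phi> \<omega> * f \<psi> \<omega>) =
       (LINT x|lborel. complex_of_real (\<phi> x) * Q \<psi>' x))"

definition fgf_kernel :: "real \<Rightarrow> real ^ 'd \<Rightarrow> real ^ 'd \<Rightarrow> real" where
  "fgf_kernel s x y = (let d = real CARD('d); H = s - d / 2 in
     if H = 0 then - (2 powr (- 2 * s + 1) * pi powr (- d / 2) / Gamma s) * ln (norm (x - y))
     else 2 powr (- 2 * s) * pi powr (- d / 2) * (Gamma (d / 2 - s) / Gamma s)
            * norm (x - y) powr (2 * H))"

text \<open>The operator with Schwartz kernel \<open>K\<close> of \<open>h\<^sup>s\<close>; for \<open>s = 0\<close> the kernel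
  is \<open>\<delta>(x - y)\<close>, that is, the operator is the identity.\<close>

definition fgf_kernel_op :: "real \<Rightarrow> (real ^ 'd \<Rightarrow> complex) \<Rightarrow> real ^ 'd \<Rightarrow> complex" where
  "fgf_kernel_op s \<psi> x =
     (if s = 0 then \<psi> x else LINT y|lborel. complex_of_real (fgf_kernel s x y) * \<psi> y)"

text \<open>The operator with Schwartz kernel \<open>a(x) a(y) K(x, y)\<close>.\<close>

definition cov_op :: "(real ^ 'd \<Rightarrow> real) \<Rightarrow> real \<Rightarrow>
    (real ^ 'd \<Rightarrow> complex) \<Rightarrow> real ^ 'd \<Rightarrow> complex" where
  "cov_op a s \<psi> x =
     complex_of_real (a x) * fgf_kernel_op s (\<lambda>y. complex_of_real (a y) * \<psi> y) x"


section \<open>Classical pseudo-differential operators\<close>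

definition symbol_class :: "real \<Rightarrow> ('a::euclidean_space \<times> 'a \<Rightarrow> complex) set" where
  "symbol_class m = {c. smooth c \<and>
     (\<forall>vs ws. set vs \<subseteq> Basis \<longrightarrow> set ws \<subseteq> Basis \<longrightarrow>
       (\<exists>C. \<forall>x \<xi>. norm (iter_deriv (map (\<lambda>v. (v, 0)) vs @ map (\<lambda>w. (0, w)) ws) c (x, \<xi>))
                    \<le> C * (1 + norm \<xi>) powr (m - real (length ws))))}"

text \<open>\<open>c\<close> has an asymptotic expansion into terms positively homogeneous in \<open>\<xi>\<close> of degrees
  \<open>m, m - 1, ...\<close> for \<open>norm \<xi> \<ge> 1\<close>, whose leading term is \<open>p\<close> there. For \<open>N = 0\<close> the last
  condition says that \<open>c\<close> is a symbol of order \<open>m\<close>.\<close>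

definition classical_symbol ::
  "real \<Rightarrow> ('a::euclidean_space \<Rightarrow> 'a \<Rightarrow> complex) \<Rightarrow> ('a \<times> 'a \<Rightarrow> complex) \<Rightarrow> bool" where
  "classical_symbol m p c \<longleftrightarrow> (\<exists>cs :: nat \<Rightarrow> 'a \<times> 'a \<Rightarrow> complex.
     (\<forall>x \<xi>. norm \<xi> \<ge> 1 \<longrightarrow> cs 0 (x, \<xi>) = p x \<xi>) \<and>
     (\<forall>j. cs j \<in> symbol_class (m - real j) \<and>
       (\<forall>x \<xi> t. norm \<xi> \<ge> 1 \<longrightarrow> t \<ge> 1 \<longrightarrow>
          cs j (x, t *\<^sub>R \<xi>) = complex_of_real (t powr (m - real j)) * cs j (x, \<xi>))) \<and>
     (\<forall>N. (\<lambda>z. c z - (\<Sum>j<N. cs j z)) \<in> symbol_class (m - real N)))"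

definition pdo :: "('a::euclidean_space \<times> 'a \<Rightarrow> complex) \<Rightarrow> ('a \<Rightarrow> complex) \<Rightarrow> 'a \<Rightarrow> complex" where
  "pdo c \<psi> x = inv_fourier (\<lambda>\<xi>. c (x, \<xi>) * fourier \<psi> \<xi>) x"

definition classical_pdo :: "real \<Rightarrow> ('a::euclidean_space \<Rightarrow> 'a \<Rightarrow> complex) \<Rightarrow>
    (('a \<Rightarrow> complex) \<Rightarrow> 'a \<Rightarrow> complex) \<Rightarrow> bool" where
  "classical_pdo m p Q \<longleftrightarrow>
     (\<exists>c. classical_symbol m p c \<and> (\<forall>\<psi>\<in>test_functions UNIV. \<forall>x. Q \<psi> x = pdo c \<psi> x))"

end

theory Submission
  imports Defs
begin

text \<open>
  Cut off away from the origin, the kernel of \<open>h\<^sup>s\<close> is a function \<open>k(x - y)\<close> whose Fourier transform is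
  \<open>norm \<xi> powr (- 2 * s)\<close> for large \<open>\<xi>\<close>, up to a rapidly decreasing function. Both the kernel and
  \<open>norm \<xi> powr (- 2 * s)\<close> are superpositions of Gaussians \<open>exp (- t * r\<^sup>2)\<close>; the Fourier transform replaces
  \<open>t\<close> by \<open>1 / t\<close>, up to constants, and the part of the superposition with small \<open>t\<close> on one side
  corresponds to the part with large \<open>t\<close> on the other. Splitting at \<open>t = 1\<close> gives incomplete Gamma
  functions, one smooth and one of rapid decrease, and treats all \<open>s\<close> (also the logarithmic case) alike.
  The full symbol of the covariance operator is
  \<open>c(x, \<xi>) = a(x) * fourier (\<lambda>z. a(x - z) * k(z)) \<xi>\<close>, an oscillatory integral of \<open>fourier k (\<xi> + \<eta>)\<close> against
  \<open>fourier a \<eta>\<close>; the Taylor expansion of \<open>fourier k (\<xi> + \<eta>)\<close> at \<open>\<xi>\<close> yields the homogeneous terms.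

  For the covariance, membership in \<open>T_space s\<close> with \<open>s \<ge> d/2\<close> forces \<open>fourier u 0 = 0\<close>, as otherwise
  \<open>norm \<xi> powr (- s) * fourier u \<xi>\<close> is at infinite distance from the transforms of functions with
  vanishing integral. Since \<open>s < d/2 + 1\<close>, this makes \<open>norm \<xi> powr (- s) * fourier u \<xi>\<close> both integrable and
  square integrable, so that the white noise is evaluated at its inverse Fourier transform and the Plancherel
  theorem applies. The resulting quadratic form is turned into the one of the kernel by the same superposition of
  Gaussians, the vanishing integral absorbing the regularization.
\<close>

section \<open>Differential calculus adapted to symbol estimates\<close>

section \<open>Derivative bounds for smooth functions\<close>

text \<open>Differentiability is proved by induction on the number n of controlled derivatives, with
  the function and the order generalised. This replaces Leibniz formulas over multi-indices:
  families closed under differentiation up to polynomial factors (powers of the norm, incomplete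
  Gamma functions, oscillatory integrals) need one product rule per step.

  The bound s < d/2 + 1 means \<sigma> = d/2 - s > -1. Then subtracting the constant 1 once
  regularizes the superposition of Gaussians, and the kernel is recovered up to one additive
  constant. That constant does no harm: times a smooth cutoff it has a rapidly decreasing transform,
  and for s \<ge> d/2 it is annihilated by functions with vanishing integral.

  The field is defined through choices of representing functions (\<open>SOME\<close>), and white
  noise acts on functions, not on classes. Hence these functions are identified only up to null
  sets, and second moments are compared. Since test functions are uncountable, the almost sure
  statement about the support needs one null set for all of them.\<close>

definition partial_deriv :: "'a::euclidean_space \<Rightarrow> ('a \<Rightarrow> 'b::real_normed_vector) \<Rightarrow> 'a \<Rightarrow> 'b" where
  "partial_deriv v f x = frechet_derivative f (at x) v"

lemma partial_deriv_eq: "(f has_derivative f') (at x) \<Longrightarrow> partial_deriv v f x = f' v"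
  unfolding partial_deriv_def by (metis frechet_derivative_at)

lemma partial_deriv_const [simp]: "partial_deriv v (\<lambda>_. c) = (\<lambda>_. 0)"
  by (rule ext, subst partial_deriv_eq[OF has_derivative_const]) simp

lemma iter_deriv_Cons: "iter_deriv (v # vs) f = partial_deriv v (iter_deriv vs f)"
  by (simp add: partial_deriv_def fun_eq_iff)

lemma iter_deriv_append: "iter_deriv (vs @ ws) f = iter_deriv vs (iter_deriv ws f)"
proof (induction vs)
  case (Cons v vs)
  have "iter_deriv ((v # vs) @ ws) f = partial_deriv v (iter_deriv (vs @ ws) f)"
    by (simp only: append_Cons iter_deriv_Cons)
  then show ?case by (simp only: Cons.IH iter_deriv_Cons)
qed simp

text \<open>\<open>B m\<close> is the bound required of a function of order \<open>m\<close>; differentiating in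
  direction \<open>v\<close> lowers the order by \<open>w v\<close>, and \<open>n\<close> derivatives are controlled.\<close>

primrec bounded_derivs :: "(real \<Rightarrow> ('a::euclidean_space \<Rightarrow> 'b::real_normed_vector) \<Rightarrow> bool) \<Rightarrow>
    ('a \<Rightarrow> real) \<Rightarrow> nat \<Rightarrow> real \<Rightarrow> ('a \<Rightarrow> 'b) \<Rightarrow> bool" where
  "bounded_derivs B w 0 m f \<longleftrightarrow> B m f"
| "bounded_derivs B w (Suc n) m f \<longleftrightarrow> B m f \<and> (\<forall>x. f differentiable (at x)) \<and>
     (\<forall>v\<in>Basis. bounded_derivs B w n (m - w v) (partial_deriv v f))"

lemma bounded_derivsD: "bounded_derivs B w n m f \<Longrightarrow> B m f"
  by (cases n) auto

lemma bounded_derivs_has_derivative: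
  "bounded_derivs B w (Suc n) m f \<Longrightarrow> (f has_derivative (\<lambda>v. partial_deriv v f x)) (at x)"
  by (simp add: partial_deriv_def frechet_derivative_works[symmetric])

lemma bounded_derivs_partial:
  "bounded_derivs B w (Suc n) m f \<Longrightarrow> v \<in> Basis \<Longrightarrow>
    bounded_derivs B w n (m - w v) (partial_deriv v f)"
  by auto

text \<open>The derivative is supplied as an explicit linear map f', which by uniqueness computes
  every \<open>partial_deriv\<close>; inductions then never have to evaluate
  \<open>frechet_derivative\<close>.\<close>

lemma bounded_derivs_SucI:
  assumes "B m f" and d: "\<And>x. (f has_derivative f' x) (at x)"
    and "\<And>v. v \<in> Basis \<Longrightarrow> bounded_derivs B w n (m - w v) (\<lambda>x. f' x v)"
  shows "bounded_derivs B w (Suc n) m f"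
proof -
  have "partial_deriv v f = (\<lambda>x. f' x v)" for v
    using partial_deriv_eq[OF d] by auto
  then show ?thesis using assms by (auto simp: differentiable_def)
qed

lemma bounded_derivs_Suc: "bounded_derivs B w (Suc n) m f \<Longrightarrow> bounded_derivs B w n m f"
proof (induction n arbitrary: m f)
  case (Suc n)
  then show ?case by (metis bounded_derivs.simps(2))
qed simp

lemma bounded_derivs_iter_deriv:
  "bounded_derivs B w (n + length vs) m f \<Longrightarrow> set vs \<subseteq> Basis \<Longrightarrow>
    bounded_derivs B w n (m - sum_list (map w vs)) (iter_deriv vs f)"
proof (induction vs arbitrary: n)
  case (Cons v vs)
  then have "bounded_derivs B w (Suc n) (m - sum_list (map w vs)) (iter_deriv vs f)"
    by (intro Cons.IH) auto
  from bounded_derivs_partial[OF this, of v] Cons.prems show ?case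
    by (simp add: iter_deriv_Cons algebra_simps del: iter_deriv.simps)
qed simp

text \<open>The two bound predicates may differ in codomain, which lets smoothness pass between real
  and complex functions along \<open>complex_of_real\<close> and \<open>Re\<close>.\<close>

lemma bounded_derivs_bounded_linear:
  assumes h: "bounded_linear h" and B: "\<And>m f. B m f \<Longrightarrow> B' m (\<lambda>x. h (f x))"
  shows "bounded_derivs B w n m f \<Longrightarrow> bounded_derivs B' w n m (\<lambda>x. h (f x))"
proof (induction n arbitrary: m f)
  case 0 then show ?case using B by auto
next
  case (Suc n)
  show ?case
  proof (rule bounded_derivs_SucI)
    show "B' m (\<lambda>x. h (f x))" using Suc.prems B by auto
    show "((\<lambda>x. h (f x)) has_derivative (\<lambda>v. h (partial_deriv v f x))) (at x)" for x
      by (rule bounded_linear.has_derivative[OF h bounded_derivs_has_derivative[OF Suc.prems]])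
    show "v \<in> Basis \<Longrightarrow> bounded_derivs B' w n (m - w v) (\<lambda>x. h (partial_deriv v f x))" for v
      by (rule Suc.IH[OF bounded_derivs_partial[OF Suc.prems]])
  qed
qed

text \<open>The closure properties of a scale of bounds that the sum and product rules consume.
  Three instances occur: the trivial bound (differentiability only), powers of 1 + norm x, and
  powers of 1 + norm \<xi> for functions of (x, \<xi>).\<close>

locale symbol_bound =
  fixes B :: "real \<Rightarrow> ('a::euclidean_space \<Rightarrow> complex) \<Rightarrow> bool" and w :: "'a \<Rightarrow> real"
  assumes B_const: "B 0 (\<lambda>_. c)"
    and B_zero: "B m (\<lambda>_. 0)"
    and B_add: "B m f \<Longrightarrow> B m g \<Longrightarrow> B m (\<lambda>x. f x + g x)"
    and B_mult: "B m f \<Longrightarrow> B k g \<Longrightarrow> B (m + k) (\<lambda>x. f x * g x)"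
    and B_mono: "B m f \<Longrightarrow> m \<le> k \<Longrightarrow> B k f"
begin

abbreviation BD where "BD \<equiv> bounded_derivs B w"

lemma zero: "BD n m (\<lambda>_. 0)"
  by (induction n arbitrary: m) (auto intro: B_zero)

lemma const: "BD n 0 (\<lambda>_. c)"
  by (cases n) (auto intro: B_const zero)

lemma mono: "BD n m f \<Longrightarrow> m \<le> k \<Longrightarrow> BD n k f"
proof (induction n arbitrary: m k f)
  case 0 then show ?case using B_mono by auto
next
  case (Suc n)
  have "m - w v \<le> k - w v" for v using Suc.prems by simp
  then show ?case using Suc B_mono by (metis bounded_derivs.simps(2))
qed

lemma add: "BD n m f \<Longrightarrow> BD n m g \<Longrightarrow> BD n m (\<lambda>x. f x + g x)"
proof (induction n arbitrary: m f g)
  case 0 then show ?case using B_add by auto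
next
  case (Suc n)
  show ?case
  proof (rule bounded_derivs_SucI)
    show "B m (\<lambda>x. f x + g x)" using Suc.prems B_add by auto
    show "((\<lambda>x. f x + g x) has_derivative (\<lambda>v. partial_deriv v f x + partial_deriv v g x)) (at x)" for x
      by (intro has_derivative_add bounded_derivs_has_derivative[OF Suc.prems(1)]
          bounded_derivs_has_derivative[OF Suc.prems(2)])
    show "v \<in> Basis \<Longrightarrow> BD n (m - w v) (\<lambda>x. partial_deriv v f x + partial_deriv v g x)" for v
      by (rule Suc.IH[OF bounded_derivs_partial[OF Suc.prems(1)] bounded_derivs_partial[OF Suc.prems(2)]])
  qed
qed

lemma mult: "BD n m f \<Longrightarrow> BD n k g \<Longrightarrow> BD n (m + k) (\<lambda>x. f x * g x)"
proof (induction n arbitrary: m k f g)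
  case 0 then show ?case using B_mult by auto
next
  case (Suc n)
  show ?case
  proof (rule bounded_derivs_SucI)
    show "B (m + k) (\<lambda>x. f x * g x)" using Suc.prems B_mult by auto
    show "((\<lambda>x. f x * g x) has_derivative (\<lambda>v. f x * partial_deriv v g x + partial_deriv v f x * g x)) (at x)" for x
      by (intro has_derivative_mult bounded_derivs_has_derivative[OF Suc.prems(1)]
          bounded_derivs_has_derivative[OF Suc.prems(2)])
    fix v :: 'a assume v: "v \<in> Basis"
    \<comment> \<open>In each Leibniz term exactly one factor loses the order \<open>w v\<close>;
      the other factor is used undifferentiated, with one controlled derivative less.\<close>
    have "BD n (m + (k - w v)) (\<lambda>x. f x * partial_deriv v g x)"
      "BD n ((m - w v) + k) (\<lambda>x. partial_deriv v f x * g x)"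
      using bounded_derivs_partial[OF Suc.prems(1) v] bounded_derivs_partial[OF Suc.prems(2) v]
        bounded_derivs_Suc[OF Suc.prems(1)] bounded_derivs_Suc[OF Suc.prems(2)] by (auto intro!: Suc.IH)
    then show "BD n (m + k - w v) (\<lambda>x. f x * partial_deriv v g x + partial_deriv v f x * g x)"
      by (auto intro!: add simp: algebra_simps)
  qed
qed

lemma cmult: "BD n m f \<Longrightarrow> BD n m (\<lambda>x. c * f x)"
  using mult[OF const[of n c], of m f] by simp

lemma sum: "(\<And>i. i \<in> I \<Longrightarrow> BD n m (f i)) \<Longrightarrow> BD n m (\<lambda>x. \<Sum>i\<in>I. f i x)"
  by (induction I rule: infinite_finite_induct) (auto intro: zero add)

lemma diff: "BD n m f \<Longrightarrow> BD n m g \<Longrightarrow> BD n m (\<lambda>x. f x - g x)"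
  using add[OF _ cmult[of n m g "-1"], of f] by simp

end

definition weight_bound :: "('a \<Rightarrow> real) \<Rightarrow> real \<Rightarrow> ('a \<Rightarrow> 'b::real_normed_vector) \<Rightarrow> bool" where
  "weight_bound W m f \<longleftrightarrow> (\<exists>C. \<forall>x. norm (f x) \<le> C * W x powr m)"

text \<open>\<open>weight_bound\<close> admits any real C; its absolute value is the nonnegative
  constant needed whenever two bounds are multiplied.\<close>

lemma weight_boundE:
  assumes "weight_bound W m f"
  obtains C where "C \<ge> 0" "\<And>x. norm (f x) \<le> C * W x powr m"
proof -
  from assms obtain C where C: "\<And>x. norm (f x) \<le> C * W x powr m"
    by (auto simp: weight_bound_def)
  have "norm (f x) \<le> \<bar>C\<bar> * W x powr m" for x
    by (rule order.trans[OF C]) (intro mult_right_mono, auto)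
  then show ?thesis by (intro that[of "\<bar>C\<bar>"]) auto
qed

text \<open>W \<ge> 1 enters through monotonicity: then \<open>W x powr m\<close> increases with m,
  so a function of order m also has every larger order.\<close>

lemma symbol_bound_weight:
  fixes W :: "'a::euclidean_space \<Rightarrow> real"
  assumes W: "\<And>x. W x \<ge> 1"
  shows "symbol_bound (weight_bound W)"
proof
  have W0: "W x \<noteq> 0" for x using W[of x] by simp
  show "weight_bound W 0 (\<lambda>_. c)" for c
    using W0 by (auto simp: weight_bound_def intro!: exI[of _ "norm c"])
  show "weight_bound W m (\<lambda>_. 0)" for m
    by (auto simp: weight_bound_def intro!: exI[of _ 0])
  fix m k and f g :: "'a \<Rightarrow> complex"
  show "weight_bound W m (\<lambda>x. f x + g x)" if fg: "weight_bound W m f" "weight_bound W m g"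
  proof -
    obtain C D where "\<And>x. norm (f x) \<le> C * W x powr m" "\<And>x. norm (g x) \<le> D * W x powr m"
      using fg by (auto simp: weight_bound_def)
    then have "norm (f x + g x) \<le> (C + D) * W x powr m" for x
      by (simp add: distrib_right norm_triangle_mono)
    then show ?thesis by (auto simp: weight_bound_def)
  qed
  show "weight_bound W (m + k) (\<lambda>x. f x * g x)" if fg: "weight_bound W m f" "weight_bound W k g"
  proof -
    obtain C D where *: "C \<ge> 0" "D \<ge> 0"
      "\<And>x. norm (f x) \<le> C * W x powr m" "\<And>x. norm (g x) \<le> D * W x powr k"
      using fg by (meson weight_boundE)
    have "norm (f x * g x) \<le> (C * W x powr m) * (D * W x powr k)" for x
      unfolding norm_mult by (rule mult_mono) (use * in auto)
    then have "norm (f x * g x) \<le> (C * D) * W x powr (m + k)" for x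
      using W0[of x] by (simp add: powr_add mult_ac)
    then show ?thesis by (auto simp: weight_bound_def)
  qed
  show "weight_bound W k f" if mk: "weight_bound W m f" "m \<le> k"
  proof -
    obtain C where C: "C \<ge> 0" "\<And>x. norm (f x) \<le> C * W x powr m"
      using mk(1) by (meson weight_boundE)
    have "norm (f x) \<le> C * W x powr k" for x
      by (rule order.trans[OF C(2)]) (use C(1) mk(2) W[of x] in \<open>auto intro!: mult_left_mono powr_mono\<close>)
    then show ?thesis by (auto simp: weight_bound_def)
  qed
qed

section \<open>Smooth functions\<close>

text \<open>With the trivial bound and no loss of order, only n-fold differentiability remains;
  required for all n, it is smoothness.\<close>

abbreviation Ck :: "nat \<Rightarrow> ('a::euclidean_space \<Rightarrow> 'b::real_normed_vector) \<Rightarrow> bool" where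
  "Ck n f \<equiv> bounded_derivs (\<lambda>_ _. True) (\<lambda>_. 0) n 0 f"

interpretation Ck: symbol_bound "\<lambda>_ _. True" "\<lambda>_. 0"
  by unfold_locales auto

lemma bounded_derivs_imp_Ck: "bounded_derivs B w n m f \<Longrightarrow> Ck n f"
proof (induction n arbitrary: m f)
  case (Suc n)
  then show ?case by (auto intro: Suc.IH)
qed simp

lemma smooth_partial_deriv: "smooth f \<Longrightarrow> v \<in> Basis \<Longrightarrow> smooth (partial_deriv v f)"
  unfolding smooth_def
proof (intro allI impI)
  fix vs :: "'a list" assume *: "\<forall>vs. set vs \<subseteq> Basis \<longrightarrow> iter_deriv vs f differentiable_on UNIV"
    "v \<in> Basis" "set vs \<subseteq> Basis"
  have "iter_deriv vs (partial_deriv v f) = iter_deriv (vs @ [v]) f"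
    by (simp add: iter_deriv_append partial_deriv_def fun_eq_iff cong: arg_cong[where f="iter_deriv vs"])
       (simp add: partial_deriv_def[abs_def])
  then show "iter_deriv vs (partial_deriv v f) differentiable_on UNIV" using * by simp
qed

lemma smooth_imp_Ck: "smooth f \<Longrightarrow> Ck n f"
proof (induction n arbitrary: f)
  case (Suc n)
  have "iter_deriv [] f differentiable_on UNIV" using Suc.prems unfolding smooth_def by (elim allE[of _ "[]"]) simp
  then show ?case using Suc smooth_partial_deriv[OF Suc.prems] by (auto simp: differentiable_on_def)
qed simp

lemma smooth_iff_Ck: "smooth f \<longleftrightarrow> (\<forall>n. Ck n f)"
proof
  assume *: "\<forall>n. Ck n f"
  show "smooth f" unfolding smooth_def
  proof (intro allI impI)
    fix vs :: "'a list" assume "set vs \<subseteq> Basis"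
    then have "Ck 1 (iter_deriv vs f)"
      using bounded_derivs_iter_deriv[of "\<lambda>_ _. True" "\<lambda>_. 0" 1 vs 0 f] * by (simp add: map_replicate_const)
    then show "iter_deriv vs f differentiable_on UNIV" by (auto simp: differentiable_on_def)
  qed
qed (auto intro: smooth_imp_Ck)

lemma smooth_has_derivative: "smooth f \<Longrightarrow> (f has_derivative (\<lambda>v. partial_deriv v f x)) (at x)"
  by (rule bounded_derivs_has_derivative[OF smooth_imp_Ck[of _ "Suc 0"]])

lemma smooth_continuous: "smooth f \<Longrightarrow> continuous_on UNIV f"
  by (metis smooth_has_derivative has_derivative_continuous continuous_at_imp_continuous_on)

lemma smooth_iter_deriv: "smooth f \<Longrightarrow> set vs \<subseteq> Basis \<Longrightarrow> smooth (iter_deriv vs f)"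
proof (induction vs)
  case (Cons v vs)
  then show ?case by (simp add: iter_deriv_Cons smooth_partial_deriv del: iter_deriv.simps)
qed simp

lemma has_derivative_partial_sum:
  fixes f :: "'a::euclidean_space \<Rightarrow> 'b::real_normed_vector"
  assumes "(f has_derivative (\<lambda>v. partial_deriv v f x)) (at x)"
  shows "partial_deriv v f x = (\<Sum>b\<in>Basis. (v \<bullet> b) *\<^sub>R partial_deriv b f x)"
proof -
  interpret L: bounded_linear "\<lambda>v. partial_deriv v f x" using assms by (rule has_derivative_bounded_linear)
  have "partial_deriv (\<Sum>b\<in>Basis. (v \<bullet> b) *\<^sub>R b) f x = (\<Sum>b\<in>Basis. (v \<bullet> b) *\<^sub>R partial_deriv b f x)"
    by (simp add: L.sum L.scaleR)
  then show ?thesis by (simp add: euclidean_representation)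
qed

section \<open>Integrals depending on a parameter\<close>

text \<open>Differentiation under the integral sign for a parameter in a normed space. The mean
  value inequality bounds the difference quotients by 2 * g, so dominated convergence
  applies.\<close>

lemma has_derivative_integral:
  fixes f :: "'x::real_normed_vector \<Rightarrow> 'z \<Rightarrow> 'b::{banach, second_countable_topology}"
  assumes int: "\<And>x. dist x x0 < r \<Longrightarrow> integrable M (f x)"
    and d: "\<And>x z. z \<in> space M \<Longrightarrow> dist x x0 < r \<Longrightarrow> ((\<lambda>x. f x z) has_derivative f' x z) (at x)"
    and meas: "\<And>h. (\<lambda>z. f' x0 z h) \<in> borel_measurable M"
    and g: "integrable M g" and r: "r > 0"
    and dom: "\<And>x z h. z \<in> space M \<Longrightarrow> dist x x0 < r \<Longrightarrow> norm (f' x z h) \<le> g z * norm h"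
  shows "((\<lambda>x. \<integral>z. f x z \<partial>M) has_derivative (\<lambda>h. \<integral>z. f' x0 z h \<partial>M)) (at x0)"
proof -
  have bl: "bounded_linear (f' x0 z)" if "z \<in> space M" for z
    using d[OF that, of x0] r by (auto dest: has_derivative_bounded_linear)
  have intf': "integrable M (\<lambda>z. f' x0 z h)" for h
    by (rule Bochner_Integration.integrable_bound[of M "\<lambda>z. g z * norm h"], unfold real_norm_def)
       (use meas g dom[of _ x0 h] r in \<open>auto intro!: AE_I2 intro: order.trans[OF _ abs_ge_self]\<close>)
  have blI: "bounded_linear (\<lambda>h. \<integral>z. f' x0 z h \<partial>M)"
  proof (rule bounded_linear_intro)
    fix h k c
    show "(\<integral>z. f' x0 z (h + k) \<partial>M) = (\<integral>z. f' x0 z h \<partial>M) + (\<integral>z. f' x0 z k \<partial>M)"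
      by (subst Bochner_Integration.integral_add[symmetric])
         (auto intro!: Bochner_Integration.integral_cong intf' simp: linear_simps[OF bl])
    show "(\<integral>z. f' x0 z (c *\<^sub>R h) \<partial>M) = c *\<^sub>R (\<integral>z. f' x0 z h \<partial>M)"
    proof -
      have "(\<integral>z. f' x0 z (c *\<^sub>R h) \<partial>M) = (\<integral>z. c *\<^sub>R f' x0 z h \<partial>M)"
        by (rule Bochner_Integration.integral_cong) (auto simp: linear_simps[OF bl])
      then show ?thesis by simp
    qed
    have "norm (\<integral>z. f' x0 z h \<partial>M) \<le> (\<integral>z. norm (f' x0 z h) \<partial>M)"
      by (rule integral_norm_bound)
    also have "\<dots> \<le> (\<integral>z. g z * norm h \<partial>M)"
      by (rule integral_mono) (use intf' g dom r in auto)
    finally show "norm (\<integral>z. f' x0 z h \<partial>M) \<le> norm h * (\<integral>z. g z \<partial>M)" by (simp add: mult.commute)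
  qed
  \<comment> \<open>The limit is tested along sequences S, as dominated convergence requires; the
    first N terms are dropped to stay in the ball of radius r.\<close>
  have "(\<lambda>h. norm ((\<integral>z. f (x0 + h) z \<partial>M) - (\<integral>z. f x0 z \<partial>M) - (\<integral>z. f' x0 z h \<partial>M)) / norm h) \<midarrow>0\<rightarrow> 0"
    unfolding LIMSEQ_SEQ_conv[symmetric]
  proof (intro allI impI, elim conjE)
    fix S :: "nat \<Rightarrow> 'x" assume S0: "\<forall>n. S n \<noteq> 0" and Sl: "S \<longlonglongrightarrow> 0"
    obtain N where N: "\<And>n. n \<ge> N \<Longrightarrow> norm (S n) < r"
      using LIMSEQ_D[OF Sl r] by auto
    define q where "q n z = (f (x0 + S n) z - f x0 z - f' x0 z (S n)) /\<^sub>R norm (S n)" for n z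
    have "(\<lambda>n. \<integral>z. q (n + N) z \<partial>M) \<longlonglongrightarrow> (\<integral>z. 0 \<partial>M)"
    proof (rule integral_dominated_convergence[where w = "\<lambda>z. 2 * g z"])
      show "q (n + N) \<in> borel_measurable M" for n
        unfolding q_def using int[of "x0 + S (n + N)"] int[of x0] intf' N[of "n + N"] r
        by (intro borel_measurable_scaleR borel_measurable_diff) (auto simp: dist_norm)
      show "integrable M (\<lambda>z. 2 * g z)" using g by simp
      show "AE z in M. (\<lambda>n. q (n + N) z) \<longlonglongrightarrow> 0"
      proof (rule AE_I2)
        fix z assume z: "z \<in> space M"
        have "(\<lambda>h. norm (f (x0 + h) z - f x0 z - f' x0 z h) / norm h) \<midarrow>0\<rightarrow> 0"
          using d[OF z, of x0] r by (simp add: has_derivative_at)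
        then have "(\<lambda>n. norm (f (x0 + S n) z - f x0 z - f' x0 z (S n)) / norm (S n)) \<longlonglongrightarrow> 0"
          unfolding LIMSEQ_SEQ_conv[symmetric] using S0 Sl by auto
        then have "(\<lambda>n. norm (q n z)) \<longlonglongrightarrow> 0"
          by (simp add: q_def divide_inverse mult.commute)
        then have "(\<lambda>n. q n z) \<longlonglongrightarrow> 0" by (rule tendsto_norm_zero_cancel)
        then show "(\<lambda>n. q (n + N) z) \<longlonglongrightarrow> 0" by (rule LIMSEQ_ignore_initial_segment)
      qed
      show "AE z in M. norm (q (n + N) z) \<le> 2 * g z" for n
      proof (rule AE_I2)
        fix z assume z: "z \<in> space M"
        let ?h = "S (n + N)"
        have h: "norm ?h < r" using N by simp
        have x0: "dist x0 x0 < r" using r by simp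
        \<comment> \<open>The domination itself forces g z \<ge> 0, because \<open>?h\<close> is
          nonzero.\<close>
        have "0 \<le> g z * norm ?h" by (rule order.trans[OF norm_ge_zero dom[OF z x0]])
        moreover have "norm ?h > 0" using S0 by simp
        ultimately have g0: "0 \<le> g z" by (meson less_le_not_le mult_neg_pos not_le)
        have "norm (f (x0 + ?h) z - f x0 z) \<le> g z * norm ((x0 + ?h) - x0)"
        proof (rule differentiable_bound[of "ball x0 r" "\<lambda>x. f x z" "\<lambda>x. f' x z"])
          show "((\<lambda>x. f x z) has_derivative f' x z) (at x within ball x0 r)" if "x \<in> ball x0 r" for x
            using d[OF z, of x] that by (auto simp: dist_commute intro: has_derivative_at_withinI)
          show "onorm (f' x z) \<le> g z" if "x \<in> ball x0 r" for x
            by (rule onorm_bound[OF g0]) (use dom[OF z, of x] that in \<open>simp add: dist_commute\<close>)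
        qed (use r h in \<open>auto simp: dist_norm\<close>)
        moreover have "norm (f' x0 z ?h) \<le> g z * norm ?h" using dom[OF z, of x0 ?h] r by simp
        ultimately have "norm (f (x0 + ?h) z - f x0 z - f' x0 z ?h) \<le> 2 * g z * norm ?h"
          using norm_triangle_ineq4[of "f (x0 + ?h) z - f x0 z" "f' x0 z ?h"] by simp
        then show "norm (q (n + N) z) \<le> 2 * g z"
          using S0 by (simp add: q_def divide_simps mult.commute)
      qed
    qed auto
    then have "(\<lambda>n. \<integral>z. q (n + N) z \<partial>M) \<longlonglongrightarrow> 0" by simp
    then have "(\<lambda>n. norm (\<integral>z. q (n + N) z \<partial>M)) \<longlonglongrightarrow> 0" by (rule tendsto_norm_zero)
    then have "(\<lambda>n. norm (\<integral>z. q n z \<partial>M)) \<longlonglongrightarrow> 0" by (rule LIMSEQ_offset)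
    moreover have "\<forall>\<^sub>F n in sequentially. norm (\<integral>z. q n z \<partial>M) =
      norm ((\<integral>z. f (x0 + S n) z \<partial>M) - (\<integral>z. f x0 z \<partial>M) - (\<integral>z. f' x0 z (S n) \<partial>M)) / norm (S n)"
      unfolding eventually_sequentially
    proof (intro exI[of _ N] allI impI)
      fix n assume n: "N \<le> n"
      have "(\<integral>z. q n z \<partial>M) = ((\<integral>z. f (x0 + S n) z \<partial>M) - (\<integral>z. f x0 z \<partial>M) - (\<integral>z. f' x0 z (S n) \<partial>M)) /\<^sub>R norm (S n)"
        unfolding q_def using int[of "x0 + S n"] int[of x0] intf' N[OF n] r
        by (simp add: Bochner_Integration.integral_diff dist_norm)
      then show "norm (\<integral>z. q n z \<partial>M) =
      norm ((\<integral>z. f (x0 + S n) z \<partial>M) - (\<integral>z. f x0 z \<partial>M) - (\<integral>z. f' x0 z (S n) \<partial>M)) / norm (S n)"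
        by (simp add: divide_inverse mult.commute)
    qed
    ultimately show "(\<lambda>n. norm ((\<integral>z. f (x0 + S n) z \<partial>M) - (\<integral>z. f x0 z \<partial>M) - (\<integral>z. f' x0 z (S n) \<partial>M)) / norm (S n)) \<longlonglongrightarrow> 0"
      by (rule Lim_transform_eventually)
  qed
  then show ?thesis using blI by (simp add: has_derivative_at)
qed

section \<open>Fourier analysis on rapidly decreasing functions\<close>

section \<open>Gaussian integrals\<close>

text \<open>\<open>lborel\<close> is the image of a product of one-dimensional Lebesgue measures
  under the coordinate map, so integrals of products of one-variable functions factor.\<close>

lemma lborel_prod_Basis:
  fixes f :: "'a::euclidean_space \<Rightarrow> real \<Rightarrow> complex"
  assumes f: "\<And>b. b \<in> Basis \<Longrightarrow> integrable lborel (f b)"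
  shows "has_bochner_integral lborel (\<lambda>x. \<Prod>b\<in>Basis. f b (x \<bullet> b)) (\<Prod>b\<in>Basis. LINT x|lborel. f b x)"
proof -
  interpret P: product_sigma_finite "\<lambda>_::'a. lborel :: real measure" ..
  let ?P = "\<Pi>\<^sub>M b\<in>(Basis :: 'a set). (lborel :: real measure)"
  let ?T = "\<lambda>x. \<Sum>b\<in>(Basis :: 'a set). x b *\<^sub>R b"
  have [measurable]: "f b \<in> borel_measurable borel" if "b \<in> Basis" for b
    using borel_measurable_integrable[OF f[OF that]] by simp
  have T[measurable]: "?T \<in> ?P \<rightarrow>\<^sub>M borel" by measurable
  have m: "(\<lambda>x::'a. \<Prod>b\<in>Basis. f b (x \<bullet> b)) \<in> borel_measurable borel" by measurable
  have *: "(\<Prod>b\<in>Basis. f b (?T x \<bullet> b)) = (\<Prod>b\<in>Basis. f b (x b))" for x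
    by (rule prod.cong) auto
  have L: "(lborel :: 'a measure) = distr ?P borel ?T"
    by (subst lborel_def) (simp add: lborel_eq_real)
  have "integrable ?P (\<lambda>x. \<Prod>b\<in>Basis. f b (x b))"
    by (rule P.product_integrable_prod) (use f in auto)
  moreover have "(\<integral>x. (\<Prod>b\<in>Basis. f b (x b)) \<partial>?P) = (\<Prod>b\<in>Basis. LINT x|lborel. f b x)"
    by (rule P.product_integral_prod) (use f in auto)
  ultimately show ?thesis
    unfolding has_bochner_integral_iff L
    by (simp add: integrable_distr_eq[OF T m] integral_distr[OF T m] *)
qed

text \<open>A rescaling of the characteristic function of the standard normal distribution.\<close>

lemma gaussian_fourier_real:
  fixes t y :: real
  assumes t: "t > 0"
  shows "has_bochner_integral lborel (\<lambda>x::real. cis (- (x * y)) * complex_of_real (exp (- t * x\<^sup>2)))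
    (complex_of_real (sqrt (pi / t) * exp (- y\<^sup>2 / (4 * t))))"
proof -
  \<comment> \<open>With this c the normal exponent (c * x)^2 / 2 equals t * x^2, and u below is
    chosen so that u * c * x = - x * y.\<close>
  define c where "c = sqrt (2 * t)"
  have c: "c > 0" "c\<^sup>2 = 2 * t" using t by (auto simp: c_def)
  define u where "u = - y / c"
  have "integrable lborel (\<lambda>x. std_normal_density x *\<^sub>R iexp (u * x))"
    by (rule Bochner_Integration.integrable_bound[of _ std_normal_density]) auto
  moreover have "(LINT x|lborel. std_normal_density x *\<^sub>R iexp (u * x)) = exp (- (u\<^sup>2) / 2)"
    using fun_cong[OF char_std_normal_distribution, of u]
    by (simp add: char_def integral_density)
  ultimately have "has_bochner_integral lborel (\<lambda>x. std_normal_density x *\<^sub>R iexp (u * x)) (exp (- (u\<^sup>2) / 2))"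
    by (simp add: has_bochner_integral_iff)
  then have "has_bochner_integral lborel (\<lambda>x. std_normal_density (0 + c * x) *\<^sub>R iexp (u * (0 + c * x)))
      (complex_of_real (exp (- (u\<^sup>2) / 2)) /\<^sub>R \<bar>c\<bar>)"
    using lborel_has_bochner_integral_real_affine_iff[of c "\<lambda>x. std_normal_density x *\<^sub>R iexp (u * x)" "complex_of_real (exp (- (u\<^sup>2) / 2))" 0] c
    by simp
  then have H: "has_bochner_integral lborel (\<lambda>x. complex_of_real (sqrt (2 * pi)) * (std_normal_density (0 + c * x) *\<^sub>R iexp (u * (0 + c * x))))
      (complex_of_real (sqrt (2 * pi)) * (complex_of_real (exp (- (u\<^sup>2) / 2)) /\<^sub>R \<bar>c\<bar>))"
    by (rule has_bochner_integral_mult_right)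
  have E1: "complex_of_real (sqrt (2 * pi)) * (std_normal_density (0 + c * x) *\<^sub>R iexp (u * (0 + c * x)))
    = cis (- (x * y)) * complex_of_real (exp (- t * x\<^sup>2))" for x
  proof -
    have 1: "u * (0 + c * x) = - (x * y)" using c(1) by (simp add: u_def)
    have 2: "sqrt (2 * pi) * std_normal_density (0 + c * x) = exp (- t * x\<^sup>2)"
      by (simp add: std_normal_density_def power_mult_distrib c(2))
    have "complex_of_real (sqrt (2 * pi)) * (std_normal_density (0 + c * x) *\<^sub>R iexp (u * (0 + c * x)))
      = complex_of_real (sqrt (2 * pi) * std_normal_density (0 + c * x)) * iexp (u * (0 + c * x))"
      by (simp only: scaleR_conv_of_real of_real_mult mult.assoc)
    then show ?thesis by (simp only: 1 2 cis_conv_exp mult.commute[of _ "exp _"])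
  qed
  have E2: "complex_of_real (sqrt (2 * pi)) * (complex_of_real (exp (- (u\<^sup>2) / 2)) /\<^sub>R \<bar>c\<bar>)
    = complex_of_real (sqrt (pi / t) * exp (- y\<^sup>2 / (4 * t)))"
  proof -
    have A: "sqrt (2 * pi) / c = sqrt (pi / t)"
      unfolding c_def real_sqrt_divide[symmetric] by simp
    have B: "- (u\<^sup>2) / 2 = - y\<^sup>2 / (4 * t)" unfolding u_def power_divide c(2) by simp
    have "complex_of_real X * (complex_of_real E /\<^sub>R \<bar>c\<bar>) = complex_of_real (X / c * E)" for X E
      using c(1) by (simp add: scaleR_conv_of_real divide_inverse)
    then show ?thesis by (simp only: A B)
  qed
  show ?thesis using H unfolding E1 E2 .
qed

lemma sqrt_power_DIM: "x > 0 \<Longrightarrow> sqrt x ^ n = x powr (real n / 2)"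
  by (simp add: powr_half_sqrt[symmetric] powr_power)

text \<open>Both the Gaussian and the phase are products over the coordinates, which reduces the
  claim to the real line.\<close>

lemma gaussian_fourier:
  fixes \<xi> :: "'a::euclidean_space"
  assumes t: "t > 0"
  shows "has_bochner_integral lborel (\<lambda>x::'a. cis (- (x \<bullet> \<xi>)) * complex_of_real (exp (- t * (norm x)\<^sup>2)))
    (complex_of_real ((pi / t) powr (real DIM('a) / 2) * exp (- (norm \<xi>)\<^sup>2 / (4 * t))))"
proof -
  have n2: "(norm x)\<^sup>2 = (\<Sum>b\<in>Basis. (x \<bullet> b)\<^sup>2)" for x :: 'a
    by (subst euclidean_inner[of x x, folded power2_norm_eq_inner]) (simp add: power2_eq_square)
  have H: "has_bochner_integral lborel
     (\<lambda>x::'a. \<Prod>b\<in>Basis. cis (- ((x \<bullet> b) * (\<xi> \<bullet> b))) * complex_of_real (exp (- t * (x \<bullet> b)\<^sup>2)))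
     (\<Prod>b\<in>Basis. LINT x|lborel. cis (- (x * (\<xi> \<bullet> b))) * complex_of_real (exp (- t * x\<^sup>2)))"
    by (rule lborel_prod_Basis) (use gaussian_fourier_real[OF t] in \<open>auto simp: has_bochner_integral_iff\<close>)
  have E1: "(\<Prod>b\<in>Basis. cis (- ((x \<bullet> b) * (\<xi> \<bullet> b))) * complex_of_real (exp (- t * (x \<bullet> b)\<^sup>2)))
    = cis (- (x \<bullet> \<xi>)) * complex_of_real (exp (- t * (norm x)\<^sup>2))" for x :: 'a
  proof -
    have "(\<Prod>b\<in>Basis. cis (- ((x \<bullet> b) * (\<xi> \<bullet> b)))) = cis (- (x \<bullet> \<xi>))"
      unfolding cis_conv_exp exp_sum[OF finite_Basis, symmetric]
      by (simp add: euclidean_inner[of x \<xi>] sum_distrib_left sum_negf)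
    moreover have "(\<Prod>b\<in>Basis. exp (- t * (x \<bullet> b)\<^sup>2)) = exp (- t * (norm x)\<^sup>2)"
      unfolding exp_sum[OF finite_Basis, symmetric] n2 by (simp add: sum_distrib_left)
    ultimately show ?thesis by (simp only: prod.distrib of_real_prod[symmetric])
  qed
  have E2: "(\<Prod>b\<in>Basis. LINT x|lborel. cis (- (x * (\<xi> \<bullet> b))) * complex_of_real (exp (- t * x\<^sup>2)))
     = complex_of_real ((pi / t) powr (real DIM('a) / 2) * exp (- (norm \<xi>)\<^sup>2 / (4 * t)))"
  proof -
    have "(\<Prod>b\<in>Basis. LINT x|lborel. cis (- (x * (\<xi> \<bullet> b))) * complex_of_real (exp (- t * x\<^sup>2)))
      = complex_of_real (\<Prod>b\<in>Basis. sqrt (pi / t) * exp (- (\<xi> \<bullet> b)\<^sup>2 / (4 * t)))"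
      using gaussian_fourier_real[OF t] by (simp add: has_bochner_integral_iff)
    also have "(\<Prod>b\<in>Basis. sqrt (pi / t) * exp (- (\<xi> \<bullet> b)\<^sup>2 / (4 * t)))
       = (pi / t) powr (real DIM('a) / 2) * exp (- (norm \<xi>)\<^sup>2 / (4 * t))"
      unfolding prod.distrib exp_sum[OF finite_Basis, symmetric] n2
      using t by (simp add: sqrt_power_DIM sum_negf sum_divide_distrib)
    finally show ?thesis .
  qed
  show ?thesis using H unfolding E1 E2 .
qed

lemma gaussian_integral:
  assumes t: "t > 0"
  shows "has_bochner_integral lborel (\<lambda>x::'a::euclidean_space. exp (- t * (norm x)\<^sup>2))
    ((pi / t) powr (real DIM('a) / 2))"
proof -
  have "has_bochner_integral lborel (\<lambda>x. Re (cis (- (x \<bullet> (0::'a))) * complex_of_real (exp (- t * (norm x)\<^sup>2))))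
    (Re (complex_of_real ((pi / t) powr (real DIM('a) / 2) * exp (- (norm (0::'a))\<^sup>2 / (4 * t)))))"
    by (intro has_bochner_integral_bounded_linear[OF bounded_linear_Re] gaussian_fourier[OF t])
  then show ?thesis by simp
qed

section \<open>Rapidly decreasing functions\<close>

text \<open>\<open>norm\<close> is 1 on basis vectors, so each derivative lowers the order by one:
  these are the symbol estimates in one variable, with n derivatives controlled.\<close>

abbreviation Sym :: "nat \<Rightarrow> real \<Rightarrow> ('a::euclidean_space \<Rightarrow> 'b::real_normed_vector) \<Rightarrow> bool" where
  "Sym \<equiv> bounded_derivs (weight_bound (\<lambda>x. 1 + norm x)) norm"

interpretation Sym: symbol_bound "weight_bound (\<lambda>x. 1 + norm x)" norm
  by (rule symbol_bound_weight) simp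

text \<open>A symbol of every order: all derivatives decay faster than any power. This is the
  Schwartz condition in the language of symbols, so that their closure rules apply to it
  directly.\<close>

definition rapid :: "('a::euclidean_space \<Rightarrow> complex) \<Rightarrow> bool" where
  "rapid f \<longleftrightarrow> (\<forall>n m. Sym n m f)"

lemma rapid_smooth: "rapid f \<Longrightarrow> smooth f"
  unfolding rapid_def smooth_iff_Ck using bounded_derivs_imp_Ck by blast

lemma rapidD: "rapid f \<Longrightarrow> Sym n m f"
  by (simp add: rapid_def)

lemma rapid_bound:
  assumes "rapid f"
  obtains C where "C \<ge> 0" "\<And>x. norm (f x) \<le> C * (1 + norm x) powr m"
  using bounded_derivsD[OF rapidD[OF assms]] by (meson weight_boundE)

lemma rapid_partial: "rapid f \<Longrightarrow> v \<in> Basis \<Longrightarrow> rapid (partial_deriv v f)"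
  unfolding rapid_def
proof (intro allI)
  fix n m assume *: "\<forall>n m. Sym n m f" "v \<in> Basis"
  then show "Sym n m (partial_deriv v f)"
    using bounded_derivs_partial[OF *(1)[rule_format, of "Suc n" "m + norm v"] *(2)] by simp
qed

lemma rapid_mult_Sym: "(\<And>n. Sym n k g) \<Longrightarrow> rapid f \<Longrightarrow> rapid (\<lambda>x. g x * f x)"
  unfolding rapid_def
proof (intro allI)
  fix n m assume *: "\<And>n. Sym n k g" "\<forall>n m. Sym n m f"
  then show "Sym n m (\<lambda>x. g x * f x)"
    using Sym.mult[of n k g "m - k" f] by auto
qed

lemma rapid_cmult: "rapid f \<Longrightarrow> rapid (\<lambda>x. c * f x)"
  by (auto simp: rapid_def intro: Sym.cmult)

lemma rapid_add: "rapid f \<Longrightarrow> rapid g \<Longrightarrow> rapid (\<lambda>x. f x + g x)"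
  by (auto simp: rapid_def intro: Sym.add)

lemma Sym_inner: "Sym n 1 (\<lambda>x. complex_of_real (x \<bullet> v))"
proof (cases n)
  case 0
  have "\<bar>x \<bullet> v\<bar> \<le> norm v * (1 + norm x)" for x :: 'a
    by (rule order.trans[OF Cauchy_Schwarz_ineq2]) (simp add: algebra_simps)
  then show ?thesis using 0 by (auto simp: weight_bound_def intro!: exI[of _ "norm v"])
next
  case (Suc k)
  have "\<bar>x \<bullet> v\<bar> \<le> norm v * (1 + norm x)" for x :: 'a
    by (rule order.trans[OF Cauchy_Schwarz_ineq2]) (simp add: algebra_simps)
  then have 1: "weight_bound (\<lambda>x. 1 + norm x) 1 (\<lambda>x. complex_of_real (x \<bullet> v))"
    by (auto simp: weight_bound_def intro!: exI[of _ "norm v"])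
  show ?thesis unfolding Suc
    by (rule bounded_derivs_SucI[where f' = "\<lambda>_ h. complex_of_real (h \<bullet> v)"])
       (auto intro!: 1 derivative_eq_intros Sym.const)
qed

lemma rapid_inner: "rapid f \<Longrightarrow> rapid (\<lambda>x. complex_of_real (x \<bullet> v) * f x)"
  by (rule rapid_mult_Sym[OF Sym_inner])

lemma rapid_continuous: "rapid f \<Longrightarrow> continuous_on UNIV f"
  by (intro smooth_continuous rapid_smooth)

lemma rapid_measurable [measurable_dest]: "rapid f \<Longrightarrow> f \<in> borel_measurable borel"
  by (intro borel_measurable_continuous_onI rapid_continuous)

lemma integrable_inverse_1_plus_square_real: "integrable lborel (\<lambda>x::real. inverse (1 + x\<^sup>2))"
  using integrable_inverse_1_plus_square by (simp add: set_integrable_def)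

text \<open>Comparison with the product of the functions 1 / (1 + (x \<bullet> b)^2), each
  integrable on the line. Every coordinate costs a square of 1 + norm x, whence the exponent 2 *
  DIM('a) used in all integrability arguments.\<close>

lemma integrable_weight:
  "integrable lborel (\<lambda>x::'a::euclidean_space. (1 + norm x) powr (- real (2 * DIM('a))))"
proof -
  have "has_bochner_integral lborel
     (\<lambda>x::'a. \<Prod>b\<in>Basis. complex_of_real (inverse (1 + (x \<bullet> b)\<^sup>2)))
     (\<Prod>b\<in>(Basis :: 'a set). LINT x|lborel. complex_of_real (inverse (1 + x\<^sup>2)))"
    by (rule lborel_prod_Basis)
       (rule integrable_of_real[OF integrable_inverse_1_plus_square_real])
  then have "integrable lborel (\<lambda>x::'a. \<Prod>b\<in>Basis. complex_of_real (inverse (1 + (x \<bullet> b)\<^sup>2)))"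
    by (simp add: has_bochner_integral_iff)
  then show ?thesis
  proof (rule Bochner_Integration.integrable_bound)
    show "AE x in lborel. norm ((1 + norm (x::'a)) powr (- real (2 * DIM('a))))
       \<le> norm (\<Prod>b\<in>Basis. complex_of_real (inverse (1 + (x \<bullet> b)\<^sup>2)))"
    proof (rule AE_I2)
      fix x :: 'a
      have "1 + (x \<bullet> b)\<^sup>2 \<le> (1 + norm x)\<^sup>2" if "b \<in> Basis" for b
      proof -
        have "(x \<bullet> b)\<^sup>2 \<le> (norm x)\<^sup>2"
          using Basis_le_norm[OF that, of x] by (simp add: abs_le_square_iff[symmetric])
        then show ?thesis by (simp add: power2_sum add_increasing2)
      qed
      then have "(\<Prod>b\<in>(Basis::'a set). inverse ((1 + norm x)\<^sup>2)) \<le> (\<Prod>b\<in>Basis. inverse (1 + (x \<bullet> b)\<^sup>2))"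
        by (intro prod_mono conjI le_imp_inverse_le) (auto simp: add_pos_nonneg)
      moreover have "(\<Prod>b\<in>(Basis::'a set). inverse ((1 + norm x)\<^sup>2)) = (1 + norm x) powr (- real (2 * DIM('a)))"
      proof -
        have "(1 + norm x) powr (- real (2 * DIM('a))) = inverse ((1 + norm x) ^ (2 * DIM('a)))"
          unfolding powr_minus by (subst powr_realpow) (auto simp: add_pos_nonneg)
        then show ?thesis by (simp add: power_mult power_inverse)
      qed
      moreover have "norm (\<Prod>b\<in>Basis. complex_of_real (inverse (1 + (x \<bullet> b)\<^sup>2))) = (\<Prod>b\<in>Basis. inverse (1 + (x \<bullet> b)\<^sup>2))"
        unfolding of_real_prod[symmetric] norm_of_real by (simp add: abs_prod)
      ultimately show "norm ((1 + norm (x::'a)) powr (- real (2 * DIM('a))))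
       \<le> norm (\<Prod>b\<in>Basis. complex_of_real (inverse (1 + (x \<bullet> b)\<^sup>2)))" by simp
    qed
  qed simp
qed

lemma weight_bound_integrable:
  fixes f :: "'a::euclidean_space \<Rightarrow> 'b::{banach, second_countable_topology}"
  assumes "f \<in> borel_measurable borel"
    and "\<And>x. norm (f x) \<le> C * (1 + norm x) powr (- real (2 * DIM('a)))"
  shows "integrable lborel f"
proof (rule Bochner_Integration.integrable_bound)
  show "integrable lborel (\<lambda>x::'a. C * (1 + norm x) powr (- real (2 * DIM('a))))"
    using integrable_weight[where 'a='a] by simp
  show "AE x in lborel. norm (f x) \<le> norm (C * (1 + norm x) powr (- real (2 * DIM('a))))"
    using assms(2) by (auto intro: order.trans[OF _ abs_ge_self])
qed (use assms in auto)

lemma rapid_integrable: "rapid f \<Longrightarrow> integrable lborel f"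
proof -
  assume f: "rapid f"
  obtain C where "\<And>x. norm (f x) \<le> C * (1 + norm x) powr (- real (2 * DIM('a)))"
    using rapid_bound[OF f, of "- real (2 * DIM('a))"] by blast
  then show ?thesis using f by (intro weight_bound_integrable) auto
qed

lemma rapid_bounded:
  assumes "rapid f"
  obtains C where "C \<ge> 0" "\<And>x. norm (f x) \<le> C"
proof -
  obtain C where C: "C \<ge> 0" "\<And>x. norm (f x) \<le> C * (1 + norm x) powr 0"
    using rapid_bound[OF assms] by blast
  have "norm (f x) \<le> C" for x
    using C(2)[of x] C(1) by (simp split: if_splits)
  with C(1) show ?thesis by (rule that)
qed

lemma rapid_norm_integrable: "rapid f \<Longrightarrow> integrable lborel (\<lambda>x. norm x * norm (f x))"
proof -
  assume f: "rapid f"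
  obtain C where C: "C \<ge> 0" "\<And>x. norm (f x) \<le> C * (1 + norm x) powr (- real (2 * DIM('a)) - 1)"
    using rapid_bound[OF f, of "- real (2 * DIM('a)) - 1"] by blast
  have "norm (norm x * norm (f x)) \<le> C * (1 + norm x) powr (- real (2 * DIM('a)))" for x
  proof -
    have "norm x * norm (f x) \<le> (1 + norm x) powr 1 * (C * (1 + norm x) powr (- real (2 * DIM('a)) - 1))"
      by (intro mult_mono C) auto
    also have "\<dots> = C * ((1 + norm x) powr (1 + (- real (2 * DIM('a)) - 1)))"
      by (simp only: powr_add mult_ac)
    also have "1 + (- real (2 * DIM('a)) - 1) = - real (2 * DIM('a))" by simp
    finally show ?thesis by (simp only: real_norm_def abs_mult abs_norm_cancel)
  qed
  then show ?thesis using f by (intro weight_bound_integrable) auto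
qed

lemma one_plus_norm_add: "1 + norm (x + y) \<le> (1 + norm x) * (1 + norm y)"
proof -
  have "1 + norm (x + y) \<le> 1 + norm x + norm y" using norm_triangle_ineq[of x y] by simp
  also have "\<dots> \<le> (1 + norm x) * (1 + norm y)" by (simp add: algebra_simps)
  finally show ?thesis .
qed

text \<open>Peetre's inequality. For m \<ge> 0 it is the submultiplicativity of 1 + norm; for m < 0
  the same is applied to x = (x + y) + (- y).\<close>

lemma peetre: "(1 + norm (x + y)) powr m \<le> (1 + norm x) powr m * (1 + norm y) powr \<bar>m\<bar>"
proof (cases "m \<ge> 0")
  case True
  then have "(1 + norm (x + y)) powr m \<le> ((1 + norm x) * (1 + norm y)) powr m"
    by (intro powr_mono2 one_plus_norm_add) auto
  then show ?thesis using True by (simp add: powr_mult)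
next
  case False
  have "(1 + norm x) powr (-m) \<le> ((1 + norm (x + y)) * (1 + norm y)) powr (-m)"
    using False one_plus_norm_add[of "x + y" "- y"] by (intro powr_mono2) auto
  also have "\<dots> = (1 + norm (x + y)) powr (-m) * (1 + norm y) powr (-m)"
    by (simp add: powr_mult)
  finally have "(1 + norm x) powr (-m) \<le> (1 + norm (x + y)) powr (-m) * (1 + norm y) powr \<bar>m\<bar>"
    using False by simp
  moreover have "(1 + norm x) \<noteq> 0" "1 + norm (x + y) \<noteq> 0" 
    using norm_ge_zero[of x] norm_ge_zero[of "x + y"] by linarith+
  ultimately show ?thesis by (simp add: powr_minus field_simps)
qed

text \<open>Derivatives vanish on the same open exterior region, so the induction on n keeps R and
  needs only boundedness on a ball.\<close>

lemma rapid_compact_support: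
  assumes "smooth f" and "\<And>x. norm x > R \<Longrightarrow> f x = 0"
  shows "rapid f"
  unfolding rapid_def
proof (intro allI)
  fix n m
  show "Sym n m f" using assms
  proof (induction n arbitrary: f m)
    have bd: "weight_bound (\<lambda>x. 1 + norm x) m f" if f: "smooth f" "\<And>x. norm x > R \<Longrightarrow> f x = 0"
      for m and f :: "'a \<Rightarrow> complex"
    proof -
      have "bounded (f ` cball 0 \<bar>R\<bar>)"
        by (intro compact_imp_bounded compact_continuous_image continuous_on_subset[OF smooth_continuous[OF f(1)]]) auto
      then obtain C where "\<forall>x\<in>cball 0 \<bar>R\<bar>. norm (f x) \<le> C"
        unfolding bounded_iff by blast
      then have C: "\<And>x. norm x \<le> \<bar>R\<bar> \<Longrightarrow> norm (f x) \<le> C" by simp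
      have C0: "C \<ge> 0" using C[of 0] norm_ge_zero[of "f 0"] by (simp del: norm_ge_zero)
      have "norm (f x) \<le> C * (1 + \<bar>R\<bar>) powr \<bar>m\<bar> * (1 + norm x) powr m" for x
      proof (cases "norm x \<le> \<bar>R\<bar>")
        case True
        \<comment> \<open>Peetre's inequality for x + (- x) = 0 bounds the weight from below on the
          ball, whatever the sign of m.\<close>
        have "1 \<le> (1 + norm x) powr m * (1 + norm (-x)) powr \<bar>m\<bar>"
          using peetre[of x "- x" m] by simp
        also have "\<dots> \<le> (1 + norm x) powr m * (1 + \<bar>R\<bar>) powr \<bar>m\<bar>"
          using True by (intro mult_left_mono powr_mono2) auto
        finally have "1 \<le> (1 + norm x) powr m * (1 + \<bar>R\<bar>) powr \<bar>m\<bar>" .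
        from mult_left_mono[OF this C0] C[OF True] show ?thesis by (simp add: mult_ac)
      next
        case False
        then show ?thesis using f(2)[of x] C0 by simp
      qed
      then show ?thesis by (auto simp: weight_bound_def)
    qed
    {
      case 0
      then show ?case using bd[OF 0] by simp
    next
      case (Suc n)
      have "partial_deriv v f x = 0" if x: "norm x > R" for v x
      proof -
        have "(f has_derivative (\<lambda>_. 0)) (at x)"
        proof (rule has_derivative_transform_within_open[of "\<lambda>_. 0" _ _ UNIV])
          show "open {x::'a. norm x > R}" by (intro open_Collect_less continuous_intros)
        qed (use x Suc.prems in auto)
        then show ?thesis by (auto dest: partial_deriv_eq)
      qed
      then have "Sym n (m - norm v) (partial_deriv v f)" if "v \<in> Basis" for v
        by (intro Suc.IH smooth_partial_deriv Suc.prems that) auto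
      then show ?case
        using bd[OF Suc.prems] smooth_has_derivative[OF Suc.prems(1)] by (auto simp: differentiable_def)
    }
  qed
qed

lemma test_functions_rapid: "f \<in> test_functions U \<Longrightarrow> rapid f"
proof -
  assume f: "f \<in> test_functions U"
  then have "bounded (supp f)" by (auto simp: test_functions_def intro: compact_imp_bounded)
  then obtain R where R: "\<And>x. x \<in> supp f \<Longrightarrow> norm x \<le> R" by (auto simp: bounded_iff)
  have "f x = 0" if "norm x > R" for x
  proof (rule ccontr)
    assume "f x \<noteq> 0"
    then have "x \<in> supp f" using closure_subset[of "{x. f x \<noteq> 0}"] by (auto simp: supp_def)
    then show False using R that by fastforce
  qed
  then show ?thesis using f by (intro rapid_compact_support[of f R]) (auto simp: test_functions_def)
qed

lemma iter_deriv_rapid: "rapid f \<Longrightarrow> set vs \<subseteq> Basis \<Longrightarrow> rapid (iter_deriv vs f)"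
proof (induction vs)
  case (Cons v vs)
  then show ?case by (simp add: iter_deriv_Cons rapid_partial del: iter_deriv.simps)
qed simp

lemma rapid_schwartz: "rapid f \<Longrightarrow> f \<in> schwartz"
  unfolding schwartz_def
proof (safe)
  show "rapid f \<Longrightarrow> smooth f" by (rule rapid_smooth)
  fix vs k assume f: "rapid f" and vs: "set vs \<subseteq> (Basis :: 'a set)"
  obtain C where C: "C \<ge> 0" "\<And>x. norm (iter_deriv vs f x) \<le> C * (1 + norm x) powr (- real k)"
    using rapid_bound[OF iter_deriv_rapid[OF f vs]] by blast
  have "norm (norm x ^ k *\<^sub>R iter_deriv vs f x) \<le> C" for x
  proof -
    have "norm (norm x ^ k *\<^sub>R iter_deriv vs f x) \<le> (1 + norm x) ^ k * (C * (1 + norm x) powr (- real k))"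
      unfolding norm_scaleR by (intro mult_mono C) (auto intro!: power_mono)
    also have "\<dots> = C"
      by (subst powr_minus, subst powr_realpow) (auto simp: add_pos_nonneg field_simps add_nonneg_eq_0_iff)
    finally show ?thesis .
  qed
  then show "bounded (range (\<lambda>x. norm x ^ k *\<^sub>R iter_deriv vs f x))" by (auto simp: bounded_iff)
qed

lemma schwartz_continuous: "f \<in> schwartz \<Longrightarrow> continuous_on UNIV f"
  by (auto simp: schwartz_def smooth_continuous)

lemma schwartz_measurable [measurable_dest]: "f \<in> schwartz \<Longrightarrow> f \<in> borel_measurable borel"
  by (intro borel_measurable_continuous_onI schwartz_continuous)

lemma schwartz_bounded:
  assumes "f \<in> schwartz"
  obtains C where "C \<ge> 0" "\<And>x. norm (norm x ^ k *\<^sub>R f x) \<le> C"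
proof -
  have "\<forall>vs k. set vs \<subseteq> Basis \<longrightarrow> bounded (range (\<lambda>x. norm x ^ k *\<^sub>R iter_deriv vs f x))"
    using assms by (simp add: schwartz_def)
  from this[rule_format, of "[]" k] obtain C where C: "\<And>x. norm (norm x ^ k *\<^sub>R f x) \<le> C" by (auto simp: bounded_iff)
  then have "C \<ge> 0" using order.trans[OF norm_ge_zero C] by blast
  with C show ?thesis by (rule that[rotated])
qed

text \<open>The seminorms of exponents 0 and k combine through (1 + norm x)^k \<le> 2^k * (1 + norm
  x^k).\<close>

lemma schwartz_weight_bound:
  assumes "f \<in> schwartz"
  obtains C where "C \<ge> 0" "\<And>x. norm (f x) \<le> C * (1 + norm x) powr (- real k)"
proof -
  obtain C0 Ck where C: "C0 \<ge> 0" "\<And>x. norm (norm x ^ 0 *\<^sub>R f x) \<le> C0"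
    "Ck \<ge> 0" "\<And>x. norm (norm x ^ k *\<^sub>R f x) \<le> Ck"
    using schwartz_bounded[OF assms] by metis
  have "norm (f x) \<le> (2 ^ k * (C0 + Ck)) * (1 + norm x) powr (- real k)" for x
  proof -
    have "(1 + norm x) ^ k \<le> (2 * max 1 (norm x)) ^ k" by (intro power_mono) auto
    also have "\<dots> \<le> 2 ^ k * (1 + norm x ^ k)"
      by (cases "norm x \<le> 1") (auto simp: power_mult_distrib max_def)
    finally have "(1 + norm x) ^ k * norm (f x) \<le> 2 ^ k * (1 + norm x ^ k) * norm (f x)"
      by (intro mult_right_mono) auto
    also have "\<dots> = 2 ^ k * (norm (f x) + norm x ^ k * norm (f x))" by (simp add: algebra_simps)
    also have "\<dots> \<le> 2 ^ k * (C0 + Ck)"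
      using C(2)[of x] C(4)[of x] by (intro mult_left_mono add_mono) auto
    finally have "(1 + norm x) ^ k * norm (f x) \<le> 2 ^ k * (C0 + Ck)" .
    then have "norm (f x) \<le> 2 ^ k * (C0 + Ck) / (1 + norm x) ^ k"
      by (simp add: pos_le_divide_eq add_pos_nonneg mult.commute)
    then show ?thesis
      by (simp add: powr_minus powr_realpow add_pos_nonneg divide_inverse)
  qed
  then show ?thesis using C by (intro that[of "2 ^ k * (C0 + Ck)"]) auto
qed

lemma schwartz_integrable:
  fixes f :: "'a::euclidean_space \<Rightarrow> 'b::{banach, second_countable_topology}"
  assumes "f \<in> schwartz"
  shows "integrable lborel f"
proof -
  obtain C where "\<And>x. norm (f x) \<le> C * (1 + norm x) powr (- real (2 * DIM('a)))"
    using schwartz_weight_bound[OF assms] by blast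
  with assms show ?thesis by (intro weight_bound_integrable) auto
qed

section \<open>The Fourier transform\<close>

lemma has_derivative_cis_compose:
  assumes "(g has_derivative g') (at x within S)"
  shows "((\<lambda>x. cis (g x)) has_derivative (\<lambda>h. \<i> * complex_of_real (g' h) * cis (g x))) (at x within S)"
  using has_derivative_cis[OF assms] by (simp add: scaleR_conv_of_real mult_ac)

lemma measurable_cis [measurable]: "cis \<in> borel_measurable borel"
  by (intro borel_measurable_continuous_onI continuous_intros)

lemma power_eq_square_powr: "x > 0 \<Longrightarrow> x ^ n = (x\<^sup>2) powr (real n / 2)"
proof -
  assume x: "x > 0"
  have "(x powr 2) powr (real n / 2) = x powr real n" by (simp only: powr_powr) simp
  then show ?thesis using x by (simp add: powr_realpow)
qed

lemma lborel_integral_affine: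
  fixes f :: "'a::euclidean_space \<Rightarrow> 'b::{banach, second_countable_topology}"
  assumes c: "c > 0" and f: "f \<in> borel_measurable borel"
  shows "(LINT x|lborel. f x) = c ^ DIM('a) *\<^sub>R (LINT x|lborel. f (t + c *\<^sub>R x))"
proof -
  have m: "(\<lambda>x::'a. t + c *\<^sub>R x) \<in> borel \<rightarrow>\<^sub>M borel" by measurable
  have "(LINT x|lborel. f x) =
    (LINT x|density (distr lborel borel (\<lambda>x. t + c *\<^sub>R x)) (\<lambda>_. \<bar>c\<bar> ^ DIM('a)). f x)"
    by (rule arg_cong[where f="\<lambda>M. integral\<^sup>L M f"], rule lborel_affine) (use c in simp)
  also have "\<dots> = (LINT x|distr lborel borel (\<lambda>x. t + c *\<^sub>R x). (\<bar>c\<bar> ^ DIM('a)) *\<^sub>R f x)"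
    by (rule integral_density) (use f in auto)
  also have "\<dots> = (LINT x|lborel. (\<bar>c\<bar> ^ DIM('a)) *\<^sub>R f (t + c *\<^sub>R x))"
    by (rule integral_distr) (use f m in auto)
  finally show ?thesis using c by simp
qed

lemma lborel_integral_translate:
  fixes f :: "'a::euclidean_space \<Rightarrow> 'b::{banach, second_countable_topology}"
  assumes f: "f \<in> borel_measurable borel"
  shows "(LINT x|lborel. f (t + x)) = (LINT x|lborel. f x)"
  using lborel_integral_affine[of 1 f t] f by simp

lemma lborel_integrable_translate:
  fixes f :: "'a::euclidean_space \<Rightarrow> 'b::{banach, second_countable_topology}"
  assumes f: "integrable lborel f"
  shows "integrable lborel (\<lambda>x. f (t + x))"
proof -
  have "integrable (distr lborel borel ((+) t)) f" using f by (simp add: lborel_distr_plus)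
  then show ?thesis by (subst (asm) integrable_distr_eq) (use f in auto)
qed

lemma lborel_integral_reflect:
  fixes f :: "'a::euclidean_space \<Rightarrow> 'b::{banach, second_countable_topology}"
  assumes f: "f \<in> borel_measurable borel"
  shows "(LINT x|lborel. f (t - x)) = (LINT x|lborel. f x)"
proof -
  have L: "(lborel::'a measure) = distr lborel borel (\<lambda>x. t - x)"
    using lborel_affine[of "-1" t] by (simp add: density_1)
  have "(LINT x|lborel. f x) = (LINT x|distr lborel borel (\<lambda>x. t - x). f x)" by (subst L) rule
  also have "\<dots> = (LINT x|lborel. f (t - x))" by (rule integral_distr) (use f in auto)
  finally show ?thesis by simp
qed

lemma lborel_integrable_reflect:
  fixes f :: "'a::euclidean_space \<Rightarrow> 'b::{banach, second_countable_topology}"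
  assumes f: "integrable lborel f"
  shows "integrable lborel (\<lambda>x. f (t - x))"
proof -
  have L: "(lborel::'a measure) = distr lborel borel (\<lambda>x. t - x)"
    using lborel_affine[of "-1" t] by (simp add: density_1)
  have "integrable (distr lborel borel (\<lambda>x. t - x)) f" using f by (subst (asm) L) 
  then show ?thesis by (subst (asm) integrable_distr_eq) (use f in auto)
qed

lemma integrable_cis_mult:
  fixes f :: "'a \<Rightarrow> complex"
  assumes "integrable M f" "g \<in> borel_measurable M"
  shows "integrable M (\<lambda>x. cis (g x) * f x)"
  by (rule Bochner_Integration.integrable_bound[OF assms(1)])
     (use assms in \<open>auto simp: norm_mult cis_conv_exp\<close>)

lemma fourier_integrable:
  "integrable lborel f \<Longrightarrow> integrable lborel (\<lambda>x. cis (- (x \<bullet> \<xi>)) * f x)"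
  by (rule integrable_cis_mult) auto

lemma norm_fourier_le: "norm (fourier f \<xi>) \<le> (LINT x|lborel. norm (f x))"
proof -
  have "norm (fourier f \<xi>) \<le> (LINT x|lborel. norm (cis (- (x \<bullet> \<xi>)) * f x))"
    unfolding fourier_def by (rule integral_norm_bound)
  then show ?thesis by (simp add: norm_mult)
qed

lemma fourier_add: "integrable lborel f \<Longrightarrow> integrable lborel g \<Longrightarrow>
    fourier (\<lambda>x. f x + g x) \<xi> = fourier f \<xi> + fourier g \<xi>"
  unfolding fourier_def
  by (subst Bochner_Integration.integral_add[symmetric]) (auto intro!: fourier_integrable simp: distrib_left)

lemma fourier_cmult: "fourier (\<lambda>x. c * f x) \<xi> = c * fourier f \<xi>"
proof -
  have "fourier (\<lambda>x. c * f x) \<xi> = (LINT x|lborel. c * (cis (- (x \<bullet> \<xi>)) * f x))"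
    unfolding fourier_def by (simp add: mult_ac)
  then show ?thesis by (simp add: fourier_def)
qed

lemma fourier_has_derivative:
  fixes f :: "'a::euclidean_space \<Rightarrow> complex"
  assumes f: "integrable lborel f" and xf: "integrable lborel (\<lambda>x. norm x * norm (f x))"
  shows "(fourier f has_derivative (\<lambda>h. fourier (\<lambda>x. - \<i> * complex_of_real (x \<bullet> h) * f x) \<xi>)) (at \<xi>)"
proof -
  have [measurable]: "f \<in> borel_measurable borel" using borel_measurable_integrable[OF f] by simp
  have "((\<lambda>\<xi>. LINT x|lborel. cis (- (x \<bullet> \<xi>)) * f x) has_derivative
    (\<lambda>h. LINT x|lborel. cis (- (x \<bullet> \<xi>)) * (- \<i> * complex_of_real (x \<bullet> h) * f x))) (at \<xi>)"
  proof (rule has_derivative_integral[where r = 1 and g = "\<lambda>x. norm x * norm (f x)"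
        and f' = "\<lambda>\<xi> x h. cis (- (x \<bullet> \<xi>)) * (- \<i> * complex_of_real (x \<bullet> h) * f x)"])
    show "((\<lambda>\<xi>. cis (- (x \<bullet> \<xi>)) * f x) has_derivative
        (\<lambda>h. cis (- (x \<bullet> \<xi>)) * (- \<i> * complex_of_real (x \<bullet> h) * f x))) (at \<xi>)" for x \<xi>
      by (rule has_derivative_eq_rhs[OF has_derivative_mult_left[OF has_derivative_cis_compose]])
         (auto intro!: derivative_eq_intros simp: fun_eq_iff)
    show "norm (cis (- (x \<bullet> \<xi>)) * (- \<i> * complex_of_real (x \<bullet> h) * f x)) \<le> norm x * norm (f x) * norm h" for x \<xi> h
      using mult_right_mono[OF Cauchy_Schwarz_ineq2[of x h], of "norm (f x)"]
      by (simp add: norm_mult mult_ac)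
  qed (use fourier_integrable[OF f] xf in auto)
  then show ?thesis unfolding fourier_def[abs_def] .
qed

text \<open>Instead of integrating by parts, the integral of the phase against the translate of f by
  t v is differentiated at t = 0 in two ways: under the integral sign, and through translation
  invariance.\<close>

lemma fourier_partial:
  fixes f :: "'a::euclidean_space \<Rightarrow> complex"
  assumes f: "rapid f" and v: "v \<in> Basis"
  shows "fourier (partial_deriv v f) \<xi> = \<i> * complex_of_real (\<xi> \<bullet> v) * fourier f \<xi>"
proof -
  let ?d = "2 * real DIM('a)"
  have pf: "rapid (partial_deriv v f)" by (rule rapid_partial[OF f v])
  note [measurable] = rapid_measurable[OF f] rapid_measurable[OF pf]
  obtain C where C: "C \<ge> 0" "\<And>x. norm (partial_deriv v f x) \<le> C * (1 + norm x) powr (- ?d)"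
    using rapid_bound[OF pf] by blast
  define \<Phi> where "\<Phi> t = (LINT x|lborel. cis (- (x \<bullet> \<xi>)) * f (t *\<^sub>R v + x))" for t :: real
  have "(\<Phi> has_derivative (\<lambda>h. LINT x|lborel. cis (- (x \<bullet> \<xi>)) * (h *\<^sub>R partial_deriv v f (0 *\<^sub>R v + x)))) (at 0)"
    unfolding \<Phi>_def[abs_def]
  \<comment> \<open>Peetre's inequality moves the decay from t v + x to x; since norm (t v) \<le> 1,
    this costs the factor \<open>2 powr ?d\<close>.\<close>
  proof (rule has_derivative_integral[where r = 1 and g = "\<lambda>x. C * 2 powr ?d * (1 + norm x) powr (- real (2 * DIM('a)))"
       and f' = "\<lambda>t x h. cis (- (x \<bullet> \<xi>)) * (h *\<^sub>R partial_deriv v f (t *\<^sub>R v + x))"])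
    show "integrable lborel (\<lambda>x. cis (- (x \<bullet> \<xi>)) * f (t *\<^sub>R v + x))" for t
      by (rule fourier_integrable[OF lborel_integrable_translate[OF rapid_integrable[OF f]]])
    show "integrable lborel (\<lambda>x::'a. C * 2 powr ?d * (1 + norm x) powr (- real (2 * DIM('a))))"
      by (intro integrable_mult_right integrable_weight)
    fix t :: real and x :: 'a
    have *: "(f has_derivative (\<lambda>w. partial_deriv w f (t *\<^sub>R v + x))) (at (t *\<^sub>R v + x))"
      by (rule smooth_has_derivative[OF rapid_smooth[OF f]])
    have lin: "partial_deriv (h *\<^sub>R v) f y = h *\<^sub>R partial_deriv v f y" for h y
      using linear_simps(5)[OF has_derivative_bounded_linear[OF smooth_has_derivative[OF rapid_smooth[OF f], of y]]] .
    have "((\<lambda>t. f (t *\<^sub>R v + x)) has_derivative (\<lambda>h. partial_deriv (h *\<^sub>R v) f (t *\<^sub>R v + x))) (at t)"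
      by (rule has_derivative_compose[where f = "\<lambda>t. t *\<^sub>R v + x" and g = f, OF _ *])
         (auto intro!: derivative_eq_intros)
    then show "((\<lambda>t. cis (- (x \<bullet> \<xi>)) * f (t *\<^sub>R v + x)) has_derivative
        (\<lambda>h. cis (- (x \<bullet> \<xi>)) * (h *\<^sub>R partial_deriv v f (t *\<^sub>R v + x)))) (at t)"
      unfolding lin by (rule has_derivative_mult_right)
    fix h assume "dist t 0 < 1"
    then have t: "\<bar>t\<bar> < 1" by simp
    have "norm (partial_deriv v f (t *\<^sub>R v + x)) \<le> C * (1 + norm (x + t *\<^sub>R v)) powr (- ?d)"
      using C(2)[of "t *\<^sub>R v + x"] by (simp add: add.commute)
    also have "\<dots> \<le> C * ((1 + norm x) powr (- ?d) * (1 + norm (t *\<^sub>R v)) powr \<bar>- ?d\<bar>)"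
      by (intro mult_left_mono peetre C)
    also have "\<dots> \<le> C * ((1 + norm x) powr (- ?d) * 2 powr ?d)"
      using v t by (intro mult_left_mono C) (auto intro!: powr_mono2)
    finally have "norm (partial_deriv v f (t *\<^sub>R v + x)) * \<bar>h\<bar> \<le> C * 2 powr ?d * (1 + norm x) powr (- ?d) * \<bar>h\<bar>"
      by (intro mult_right_mono) (auto simp: mult_ac)
    then show "norm (cis (- (x \<bullet> \<xi>)) * (h *\<^sub>R partial_deriv v f (t *\<^sub>R v + x)))
        \<le> C * 2 powr ?d * (1 + norm x) powr (- real (2 * DIM('a))) * norm h"
      by (simp add: norm_mult mult.commute)
  qed auto
  \<comment> \<open>Translation invariance turns the shift by t v into a phase, whose derivative at
    t = 0 is the multiplier.\<close>
  moreover have "\<Phi> t = cis (t * (v \<bullet> \<xi>)) * fourier f \<xi>" for t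
  proof -
    have "\<Phi> t = (LINT x|lborel. cis (t * (v \<bullet> \<xi>)) * (cis (- ((t *\<^sub>R v + x) \<bullet> \<xi>)) * f (t *\<^sub>R v + x)))"
      unfolding \<Phi>_def
      by (rule Bochner_Integration.integral_cong[OF refl], simp only: mult.assoc[symmetric] cis_mult)
         (simp add: inner_add_left)
    also have "\<dots> = cis (t * (v \<bullet> \<xi>)) * (LINT x|lborel. cis (- ((t *\<^sub>R v + x) \<bullet> \<xi>)) * f (t *\<^sub>R v + x))"
      by simp
    also have "(LINT x|lborel. cis (- ((t *\<^sub>R v + x) \<bullet> \<xi>)) * f (t *\<^sub>R v + x)) = fourier f \<xi>"
      unfolding fourier_def by (rule lborel_integral_translate[of "\<lambda>x. cis (- (x \<bullet> \<xi>)) * f x"]) auto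
    finally show ?thesis .
  qed
  then have "\<Phi> = (\<lambda>t. cis (t * (v \<bullet> \<xi>)) * fourier f \<xi>)" by auto
  moreover have "((\<lambda>t. cis (t * (v \<bullet> \<xi>)) * fourier f \<xi>) has_derivative
      (\<lambda>h. \<i> * complex_of_real (h * (v \<bullet> \<xi>)) * fourier f \<xi>)) (at 0)"
    by (rule has_derivative_eq_rhs[OF has_derivative_mult_left[OF has_derivative_cis_compose]])
       (auto intro!: derivative_eq_intros simp: fun_eq_iff)
  ultimately have "(\<lambda>h. LINT x|lborel. cis (- (x \<bullet> \<xi>)) * (h *\<^sub>R partial_deriv v f (0 *\<^sub>R v + x)))
      = (\<lambda>h. \<i> * complex_of_real (h * (v \<bullet> \<xi>)) * fourier f \<xi>)"
    using has_derivative_unique by blast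
  from fun_cong[OF this, of 1] show ?thesis by (simp add: fourier_def inner_commute)
qed

lemma norm_le_sum_Basis: "norm x \<le> (\<Sum>b\<in>Basis. \<bar>x \<bullet> b\<bar>)"
  by (rule norm_le_l1)

text \<open>Decay: one factor 1 + norm \<xi> is bounded by 1 plus the sum of the coordinates'
  absolute values, and each coordinate is absorbed as a derivative of f, by induction on the power.
  Derivatives of the transform are transforms of coordinate multiples of f, hence covered by the
  same decay.\<close>

lemma rapid_fourier:
  fixes f :: "'a::euclidean_space \<Rightarrow> complex"
  assumes f: "rapid f"
  shows "rapid (fourier f)"
proof -
  have decay: "\<exists>C. \<forall>\<xi>. (1 + norm \<xi>) ^ k * norm (fourier f \<xi>) \<le> C" if "rapid f"
    for k and f :: "'a \<Rightarrow> complex"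
    using that
  proof (induction k arbitrary: f)
    case 0
    then show ?case using norm_fourier_le[of f] by auto
  next
    case (Suc k)
    have "\<forall>b\<in>Basis. \<exists>C. \<forall>\<xi>. (1 + norm \<xi>) ^ k * norm (fourier (partial_deriv b f) \<xi>) \<le> C"
      using Suc rapid_partial by blast
    then obtain C where C: "\<And>b \<xi>. b \<in> Basis \<Longrightarrow> (1 + norm \<xi>) ^ k * norm (fourier (partial_deriv b f) \<xi>) \<le> C b"
      by metis
    obtain C0 where C0: "\<And>\<xi>. (1 + norm \<xi>) ^ k * norm (fourier f \<xi>) \<le> C0" using Suc by blast
    have "(1 + norm \<xi>) ^ Suc k * norm (fourier f \<xi>) \<le> C0 + (\<Sum>b\<in>Basis. C b)" for \<xi>
    proof -
      have "(1 + norm \<xi>) ^ Suc k * norm (fourier f \<xi>) =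
          (1 + norm \<xi>) * ((1 + norm \<xi>) ^ k * norm (fourier f \<xi>))" by simp
      also have "\<dots> \<le> (1 + (\<Sum>b\<in>Basis. \<bar>\<xi> \<bullet> b\<bar>)) * ((1 + norm \<xi>) ^ k * norm (fourier f \<xi>))"
        by (intro mult_right_mono add_left_mono norm_le_sum_Basis) auto
      also have "\<dots> = (1 + norm \<xi>) ^ k * norm (fourier f \<xi>) +
          (\<Sum>b\<in>Basis. \<bar>\<xi> \<bullet> b\<bar> * ((1 + norm \<xi>) ^ k * norm (fourier f \<xi>)))"
        by (simp only: distrib_right mult_1_left sum_distrib_right)
      also have "(\<Sum>b\<in>Basis. \<bar>\<xi> \<bullet> b\<bar> * ((1 + norm \<xi>) ^ k * norm (fourier f \<xi>))) =
          (\<Sum>b\<in>Basis. (1 + norm \<xi>) ^ k * norm (fourier (partial_deriv b f) \<xi>))"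
        by (intro sum.cong refl) (simp add: fourier_partial[OF Suc.prems] norm_mult)
      also have "\<dots> \<le> (\<Sum>b\<in>Basis. C b)" by (intro sum_mono C)
      finally show ?thesis using C0[of \<xi>] by linarith
    qed
    then show ?case by blast
  qed
  have wb: "weight_bound (\<lambda>x. 1 + norm x) m (fourier f)" if f: "rapid f" for m and f :: "'a \<Rightarrow> complex"
  proof -
    obtain C where C: "\<And>\<xi>. (1 + norm \<xi>) ^ (nat \<lceil>- m\<rceil>) * norm (fourier f \<xi>) \<le> C"
      using decay[OF f] by blast
    have "norm (fourier f \<xi>) \<le> C * (1 + norm \<xi>) powr m" for \<xi>
    proof -
      have p: "1 + norm \<xi> > 0" by (simp add: add_pos_nonneg)
      have "(1 + norm \<xi>) powr (- m) * norm (fourier f \<xi>) \<le> (1 + norm \<xi>) powr (real (nat \<lceil>- m\<rceil>)) * norm (fourier f \<xi>)"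
        by (intro mult_right_mono powr_mono) (auto simp: real_nat_ceiling_ge)
      also have "\<dots> \<le> C" using C[of \<xi>] p by (simp add: powr_realpow)
      finally show ?thesis using p by (simp add: powr_minus field_simps)
    qed
    then show ?thesis by (auto simp: weight_bound_def)
  qed
  have "Sym n m (fourier f)" if "rapid f" for n m and f :: "'a \<Rightarrow> complex"
    using that
  proof (induction n arbitrary: m f)
    case 0
    then show ?case using wb by simp
  next
    case (Suc n)
    show ?case
    proof (rule bounded_derivs_SucI)
      show "weight_bound (\<lambda>x. 1 + norm x) m (fourier f)" by (rule wb[OF Suc.prems])
      show "(fourier f has_derivative (\<lambda>h. fourier (\<lambda>x. - \<i> * complex_of_real (x \<bullet> h) * f x) \<xi>)) (at \<xi>)" for \<xi>
        by (intro fourier_has_derivative rapid_integrable rapid_norm_integrable Suc.prems)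
      fix v :: 'a assume "v \<in> Basis"
      have "rapid (\<lambda>x. - \<i> * (complex_of_real (x \<bullet> v) * f x))"
        by (intro rapid_cmult rapid_inner Suc.prems)
      then show "Sym n (m - norm v) (\<lambda>\<xi>. fourier (\<lambda>x. - \<i> * complex_of_real (x \<bullet> v) * f x) \<xi>)"
        using Suc.IH by (simp add: mult.assoc)
    qed
  qed
  then show ?thesis using f by (simp add: rapid_def)
qed

lemma integrable_pair_mult:
  fixes f :: "'a::euclidean_space \<Rightarrow> complex" and g :: "'b::euclidean_space \<Rightarrow> complex"
  assumes f: "integrable lborel f" and g: "integrable lborel g"
    and k: "k \<in> borel_measurable (borel \<Otimes>\<^sub>M borel)" and B: "\<And>x y. norm (k (x, y)) \<le> B"
  shows "integrable (lborel \<Otimes>\<^sub>M lborel) (\<lambda>(x, y). k (x, y) * (f x * g y))"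
proof -
  have [measurable]: "f \<in> borel_measurable borel" "g \<in> borel_measurable borel"
    using borel_measurable_integrable[OF f] borel_measurable_integrable[OF g] by simp_all
  have k'[measurable]: "k \<in> borel_measurable (lborel \<Otimes>\<^sub>M lborel)"
    using k by (subst measurable_cong_sets[OF sets_pair_measure_cong[OF sets_lborel sets_lborel] refl])
  have "integrable (lborel \<Otimes>\<^sub>M lborel) (\<lambda>(x, y). f x * g y)"
  proof (rule lborel_pair.Fubini_integrable)
    show "integrable lborel (\<lambda>x. LINT y|lborel. norm (case (x, y) of (x, y) \<Rightarrow> f x * g y))"
      using f g by (auto simp: norm_mult)
    show "AE x in lborel. integrable lborel (\<lambda>y. case (x, y) of (x, y) \<Rightarrow> f x * g y)"
      using g by auto
  qed measurable
  then have "integrable (lborel \<Otimes>\<^sub>M lborel) (\<lambda>z. B * norm (case z of (x, y) \<Rightarrow> f x * g y))"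
    by (intro integrable_mult_right integrable_norm)
  then show ?thesis
  proof (rule Bochner_Integration.integrable_bound)
    have B0: "B \<ge> 0" using order.trans[OF norm_ge_zero B] by blast
    show "AE z in lborel \<Otimes>\<^sub>M lborel. norm (case z of (x, y) \<Rightarrow> k (x, y) * (f x * g y))
        \<le> norm (B * norm (case z of (x, y) \<Rightarrow> f x * g y))"
      using B B0 by (intro AE_I2) (auto simp: norm_mult abs_mult intro!: mult_right_mono split: prod.splits)
  qed measurable
qed

text \<open>The bounded kernel k is a phase factor in all applications; absolute integrability of f
  and g then justifies the exchange.\<close>

lemma fubini_mult:
  fixes f :: "'a::euclidean_space \<Rightarrow> complex" and g :: "'b::euclidean_space \<Rightarrow> complex"
  assumes f: "integrable lborel f" and g: "integrable lborel g"
    and k: "k \<in> borel_measurable (borel \<Otimes>\<^sub>M borel)" and B: "\<And>x y. norm (k (x, y)) \<le> B"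
  shows "(LINT x|lborel. f x * (LINT y|lborel. k (x, y) * g y)) =
    (LINT y|lborel. (LINT x|lborel. k (x, y) * f x) * g y)"
proof -
  have "(LINT y|lborel. LINT x|lborel. k (x, y) * (f x * g y)) = (LINT x|lborel. LINT y|lborel. k (x, y) * (f x * g y))"
    by (rule lborel_pair.Fubini_integral) (use integrable_pair_mult[OF assms] in simp)
  moreover have "(LINT y|lborel. k (x, y) * (f x * g y)) = f x * (LINT y|lborel. k (x, y) * g y)" for x
    by (subst integral_mult_right_zero[symmetric]) (simp add: mult_ac)
  moreover have "(LINT x|lborel. k (x, y) * (f x * g y)) = (LINT x|lborel. k (x, y) * f x) * g y" for y
    by (subst integral_mult_left_zero[symmetric]) (simp add: mult_ac)
  ultimately show ?thesis by simp
qed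

lemma fourier_measurable:
  assumes "integrable lborel f"
  shows "fourier f \<in> borel_measurable borel"
proof -
  have [measurable]: "f \<in> borel_measurable borel" using borel_measurable_integrable[OF assms] by simp
  show ?thesis unfolding fourier_def[abs_def] by measurable
qed

text \<open>Exchanging the integrals leaves the transform of a Gaussian, which is (2 pi)^d times the
  heat kernel at time t: damping in frequency is heat flow in space. The inversion theorem and the
  damped Parseval identity both rest on this.\<close>

lemma gaussian_regularization:
  fixes f :: "'a::euclidean_space \<Rightarrow> complex"
  assumes f: "integrable lborel f" and t: "t > 0"
  shows "(LINT \<xi>|lborel. cis (x \<bullet> \<xi>) * complex_of_real (exp (- t * (norm \<xi>)\<^sup>2)) * fourier f \<xi>)
    = complex_of_real ((2 * pi) ^ DIM('a)) *
      (LINT y|lborel. complex_of_real ((4 * pi * t) powr (- real DIM('a) / 2) * exp (- (norm (x - y))\<^sup>2 / (4 * t))) * f y)"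
proof -
  let ?g = "\<lambda>\<xi>::'a. complex_of_real (exp (- t * (norm \<xi>)\<^sup>2))"
  have g: "integrable lborel ?g"
    using gaussian_integral[OF t, where 'a='a] by (intro integrable_of_real) (simp add: has_bochner_integral_iff)
  have "(LINT \<xi>|lborel. cis (x \<bullet> \<xi>) * ?g \<xi> * fourier f \<xi>) =
    (LINT \<xi>|lborel. ?g \<xi> * (LINT y|lborel. cis ((x - y) \<bullet> \<xi>) * f y))"
  proof (rule Bochner_Integration.integral_cong[OF refl])
    fix \<xi> :: 'a
    have "cis (x \<bullet> \<xi>) * fourier f \<xi> = (LINT y|lborel. cis ((x - y) \<bullet> \<xi>) * f y)"
      unfolding fourier_def by (subst integral_mult_right_zero[symmetric])
        (simp add: cis_mult inner_diff_left flip: mult.assoc)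
    then show "cis (x \<bullet> \<xi>) * ?g \<xi> * fourier f \<xi> = ?g \<xi> * (LINT y|lborel. cis ((x - y) \<bullet> \<xi>) * f y)"
      by (simp only: mult.assoc mult.left_commute[of _ "?g \<xi>"])
  qed
  also have "\<dots> = (LINT y|lborel. (LINT \<xi>|lborel. cis ((x - y) \<bullet> \<xi>) * ?g \<xi>) * f y)"
    using fubini_mult[OF g f, of "\<lambda>(\<xi>, y). cis ((x - y) \<bullet> \<xi>)" 1] by (simp add: split_beta')
  also have "\<dots> = (LINT y|lborel. complex_of_real ((2 * pi) ^ DIM('a)) *
     (complex_of_real ((4 * pi * t) powr (- real DIM('a) / 2) * exp (- (norm (x - y))\<^sup>2 / (4 * t))) * f y))"
  proof (rule Bochner_Integration.integral_cong[OF refl])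
    fix y
    have "(LINT \<xi>|lborel. cis ((x - y) \<bullet> \<xi>) * ?g \<xi>) = (LINT \<xi>|lborel. cis (- (\<xi> \<bullet> (y - x))) * ?g \<xi>)"
      by (simp add: inner_diff_left inner_diff_right inner_commute)
    also have "\<dots> = complex_of_real ((pi / t) powr (real DIM('a) / 2) * exp (- (norm (y - x))\<^sup>2 / (4 * t)))"
      using gaussian_fourier[OF t] by (rule has_bochner_integral_integral_eq)
    \<comment> \<open>Rewrites the Gaussian constant so that the heat kernel normalisation (4 pi
      t)^(-d/2) becomes visible.\<close>
    also have "(pi / t) powr (real DIM('a) / 2) = (2 * pi) ^ DIM('a) * (4 * pi * t) powr (- real DIM('a) / 2)"
    proof -
      have P: "(2 * pi) ^ DIM('a) = ((2 * pi)\<^sup>2) powr (real DIM('a) / 2)"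
        by (rule power_eq_square_powr) simp
      have Q: "(4 * pi * t) powr (- real DIM('a) / 2) = (1 / (4 * pi * t)) powr (real DIM('a) / 2)"
      proof -
        have "X powr (- a) = (1 / X) powr a" if "X > 0" for X a :: real
          using that by (simp add: powr_divide powr_minus_divide)
        from this[of "4 * pi * t" "real DIM('a) / 2"] show ?thesis using t by simp
      qed
      have "(2 * pi) ^ DIM('a) * (4 * pi * t) powr (- real DIM('a) / 2)
          = ((2 * pi)\<^sup>2 * (1 / (4 * pi * t))) powr (real DIM('a) / 2)"
        unfolding P Q by (rule powr_mult[symmetric]; use t in simp)
      moreover have "(2 * pi)\<^sup>2 * (1 / (4 * pi * t)) = pi / t"
        using t by (simp add: power2_eq_square field_simps)
      ultimately show ?thesis by simp
    qed
    finally show "(LINT \<xi>|lborel. cis ((x - y) \<bullet> \<xi>) * ?g \<xi>) * f y = complex_of_real ((2 * pi) ^ DIM('a)) *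
     (complex_of_real ((4 * pi * t) powr (- real DIM('a) / 2) * exp (- (norm (x - y))\<^sup>2 / (4 * t))) * f y)"
      by (simp add: norm_minus_commute mult_ac)
  qed
  finally show ?thesis by simp
qed

text \<open>As \<epsilon> tends to 0, the damping factor disappears on the frequency side, while the
  heat kernel on the other side acts as an approximate identity.\<close>

theorem fourier_inversion:
  fixes f :: "'a::euclidean_space \<Rightarrow> complex"
  assumes f: "rapid f"
  shows "inv_fourier (fourier f) x = f x"
proof -
  have fi: "integrable lborel f" by (rule rapid_integrable[OF f])
  have Fi: "integrable lborel (fourier f)" by (intro rapid_integrable rapid_fourier f)
  note [measurable] = rapid_measurable[OF f] rapid_measurable[OF rapid_fourier[OF f]]
  define \<epsilon> where "\<epsilon> n = inverse (real (Suc n))" for n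
  have \<epsilon>: "\<epsilon> n > 0" "\<epsilon> \<longlonglongrightarrow> 0" for n
    unfolding \<epsilon>_def using LIMSEQ_inverse_real_of_nat by auto
  let ?I = "\<lambda>n. LINT \<xi>|lborel. cis (x \<bullet> \<xi>) * complex_of_real (exp (- \<epsilon> n * (norm \<xi>)\<^sup>2)) * fourier f \<xi>"
  have 1: "?I \<longlonglongrightarrow> (LINT \<xi>|lborel. cis (x \<bullet> \<xi>) * fourier f \<xi>)"
  proof (rule integral_dominated_convergence[where w = "\<lambda>\<xi>. norm (fourier f \<xi>)"])
    show "AE \<xi> in lborel. (\<lambda>n. cis (x \<bullet> \<xi>) * complex_of_real (exp (- \<epsilon> n * (norm \<xi>)\<^sup>2)) * fourier f \<xi>)
       \<longlonglongrightarrow> cis (x \<bullet> \<xi>) * fourier f \<xi>"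
    proof (rule AE_I2)
      fix \<xi> :: 'a
      have "(\<lambda>n. cis (x \<bullet> \<xi>) * complex_of_real (exp (- \<epsilon> n * (norm \<xi>)\<^sup>2)) * fourier f \<xi>)
       \<longlonglongrightarrow> cis (x \<bullet> \<xi>) * complex_of_real (exp (- 0 * (norm \<xi>)\<^sup>2)) * fourier f \<xi>"
        by (intro tendsto_intros \<epsilon>)
      then show "(\<lambda>n. cis (x \<bullet> \<xi>) * complex_of_real (exp (- \<epsilon> n * (norm \<xi>)\<^sup>2)) * fourier f \<xi>)
       \<longlonglongrightarrow> cis (x \<bullet> \<xi>) * fourier f \<xi>" by simp
    qed
    show "AE \<xi> in lborel. norm (cis (x \<bullet> \<xi>) * complex_of_real (exp (- \<epsilon> n * (norm \<xi>)\<^sup>2)) * fourier f \<xi>)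
        \<le> norm (fourier f \<xi>)" for n
      using \<epsilon>(1)[of n] by (intro AE_I2) (auto simp: norm_mult intro!: mult_left_le_one_le)
  qed (use Fi in auto)
  let ?g = "\<lambda>z::'a. exp (- (norm z)\<^sup>2)"
  have gi: "has_bochner_integral lborel ?g (pi powr (real DIM('a) / 2))"
    using gaussian_integral[of 1, where 'a='a] by simp
  \<comment> \<open>The substitution y = x + 2 sqrt(\<epsilon> n) z makes the Gaussian weight
    independent of n, so that only the argument of f moves.\<close>
  have 2: "?I n = complex_of_real ((2 * pi) ^ DIM('a) * pi powr (- real DIM('a) / 2)) *
      (LINT z|lborel. complex_of_real (?g z) * f (x + (2 * sqrt (\<epsilon> n)) *\<^sub>R z))" for n
  proof -
    let ?c = "2 * sqrt (\<epsilon> n)"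
    have c: "?c > 0" using \<epsilon>(1)[of n] by simp
    have c2: "?c\<^sup>2 = 4 * \<epsilon> n" using \<epsilon>(1)[of n] by (simp add: power_mult_distrib)
    let ?k = "\<lambda>y. complex_of_real ((4 * pi * \<epsilon> n) powr (- real DIM('a) / 2) * exp (- (norm (x - y))\<^sup>2 / (4 * \<epsilon> n))) * f y"
    have "(LINT y|lborel. ?k y) = ?c ^ DIM('a) *\<^sub>R (LINT z|lborel. ?k (x + ?c *\<^sub>R z))"
      by (rule lborel_integral_affine[OF c]) measurable
    also have "(LINT z|lborel. ?k (x + ?c *\<^sub>R z)) = complex_of_real ((4 * pi * \<epsilon> n) powr (- real DIM('a) / 2)) *
        (LINT z|lborel. complex_of_real (?g z) * f (x + ?c *\<^sub>R z))"
    proof (subst integral_mult_right_zero[symmetric], rule Bochner_Integration.integral_cong[OF refl])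
      fix z :: 'a
      have "(norm (x - (x + ?c *\<^sub>R z)))\<^sup>2 / (4 * \<epsilon> n) = (norm z)\<^sup>2"
        using c2 \<epsilon>(1)[of n] by (simp add: power_mult_distrib)
      then show "?k (x + ?c *\<^sub>R z) = complex_of_real ((4 * pi * \<epsilon> n) powr (- real DIM('a) / 2)) * (complex_of_real (?g z) * f (x + ?c *\<^sub>R z))"
        by (simp add: minus_divide_left[symmetric] mult.assoc del: minus_divide_left)
    qed
    finally have A: "(LINT y|lborel. ?k y) = complex_of_real (?c ^ DIM('a) * (4 * pi * \<epsilon> n) powr (- real DIM('a) / 2)) *
        (LINT z|lborel. complex_of_real (?g z) * f (x + ?c *\<^sub>R z))"
      by (simp add: scaleR_conv_of_real mult.assoc)
    have B: "?c ^ DIM('a) * (4 * pi * \<epsilon> n) powr (- real DIM('a) / 2) = pi powr (- real DIM('a) / 2)"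
    proof -
      have "?c ^ DIM('a) = (4 * \<epsilon> n) powr (real DIM('a) / 2)"
        using power_eq_square_powr[OF c] unfolding c2 .
      then have "?c ^ DIM('a) * (4 * pi * \<epsilon> n) powr (- real DIM('a) / 2) =
        (4 * \<epsilon> n) powr (real DIM('a) / 2) * (pi powr (- real DIM('a) / 2) * (4 * \<epsilon> n) powr (- (real DIM('a) / 2)))"
        using \<epsilon>(1)[of n] by (simp add: powr_mult[symmetric] mult_ac)
      also have "\<dots> = pi powr (- real DIM('a) / 2)"
        unfolding powr_minus[of "4 * \<epsilon> n"] using \<epsilon>(1)[of n] by simp
      finally show ?thesis .
    qed
    show ?thesis
      unfolding gaussian_regularization[OF fi \<epsilon>(1)] A B by (simp only: of_real_mult mult.assoc)
  qed
  obtain C where C: "C \<ge> 0" "\<And>x. norm (f x) \<le> C" using rapid_bounded[OF f] by blast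
  have "(\<lambda>n. LINT z|lborel. complex_of_real (?g z) * f (x + (2 * sqrt (\<epsilon> n)) *\<^sub>R z)) \<longlonglongrightarrow>
      (LINT z|lborel. complex_of_real (?g z) * f x)"
  proof (rule integral_dominated_convergence[where w = "\<lambda>z. ?g z * C"])
    show "integrable lborel (\<lambda>z. ?g z * C)" using gi by (auto simp: has_bochner_integral_iff)
    have "isCont f x" using rapid_continuous[OF f] by (simp add: continuous_on_eq_continuous_at)
    have "(\<lambda>n. f (x + (2 * sqrt (\<epsilon> n)) *\<^sub>R z)) \<longlonglongrightarrow> f x" for z
    proof (rule isCont_tendsto_compose[OF \<open>isCont f x\<close>])
      have "(\<lambda>n. x + (2 * sqrt (\<epsilon> n)) *\<^sub>R z) \<longlonglongrightarrow> x + (2 * sqrt 0) *\<^sub>R z"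
        by (intro tendsto_intros \<epsilon>)
      then show "(\<lambda>n. x + (2 * sqrt (\<epsilon> n)) *\<^sub>R z) \<longlonglongrightarrow> x" by simp
    qed
    then show "AE z in lborel. (\<lambda>n. complex_of_real (?g z) * f (x + (2 * sqrt (\<epsilon> n)) *\<^sub>R z)) \<longlonglongrightarrow> complex_of_real (?g z) * f x"
      by (intro AE_I2 tendsto_intros)
    show "AE z in lborel. norm (complex_of_real (?g z) * f (x + (2 * sqrt (\<epsilon> n)) *\<^sub>R z)) \<le> ?g z * C" for n
      using C by (intro AE_I2) (auto simp: norm_mult)
  qed measurable
  then have "?I \<longlonglongrightarrow> complex_of_real ((2 * pi) ^ DIM('a) * pi powr (- real DIM('a) / 2)) *
     (LINT z|lborel. complex_of_real (?g z) * f x)"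
    unfolding 2 by (intro tendsto_intros)
  also have "(LINT z|lborel. complex_of_real (?g z) * f x) = complex_of_real (pi powr (real DIM('a) / 2)) * f x"
    using gi by (simp add: has_bochner_integral_iff del: of_real_exp)
  finally have "(LINT \<xi>|lborel. cis (x \<bullet> \<xi>) * fourier f \<xi>) =
    complex_of_real ((2 * pi) ^ DIM('a) * pi powr (- real DIM('a) / 2)) * (complex_of_real (pi powr (real DIM('a) / 2)) * f x)"
    using 1 LIMSEQ_unique by blast
  also have "\<dots> = complex_of_real ((2 * pi) ^ DIM('a) * (pi powr (- real DIM('a) / 2) * pi powr (real DIM('a) / 2))) * f x"
    by simp
  also have "pi powr (- real DIM('a) / 2) * pi powr (real DIM('a) / 2) = 1"
    by (simp add: powr_add[symmetric])
  finally show ?thesis by (simp add: inv_fourier_def)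
qed

section \<open>Cutoffs and uniqueness of representing functions\<close>

section \<open>Cutoff functions\<close>

lemma Ck_inverse:
  fixes f :: "'a::euclidean_space \<Rightarrow> complex"
  assumes "Ck n f" "\<And>x. f x \<noteq> 0"
  shows "Ck n (\<lambda>x. inverse (f x))"
  using assms(1)
proof (induction n)
  case (Suc n)
  have IH: "Ck n (\<lambda>x. inverse (f x))" using Suc.IH[OF bounded_derivs_Suc[OF Suc.prems]] .
  show ?case
  proof (rule bounded_derivs_SucI)
    show "((\<lambda>x. inverse (f x)) has_derivative (\<lambda>v. - (inverse (f x) * partial_deriv v f x * inverse (f x)))) (at x)" for x
      by (rule Deriv.has_derivative_inverse[OF assms(2) bounded_derivs_has_derivative[OF Suc.prems]])
    fix v :: 'a assume v: "v \<in> Basis"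
    have "Ck n (\<lambda>x. - 1 * (inverse (f x) * partial_deriv v f x * inverse (f x)))"
      using Ck.cmult[OF Ck.mult[OF Ck.mult[OF IH, of 0] IH], of "partial_deriv v f" "-1"]
        bounded_derivs_partial[OF Suc.prems v] by simp
    then show "bounded_derivs (\<lambda>_ _. True) (\<lambda>_. 0) n (0 - 0) (\<lambda>x. - (inverse (f x) * partial_deriv v f x * inverse (f x)))"
      by simp
  qed simp
qed simp

text \<open>Here \<open>r'\<close> is passed explicitly because the inner function is real-valued.\<close>

lemma Ck_compose_real:
  fixes g :: "real \<Rightarrow> complex" and r :: "'a::euclidean_space \<Rightarrow> real"
  assumes "\<And>n. Ck n g" and r: "\<And>x. (r has_derivative r' x) (at x)"
    and r': "\<And>v n. v \<in> Basis \<Longrightarrow> Ck n (\<lambda>x. complex_of_real (r' x v))"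
  shows "Ck n (\<lambda>x. g (r x))"
  using assms(1)
proof (induction n arbitrary: g)
  case (Suc n)
  have g: "(g has_derivative (\<lambda>h. partial_deriv h g y)) (at y)" for y
    by (rule bounded_derivs_has_derivative[OF Suc.prems[of "Suc 0"]])
  have lin: "partial_deriv h g y = complex_of_real h * partial_deriv 1 g y" for h y
    using linear_simps(5)[OF has_derivative_bounded_linear[OF g[of y]], of h 1]
    by (simp add: scaleR_conv_of_real)
  show ?case
  proof (rule bounded_derivs_SucI)
    show "((\<lambda>x. g (r x)) has_derivative (\<lambda>h. complex_of_real (r' x h) * partial_deriv 1 g (r x))) (at x)" for x
    proof -
      have "(\<lambda>h. partial_deriv (r' x h) g (r x)) = (\<lambda>h. complex_of_real (r' x h) * partial_deriv 1 g (r x))"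
        by (rule ext) (rule lin)
      then show ?thesis using has_derivative_compose[OF r g, of x] by metis
    qed
    fix v :: 'a assume v: "v \<in> Basis"
    have "Ck n (\<lambda>x. partial_deriv 1 g (r x))"
      by (rule Suc.IH) (use bounded_derivs_partial[OF Suc.prems, of 1] in simp)
    then have "Ck n (\<lambda>x. complex_of_real (r' x v) * partial_deriv 1 g (r x))"
      using Ck.mult[OF r'[OF v]] by simp
    then show "bounded_derivs (\<lambda>_ _. True) (\<lambda>_. 0) n (0 - 0) (\<lambda>x. complex_of_real (r' x v) * partial_deriv 1 g (r x))"
      by simp
  qed simp
qed simp

lemma Ck_inner: "Ck n (\<lambda>x. complex_of_real (x \<bullet> v))"
  by (rule bounded_derivs_imp_Ck[OF Sym_inner])

lemma Ck_prod: "(\<And>i. i \<in> I \<Longrightarrow> Ck n (f i)) \<Longrightarrow> Ck n (\<lambda>x. \<Prod>i\<in>I. f i x :: complex)"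
proof (induction I rule: infinite_finite_induct)
  case (insert i I)
  then show ?case using Ck.mult[of n 0 "f i" 0 "\<lambda>x. \<Prod>i\<in>I. f i x"] by simp
qed (auto intro: Ck.const)

text \<open>The division by t^k makes the family closed under differentiation; k = 0 is the
  classical smooth function that is flat at the origin.\<close>

definition flat :: "nat \<Rightarrow> real \<Rightarrow> real" where
  "flat k t = (if t > 0 then exp (- 1 / t) / t ^ k else 0)"

text \<open>From exp (1 / t) \<ge> (1 + 1 / (t * n))^n with n = k + 2: two powers more than the
  denominator, so a factor t^2 is left and the derivative at 0 vanishes.\<close>

lemma flat_bound: "\<bar>flat k t\<bar> \<le> real (k + 2) ^ (k + 2) * t\<^sup>2"
proof (cases "t > 0")
  case True
  have "(1 / t / real (k + 2)) ^ (k + 2) \<le> (1 + 1 / t / real (k + 2)) ^ (k + 2)"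
    using True by (intro power_mono) auto
  also have "\<dots> \<le> exp (1 / t)"
    by (rule exp_ge_one_plus_x_over_n_power_n) (use True in \<open>auto intro: order.trans[of _ 0]\<close>)
  finally have "(1 / t) ^ (k + 2) / real (k + 2) ^ (k + 2) \<le> exp (1 / t)"
    by (simp only: power_divide)
  then have "(1 / t) ^ (k + 2) \<le> exp (1 / t) * real (k + 2) ^ (k + 2)"
    by (subst (asm) pos_divide_le_eq) auto
  then have "(1 / t) ^ (k + 2) * exp (- 1 / t) \<le> exp (1 / t) * real (k + 2) ^ (k + 2) * exp (- 1 / t)"
    by (intro mult_right_mono) auto
  also have "\<dots> = real (k + 2) ^ (k + 2)" by (simp add: exp_minus)
  finally have "(1 / t) ^ (k + 2) * exp (- 1 / t) \<le> real (k + 2) ^ (k + 2)" .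
  then have "(1 / t) ^ (k + 2) * exp (- 1 / t) * t\<^sup>2 \<le> real (k + 2) ^ (k + 2) * t\<^sup>2"
    by (intro mult_right_mono) auto
  moreover have "(1 / t) ^ (k + 2) * exp (- 1 / t) * t\<^sup>2 = flat k t"
    using True by (simp add: flat_def power_add power_one_over field_simps power2_eq_square)
  moreover have "flat k t \<ge> 0" using True by (simp add: flat_def)
  ultimately show ?thesis by simp
qed (simp add: flat_def)

lemma flat_has_derivative:
  "(flat k has_real_derivative (flat (k + 2) t - real k * flat (k + 1) t)) (at t)"
proof -
  consider "t > 0" | "t < 0" | "t = 0" by linarith
  then show ?thesis
  proof cases
    case 1
    have "((\<lambda>t. exp (- 1 / t) / t ^ k) has_real_derivative
        (exp (- 1 / t) * (1 / t\<^sup>2) * t ^ k - exp (- 1 / t) * (real k * t ^ (k - 1))) / (t ^ k * t ^ k)) (at t)"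
      using 1 by (auto intro!: derivative_eq_intros simp: power2_eq_square)
    moreover have "(exp (- 1 / t) * (1 / t\<^sup>2) * t ^ k - exp (- 1 / t) * (real k * t ^ (k - 1))) / (t ^ k * t ^ k)
        = flat (k + 2) t - real k * flat (k + 1) t"
      using 1 by (cases k) (auto simp: flat_def field_simps power2_eq_square)
    ultimately have "((\<lambda>t. exp (- 1 / t) / t ^ k) has_real_derivative (flat (k + 2) t - real k * flat (k + 1) t)) (at t)"
      by simp
    then show ?thesis
      by (rule has_field_derivative_transform_within_open[of _ _ _ "{0<..}"]) (use 1 in \<open>auto simp: flat_def\<close>)
  next
    case 2
    have "((\<lambda>_. 0) has_real_derivative (flat (k + 2) t - real k * flat (k + 1) t)) (at t)"
      using 2 by (simp add: flat_def)
    then show ?thesis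
      by (rule has_field_derivative_transform_within_open[of _ _ _ "{..<0}"]) (use 2 in \<open>auto simp: flat_def\<close>)
  next
    case 3
    have "(\<lambda>h. flat k h / h) \<midarrow>0\<rightarrow> 0"
    proof (rule tendsto_0_le[where K = "real (k + 2) ^ (k + 2)"])
      show "\<forall>\<^sub>F h in at 0. norm (flat k h / h) \<le> norm h * real (k + 2) ^ (k + 2)"
      proof (rule always_eventually, rule allI)
        fix h :: real
        have "\<bar>flat k h\<bar> \<le> \<bar>h\<bar> * real (k + 2) ^ (k + 2) * \<bar>h\<bar>" using flat_bound[of k h] by (simp add: power2_eq_square abs_mult_self_eq mult_ac)
        then show "norm (flat k h / h) \<le> norm h * real (k + 2) ^ (k + 2)"
          by (cases "h = 0") (auto simp: divide_le_eq)
      qed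
    qed (rule tendsto_ident_at)
    then show ?thesis using 3 by (simp add: has_field_derivative_iff flat_def[of _ 0])
  qed
qed

lemma Ck_flat: "Ck n (\<lambda>t. complex_of_real (flat k t))"
proof (induction n arbitrary: k)
  case (Suc n)
  show ?case
  proof (rule bounded_derivs_SucI)
    have "(flat k has_derivative (*) (flat (k + 2) t - real k * flat (k + 1) t)) (at t)" for t
      using flat_has_derivative by (simp add: has_field_derivative_def)
    from has_derivative_of_real[OF this]
    show "((\<lambda>t. complex_of_real (flat k t)) has_derivative
        (\<lambda>h. complex_of_real ((flat (k + 2) t - real k * flat (k + 1) t) * h))) (at t)" for t .
    show "bounded_derivs (\<lambda>_ _. True) (\<lambda>_. 0) n (0 - 0) (\<lambda>t. complex_of_real ((flat (k + 2) t - real k * flat (k + 1) t) * v))"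
      if "v \<in> Basis" for v
      using that Ck.diff[OF Suc.IH[of "k + 2"] Ck.cmult[OF Suc.IH[of "k + 1"], of "complex_of_real (real k)"]] by simp
  qed simp
qed simp

definition smooth_step :: "real \<Rightarrow> real" where
  "smooth_step t = flat 0 t / (flat 0 t + flat 0 (1 - t))"

lemma flat_nonneg: "flat k t \<ge> 0" and flat_pos: "t > 0 \<Longrightarrow> flat k t > 0"
  by (auto simp: flat_def)

lemma smooth_step_denominator: "flat 0 t + flat 0 (1 - t) > 0"
  using flat_nonneg[of 0] flat_pos[of t 0] flat_pos[of "1 - t" 0]
  by (cases "t > 0") (auto intro: add_pos_nonneg add_nonneg_pos)

lemma smooth_step_0: "t \<le> 0 \<Longrightarrow> smooth_step t = 0"
  by (simp add: smooth_step_def flat_def)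

lemma smooth_step_1: "t \<ge> 1 \<Longrightarrow> smooth_step t = 1"
  using smooth_step_denominator[of t] by (auto simp: smooth_step_def flat_def)

lemma smooth_step_range: "0 \<le> smooth_step t" "smooth_step t \<le> 1"
  using smooth_step_denominator[of t] flat_nonneg[of 0 t] flat_nonneg[of 0 "1 - t"]
  by (auto simp: smooth_step_def)

lemma Ck_smooth_step: "Ck n (\<lambda>t. complex_of_real (smooth_step t))"
proof -
  have 1: "Ck n (\<lambda>t. complex_of_real (flat 0 (1 - t)))" for n
    by (rule Ck_compose_real[where g = "\<lambda>t. complex_of_real (flat 0 t)" and r = "\<lambda>t. 1 - t" and r' = "\<lambda>_ h. - h"])
       (auto intro!: Ck_flat derivative_eq_intros Ck.const)
  have "Ck n (\<lambda>t. inverse (complex_of_real (flat 0 t) + complex_of_real (flat 0 (1 - t))))"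
    using smooth_step_denominator[THEN less_imp_neq]
    by (intro Ck_inverse Ck.add Ck_flat 1) (metis of_real_add of_real_eq_0_iff)
  from Ck.mult[OF Ck_flat[of n 0] this] show ?thesis
    by (simp add: smooth_step_def divide_inverse)
qed

lemma smooth_step_measurable [measurable]: "smooth_step \<in> borel_measurable borel"
proof -
  have "continuous_on UNIV (\<lambda>t. Re (complex_of_real (smooth_step t)))"
    by (intro continuous_on_Re smooth_continuous) (auto simp: smooth_iff_Ck Ck_smooth_step)
  then show ?thesis by (intro borel_measurable_continuous_onI) simp
qed

text \<open>Rises from 0 at radius r to 1 at radius 2 * r; the divisor is (2 * r)^2 - r^2. Using the
  squared norm keeps it smooth at the origin.\<close>

definition annular_step :: "real \<Rightarrow> 'a::euclidean_space \<Rightarrow> real" where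
  "annular_step r x = smooth_step (((norm x)\<^sup>2 - r\<^sup>2) / (3 * r\<^sup>2))"

lemma annular_step_0: "norm x \<le> r \<Longrightarrow> annular_step r x = 0"
  unfolding annular_step_def by (intro smooth_step_0 divide_nonpos_nonneg) (auto intro: power_mono)

lemma annular_step_1: "r > 0 \<Longrightarrow> norm x \<ge> 2 * r \<Longrightarrow> annular_step r x = 1"
  unfolding annular_step_def
  using power_mono[of "2 * r" "norm x" 2] by (intro smooth_step_1) (simp add: power_mult_distrib)

lemma annular_step_range: "0 \<le> annular_step r x" "annular_step r x \<le> 1"
  by (auto simp: annular_step_def smooth_step_range)

lemma annular_step_measurable [measurable]: "annular_step r \<in> borel_measurable borel"
  unfolding annular_step_def[abs_def] by measurable

lemma smooth_annular_step: "smooth (\<lambda>x. complex_of_real (annular_step r x))"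
  unfolding smooth_iff_Ck annular_step_def
proof (rule allI, rule Ck_compose_real[where g = "\<lambda>t. complex_of_real (smooth_step t)"
      and r' = "\<lambda>x h. 2 * (x \<bullet> h) / (3 * r\<^sup>2)"])
  show "((\<lambda>x::'a. ((norm x)\<^sup>2 - r\<^sup>2) / (3 * r\<^sup>2)) has_derivative (\<lambda>h. 2 * (x \<bullet> h) / (3 * r\<^sup>2))) (at x)" for x
    unfolding power2_norm_eq_inner divide_inverse by (auto intro!: derivative_eq_intros simp: inner_commute)
  show "Ck n (\<lambda>x. complex_of_real (2 * (x \<bullet> v) / (3 * r\<^sup>2)))" for v :: 'a and n
    using Ck.cmult[OF Ck_inner[of n v], of "complex_of_real (2 / (3 * r\<^sup>2))"] by simp
qed (rule Ck_smooth_step)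

lemma rapid_one_minus_annular_step: "r > 0 \<Longrightarrow> rapid (\<lambda>x. 1 - complex_of_real (annular_step r x))"
proof (rule rapid_compact_support[where R = "2 * r"])
  show "smooth (\<lambda>x. 1 - complex_of_real (annular_step r x))"
    using smooth_annular_step[of r] unfolding smooth_iff_Ck by (auto intro: Ck.diff Ck.const)
  show "r > 0 \<Longrightarrow> norm x > 2 * r \<Longrightarrow> 1 - complex_of_real (annular_step r x) = 0" for x :: 'a
    by (simp add: annular_step_1)
qed

lemma Sym_annular_step: "r > 0 \<Longrightarrow> Sym n 0 (\<lambda>x. complex_of_real (annular_step r x))"
  using Sym.diff[OF Sym.const rapidD[OF rapid_one_minus_annular_step], of r n 1] by simp

section \<open>The fundamental lemma of the calculus of variations\<close>

text \<open>Smooth, supported in the closed box for every c > 0, and converging pointwise to the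
  indicator of the open box as c grows.\<close>

definition box_step :: "real \<Rightarrow> 'a::euclidean_space \<Rightarrow> 'a \<Rightarrow> 'a \<Rightarrow> real" where
  "box_step c l u x = (\<Prod>b\<in>Basis. smooth_step (c * ((x - l) \<bullet> b)) * smooth_step (c * ((u - x) \<bullet> b)))"

lemma smooth_box_step: "smooth (\<lambda>x. complex_of_real (box_step c l u x))"
  unfolding smooth_iff_Ck box_step_def of_real_prod of_real_mult
proof (rule allI, rule Ck_prod)
  fix n and b :: 'a
  have 1: "Ck n (\<lambda>x. complex_of_real (smooth_step (c * ((x - l) \<bullet> b))))"
    by (rule Ck_compose_real[where g = "\<lambda>t. complex_of_real (smooth_step t)" and r' = "\<lambda>x h. c * (h \<bullet> b)"])
       (auto intro!: Ck_smooth_step derivative_eq_intros Ck.const)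
  have 2: "Ck n (\<lambda>x. complex_of_real (smooth_step (c * ((u - x) \<bullet> b))))"
    by (rule Ck_compose_real[where g = "\<lambda>t. complex_of_real (smooth_step t)" and r' = "\<lambda>x h. c * (- h \<bullet> b)"])
       (auto intro!: Ck_smooth_step derivative_eq_intros Ck.const)
  show "Ck n (\<lambda>x. complex_of_real (smooth_step (c * ((x - l) \<bullet> b))) * complex_of_real (smooth_step (c * ((u - x) \<bullet> b))))"
    using Ck.mult[OF 1 2] by simp
qed

lemma box_step_range: "0 \<le> box_step c l u x" "box_step c l u x \<le> 1"
  unfolding box_step_def
  by (auto intro!: prod_nonneg prod_le_1 mult_le_one smooth_step_range simp: smooth_step_range)

lemma box_step_0: "c > 0 \<Longrightarrow> x \<notin> box l u \<Longrightarrow> box_step c l u x = 0"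
proof -
  assume c: "c > 0" and "x \<notin> box l u"
  then obtain b where b: "b \<in> Basis" "\<not> (l \<bullet> b < x \<bullet> b \<and> x \<bullet> b < u \<bullet> b)" by (auto simp: mem_box)
  then have "smooth_step (c * ((x - l) \<bullet> b)) * smooth_step (c * ((u - x) \<bullet> b)) = 0"
    using c by (auto simp: inner_diff_left not_less mult_le_0_iff intro!: smooth_step_0)
  then show ?thesis unfolding box_step_def using b(1) by (intro prod_zero) auto
qed

lemma rapid_box_step: "c > 0 \<Longrightarrow> rapid (\<lambda>x. complex_of_real (box_step c l u x))"
proof -
  assume c: "c > 0"
  obtain R where R: "\<And>x. x \<in> box l u \<Longrightarrow> norm x \<le> R"
    using bounded_box[of l u] by (auto simp: bounded_iff)
  show ?thesis
    by (rule rapid_compact_support[of _ R]) (use c R in \<open>auto intro!: smooth_box_step box_step_0 simp: not_less[symmetric]\<close>)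
qed

lemma box_step_tendsto: "(\<lambda>n. box_step (real (Suc n)) l u x) \<longlonglongrightarrow> indicator (box l u) x"
proof (cases "x \<in> box l u")
  case True
  have *: "\<forall>\<^sub>F n in sequentially. smooth_step (real (Suc n) * y) = 1" if y: "y > 0" for y
  proof -
    obtain N where "1 < real N * y" using reals_Archimedean3[OF y] by blast
    then have "smooth_step (real (Suc n) * y) = 1" if "n \<ge> N" for n
      using that y by (intro smooth_step_1) (smt (verit) mult_right_mono of_nat_Suc of_nat_mono)
    then show ?thesis by (auto simp: eventually_sequentially)
  qed
  have "\<forall>\<^sub>F n in sequentially. \<forall>b\<in>Basis. smooth_step (real (Suc n) * ((x - l) \<bullet> b)) = 1 \<and>
      smooth_step (real (Suc n) * ((u - x) \<bullet> b)) = 1"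
    using True by (intro eventually_ball_finite ballI eventually_conj *) (auto simp: mem_box inner_diff_left)
  then have "\<forall>\<^sub>F n in sequentially. box_step (real (Suc n)) l u x = 1"
    by eventually_elim (simp add: box_step_def)
  then show ?thesis using True by (simp add: tendsto_eventually)
next
  case False
  then show ?thesis by (simp add: box_step_0)
qed

text \<open>The positive and the negative part of f are densities of measures that agree on boxes.
  Boxes are stable under intersection and generate the Borel sets, so the measures and hence the
  densities agree.\<close>

lemma AE_zero_if_box_integrals_zero:
  fixes f :: "'a::euclidean_space \<Rightarrow> real"
  assumes f: "f \<in> borel_measurable borel"
    and int: "\<And>l u. integrable lborel (\<lambda>x. indicator (box l u) x * f x)"
    and zero: "\<And>l u. (LINT x|lborel. indicator (box l u) x * f x) = 0"
  shows "AE x in lborel. f x = 0"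
proof -
  note [measurable] = f
  let ?p = "\<lambda>x. ennreal (f x)" and ?m = "\<lambda>x. ennreal (- f x)"
  have em: "emeasure (density lborel ?p) (box l u) = ennreal (LINT x|lborel. indicator (box l u) x * max 0 (f x))"
    "emeasure (density lborel ?m) (box l u) = ennreal (LINT x|lborel. indicator (box l u) x * max 0 (- f x))"
    "(LINT x|lborel. indicator (box l u) x * max 0 (f x)) = (LINT x|lborel. indicator (box l u) x * max 0 (- f x))"
    for l u
  proof -
    have i: "integrable lborel (\<lambda>x. indicator (box l u) x * max 0 (f x))"
      "integrable lborel (\<lambda>x. indicator (box l u) x * max 0 (- f x))"
      by (rule Bochner_Integration.integrable_bound[OF int[of l u]];
          auto simp: indicator_def)+
    show "emeasure (density lborel ?p) (box l u) = ennreal (LINT x|lborel. indicator (box l u) x * max 0 (f x))"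
      by (subst emeasure_density, simp, simp, subst nn_integral_eq_integral[OF i(1), symmetric])
         (auto intro!: nn_integral_cong simp: indicator_def ennreal_neg max_def)
    show "emeasure (density lborel ?m) (box l u) = ennreal (LINT x|lborel. indicator (box l u) x * max 0 (- f x))"
      by (subst emeasure_density, simp, simp, subst nn_integral_eq_integral[OF i(2), symmetric])
         (auto intro!: nn_integral_cong simp: indicator_def ennreal_neg max_def)
    have "(LINT x|lborel. indicator (box l u) x * max 0 (f x)) - (LINT x|lborel. indicator (box l u) x * max 0 (- f x))
      = (LINT x|lborel. indicator (box l u) x * f x)"
      unfolding Bochner_Integration.integral_diff[OF i, symmetric]
      by (rule Bochner_Integration.integral_cong) (auto simp: indicator_def)
    then show "(LINT x|lborel. indicator (box l u) x * max 0 (f x)) = (LINT x|lborel. indicator (box l u) x * max 0 (- f x))"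
      using zero[of l u] by simp
  qed
  let ?E = "range (\<lambda>(a, b). box a b :: 'a set)"
  have "density lborel ?p = density lborel ?m"
  proof (rule measure_eqI_generator_eq[where E = ?E and \<Omega> = UNIV and A = "\<lambda>n::nat. box (- (real n *\<^sub>R One)) (real n *\<^sub>R One)"])
    show "Int_stable ?E" by (auto simp: Int_stable_def box_Int_box)
    show "sets (density lborel ?p) = sigma_sets UNIV ?E"
      by (simp add: borel_eq_box)
    show "sets (density lborel ?m) = sigma_sets UNIV ?E"
      by (simp add: borel_eq_box)
    show "(\<Union>n. box (- (real n *\<^sub>R One)) (real n *\<^sub>R One)) = (UNIV :: 'a set)"
      unfolding UN_box_eq_UNIV ..
    show "emeasure (density lborel ?p) X = emeasure (density lborel ?m) X" if "X \<in> ?E" for X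
      using that em by auto
    show "emeasure (density lborel ?p) (box (- (real n *\<^sub>R One)) (real n *\<^sub>R One)) \<noteq> \<infinity>" for n
      using em by simp
  qed auto
  then have "AE x in lborel. ?p x = ?m x"
    by (intro sigma_finite_measure.density_unique[OF sigma_finite_lborel]) auto
  then show ?thesis
  proof eventually_elim
    case (elim x)
    then show ?case by (cases "f x \<ge> 0") (auto simp: ennreal_neg)
  qed
qed

text \<open>Smooth steps converge boundedly to box indicators, so testing against Schwartz functions
  determines all integrals over boxes, for real and imaginary part separately.\<close>

lemma AE_zero_if_schwartz_integrals_zero:
  fixes v :: "'a::euclidean_space \<Rightarrow> complex"
  assumes v: "v \<in> borel_measurable borel"
    and int: "\<And>\<theta>. \<theta> \<in> schwartz \<Longrightarrow> integrable lborel (\<lambda>x. v x * \<theta> x)"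
    and zero: "\<And>\<theta>. \<theta> \<in> schwartz \<Longrightarrow> (LINT x|lborel. v x * \<theta> x) = 0"
  shows "AE x in lborel. v x = 0"
proof -
  note [measurable] = v
  have st: "(\<lambda>x. complex_of_real (box_step c l u x)) \<in> schwartz" if "c > 0" for c l u
    using that by (intro rapid_schwartz rapid_box_step)
  \<comment> \<open>Local integrability comes from one test function: the step of the box enlarged
    by \<open>One\<close> on each side equals 1 on the original box.\<close>
  have i: "integrable lborel (\<lambda>x. indicator (box l u) x * v x)" for l u
  proof (rule Bochner_Integration.integrable_bound[OF int[OF st[of 1 "l - One" "u + One"]]])
    show "AE x in lborel. norm (indicator (box l u) x * v x) \<le> norm (v x * complex_of_real (box_step 1 (l - One) (u + One) x))"
    proof (rule AE_I2)
      fix x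
      have "box_step 1 (l - One) (u + One) x = 1" if "x \<in> box l u"
        unfolding box_step_def using that
        by (intro prod.neutral ballI)
           (auto simp: mem_box inner_diff_left inner_add_left smooth_step_1 less_imp_le)
      then show "norm (indicator (box l u) x * v x) \<le> norm (v x * complex_of_real (box_step 1 (l - One) (u + One) x))"
        by (auto simp: indicator_def)
    qed
  qed auto
  have z: "(LINT x|lborel. indicator (box l u) x * v x) = 0" for l u
  proof -
    have "(\<lambda>n. LINT x|lborel. v x * complex_of_real (box_step (real (Suc n)) l u x)) \<longlonglongrightarrow>
        (LINT x|lborel. v x * complex_of_real (indicator (box l u) x))"
    proof (rule integral_dominated_convergence[where w = "\<lambda>x. norm (indicator (box l u) x * v x)"])
      show "AE x in lborel. (\<lambda>n. v x * complex_of_real (box_step (real (Suc n)) l u x))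
          \<longlonglongrightarrow> v x * complex_of_real (indicator (box l u) x)"
        by (intro AE_I2 tendsto_intros box_step_tendsto)
      show "AE x in lborel. norm (v x * complex_of_real (box_step (real (Suc n)) l u x)) \<le> norm (indicator (box l u) x * v x)" for n
      proof (rule AE_I2)
        fix x
        show "norm (v x * complex_of_real (box_step (real (Suc n)) l u x)) \<le> norm (indicator (box l u) x * v x)"
          using box_step_range[of "real (Suc n)" l u x] box_step_0[of "real (Suc n)" x l u]
          by (cases "x \<in> box l u") (auto simp: norm_mult mult_right_le_one_le simp del: of_nat_Suc)
      qed
      show "(\<lambda>x. v x * complex_of_real (box_step (real (Suc n)) l u x)) \<in> borel_measurable lborel" for n
        using borel_measurable_integrable[OF int[OF st]] by simp
    qed (use i in auto)
    moreover have "(LINT x|lborel. v x * complex_of_real (box_step (real (Suc n)) l u x)) = 0" for n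
      by (rule zero[OF st]) simp
    ultimately have "(LINT x|lborel. v x * complex_of_real (indicator (box l u) x)) = 0"
      by (simp add: LIMSEQ_const_iff)
    moreover have "(\<lambda>x. v x * complex_of_real (indicator (box l u) x)) = (\<lambda>x. indicator (box l u) x * v x)"
      by (auto simp: indicator_def fun_eq_iff)
    ultimately show ?thesis by simp
  qed
  have "AE x in lborel. Re (v x) = 0"
  proof (rule AE_zero_if_box_integrals_zero)
    have *: "Re (indicator (box l u) x * v x) = indicator (box l u) x * Re (v x)" for l u x
      by (simp add: indicator_def)
    show "integrable lborel (\<lambda>x. indicator (box l u) x * Re (v x))" for l u
      using integrable_Re[OF i[of l u]] by (simp only: *)
    show "(LINT x|lborel. indicator (box l u) x * Re (v x)) = 0" for l u
      using integral_Re[OF i[of l u]] z[of l u] by (simp only: *) simp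
  qed simp
  moreover have "AE x in lborel. Im (v x) = 0"
  proof (rule AE_zero_if_box_integrals_zero)
    have *: "Im (indicator (box l u) x * v x) = indicator (box l u) x * Im (v x)" for l u x
      by (simp add: indicator_def)
    show "integrable lborel (\<lambda>x. indicator (box l u) x * Im (v x))" for l u
      using integrable_Im[OF i[of l u]] by (simp only: *)
    show "(LINT x|lborel. indicator (box l u) x * Im (v x)) = 0" for l u
      using integral_Im[OF i[of l u]] z[of l u] by (simp only: *) simp
  qed simp
  ultimately show ?thesis
    by eventually_elim (simp add: complex_eq_iff)
qed

text \<open>Makes the choices by \<open>SOME\<close> in \<open>frac_laplacian\<close> and
  \<open>fgf\<close> immaterial up to null sets.\<close>

lemma represents_unique:
  assumes "represents v u" "represents v' u"
  shows "AE x in lborel. v x = v' x"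
proof -
  have "AE x in lborel. v x - v' x = 0"
    using assms by (intro AE_zero_if_schwartz_integrals_zero)
      (auto simp: represents_def left_diff_distrib distr_of_def)
  then show ?thesis by simp
qed

section \<open>The symbol of the cut off kernel\<close>

section \<open>Homogeneous symbols\<close>

lemma norm_powr_has_derivative:
  fixes x :: "'a::euclidean_space"
  assumes "x \<noteq> 0"
  shows "((\<lambda>x. norm x powr \<tau>) has_derivative (\<lambda>h. \<tau> * (x \<bullet> h) * norm x powr (\<tau> - 2))) (at x)"
proof -
  have "((\<lambda>x::'a. (x \<bullet> x) powr (\<tau> / 2)) has_derivative
      (\<lambda>h. (x \<bullet> x) powr (\<tau> / 2) * (0 * ln (x \<bullet> x) + (2 * (x \<bullet> h)) * (\<tau> / 2) / (x \<bullet> x)))) (at x)"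
    using assms by (auto intro!: has_derivative_powr derivative_eq_intros simp: inner_commute)
  moreover have "(x \<bullet> x) powr (\<tau> / 2) = norm x powr \<tau>" for x :: 'a
    by (simp add: power2_norm_eq_inner[symmetric] powr_powr powr_numeral[symmetric] del: powr_numeral)
  moreover have "norm x powr (\<tau> - 2) = norm x powr \<tau> / (x \<bullet> x)"
    using assms by (simp add: powr_diff power2_norm_eq_inner)
  ultimately show ?thesis by (simp add: mult_ac)
qed

text \<open>The derivative of norm x powr \<tau> is \<tau> * (x \<bullet> v) * norm x powr (\<tau> -
  2). The linear factor joins f and raises its order by one while the exponent drops by two, so the
  induction closes with f, k and \<tau> general.\<close>

lemma Sym_times_norm_powr:
  fixes f :: "'a::euclidean_space \<Rightarrow> complex"
  assumes f: "\<And>n. Sym n k f" and f0: "\<And>x. norm x < r \<Longrightarrow> f x = 0" and r: "0 < r" "r \<le> 1"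
  shows "Sym n (k + \<tau>) (\<lambda>x. f x * complex_of_real (norm x powr \<tau>))"
  using f f0
proof (induction n arbitrary: f k \<tau>)
  have bd: "weight_bound (\<lambda>x. 1 + norm x) (k + \<tau>) (\<lambda>x. f x * complex_of_real (norm x powr \<tau>))"
    if f: "\<And>n. Sym n k f" "\<And>x. norm x < r \<Longrightarrow> f x = 0" for k \<tau> and f :: "'a \<Rightarrow> complex"
  proof -
    obtain C where C: "C \<ge> 0" "\<And>x. norm (f x) \<le> C * (1 + norm x) powr k"
      using bounded_derivsD[OF f(1)] by (meson weight_boundE)
    have "norm (f x * complex_of_real (norm x powr \<tau>)) \<le> (C * (2 / r) powr \<bar>\<tau>\<bar>) * (1 + norm x) powr (k + \<tau>)" for x
    proof (cases "norm x < r")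
      case True
      then show ?thesis using f(2)[of x] C(1) by simp
    next
      case False
      then have x: "norm x \<ge> r" by simp
      have "norm x powr \<tau> \<le> (2 / r) powr \<bar>\<tau>\<bar> * (1 + norm x) powr \<tau>"
      proof (cases "\<tau> \<ge> 0")
        case True
        have "norm x powr \<tau> \<le> 1 * (1 + norm x) powr \<tau>" using True by (simp add: powr_mono2)
        also have "\<dots> \<le> (2 / r) powr \<bar>\<tau>\<bar> * (1 + norm x) powr \<tau>"
          using r by (intro mult_right_mono ge_one_powr_ge_zero) auto
        finally show ?thesis .
      next
        case False
        \<comment> \<open>For negative \<tau> the quantities 1 + norm x and norm x must be
          comparable; outside the ball of radius r \<le> 1 their ratio is at most 2 / r.\<close>
        have "r * norm x \<le> 1 * norm x" using r by (intro mult_right_mono) auto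
        then have "1 + norm x \<le> (2 / r) * norm x" using x r by (simp add: field_simps)
        then have "(1 + norm x) powr (- \<tau>) \<le> ((2 / r) * norm x) powr (- \<tau>)"
          using False by (intro powr_mono2) auto
        also have "\<dots> = (2 / r) powr (- \<tau>) * norm x powr (- \<tau>)"
          by (rule powr_mult; use r in simp)
        finally have "(1 + norm x) powr (- \<tau>) \<le> (2 / r) powr \<bar>\<tau>\<bar> * norm x powr (- \<tau>)" using False by simp
        moreover have "norm x > 0" "1 + norm x > 0" using x r by (auto simp: add_pos_nonneg)
        ultimately show ?thesis by (simp add: powr_minus field_simps)
      qed
      then have "norm (f x) * norm x powr \<tau> \<le> (C * (1 + norm x) powr k) * ((2 / r) powr \<bar>\<tau>\<bar> * (1 + norm x) powr \<tau>)"
        using C by (intro mult_mono) auto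
      then show ?thesis by (simp add: norm_mult powr_add mult_ac)
    qed
    then show ?thesis by (auto simp: weight_bound_def)
  qed
  {
    case 0
    show ?case using bd[OF 0] by simp
  next
    case (Suc n)
    have fd: "(f has_derivative (\<lambda>v. partial_deriv v f x)) (at x)" for x
      by (rule bounded_derivs_has_derivative[OF Suc.prems(1)])
    have p0: "partial_deriv v f x = 0" if x: "norm x < r" for v x
    proof -
      have "(f has_derivative (\<lambda>_. 0)) (at x)"
      proof (rule has_derivative_transform_within_open[of "\<lambda>_. 0" _ _ UNIV])
        show "open {x::'a. norm x < r}" by (intro open_Collect_less continuous_intros)
      qed (use x Suc.prems(2) in auto)
      then show ?thesis by (auto dest: partial_deriv_eq)
    qed
    show ?case
    proof (rule bounded_derivs_SucI)
      show "weight_bound (\<lambda>x. 1 + norm x) (k + \<tau>) (\<lambda>x. f x * complex_of_real (norm x powr \<tau>))"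
        by (rule bd[OF Suc.prems])
      show "((\<lambda>x. f x * complex_of_real (norm x powr \<tau>)) has_derivative
        (\<lambda>v. partial_deriv v f x * complex_of_real (norm x powr \<tau>)
           + (\<tau> * (complex_of_real (x \<bullet> v) * f x)) * complex_of_real (norm x powr (\<tau> - 2)))) (at x)" for x
      proof (cases "norm x < r")
        case True
        have "((\<lambda>x. f x * complex_of_real (norm x powr \<tau>)) has_derivative (\<lambda>_. 0)) (at x)"
        proof (rule has_derivative_transform_within_open[of "\<lambda>_. 0" _ _ UNIV])
          show "open {x::'a. norm x < r}" by (intro open_Collect_less continuous_intros)
        qed (use True Suc.prems(2) in auto)
        then show ?thesis using p0[OF True] Suc.prems(2)[OF True] by simp
      next
        case False
        then have "x \<noteq> 0" using r by auto
        from has_derivative_mult[OF fd has_derivative_of_real[OF norm_powr_has_derivative[OF this]]]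
        show ?thesis by (simp add: mult_ac add_ac)
      qed
      fix v :: 'a assume v: "v \<in> Basis"
      have "Sym n ((k - norm v) + \<tau>) (\<lambda>x. partial_deriv v f x * complex_of_real (norm x powr \<tau>))"
        using bounded_derivs_partial[OF Suc.prems(1) v] p0 by (intro Suc.IH) auto
      moreover have "Sym n ((1 + k) + (\<tau> - 2)) (\<lambda>x. (\<tau> * (complex_of_real (x \<bullet> v) * f x)) * complex_of_real (norm x powr (\<tau> - 2)))"
        by (intro Suc.IH Sym.cmult Sym.mult Sym_inner Suc.prems) (use Suc.prems in auto)
      ultimately show "Sym n (k + \<tau> - norm v) (\<lambda>x. partial_deriv v f x * complex_of_real (norm x powr \<tau>)
           + (\<tau> * (complex_of_real (x \<bullet> v) * f x)) * complex_of_real (norm x powr (\<tau> - 2)))"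
        using v by (intro Sym.add) (simp_all add: algebra_simps)
    qed
  }
qed

text \<open>The cutoff equals 1 from radius 1/2 on. Homogeneity thus holds on an open set containing
  all \<xi> with norm \<xi> \<ge> 1 and passes to derivatives there.\<close>

definition hom_symbol :: "real \<Rightarrow> 'a::euclidean_space \<Rightarrow> complex" where
  "hom_symbol \<tau> \<xi> = complex_of_real (annular_step (1/4) \<xi>) * complex_of_real (norm \<xi> powr \<tau>)"

lemma Sym_hom_symbol: "Sym n \<tau> (hom_symbol \<tau>)"
proof -
  have "Sym n (0 + \<tau>) (\<lambda>\<xi>::'a. complex_of_real (annular_step (1/4) \<xi>) * complex_of_real (norm \<xi> powr \<tau>))"
    by (rule Sym_times_norm_powr[where r = "1/4"]) (auto simp: Sym_annular_step annular_step_0)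
  then show ?thesis by (simp add: hom_symbol_def[abs_def])
qed

lemma hom_symbol_eq: "norm \<xi> \<ge> 1/2 \<Longrightarrow> hom_symbol \<tau> \<xi> = complex_of_real (norm \<xi> powr \<tau>)"
  by (simp add: hom_symbol_def annular_step_1)

text \<open>Both sides of the homogeneity relation are differentiated in \<xi>; the strict
  inequality keeps the region open. The inner derivative contributes the factor t that lowers the
  degree by one.\<close>

lemma homogeneous_partial_deriv:
  fixes f :: "'a::euclidean_space \<Rightarrow> complex"
  assumes f: "smooth f" and h: "\<And>\<xi> t. norm \<xi> > r \<Longrightarrow> t \<ge> 1 \<Longrightarrow> f (t *\<^sub>R \<xi>) = complex_of_real (t powr m) * f \<xi>"
    and \<xi>: "norm \<xi> > r" and t: "t \<ge> 1"
  shows "partial_deriv v f (t *\<^sub>R \<xi>) = complex_of_real (t powr (m - 1)) * partial_deriv v f \<xi>"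
proof -
  have lin: "partial_deriv (t *\<^sub>R v) f y = t *\<^sub>R partial_deriv v f y" for y
    using linear_simps(5)[OF has_derivative_bounded_linear[OF smooth_has_derivative[OF f, of y]]] .
  have "((\<lambda>\<xi>. f (t *\<^sub>R \<xi>)) has_derivative (\<lambda>v. partial_deriv (t *\<^sub>R v) f (t *\<^sub>R \<xi>))) (at \<xi>)"
    by (rule has_derivative_compose[where f = "\<lambda>\<xi>. t *\<^sub>R \<xi>" and g = f, OF _ smooth_has_derivative[OF f]])
       (auto intro!: derivative_eq_intros)
  moreover have "((\<lambda>\<xi>. f (t *\<^sub>R \<xi>)) has_derivative (\<lambda>v. complex_of_real (t powr m) * partial_deriv v f \<xi>)) (at \<xi>)"
  proof (rule has_derivative_transform_within_open[of "\<lambda>\<xi>. complex_of_real (t powr m) * f \<xi>" _ _ UNIV])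
    show "open {x::'a. norm x > r}" by (intro open_Collect_less continuous_intros)
    show "((\<lambda>\<xi>. complex_of_real (t powr m) * f \<xi>) has_derivative (\<lambda>v. complex_of_real (t powr m) * partial_deriv v f \<xi>)) (at \<xi>)"
      by (rule has_derivative_mult_right[OF smooth_has_derivative[OF f]])
  qed (use \<xi> h t in auto)
  ultimately have "partial_deriv (t *\<^sub>R v) f (t *\<^sub>R \<xi>) = complex_of_real (t powr m) * partial_deriv v f \<xi>"
    using has_derivative_unique by metis
  then have "complex_of_real t * partial_deriv v f (t *\<^sub>R \<xi>) = complex_of_real (t powr m) * partial_deriv v f \<xi>"
    by (simp add: lin scaleR_conv_of_real)
  moreover have "complex_of_real (t powr m) = complex_of_real t * complex_of_real (t powr (m - 1))"
  proof -
    have "t powr m = t * t powr (m - 1)" using t by (simp add: powr_diff)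
    then show ?thesis by (metis of_real_mult)
  qed
  ultimately show ?thesis using t by (simp add: mult.assoc)
qed

lemma homogeneous_iter_deriv:
  fixes f :: "'a::euclidean_space \<Rightarrow> complex"
  assumes f: "smooth f" and h: "\<And>\<xi> t. norm \<xi> > r \<Longrightarrow> t \<ge> 1 \<Longrightarrow> f (t *\<^sub>R \<xi>) = complex_of_real (t powr m) * f \<xi>"
    and vs: "set vs \<subseteq> Basis" and \<xi>: "norm \<xi> > r" and t: "t \<ge> 1"
  shows "iter_deriv vs f (t *\<^sub>R \<xi>) = complex_of_real (t powr (m - real (length vs))) * iter_deriv vs f \<xi>"
  using vs \<xi> t
proof (induction vs arbitrary: \<xi> t)
  case Nil
  then show ?case using h by simp
next
  case (Cons v vs)
  have "partial_deriv v (iter_deriv vs f) (t *\<^sub>R \<xi>) =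
      complex_of_real (t powr (m - real (length vs) - 1)) * partial_deriv v (iter_deriv vs f) \<xi>"
    by (rule homogeneous_partial_deriv[where r = r]) (use Cons f smooth_iter_deriv in auto)
  then show ?case by (simp add: iter_deriv_Cons diff_diff_eq add.commute del: iter_deriv.simps)
qed

section \<open>Incomplete Gamma functions\<close>

text \<open>Translates between the set integral over S in the change of variables theorem and the
  Bochner integral over \<open>lborel\<close> with an indicator.\<close>

lemma has_bochner_integral_set_lborel:
  fixes h :: "real \<Rightarrow> real"
  assumes h: "h \<in> borel_measurable borel" and S: "S \<in> sets borel"
  shows "h absolutely_integrable_on S \<and> integral S h = b \<longleftrightarrow>
    has_bochner_integral lborel (\<lambda>x. indicator S x * h x) b"
proof -
  have m: "(\<lambda>x. indicator S x * h x) \<in> borel_measurable lborel" using assms by measurable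
  have "set_integrable lebesgue S h \<longleftrightarrow> integrable lborel (\<lambda>x. indicator S x * h x)"
    unfolding set_integrable_def using integrable_completion[OF m] by simp
  moreover have "integral S h = (LINT x|lborel. indicator S x * h x)" if "set_integrable lebesgue S h"
    using set_lebesgue_integral_eq_integral(2)[OF that] integral_completion[OF m]
    by (simp add: set_lebesgue_integral_def)
  ultimately show ?thesis by (auto simp: has_bochner_integral_iff)
qed

text \<open>Change of variables by the involution t -> 1 / t of the half line, with Jacobian 1 /
  t^2.\<close>

lemma has_bochner_integral_inverse_substitution:
  fixes f :: "real \<Rightarrow> real"
  assumes f[measurable]: "f \<in> borel_measurable borel"
  shows "has_bochner_integral lborel (\<lambda>t. indicator {0<..} t * f t) b \<longleftrightarrow>
    has_bochner_integral lborel (\<lambda>t. indicator {0<..} t * (1 / t\<^sup>2 * f (1 / t))) b"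
proof -
  have img: "(\<lambda>t. 1 / t) ` {0<..} = {0::real<..}"
  proof
    show "{0<..} \<subseteq> (\<lambda>t. 1 / t) ` {0::real<..}"
    proof
      fix t :: real assume "t \<in> {0<..}"
      then show "t \<in> (\<lambda>t. 1 / t) ` {0<..}" by (intro image_eqI[of _ _ "1 / t"]) auto
    qed
  qed auto
  define S where "S = {0::real<..}"
  define g where "g = (\<lambda>t::real. 1 / t)"
  define h where "h = (\<lambda>x::real. \<bar>- (1 / x\<^sup>2)\<bar> * f (g x))"
  have "h absolutely_integrable_on S \<and> integral S h = b \<longleftrightarrow>
      f absolutely_integrable_on (g ` S) \<and> integral (g ` S) f = b"
    unfolding h_def
    by (rule has_absolute_integral_change_of_variables_1')
       (auto intro!: derivative_eq_intros inj_onI simp: power2_eq_square S_def g_def)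
  moreover have "g ` S = S" using img by (simp add: g_def S_def)
  moreover have "h \<in> borel_measurable borel" "S \<in> sets borel" unfolding h_def g_def S_def by measurable
  ultimately show ?thesis
    using has_bochner_integral_set_lborel[of h S b] has_bochner_integral_set_lborel[of f S b] f
    by (simp add: h_def g_def S_def)
qed

lemma has_bochner_integral_Gamma:
  fixes s r :: real
  assumes s: "s > 0" and r: "r > 0"
  shows "has_bochner_integral lborel (\<lambda>t. indicator {0<..} t * (t powr (s - 1) * exp (- t * r))) (Gamma s * r powr (- s))"
proof (rule has_bochner_integral_nn_integral)
  let ?I = "\<integral>\<^sup>+t. ennreal (indicator {0<..} t * (t powr (s - 1) * exp (- t * r))) \<partial>lborel"
  have G: "Gamma s > 0" using s by (rule Gamma_real_pos)
  have "ennreal (Gamma s) = (\<integral>\<^sup>+t. ennreal (indicator {0..} t * t powr (s - 1) / exp t) \<partial>lborel)"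
    by (rule Gamma_conv_nn_integral_real[OF s])
  also have "\<dots> = ennreal \<bar>r\<bar> * (\<integral>\<^sup>+t. ennreal (indicator {0..} (0 + r * t) * (0 + r * t) powr (s - 1) / exp (0 + r * t)) \<partial>lborel)"
    by (rule nn_integral_real_affine) (use r in auto)
  also have "(\<integral>\<^sup>+t. ennreal (indicator {0..} (0 + r * t) * (0 + r * t) powr (s - 1) / exp (0 + r * t)) \<partial>lborel)
     = (\<integral>\<^sup>+t. ennreal (r powr (s - 1)) * ennreal (indicator {0<..} t * (t powr (s - 1) * exp (- t * r))) \<partial>lborel)"
  proof (rule nn_integral_cong)
    fix t :: real
    consider "t > 0" | "t = 0" | "t < 0" by linarith
    then show "ennreal (indicator {0..} (0 + r * t) * (0 + r * t) powr (s - 1) / exp (0 + r * t))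
       = ennreal (r powr (s - 1)) * ennreal (indicator {0<..} t * (t powr (s - 1) * exp (- t * r)))"
    proof cases
      case 1
      then show ?thesis using r
        by (simp add: ennreal_mult[symmetric] powr_mult exp_minus divide_inverse mult_ac)
    next
      case 3
      then have "\<not> 0 \<le> r * t" using r by (simp add: zero_le_mult_iff)
      then show ?thesis using 3 by simp
    qed simp
  qed
  also have "\<dots> = ennreal (r powr (s - 1)) * ?I"
    by (rule nn_integral_cmult) simp
  finally have "ennreal (Gamma s) = ennreal \<bar>r\<bar> * (ennreal (r powr (s - 1)) * ?I)" .
  moreover have "ennreal (r powr s) = ennreal \<bar>r\<bar> * ennreal (r powr (s - 1))"
    using r by (simp add: ennreal_mult[symmetric] powr_diff)
  ultimately have *: "ennreal (Gamma s) = ennreal (r powr s) * ?I"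
    by (simp only: mult.assoc)
  have "?I = ennreal (r powr (- s)) * (ennreal (r powr s) * ?I)"
    using r by (simp add: mult.assoc[symmetric] ennreal_mult[symmetric] powr_add[symmetric])
  also have "\<dots> = ennreal (r powr (- s)) * ennreal (Gamma s)" by (simp only: *)
  also have "\<dots> = ennreal (Gamma s * r powr (- s))"
    using G by (simp add: ennreal_mult[symmetric] mult.commute)
  finally show "?I = ennreal (Gamma s * r powr (- s))" .
  show "0 \<le> Gamma s * r powr (- s)" using G by simp
qed auto

text \<open>For r > 0 this is r powr (- \<sigma>) times the upper incomplete Gamma function. In this
  form differentiation in r merely shifts \<sigma> by one.\<close>

definition gamma_tail :: "real \<Rightarrow> real \<Rightarrow> real" where
  "gamma_tail \<sigma> r = (LINT t|lborel. indicator {1..} t * (t powr (\<sigma> - 1) * exp (- t * r)))"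

text \<open>For \<open>- 1 < \<sigma> \<le> 0\<close> the integrand is regularized at \<open>t = 0\<close>.\<close>

definition gamma_head :: "real \<Rightarrow> real \<Rightarrow> real" where
  "gamma_head \<sigma> r = (LINT t|lborel. indicator {0<..<1} t *
     (t powr (\<sigma> - 1) * (exp (- t * r) - (if \<sigma> \<le> 0 then 1 else 0))))"

text \<open>For t \<ge> 1 the power increases with its exponent, so Euler's integrand with parameter
  \<open>max \<sigma> 1\<close> dominates.\<close>

lemma integrable_gamma_tail:
  fixes \<sigma> r :: real
  assumes r: "r > 0"
  shows "integrable lborel (\<lambda>t. indicator {1..} t * (t powr (\<sigma> - 1) * exp (- t * r)))"
proof -
  have "integrable lborel (\<lambda>t. indicator {0<..} t * (t powr (max \<sigma> 1 - 1) * exp (- t * r)))"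
    using has_bochner_integral_Gamma[of "max \<sigma> 1" r] r by (auto simp: has_bochner_integral_iff)
  then show ?thesis
    by (rule Bochner_Integration.integrable_bound)
       (auto simp: indicator_def powr_mono intro!: mult_right_mono)
qed

text \<open>On the unit interval exp 1 * exp (- t) \<ge> 1, so a multiple of Euler's integrand with
  parameter a + 1 dominates.\<close>

lemma integrable_powr_0_1:
  assumes "a > - 1"
  shows "integrable lborel (\<lambda>t::real. indicator {0<..<1} t * t powr a)"
proof -
  have "integrable lborel (\<lambda>t. exp 1 * (indicator {0<..} t * (t powr ((a + 1) - 1) * exp (- t * 1))))"
    using has_bochner_integral_Gamma[of "a + 1" 1] assms
    by (intro integrable_mult_right) (auto simp: has_bochner_integral_iff)
  then show ?thesis
  proof (rule Bochner_Integration.integrable_bound)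
    show "AE t in lborel. norm (indicator {0<..<1} t * t powr a) \<le> norm (exp 1 * (indicator {0<..} t * (t powr ((a + 1) - 1) * exp (- t * 1))))"
    proof (rule AE_I2)
      fix t :: real
      have "t powr a * 1 \<le> t powr a * (exp 1 * exp (- t))" if "0 < t" "t < 1"
        using that by (intro mult_left_mono) (auto simp flip: exp_add)
      then show "norm (indicator {0<..<1} t * t powr a) \<le> norm (exp 1 * (indicator {0<..} t * (t powr ((a + 1) - 1) * exp (- t * 1))))"
        by (auto simp: indicator_def mult_ac)
    qed
  qed simp
qed

lemma abs_exp_minus_one_le: "\<bar>exp x - 1\<bar> \<le> \<bar>x\<bar> * exp \<bar>x\<bar>" for x :: real
proof -
  have "exp x - 1 \<le> \<bar>x\<bar> * exp \<bar>x\<bar>"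
  proof -
    have "1 - x \<le> exp (- x)" using exp_ge_add_one_self[of "- x"] by simp
    then have "(1 - x) * exp x \<le> exp (- x) * exp x" by (intro mult_right_mono) auto
    then have "exp x - 1 \<le> x * exp x" by (simp add: exp_minus algebra_simps)
    also have "\<dots> \<le> \<bar>x\<bar> * exp \<bar>x\<bar>" by (intro mult_mono) auto
    finally show ?thesis .
  qed
  moreover have "1 - exp x \<le> \<bar>x\<bar> * exp \<bar>x\<bar>"
  proof -
    have "1 - exp x \<le> - x" using exp_ge_add_one_self[of x] by linarith
    also have "\<dots> \<le> \<bar>x\<bar> * 1" by simp
    also have "\<dots> \<le> \<bar>x\<bar> * exp \<bar>x\<bar>" by (intro mult_left_mono) auto
    finally show ?thesis .
  qed
  ultimately show ?thesis by linarith
qed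

text \<open>For \<sigma> \<le> 0 the subtracted 1 gains a factor t from exp (- t * r) - 1 = O(t),
  which leaves t powr \<sigma>, integrable at 0 exactly when \<sigma> > -1.\<close>

lemma integrable_gamma_head:
  fixes \<sigma> r :: real
  assumes \<sigma>: "\<sigma> > - 1"
  shows "integrable lborel (\<lambda>t. indicator {0<..<1} t *
     (t powr (\<sigma> - 1) * (exp (- t * r) - (if \<sigma> \<le> 0 then 1 else 0))))"
proof (cases "\<sigma> > 0")
  case True
  have "integrable lborel (\<lambda>t. exp \<bar>r\<bar> * (indicator {0<..<1} t * t powr (\<sigma> - 1)))"
    using True by (intro integrable_mult_right integrable_powr_0_1) auto
  then show ?thesis
  proof (rule Bochner_Integration.integrable_bound)
    show "AE t in lborel. norm (indicator {0<..<1} t * (t powr (\<sigma> - 1) * (exp (- t * r) - (if \<sigma> \<le> 0 then 1 else 0))))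
       \<le> norm (exp \<bar>r\<bar> * (indicator {0<..<1} t * t powr (\<sigma> - 1)))"
    proof (rule AE_I2)
      fix t :: real
      have "t powr (\<sigma> - 1) * exp (- t * r) \<le> t powr (\<sigma> - 1) * exp \<bar>r\<bar>" if "0 < t" "t < 1"
      proof -
        have "\<bar>t * r\<bar> \<le> 1 * \<bar>r\<bar>" using that unfolding abs_mult by (intro mult_right_mono) auto
        then have "- t * r \<le> \<bar>r\<bar>" by simp
        then show ?thesis by (intro mult_left_mono) auto
      qed
      then show "norm (indicator {0<..<1} t * (t powr (\<sigma> - 1) * (exp (- t * r) - (if \<sigma> \<le> 0 then 1 else 0))))
       \<le> norm (exp \<bar>r\<bar> * (indicator {0<..<1} t * t powr (\<sigma> - 1)))"
        using True by (auto simp: indicator_def mult_ac)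
    qed
  qed simp
next
  case False
  have "integrable lborel (\<lambda>t. \<bar>r\<bar> * exp \<bar>r\<bar> * (indicator {0<..<1} t * t powr \<sigma>))"
    using \<sigma> by (intro integrable_mult_right integrable_powr_0_1) auto
  then show ?thesis
  proof (rule Bochner_Integration.integrable_bound)
    show "AE t in lborel. norm (indicator {0<..<1} t * (t powr (\<sigma> - 1) * (exp (- t * r) - (if \<sigma> \<le> 0 then 1 else 0))))
       \<le> norm (\<bar>r\<bar> * exp \<bar>r\<bar> * (indicator {0<..<1} t * t powr \<sigma>))"
    proof (rule AE_I2)
      fix t :: real
      have "t powr (\<sigma> - 1) * \<bar>exp (- t * r) - 1\<bar> \<le> \<bar>r\<bar> * exp \<bar>r\<bar> * t powr \<sigma>" if "0 < t" "t < 1"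
      proof -
        have "\<bar>exp (- t * r) - 1\<bar> \<le> \<bar>- t * r\<bar> * exp \<bar>- t * r\<bar>" by (rule abs_exp_minus_one_le)
        also have "\<dots> \<le> (t * \<bar>r\<bar>) * exp \<bar>r\<bar>"
        proof (intro mult_mono)
          have "\<bar>t * r\<bar> \<le> 1 * \<bar>r\<bar>" using that unfolding abs_mult by (intro mult_right_mono) auto
          then show "exp \<bar>- t * r\<bar> \<le> exp \<bar>r\<bar>" by simp
        qed (use that in \<open>auto simp: abs_mult\<close>)
        finally have "t powr (\<sigma> - 1) * \<bar>exp (- t * r) - 1\<bar> \<le> t powr (\<sigma> - 1) * ((t * \<bar>r\<bar>) * exp \<bar>r\<bar>)"
          by (intro mult_left_mono) auto
        also have "\<dots> = \<bar>r\<bar> * exp \<bar>r\<bar> * t powr \<sigma>"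
          using that by (simp add: powr_diff)
        finally show ?thesis .
      qed
      then show "norm (indicator {0<..<1} t * (t powr (\<sigma> - 1) * (exp (- t * r) - (if \<sigma> \<le> 0 then 1 else 0))))
       \<le> norm (\<bar>r\<bar> * exp \<bar>r\<bar> * (indicator {0<..<1} t * t powr \<sigma>))"
        using False by (auto simp: indicator_def abs_mult)
    qed
  qed simp
qed

text \<open>For parameters within r / 2 of r, the differentiated integrands are dominated by the one
  at r / 2.\<close>

lemma gamma_tail_has_derivative:
  assumes r: "r > 0"
  shows "(gamma_tail \<sigma> has_real_derivative - gamma_tail (\<sigma> + 1) r) (at r)"
proof -
  have D: "(gamma_tail \<sigma> has_derivative
    (\<lambda>h. LINT t|lborel. - h * (indicator {1..} t * (t powr (\<sigma> + 1 - 1) * exp (- t * r))))) (at r)"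
    unfolding gamma_tail_def[abs_def]
  proof (rule has_derivative_integral[where r = "r / 2"
        and g = "\<lambda>t. indicator {1..} t * (t powr (\<sigma> + 1 - 1) * exp (- t * (r / 2)))"
        and f' = "\<lambda>r t h. - h * (indicator {1..} t * (t powr (\<sigma> + 1 - 1) * exp (- t * r)))"])
    fix x :: real assume "dist x r < r / 2"
    then have x: "x > r / 2" using r by (auto simp: dist_real_def abs_if split: if_splits)
    show "integrable lborel (\<lambda>t. indicator {1..} t * (t powr (\<sigma> - 1) * exp (- t * x)))"
      using x r by (intro integrable_gamma_tail) auto
    fix t :: real
    have "t powr \<sigma> = t * t powr (\<sigma> - 1)" if "t \<ge> 1" using that by (simp add: powr_diff)
    then show "((\<lambda>x. indicator {1..} t * (t powr (\<sigma> - 1) * exp (- t * x))) has_derivative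
        (\<lambda>h. - h * (indicator {1..} t * (t powr (\<sigma> + 1 - 1) * exp (- t * x))))) (at x)"
      by (auto intro!: derivative_eq_intros simp: fun_eq_iff indicator_def)
    fix h :: real
    have "exp (- t * x) \<le> exp (- t * (r / 2))" if "t \<ge> 1"
      using x that by (auto intro!: mult_left_mono)
    then show "norm (- h * (indicator {1..} t * (t powr (\<sigma> + 1 - 1) * exp (- t * x)))) \<le>
        indicator {1..} t * (t powr (\<sigma> + 1 - 1) * exp (- t * (r / 2))) * norm h"
      by (auto simp: indicator_def abs_mult mult.commute[of "\<bar>h\<bar>"] intro!: mult_right_mono mult_left_mono)
  qed (use r integrable_gamma_tail[of "r / 2" "\<sigma> + 1"] in auto)
  have L: "(LINT t|lborel. - h * (indicator {1..} t * (t powr (\<sigma> + 1 - 1) * exp (- t * r)))) = - gamma_tail (\<sigma> + 1) r * h" for h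
    unfolding gamma_tail_def by (subst integral_mult_right_zero) simp
  show ?thesis using D unfolding L has_field_derivative_def .
qed

text \<open>The derivative is a head with parameter \<sigma> + 1 > 0, so the regularizing constant
  disappears after one differentiation. The formula holds for every real r, which gives smoothness
  through r = 0.\<close>

lemma gamma_head_has_derivative:
  assumes \<sigma>: "\<sigma> > - 1"
  shows "(gamma_head \<sigma> has_real_derivative - gamma_head (\<sigma> + 1) r) (at r)"
proof -
  let ?c = "\<lambda>\<sigma>::real. if \<sigma> \<le> 0 then 1 else 0 :: real"
  have D: "(gamma_head \<sigma> has_derivative
    (\<lambda>h. LINT t|lborel. - h * (indicator {0<..<1} t * (t powr (\<sigma> + 1 - 1) * (exp (- t * r) - ?c (\<sigma> + 1)))))) (at r)"
    unfolding gamma_head_def[abs_def]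
  proof (rule has_derivative_integral[where r = 1
        and g = "\<lambda>t. exp (\<bar>r\<bar> + 1) * (indicator {0<..<1} t * t powr \<sigma>)"
        and f' = "\<lambda>r t h. - h * (indicator {0<..<1} t * (t powr (\<sigma> + 1 - 1) * (exp (- t * r) - ?c (\<sigma> + 1))))"])
    fix x :: real assume "dist x r < 1"
    then have x: "\<bar>x\<bar> \<le> \<bar>r\<bar> + 1" by (auto simp: dist_real_def)
    show "integrable lborel (\<lambda>t. indicator {0<..<1} t * (t powr (\<sigma> - 1) * (exp (- t * x) - ?c \<sigma>)))"
      by (rule integrable_gamma_head[OF \<sigma>])
    fix t :: real
    have "t powr \<sigma> = t * t powr (\<sigma> - 1)" if "t > 0" using that by (simp add: powr_diff)
    then show "((\<lambda>x. indicator {0<..<1} t * (t powr (\<sigma> - 1) * (exp (- t * x) - ?c \<sigma>))) has_derivative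
        (\<lambda>h. - h * (indicator {0<..<1} t * (t powr (\<sigma> + 1 - 1) * (exp (- t * x) - ?c (\<sigma> + 1)))))) (at x)"
      using \<sigma> by (auto intro!: derivative_eq_intros simp: fun_eq_iff indicator_def)
    fix h :: real
    have "exp (- t * x) \<le> exp (\<bar>r\<bar> + 1)" if "0 < t" "t < 1"
    proof -
      have "\<bar>t * x\<bar> \<le> 1 * \<bar>x\<bar>" using that unfolding abs_mult by (intro mult_right_mono) auto
      then show ?thesis using x by simp
    qed
    then show "norm (- h * (indicator {0<..<1} t * (t powr (\<sigma> + 1 - 1) * (exp (- t * x) - ?c (\<sigma> + 1))))) \<le>
        exp (\<bar>r\<bar> + 1) * (indicator {0<..<1} t * t powr \<sigma>) * norm h"
      using \<sigma> by (auto simp: indicator_def abs_mult mult_ac intro!: mult_left_mono)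
  next
    show "integrable lborel (\<lambda>t. exp (\<bar>r\<bar> + 1) * (indicator {0<..<1} t * t powr \<sigma>))"
      by (intro integrable_mult_right integrable_powr_0_1 \<sigma>)
  qed auto
  have L: "(LINT t|lborel. - h * (indicator {0<..<1} t * (t powr (\<sigma> + 1 - 1) * (exp (- t * r) - ?c (\<sigma> + 1))))) = - gamma_head (\<sigma> + 1) r * h" for h
    unfolding gamma_head_def by (subst integral_mult_right_zero) simp
  show ?thesis using D unfolding L has_field_derivative_def .
qed

lemma gamma_tail_plus_head_pos:
  assumes \<sigma>: "\<sigma> > 0" and r: "r > 0"
  shows "gamma_tail \<sigma> r + gamma_head \<sigma> r = Gamma \<sigma> * r powr (- \<sigma>)"
proof -
  have "gamma_tail \<sigma> r + gamma_head \<sigma> r = (LINT t|lborel. indicator {1..} t * (t powr (\<sigma> - 1) * exp (- t * r)) +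
      indicator {0<..<1} t * (t powr (\<sigma> - 1) * (exp (- t * r) - (if \<sigma> \<le> 0 then 1 else 0))))"
    unfolding gamma_tail_def gamma_head_def
    by (rule Bochner_Integration.integral_add[symmetric])
       (use integrable_gamma_tail[OF r] integrable_gamma_head[of \<sigma> r] \<sigma> in auto)
  also have "\<dots> = (LINT t|lborel. indicator {0<..} t * (t powr (\<sigma> - 1) * exp (- t * r)))"
    by (rule Bochner_Integration.integral_cong) (use \<sigma> in \<open>auto simp: indicator_def\<close>)
  also have "\<dots> = Gamma \<sigma> * r powr (- \<sigma>)"
    using has_bochner_integral_Gamma[OF \<sigma> r] by (rule has_bochner_integral_integral_eq)
  finally show ?thesis .
qed

text \<open>Both sides have the derivative \<open>- Gamma (\<sigma> + 1) * r powr (- \<sigma> - 1)\<close>, so the constant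
  need not be computed.\<close>

lemma gamma_tail_plus_head:
  assumes \<sigma>: "\<sigma> > - 1"
  shows "\<exists>c. (\<sigma> > 0 \<longrightarrow> c = 0) \<and>
    (\<forall>r>0. gamma_tail \<sigma> r + gamma_head \<sigma> r = c + (if \<sigma> = 0 then - ln r else Gamma \<sigma> * r powr (- \<sigma>)))"
proof (cases "\<sigma> > 0")
  case True
  then show ?thesis using gamma_tail_plus_head_pos[OF True] by (intro exI[of _ 0]) auto
next
  case False
  define F where "F r = (if \<sigma> = 0 then - ln r else Gamma \<sigma> * r powr (- \<sigma>))" for r :: real
  have F: "(F has_real_derivative - (Gamma (\<sigma> + 1) * r powr (- (\<sigma> + 1)))) (at r)" if r: "r > 0" for r
  proof (cases "\<sigma> = 0")
    case True
    have "((\<lambda>r. - ln r) has_real_derivative - inverse r) (at r)"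
      using r by (auto intro!: derivative_eq_intros simp: divide_inverse)
    then show ?thesis using True r by (simp add: F_def[abs_def] powr_minus powr_one)
  next
    case False
    have "\<sigma> \<notin> \<int>\<^sub>\<le>\<^sub>0"
    proof
      assume "\<sigma> \<in> \<int>\<^sub>\<le>\<^sub>0"
      then obtain n :: nat where "\<sigma> = - real n" by (auto elim!: nonpos_Ints_cases')
      with \<sigma> False show False by (cases n) auto
    qed
    then have G: "Gamma (\<sigma> + 1) = \<sigma> * Gamma \<sigma>" by (rule Gamma_plus1)
    have "((\<lambda>r. Gamma \<sigma> * r powr (- \<sigma>)) has_real_derivative Gamma \<sigma> * (- \<sigma> * r powr (- \<sigma> - 1))) (at r)"
      using r by (intro DERIV_cmult has_real_derivative_powr)
    then show ?thesis using False r by (simp add: F_def[abs_def] G mult_ac)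
  qed
  have "\<exists>c. \<forall>r\<in>{0<..}. gamma_tail \<sigma> r + gamma_head \<sigma> r - F r = c"
  proof (rule has_field_derivative_zero_constant)
    fix r :: real assume "r \<in> {0<..}"
    then have r: "r > 0" by simp
    have "((\<lambda>r. gamma_tail \<sigma> r + gamma_head \<sigma> r - F r) has_real_derivative
       (- gamma_tail (\<sigma> + 1) r + - gamma_head (\<sigma> + 1) r - - (Gamma (\<sigma> + 1) * r powr (- (\<sigma> + 1))))) (at r)"
      by (intro DERIV_diff DERIV_add gamma_tail_has_derivative gamma_head_has_derivative F r \<sigma>)
    moreover have "gamma_tail (\<sigma> + 1) r + gamma_head (\<sigma> + 1) r = Gamma (\<sigma> + 1) * r powr (- (\<sigma> + 1))"
      by (rule gamma_tail_plus_head_pos) (use \<sigma> r in auto)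
    then have "- gamma_tail (\<sigma> + 1) r + - gamma_head (\<sigma> + 1) r - - (Gamma (\<sigma> + 1) * r powr (- (\<sigma> + 1))) = 0"
      by linarith
    ultimately have "((\<lambda>r. gamma_tail \<sigma> r + gamma_head \<sigma> r - F r) has_real_derivative 0) (at r)"
      by metis
    then show "((\<lambda>r. gamma_tail \<sigma> r + gamma_head \<sigma> r - F r) has_real_derivative 0) (at r within {0<..})"
      by (rule has_field_derivative_at_within)
  qed auto
  then show ?thesis using False by (auto simp: F_def algebra_simps)
qed

lemma gamma_tail_nonneg: "0 \<le> gamma_tail \<sigma> r"
  unfolding gamma_tail_def by (intro integral_nonneg_AE AE_I2) (auto simp: indicator_def)

text \<open>For t \<ge> 1 the exponent t * r is split into halves, one at least r / 2 and the other
  at least t * r0 / 2: the first gives the decay, the second the convergence.\<close>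

lemma gamma_tail_bound:
  assumes r0: "r0 > 0" and r: "r \<ge> r0"
  shows "gamma_tail \<sigma> r \<le> exp (- r / 2) * gamma_tail \<sigma> (r0 / 2)"
proof -
  have "gamma_tail \<sigma> r \<le> (LINT t|lborel. exp (- r / 2) * (indicator {1..} t * (t powr (\<sigma> - 1) * exp (- t * (r0 / 2)))))"
    unfolding gamma_tail_def
  proof (rule integral_mono)
    fix t :: real
    have "exp (- t * r) \<le> exp (- r / 2) * exp (- t * (r0 / 2))" if "t \<ge> 1"
    proof -
      have "t * r0 \<le> t * r" "1 * r \<le> t * r" using that r r0 by (intro mult_left_mono mult_right_mono; simp)+
      then show ?thesis by (simp flip: exp_add)
    qed
    then show "indicator {1..} t * (t powr (\<sigma> - 1) * exp (- t * r)) \<le>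
      exp (- r / 2) * (indicator {1..} t * (t powr (\<sigma> - 1) * exp (- t * (r0 / 2))))"
      by (auto simp: indicator_def mult.left_commute[of "exp (- (r / 2))"] intro!: mult_left_mono)
  qed (use integrable_gamma_tail[of r \<sigma>] integrable_gamma_tail[of "r0 / 2" \<sigma>] r0 r in auto)
  then show ?thesis by (simp add: gamma_tail_def)
qed

lemma Ck_gamma_head: "\<sigma> > - 1 \<Longrightarrow> Ck n (\<lambda>r. complex_of_real (gamma_head \<sigma> r))"
proof (induction n arbitrary: \<sigma>)
  case (Suc n)
  show ?case
  proof (rule bounded_derivs_SucI)
    have "(gamma_head \<sigma> has_derivative (*) (- gamma_head (\<sigma> + 1) r)) (at r)" for r
      using gamma_head_has_derivative[OF Suc.prems] by (simp add: has_field_derivative_def)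
    from has_derivative_of_real[OF this]
    show "((\<lambda>r. complex_of_real (gamma_head \<sigma> r)) has_derivative
        (\<lambda>h. complex_of_real (- gamma_head (\<sigma> + 1) r * h))) (at r)" for r .
    show "bounded_derivs (\<lambda>_ _. True) (\<lambda>_. 0) n (0 - 0) (\<lambda>r. complex_of_real (- gamma_head (\<sigma> + 1) r * v))"
      if "v \<in> Basis" for v
      using that Ck.cmult[OF Suc.IH[of "\<sigma> + 1"], of "- 1"] Suc.prems by simp
  qed simp
qed simp

text \<open>As \<open>gamma_head\<close> is smooth on the whole line, composing it with the
  polynomial c * (norm x)^2 is smooth also at the origin.\<close>

lemma smooth_gamma_head_norm:
  assumes "\<sigma> > - 1"
  shows "smooth (\<lambda>x::'a::euclidean_space. complex_of_real (gamma_head \<sigma> (c * (norm x)\<^sup>2)))"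
  unfolding smooth_iff_Ck
proof (rule allI, rule Ck_compose_real[where g = "\<lambda>r. complex_of_real (gamma_head \<sigma> r)"
      and r' = "\<lambda>x h. c * (2 * (x \<bullet> h))"])
  show "((\<lambda>x::'a. c * (norm x)\<^sup>2) has_derivative (\<lambda>h. c * (2 * (x \<bullet> h)))) (at x)" for x
    unfolding power2_norm_eq_inner by (auto intro!: derivative_eq_intros simp: inner_commute)
  show "Ck n (\<lambda>x. complex_of_real (c * (2 * (x \<bullet> v))))" for v :: 'a and n
    using Ck.cmult[OF Ck_inner[of n v], of "complex_of_real (c * 2)"] by (simp add: mult.assoc)
qed (rule Ck_gamma_head[OF assms])

lemma exp_minus_square_bound:
  assumes c: "c > 0"
  obtains C where "C \<ge> 0" "\<And>x::'a::real_normed_vector. exp (- c * (norm x)\<^sup>2) \<le> C * (1 + norm x) powr m"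
proof -
  define n where "n = Suc (nat \<lceil>- m\<rceil>)"
  \<comment> \<open>Chosen so that \<delta> * (1 + norm x) \<le> 1 + c * (norm x)^2 / n both for
    norm x \<le> 1 (by the 1 in the minimum) and beyond (by c / n). The n-th power of the right side
    is at most exp (c * (norm x)^2).\<close>
  define \<delta> where "\<delta> = min 1 (c / real n) / 2"
  have n: "n > 0" "- m \<le> real n" by (auto simp: n_def) linarith
  have \<delta>: "\<delta> > 0" using c n by (simp add: \<delta>_def)
  have "exp (- c * (norm x)\<^sup>2) \<le> (1 / \<delta>) ^ n * (1 + norm x) powr m" for x :: 'a
  proof -
    have p: "1 + norm x > 0" by (simp add: add_pos_nonneg)
    have "\<delta> * (1 + norm x) \<le> 1 + c * (norm x)\<^sup>2 / real n"
    proof (cases "norm x \<le> 1")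
      case True
      have "\<delta> * (1 + norm x) \<le> (1 / 2) * 2" using True by (intro mult_mono) (auto simp: \<delta>_def)
      also have "\<dots> \<le> 1 + c * (norm x)\<^sup>2 / real n" using c n by simp
      finally show ?thesis .
    next
      case False
      have "\<delta> * (1 + norm x) \<le> (c / real n / 2) * (2 * norm x)" using False c by (intro mult_mono) (auto simp: \<delta>_def)
      also have "\<dots> = c / real n * norm x" by simp
      also have "\<dots> \<le> c / real n * (norm x)\<^sup>2"
        using False c mult_left_mono[of 1 "norm x" "norm x"] by (intro mult_left_mono) (auto simp: power2_eq_square)
      finally show ?thesis by simp
    qed
    then have "(\<delta> * (1 + norm x)) ^ n \<le> (1 + c * (norm x)\<^sup>2 / real n) ^ n"
      using \<delta> by (intro power_mono) auto
    also have "\<dots> \<le> exp (c * (norm x)\<^sup>2)"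
      by (rule exp_ge_one_plus_x_over_n_power_n) (use n c in \<open>auto intro: order.trans[of _ 0]\<close>)
    finally have 1: "(\<delta> * (1 + norm x)) ^ n \<le> exp (c * (norm x)\<^sup>2)" .
    have "exp (- c * (norm x)\<^sup>2) = 1 / exp (c * (norm x)\<^sup>2)" by (simp add: exp_minus divide_inverse)
    also have "\<dots> \<le> 1 / (\<delta> * (1 + norm x)) ^ n"
      using 1 \<delta> p by (intro divide_left_mono) auto
    also have "\<dots> = (1 / \<delta>) ^ n * (1 + norm x) powr (- real n)"
      by (simp only: power_mult_distrib powr_minus powr_realpow[OF p] power_one_over) (simp add: divide_inverse)
    also have "\<dots> \<le> (1 / \<delta>) ^ n * (1 + norm x) powr m"
      using n \<delta> by (intro mult_left_mono powr_mono) auto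
    finally show ?thesis .
  qed
  then show ?thesis using \<delta> by (intro that[of "(1 / \<delta>) ^ n"]) auto
qed

text \<open>The scheme used for powers of the norm: a derivative produces a linear factor, absorbed
  by f, and shifts \<sigma> by one. Exponential decay of the tail gives every order m at each step;
  f vanishes near the origin, where the tail may be singular.\<close>

lemma rapid_gamma_tail_norm:
  fixes f :: "'a::euclidean_space \<Rightarrow> complex"
  assumes f: "\<And>n. Sym n k f" and f0: "\<And>x. norm x < r \<Longrightarrow> f x = 0" and r: "0 < r" and c: "c > 0"
  shows "rapid (\<lambda>x. f x * complex_of_real (gamma_tail \<sigma> (c * (norm x)\<^sup>2)))"
proof -
  have "Sym n m (\<lambda>x. f x * complex_of_real (gamma_tail \<sigma> (c * (norm x)\<^sup>2)))" for n m
    using f f0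
  proof (induction n arbitrary: f k \<sigma> m)
    have bd: "weight_bound (\<lambda>x. 1 + norm x) m (\<lambda>x. f x * complex_of_real (gamma_tail \<sigma> (c * (norm x)\<^sup>2)))"
      if f: "\<And>n. Sym n k f" "\<And>x. norm x < r \<Longrightarrow> f x = 0" for k \<sigma> m and f :: "'a \<Rightarrow> complex"
    proof -
      obtain C where C: "C \<ge> 0" "\<And>x. norm (f x) \<le> C * (1 + norm x) powr k"
        using bounded_derivsD[OF f(1)] by (meson weight_boundE)
      have "c / 2 > 0" using c by simp
      then obtain E where E: "E \<ge> 0" "\<And>x::'a. exp (- (c / 2) * (norm x)\<^sup>2) \<le> E * (1 + norm x) powr (m - k)"
        using exp_minus_square_bound by blast
      let ?G = "gamma_tail \<sigma> (c * r\<^sup>2 / 2)"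
      have "norm (f x * complex_of_real (gamma_tail \<sigma> (c * (norm x)\<^sup>2))) \<le> C * E * ?G * (1 + norm x) powr m" for x
      proof (cases "norm x < r")
        case True
        then show ?thesis using f(2)[of x] C(1) E(1) gamma_tail_nonneg by simp
      next
        case False
        have "gamma_tail \<sigma> (c * (norm x)\<^sup>2) \<le> exp (- (c * (norm x)\<^sup>2) / 2) * ?G"
          using False r c by (intro gamma_tail_bound) (auto intro!: power_mono)
        also have "\<dots> \<le> (E * (1 + norm x) powr (m - k)) * ?G"
          using E(2)[of x] by (intro mult_right_mono gamma_tail_nonneg) (simp add: field_simps)
        finally have "norm (f x) * gamma_tail \<sigma> (c * (norm x)\<^sup>2) \<le>
            (C * (1 + norm x) powr k) * ((E * (1 + norm x) powr (m - k)) * ?G)"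
          using C gamma_tail_nonneg by (intro mult_mono) auto
        also have "\<dots> = C * E * ?G * ((1 + norm x) powr (k + (m - k)))"
          unfolding powr_add by simp
        finally show ?thesis using gamma_tail_nonneg[of \<sigma> "c * (norm x)\<^sup>2"] by (simp add: norm_mult)
      qed
      then show ?thesis by (auto simp: weight_bound_def)
    qed
    {
      case 0
      show ?case using bd[OF 0] by simp
    next
      case (Suc n)
      have fd: "(f has_derivative (\<lambda>v. partial_deriv v f x)) (at x)" for x
        by (rule bounded_derivs_has_derivative[OF Suc.prems(1)])
      have p0: "partial_deriv v f x = 0" if x: "norm x < r" for v x
      proof -
        have "(f has_derivative (\<lambda>_. 0)) (at x)"
        proof (rule has_derivative_transform_within_open[of "\<lambda>_. 0" _ _ UNIV])
          show "open {x::'a. norm x < r}" by (intro open_Collect_less continuous_intros)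
        qed (use x Suc.prems(2) in auto)
        then show ?thesis by (auto dest: partial_deriv_eq)
      qed
      show ?case
      proof (rule bounded_derivs_SucI)
        show "weight_bound (\<lambda>x. 1 + norm x) m (\<lambda>x. f x * complex_of_real (gamma_tail \<sigma> (c * (norm x)\<^sup>2)))"
          by (rule bd[OF Suc.prems])
        show "((\<lambda>x. f x * complex_of_real (gamma_tail \<sigma> (c * (norm x)\<^sup>2))) has_derivative
          (\<lambda>v. partial_deriv v f x * complex_of_real (gamma_tail \<sigma> (c * (norm x)\<^sup>2))
             + (complex_of_real (- 2 * c) * (complex_of_real (x \<bullet> v) * f x)) * complex_of_real (gamma_tail (\<sigma> + 1) (c * (norm x)\<^sup>2)))) (at x)" for x
        proof (cases "norm x < r")
          case True
          have "((\<lambda>x. f x * complex_of_real (gamma_tail \<sigma> (c * (norm x)\<^sup>2))) has_derivative (\<lambda>_. 0)) (at x)"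
          proof (rule has_derivative_transform_within_open[of "\<lambda>_. 0" _ _ UNIV])
            show "open {x::'a. norm x < r}" by (intro open_Collect_less continuous_intros)
          qed (use True Suc.prems(2) in auto)
          then show ?thesis using p0[OF True] Suc.prems(2)[OF True] by simp
        next
          case False
          then have "norm x > 0" using r by linarith
          then have "c * (norm x)\<^sup>2 > 0" using c by (intro mult_pos_pos zero_less_power) auto
          then have "(gamma_tail \<sigma> has_derivative (*) (- gamma_tail (\<sigma> + 1) (c * (norm x)\<^sup>2))) (at (c * (norm x)\<^sup>2))"
            using gamma_tail_has_derivative[of "c * (norm x)\<^sup>2" \<sigma>] unfolding has_field_derivative_def by simp
          moreover have "((\<lambda>x::'a. c * (norm x)\<^sup>2) has_derivative (\<lambda>h. c * (2 * (x \<bullet> h)))) (at x)"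
            unfolding power2_norm_eq_inner by (auto intro!: derivative_eq_intros simp: inner_commute)
          ultimately have "((\<lambda>x. gamma_tail \<sigma> (c * (norm x)\<^sup>2)) has_derivative
              (\<lambda>h. - gamma_tail (\<sigma> + 1) (c * (norm x)\<^sup>2) * (c * (2 * (x \<bullet> h))))) (at x)"
            by (rule has_derivative_compose[rotated])
          from has_derivative_mult[OF fd has_derivative_of_real[OF this]]
          show ?thesis by (rule has_derivative_eq_rhs) (auto simp: fun_eq_iff)
        qed
        fix v :: 'a assume v: "v \<in> Basis"
        have "Sym n (m - norm v) (\<lambda>x. partial_deriv v f x * complex_of_real (gamma_tail \<sigma> (c * (norm x)\<^sup>2)))"
          using bounded_derivs_partial[OF Suc.prems(1) v] p0 by (intro Suc.IH[where k = "k - norm v"]) auto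
        moreover have "Sym n (m - norm v) (\<lambda>x. (complex_of_real (- 2 * c) * (complex_of_real (x \<bullet> v) * f x)) * complex_of_real (gamma_tail (\<sigma> + 1) (c * (norm x)\<^sup>2)))"
          by (intro Suc.IH[where k = "1 + k"] Sym.cmult Sym.mult Sym_inner Suc.prems) (use Suc.prems(2) in auto)
        ultimately show "Sym n (m - norm v) (\<lambda>x. partial_deriv v f x * complex_of_real (gamma_tail \<sigma> (c * (norm x)\<^sup>2))
             + (complex_of_real (- 2 * c) * (complex_of_real (x \<bullet> v) * f x)) * complex_of_real (gamma_tail (\<sigma> + 1) (c * (norm x)\<^sup>2)))"
          by (rule Sym.add)
      qed
    }
  qed
  then show ?thesis by (simp add: rapid_def)
qed

section \<open>The Riesz kernel and its Fourier transform\<close>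

text \<open>The substitution t -> 1 / t carries the head to an integral over large t. The endpoint t
  = 1 is a null set, and s > 0 excludes the regularizing constant.\<close>

lemma gamma_head_inverse:
  assumes s: "s > 0"
  shows "has_bochner_integral lborel (\<lambda>t. indicator {1..} t * (t powr (- s - 1) * exp (- r / t))) (gamma_head s r)"
proof -
  define f where "f t = indicator {..<1} t * (t powr (s - 1) * exp (- t * r))" for t :: real
  have [measurable]: "f \<in> borel_measurable borel" unfolding f_def[abs_def] by measurable
  have "has_bochner_integral lborel (\<lambda>t. indicator {0<..<1} t * (t powr (s - 1) * (exp (- t * r) - (if s \<le> 0 then 1 else 0)))) (gamma_head s r)"
    using integrable_gamma_head[of s r] s by (simp add: has_bochner_integral_iff gamma_head_def)
  also have "(\<lambda>t. indicator {0<..<1} t * (t powr (s - 1) * (exp (- t * r) - (if s \<le> 0 then 1 else 0)))) = (\<lambda>t. indicator {0<..} t * f t)"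
    using s by (auto simp: f_def indicator_def fun_eq_iff)
  finally have "has_bochner_integral lborel (\<lambda>t. indicator {0<..} t * (1 / t\<^sup>2 * f (1 / t))) (gamma_head s r)"
    by (subst (asm) has_bochner_integral_inverse_substitution) auto
  moreover have "AE t in lborel. indicator {0<..} t * (1 / t\<^sup>2 * f (1 / t)) = indicator {1..} t * (t powr (- s - 1) * exp (- r / t))"
    using AE_lborel_singleton[of "1::real"]
  proof eventually_elim
    case (elim t)
    have "1 / t\<^sup>2 * (1 / t) powr (s - 1) = t powr (- s - 1)" if "t > 0"
    proof -
      have "(1 / t) powr (s - 1) = t powr (1 - s)" using that by (simp add: powr_divide powr_minus_divide[symmetric])
      moreover have "1 / t\<^sup>2 = t powr (- 2)" using that by (simp add: powr_minus_divide)
      moreover have "t powr (- 2) * t powr (1 - s) = t powr (- s - 1)"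
        unfolding powr_add[symmetric] by (rule arg_cong[where f = "\<lambda>a. t powr a"]) simp
      ultimately show ?thesis by simp
    qed
    note key = this
    show ?case
    proof (cases "t > 1")
      case True
      have fe: "f (1 / t) = (1 / t) powr (s - 1) * exp (- r / t)" using True by (simp add: f_def)
      have ind: "indicator {0<..} t = (1::real)" "indicator {1..} t = (1::real)" using True by auto
      show ?thesis
        unfolding fe ind mult_1 mult.assoc[symmetric] using key True by simp
    next
      case False
      then have "indicator {0<..} t * f (1 / t) = 0" "indicator {1..} t = (0::real)"
        using elim by (auto simp: f_def indicator_def)
      then show ?thesis by simp
    qed
  qed
  ultimately show ?thesis
    by (subst has_bochner_integral_cong_AE[symmetric, where f = "\<lambda>t. indicator {0<..} t * (1 / t\<^sup>2 * f (1 / t))"]) auto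
qed

text \<open>The Gaussians are transformed under the t-integral. Dividing (norm z)^2 by 4 makes the
  transform replace t by exactly 1 / t, and the power t powr (\<sigma> - 1 - d/2) becomes t powr (-
  s - 1), as in \<open>gamma_head_inverse\<close>.\<close>

lemma fourier_gamma_tail:
  fixes \<xi> :: "'a::euclidean_space"
  assumes s: "s > 0"
  defines "\<sigma> \<equiv> real DIM('a) / 2 - s"
  shows "integrable lborel (\<lambda>z::'a. complex_of_real (gamma_tail \<sigma> ((norm z)\<^sup>2 / 4)))" (is ?int)
    and "fourier (\<lambda>z. complex_of_real (gamma_tail \<sigma> ((norm z)\<^sup>2 / 4))) \<xi> =
      complex_of_real ((4 * pi) powr (real DIM('a) / 2) * gamma_head s ((norm \<xi>)\<^sup>2))" (is ?eq)
proof -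
  let ?d = "real DIM('a) / 2"
  let ?F = "\<lambda>t z::'a. indicator {1..} t * (t powr (\<sigma> - 1) * exp (- t * ((norm z)\<^sup>2 / 4)))"
  let ?G = "\<lambda>\<xi> (t, z). cis (- (z \<bullet> \<xi>)) * complex_of_real (?F t z)"
  have gauss: "has_bochner_integral lborel (\<lambda>z. ?G \<xi> (t, z))
      (complex_of_real ((4 * pi) powr ?d * (indicator {1..} t * (t powr (- s - 1) * exp (- (norm \<xi>)\<^sup>2 / t)))))" for t \<xi>
  proof (cases "t \<ge> 1")
    case True
    have H: "has_bochner_integral lborel (\<lambda>z::'a. complex_of_real (t powr (\<sigma> - 1)) * (cis (- (z \<bullet> \<xi>)) * complex_of_real (exp (- (t / 4) * (norm z)\<^sup>2))))
      (complex_of_real (t powr (\<sigma> - 1)) * complex_of_real ((pi / (t / 4)) powr ?d * exp (- (norm \<xi>)\<^sup>2 / (4 * (t / 4)))))"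
      using True by (intro has_bochner_integral_mult_right gaussian_fourier) auto
    have E: "t powr (\<sigma> - 1) * ((pi / (t / 4)) powr ?d * exp (- (norm \<xi>)\<^sup>2 / (4 * (t / 4)))) =
        (4 * pi) powr ?d * (t powr (- s - 1) * exp (- (norm \<xi>)\<^sup>2 / t))"
    proof -
      have "(pi / (t / 4)) powr ?d = (4 * pi) powr ?d * t powr (- ?d)"
      proof -
        have 1: "pi / (t / 4) = (4 * pi) / t" by simp
        have 2: "((4 * pi) / t) powr ?d = (4 * pi) powr ?d / t powr ?d"
          by (rule powr_divide)
        show ?thesis unfolding 1 2 powr_minus by (simp only: divide_inverse)
      qed
      moreover have "t powr (\<sigma> - 1) * t powr (- ?d) = t powr (- s - 1)"
        by (simp add: powr_add[symmetric] \<sigma>_def)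
      ultimately have "t powr (\<sigma> - 1) * (pi / (t / 4)) powr ?d = (4 * pi) powr ?d * t powr (- s - 1)"
        by (simp add: mult.left_commute)
      then show ?thesis by (simp add: mult.assoc[symmetric])
    qed
    show ?thesis using H[unfolded of_real_mult[symmetric] E] True by (simp add: mult_ac flip: of_real_mult)
  qed (simp add: has_bochner_integral_zero)
  have int: "integrable (lborel \<Otimes>\<^sub>M lborel) (?G \<xi>)" for \<xi>
  proof (rule lborel_pair.Fubini_integrable)
    show "?G \<xi> \<in> borel_measurable (lborel \<Otimes>\<^sub>M lborel)" by measurable
    show "AE t in lborel. integrable lborel (\<lambda>z. ?G \<xi> (t, z))"
      using gauss by (auto simp: has_bochner_integral_iff)
    \<comment> \<open>The Gaussians are positive, so the norm of the integrand integrates over z to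
      the transform at frequency 0; its t-integral is a multiple of \<open>gamma_head s 0\<close>,
      which converges.\<close>
    have "integrable lborel (\<lambda>t. (4 * pi) powr ?d * (indicator {1..} t * (t powr (- s - 1) * exp (- 0 / t))))"
      using gamma_head_inverse[OF s, of 0] by (intro integrable_mult_right) (auto simp: has_bochner_integral_iff)
    moreover have "(LINT z|lborel. norm (?G \<xi> (t, z))) = (4 * pi) powr ?d * (indicator {1..} t * (t powr (- s - 1) * exp (- 0 / t)))" for t
    proof -
      have "complex_of_real (LINT z|lborel. norm (?G \<xi> (t, z))) = (LINT z|lborel. ?G 0 (t, z))"
        by (subst integral_complex_of_real[symmetric], rule Bochner_Integration.integral_cong)
           (auto simp: norm_mult abs_mult)
      also have "\<dots> = complex_of_real ((4 * pi) powr ?d * (indicator {1..} t * (t powr (- s - 1) * exp (- (norm (0::'a))\<^sup>2 / t))))"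
        using gauss by (rule has_bochner_integral_integral_eq)
      finally show ?thesis unfolding of_real_eq_iff by simp
    qed
    ultimately show "integrable lborel (\<lambda>t. LINT z|lborel. norm (?G \<xi> (t, z)))" by presburger
  qed
  have inner: "(LINT t|lborel. ?G \<xi> (t, z)) = cis (- (z \<bullet> \<xi>)) * complex_of_real (gamma_tail \<sigma> ((norm z)\<^sup>2 / 4))" for z \<xi>
  proof -
    have "(LINT t|lborel. ?G \<xi> (t, z)) = (LINT t|lborel. cis (- (z \<bullet> \<xi>)) * complex_of_real (?F t z))"
      by (simp only: prod.case)
    also have "\<dots> = cis (- (z \<bullet> \<xi>)) * (LINT t|lborel. complex_of_real (?F t z))"
      by (rule integral_mult_right_zero)
    also have "(LINT t|lborel. complex_of_real (?F t z)) = complex_of_real (gamma_tail \<sigma> ((norm z)\<^sup>2 / 4))"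
      unfolding gamma_tail_def by (rule integral_complex_of_real)
    finally show ?thesis .
  qed
  have "integrable (lborel \<Otimes>\<^sub>M lborel) (\<lambda>(z, t). ?G 0 (t, z))"
    using lborel_pair.integrable_product_swap[OF int[of 0]] .
  from lborel_pair.integrable_fst'[OF this]
  have "integrable lborel (\<lambda>z. LINT t|lborel. ?G 0 (t, z))" by simp
  then show ?int unfolding inner by simp
  have "(LINT z|lborel. LINT t|lborel. ?G \<xi> (t, z)) = (LINT t|lborel. LINT z|lborel. ?G \<xi> (t, z))"
    using lborel_pair.Fubini_integral[of "\<lambda>t z. ?G \<xi> (t, z)"] int[of \<xi>] by simp
  also have "\<dots> = complex_of_real (LINT t|lborel. (4 * pi) powr ?d * (indicator {1..} t * (t powr (- s - 1) * exp (- (norm \<xi>)\<^sup>2 / t))))"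
    unfolding has_bochner_integral_integral_eq[OF gauss] by (rule integral_complex_of_real)
  also have "(LINT t|lborel. (4 * pi) powr ?d * (indicator {1..} t * (t powr (- s - 1) * exp (- (norm \<xi>)\<^sup>2 / t)))) = (4 * pi) powr ?d * gamma_head s ((norm \<xi>)\<^sup>2)"
    using has_bochner_integral_integral_eq[OF gamma_head_inverse[OF s, of "(norm \<xi>)\<^sup>2"]] by simp
  finally show ?eq unfolding inner by (simp add: fourier_def)
qed

text \<open>Up to an additive constant, the kernel is this factor times the superposition of the
  Gaussians exp (- t * (norm (x - y))^2 / 4) with density t powr (\<sigma> - 1). The power of 4 pi
  cancels the one from the Fourier transform, and 1 / Gamma s normalises the transform to norm \<xi>
  powr (- 2 * s).\<close>

definition riesz_const :: "'d itself \<Rightarrow> real \<Rightarrow> real" where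
  "riesz_const _ s = (4 * pi) powr (- real CARD('d) / 2) / Gamma s"

text \<open>The constant c collects the constant of \<open>gamma_tail_plus_head\<close> and, in the
  logarithmic case, the ln 4 due to the scaling by 1/4. It vanishes for s < d/2, where the
  superposition converges without regularization.\<close>

lemma fgf_kernel_eq_gamma:
  fixes s :: real
  assumes s: "0 < s" "s < real CARD('d) / 2 + 1"
  defines "\<sigma> \<equiv> real CARD('d) / 2 - s"
  shows "\<exists>c. (s < real CARD('d) / 2 \<longrightarrow> c = 0) \<and> (\<forall>x y :: real ^ 'd. x \<noteq> y \<longrightarrow> fgf_kernel s x y =
    riesz_const TYPE('d) s * (gamma_tail \<sigma> ((norm (x - y))\<^sup>2 / 4) + gamma_head \<sigma> ((norm (x - y))\<^sup>2 / 4)) + c)"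
proof -
  let ?d = "real CARD('d)" and ?A = "riesz_const TYPE('d) s"
  have "\<sigma> > - 1" using s by (simp add: \<sigma>_def)
  then obtain c0 where c00: "\<sigma> > 0 \<longrightarrow> c0 = 0" and c0: "\<And>r. r > 0 \<Longrightarrow> gamma_tail \<sigma> r + gamma_head \<sigma> r = c0 + (if \<sigma> = 0 then - ln r else Gamma \<sigma> * r powr (- \<sigma>))"
    using gamma_tail_plus_head by blast
  have four: "(4::real) powr a = 2 powr (2 * a)" for a
    using powr_powr[of 2 2 a] by simp
  have A: "?A = 2 powr (- ?d) * pi powr (- ?d / 2) / Gamma s"
    by (simp add: riesz_const_def powr_mult four)
  show ?thesis
  proof (cases "\<sigma> = 0")
    case True
    then have sd: "2 * s = ?d" by (simp add: \<sigma>_def)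
    have A2: "2 powr (- 2 * s + 1) * pi powr (- ?d / 2) / Gamma s = 2 * ?A"
      unfolding A sd[symmetric] powr_add by simp
    show ?thesis
    proof (intro exI[of _ "- ?A * (c0 + ln 4)"] conjI allI impI)
      show "s < ?d / 2 \<Longrightarrow> - ?A * (c0 + ln 4) = 0" using sd by simp
    next
      fix x y :: "real ^ 'd" assume "x \<noteq> y"
      then have n: "norm (x - y) > 0" by simp
      then have r: "(norm (x - y))\<^sup>2 / 4 > 0" by (intro divide_pos_pos zero_less_power) auto
      have "ln ((norm (x - y))\<^sup>2 / 4) = 2 * ln (norm (x - y)) - ln 4"
        using n by (simp add: ln_div ln_realpow)
      then have *: "gamma_tail \<sigma> ((norm (x - y))\<^sup>2 / 4) + gamma_head \<sigma> ((norm (x - y))\<^sup>2 / 4) = c0 - (2 * ln (norm (x - y)) - ln 4)"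
        using c0[OF r] True by simp
      have "fgf_kernel s x y = - (2 * ?A) * ln (norm (x - y))"
        unfolding fgf_kernel_def Let_def A2 using True by (simp add: \<sigma>_def)
      then show "fgf_kernel s x y = ?A * (gamma_tail \<sigma> ((norm (x - y))\<^sup>2 / 4) + gamma_head \<sigma> ((norm (x - y))\<^sup>2 / 4)) + - ?A * (c0 + ln 4)"
        unfolding * by (simp add: algebra_simps)
    qed
  next
    case False
    show ?thesis
    proof (intro exI[of _ "- ?A * c0"] conjI allI impI)
      show "s < ?d / 2 \<Longrightarrow> - ?A * c0 = 0" using c00 by (simp add: \<sigma>_def)
    next
      fix x y :: "real ^ 'd" assume "x \<noteq> y"
      then have n: "norm (x - y) > 0" by simp
      then have r: "(norm (x - y))\<^sup>2 / 4 > 0" by (intro divide_pos_pos zero_less_power) auto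
      have "((norm (x - y))\<^sup>2 / 4) powr (- \<sigma>) = norm (x - y) powr (2 * (- \<sigma>)) * 4 powr \<sigma>"
      proof -
        have 1: "((norm (x - y))\<^sup>2) powr (- \<sigma>) = norm (x - y) powr (2 * (- \<sigma>))"
          using n powr_powr[of "norm (x - y)" 2 "- \<sigma>"] by simp
        have 2: "((norm (x - y))\<^sup>2 / 4) powr (- \<sigma>) = ((norm (x - y))\<^sup>2) powr (- \<sigma>) / 4 powr (- \<sigma>)"
          by (rule powr_divide)
        have 3: "X / 4 powr (- \<sigma>) = X * 4 powr \<sigma>" for X :: real
          by (simp add: powr_minus field_simps)
        show ?thesis unfolding 2 3 1 ..
      qed
      then have *: "gamma_tail \<sigma> ((norm (x - y))\<^sup>2 / 4) + gamma_head \<sigma> ((norm (x - y))\<^sup>2 / 4) =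
          c0 + Gamma \<sigma> * (norm (x - y) powr (2 * (- \<sigma>)) * 4 powr \<sigma>)"
        using c0[OF r] False by simp
      have "2 powr (- 2 * s) = 2 powr (- ?d) * 4 powr \<sigma>"
        by (simp add: four \<sigma>_def powr_add[symmetric])
      then have "fgf_kernel s x y = ?A * (Gamma \<sigma> * (norm (x - y) powr (2 * (- \<sigma>)) * 4 powr \<sigma>))"
        unfolding fgf_kernel_def Let_def A using False by (simp add: \<sigma>_def)
      then show "fgf_kernel s x y = ?A * (gamma_tail \<sigma> ((norm (x - y))\<^sup>2 / 4) + gamma_head \<sigma> ((norm (x - y))\<^sup>2 / 4)) + - ?A * c0"
        unfolding * by (simp add: algebra_simps)
    qed
  qed
qed

lemma smooth_mult_complex:
  fixes f g :: "'a::euclidean_space \<Rightarrow> complex"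
  shows "smooth f \<Longrightarrow> smooth g \<Longrightarrow> smooth (\<lambda>x. f x * g x)"
  unfolding smooth_iff_Ck using Ck.mult[of _ 0 f 0 g] by simp

lemma smooth_affine_complex:
  fixes f :: "'a::euclidean_space \<Rightarrow> complex"
  shows "smooth f \<Longrightarrow> smooth (\<lambda>x. c * f x + e)"
  unfolding smooth_iff_Ck by (auto intro!: Ck.add Ck.cmult Ck.const)

text \<open>Up to a rapidly decreasing \<rho>, the cut off kernel is a multiple of
  \<open>gamma_tail\<close>, whose transform is \<open>gamma_head s\<close> at (norm \<xi>)^2 over
  Gamma s. Away from the origin this is the pure power minus a tail of rapid decrease.\<close>

lemma fgf_kernel_cutoff:
  fixes s R :: real
  assumes s: "0 < s" "s < real CARD('d) / 2 + 1" and R: "R > 0"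
  defines "k \<equiv> \<lambda>z :: real ^ 'd. complex_of_real (fgf_kernel s z 0 * (1 - annular_step R z))"
  shows "integrable lborel k"
    and "rapid (\<lambda>\<xi>. fourier k \<xi> - hom_symbol (- 2 * s) \<xi>)"
proof -
  define \<sigma> where "\<sigma> = real CARD('d) / 2 - s"
  define A where "A = riesz_const TYPE('d) s"
  have \<sigma>: "\<sigma> > - 1" using s by (simp add: \<sigma>_def)
  have d: "real DIM(real ^ 'd) = real CARD('d)" by simp
  obtain c where c: "\<And>x y :: real ^ 'd. x \<noteq> y \<Longrightarrow> fgf_kernel s x y =
    A * (gamma_tail \<sigma> ((norm (x - y))\<^sup>2 / 4) + gamma_head \<sigma> ((norm (x - y))\<^sup>2 / 4)) + c"
    using fgf_kernel_eq_gamma[OF s] unfolding \<sigma>_def A_def by blast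
  let ?\<chi> = "\<lambda>z :: real ^ 'd. complex_of_real (annular_step R z)"
  let ?t = "\<lambda>z :: real ^ 'd. complex_of_real (gamma_tail \<sigma> ((norm z)\<^sup>2 / 4))"
  let ?h = "\<lambda>z :: real ^ 'd. complex_of_real (gamma_head \<sigma> ((norm z)\<^sup>2 / 4))"
  \<comment> \<open>The difference between \<open>k\<close> and A times the tail off the origin: the
    tail where the cutoff removes it, which is away from 0, and the smooth head plus constant on a
    compact set.\<close>
  define \<rho> where "\<rho> z = - complex_of_real A * (?\<chi> z * ?t z) + (1 - ?\<chi> z) * (complex_of_real A * ?h z + complex_of_real c)" for z :: "real ^ 'd"
  have "rapid (\<lambda>z. ?\<chi> z * ?t z)"
    using rapid_gamma_tail_norm[of 0 ?\<chi> R "1 / 4" \<sigma>] R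
    by (simp add: Sym_annular_step annular_step_0)
  moreover have "rapid (\<lambda>z. (1 - ?\<chi> z) * (complex_of_real A * ?h z + complex_of_real c))"
  proof (rule rapid_compact_support[where R = "2 * R"])
    show "smooth (\<lambda>z. (1 - ?\<chi> z) * (complex_of_real A * ?h z + complex_of_real c))"
      using smooth_gamma_head_norm[OF \<sigma>, of "1 / 4"] rapid_smooth[OF rapid_one_minus_annular_step[OF R]]
      by (intro smooth_mult_complex smooth_affine_complex) auto
  qed (use R in \<open>simp add: annular_step_1\<close>)
  ultimately have \<rho>: "rapid \<rho>"
    unfolding \<rho>_def[abs_def] by (intro rapid_add rapid_cmult)
  have k: "k z = complex_of_real A * ?t z + \<rho> z" if "z \<noteq> 0" for z
    using c[OF that] by (simp add: k_def \<rho>_def algebra_simps)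
  have k_ae: "AE z in lborel. k z = complex_of_real A * ?t z + \<rho> z"
    using AE_lborel_singleton[of "0 :: real ^ 'd"] by eventually_elim (rule k)
  have fgt: "integrable lborel ?t"
    "fourier ?t \<xi> = complex_of_real ((4 * pi) powr (real CARD('d) / 2) * gamma_head s ((norm \<xi>)\<^sup>2))" for \<xi>
    using fourier_gamma_tail[OF s(1), where 'a = "real ^ 'd"] by (simp_all add: \<sigma>_def)
  have km[measurable]: "k \<in> borel_measurable borel"
    unfolding k_def fgf_kernel_def Let_def by measurable
  have i: "integrable lborel (\<lambda>z. complex_of_real A * ?t z + \<rho> z)"
    by (intro Bochner_Integration.integrable_add integrable_mult_right fgt rapid_integrable \<rho>)
  show "integrable lborel k"
    using i k_ae by (subst integrable_cong_AE[OF _ _ k_ae]) auto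
  have G: "Gamma s > 0" using s(1) by (rule Gamma_real_pos)
  have F: "fourier k \<xi> = complex_of_real (gamma_head s ((norm \<xi>)\<^sup>2) / Gamma s) + fourier \<rho> \<xi>" for \<xi>
  proof -
    have "fourier k \<xi> = fourier (\<lambda>z. complex_of_real A * ?t z + \<rho> z) \<xi>"
      unfolding fourier_def
    proof (rule integral_cong_AE)
      show "AE z in lborel. cis (- (z \<bullet> \<xi>)) * k z = cis (- (z \<bullet> \<xi>)) * (complex_of_real A * ?t z + \<rho> z)"
        using k_ae by eventually_elim simp
    qed (use i in auto)
    also have "\<dots> = complex_of_real A * fourier ?t \<xi> + fourier \<rho> \<xi>"
      by (simp add: fourier_add fourier_cmult fgt(1) rapid_integrable[OF \<rho>] del: of_real_mult)
    also have "complex_of_real A * fourier ?t \<xi> = complex_of_real (gamma_head s ((norm \<xi>)\<^sup>2) / Gamma s)"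
      unfolding fgt(2) of_real_mult[symmetric] of_real_eq_iff A_def riesz_const_def
      by (simp add: powr_minus field_simps)
    finally show ?thesis .
  qed
  let ?X = "\<lambda>\<xi> :: real ^ 'd. complex_of_real (annular_step (1/4) \<xi>)"
  let ?gt = "\<lambda>\<xi> :: real ^ 'd. complex_of_real (gamma_tail s (1 * (norm \<xi>)\<^sup>2))"
  let ?gh = "\<lambda>\<xi> :: real ^ 'd. complex_of_real (gamma_head s (1 * (norm \<xi>)\<^sup>2))"
  have "rapid (\<lambda>\<xi>. ?X \<xi> * ?gt \<xi>)"
    by (rule rapid_gamma_tail_norm[where r = "1/4" and k = 0]) (auto simp: Sym_annular_step annular_step_0)
  moreover have "rapid (\<lambda>\<xi>. (1 - ?X \<xi>) * ?gh \<xi>)"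
  proof (rule rapid_compact_support[where R = "2 * (1/4)"])
    show "smooth (\<lambda>\<xi>. (1 - ?X \<xi>) * ?gh \<xi>)"
      using s(1) by (intro smooth_mult_complex rapid_smooth[OF rapid_one_minus_annular_step] smooth_gamma_head_norm) auto
  qed (simp add: annular_step_1)
  ultimately have "rapid (\<lambda>\<xi>. (complex_of_real (1 / Gamma s) * ((1 - ?X \<xi>) * ?gh \<xi>) + complex_of_real (- 1 / Gamma s) * (?X \<xi> * ?gt \<xi>)) + fourier \<rho> \<xi>)"
    by (intro rapid_add rapid_cmult rapid_fourier \<rho>)
  \<comment> \<open>Head minus cutoff X times (head + tail) leaves (1 - X) times the head, compactly
    supported, minus X times the tail, which avoids the singularity at the origin.\<close>
  moreover have "(complex_of_real (1 / Gamma s) * ((1 - ?X \<xi>) * ?gh \<xi>) + complex_of_real (- 1 / Gamma s) * (?X \<xi> * ?gt \<xi>)) + fourier \<rho> \<xi>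
      = fourier k \<xi> - hom_symbol (- 2 * s) \<xi>" for \<xi>
  proof (cases "\<xi> = 0")
    case True
    then show ?thesis by (simp add: F hom_symbol_def annular_step_0)
  next
    case False
    then have n: "norm \<xi> > 0" "(norm \<xi>)\<^sup>2 > 0" by auto
    have "((norm \<xi>)\<^sup>2) powr (- s) = norm \<xi> powr (- 2 * s)"
      using n(1) powr_powr[of "norm \<xi>" 2 "- s"] by simp
    then have "norm \<xi> powr (- 2 * s) = (gamma_tail s ((norm \<xi>)\<^sup>2) + gamma_head s ((norm \<xi>)\<^sup>2)) / Gamma s"
      using gamma_tail_plus_head_pos[OF s(1) n(2)] G by simp
    then show ?thesis
      unfolding F hom_symbol_def by (simp add: algebra_simps diff_divide_distrib add_divide_distrib)
  qed
  ultimately show "rapid (\<lambda>\<xi>. fourier k \<xi> - hom_symbol (- 2 * s) \<xi>)" by simp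
qed

section \<open>The full symbol and its asymptotic expansion\<close>

section \<open>Symbols in two variables\<close>

text \<open>\<open>norm (snd v)\<close> is 0 or 1 on basis vectors: derivatives in x cost nothing,
  derivatives in \<xi> lower the order by one. The bounds are uniform in x.\<close>

abbreviation Sym2 :: "nat \<Rightarrow> real \<Rightarrow> ('a::euclidean_space \<times> 'a \<Rightarrow> complex) \<Rightarrow> bool" where
  "Sym2 \<equiv> bounded_derivs (weight_bound (\<lambda>z. 1 + norm (snd z))) (\<lambda>v. norm (snd v))"

interpretation Sym2: symbol_bound "weight_bound (\<lambda>z :: 'a \<times> 'a::euclidean_space. 1 + norm (snd z))" "\<lambda>v. norm (snd v)"
  by (rule symbol_bound_weight) simp

lemma Sym_smooth: "(\<And>n. Sym n m r) \<Longrightarrow> smooth r"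
  unfolding smooth_iff_Ck using bounded_derivs_imp_Ck by blast

lemma partial_deriv_zero: "(f has_derivative (\<lambda>v. partial_deriv v f x)) (at x) \<Longrightarrow> partial_deriv 0 f x = 0"
  using linear_simps(3)[OF has_derivative_bounded_linear] by blast

lemma Sym2_fst: "rapid b \<Longrightarrow> Sym2 n 0 (\<lambda>z. b (fst z))"
proof (induction n arbitrary: b)
  have bd: "weight_bound (\<lambda>z :: 'a \<times> 'a. 1 + norm (snd z)) 0 (\<lambda>z. b (fst z))" if b: "rapid b" for b :: "'a \<Rightarrow> complex"
  proof -
    obtain C where C: "C \<ge> 0" "\<And>x. norm (b x) \<le> C" using rapid_bounded[OF b] by blast
    have "norm (b x) \<le> C * (1 + norm y) powr 0" for x y :: 'a
      using C norm_ge_zero[of y] by (simp add: add_nonneg_eq_0_iff)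
    then show ?thesis unfolding weight_bound_def by blast
  qed
  {
    case 0
    then show ?case using bd by simp
  next
    case (Suc n)
    have bder: "(b has_derivative (\<lambda>v. partial_deriv v b y)) (at y)" for y
      by (rule smooth_has_derivative[OF rapid_smooth[OF Suc.prems]])
    show ?case
    proof (rule bounded_derivs_SucI)
      show "weight_bound (\<lambda>z :: 'a \<times> 'a. 1 + norm (snd z)) 0 (\<lambda>z. b (fst z))" by (rule bd[OF Suc.prems])
      show "((\<lambda>z. b (fst z)) has_derivative (\<lambda>h. partial_deriv (fst h) b (fst z))) (at z)" for z :: "'a \<times> 'a"
        by (rule has_derivative_compose[where f = fst and g = b, OF _ bder]) (intro has_derivative_fst has_derivative_ident)
      fix v :: "'a \<times> 'a" assume "v \<in> Basis"
      then consider u where "v = (u, 0)" "u \<in> Basis" | u where "v = (0, u)" "u \<in> Basis"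
        by (auto simp: Basis_prod_def)
      then show "Sym2 n (0 - norm (snd v)) (\<lambda>z. partial_deriv (fst v) b (fst z))"
      proof cases
        case 1
        then show ?thesis using Suc.IH[OF rapid_partial[OF Suc.prems]] by simp
      next
        case 2
        then show ?thesis using partial_deriv_zero[OF bder] by (simp add: Sym2.zero)
      qed
    qed
  }
qed

lemma Sym2_snd: "(\<And>n. Sym n m r) \<Longrightarrow> Sym2 n m (\<lambda>z. r (snd z))"
proof (induction n arbitrary: r m)
  case 0
  then show ?case using bounded_derivsD[OF 0] by (auto simp: weight_bound_def)
next
  case (Suc n)
  have rder: "(r has_derivative (\<lambda>v. partial_deriv v r y)) (at y)" for y
    by (rule bounded_derivs_has_derivative[OF Suc.prems])
  show ?case
  proof (rule bounded_derivs_SucI)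
    show "weight_bound (\<lambda>z. 1 + norm (snd z)) m (\<lambda>z. r (snd z))"
      using bounded_derivsD[OF Suc.prems] by (auto simp: weight_bound_def)
    show "((\<lambda>z. r (snd z)) has_derivative (\<lambda>h. partial_deriv (snd h) r (snd z))) (at z)" for z :: "'a \<times> 'a"
      by (rule has_derivative_compose[where f = snd and g = r, OF _ rder]) (intro has_derivative_snd has_derivative_ident)
    fix v :: "'a \<times> 'a" assume "v \<in> Basis"
    then consider u where "v = (u, 0)" "u \<in> Basis" | u where "v = (0, u)" "u \<in> Basis"
      by (auto simp: Basis_prod_def)
    then show "Sym2 n (m - norm (snd v)) (\<lambda>z. partial_deriv (snd v) r (snd z))"
    proof cases
      case 1
      then show ?thesis using partial_deriv_zero[OF rder] by (simp add: Sym2.zero)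
    next
      case 2
      then show ?thesis using Suc.IH[OF bounded_derivs_partial[OF Suc.prems 2(2)]] by simp
    qed
  qed
qed

lemma symbol_classI:
  fixes c :: "'a::euclidean_space \<times> 'a \<Rightarrow> complex"
  assumes c: "\<And>n. Sym2 n m c"
  shows "c \<in> symbol_class m"
  unfolding symbol_class_def
proof (intro CollectI conjI allI impI)
  show "smooth c" unfolding smooth_iff_Ck using bounded_derivs_imp_Ck[OF c] by blast
  fix vs ws :: "'a list" assume vs: "set vs \<subseteq> Basis" and ws: "set ws \<subseteq> Basis"
  let ?us = "map (\<lambda>v. (v, 0)) vs @ map (\<lambda>w. (0, w)) ws :: ('a \<times> 'a) list"
  have "set ?us \<subseteq> Basis" using vs ws by (auto simp: Basis_prod_def)
  from bounded_derivsD[OF bounded_derivs_iter_deriv[OF c this]]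
  have "weight_bound (\<lambda>z. 1 + norm (snd z)) (m - sum_list (map (\<lambda>v. norm (snd v)) ?us)) (iter_deriv ?us c)" .
  moreover have "sum_list (map (\<lambda>v. norm (snd v)) ?us) = real (length ws)"
  proof -
    have "sum_list (map (\<lambda>w. norm w) ws) = sum_list (map (\<lambda>_. 1) ws)"
      by (rule arg_cong[where f = sum_list], rule map_cong) (use ws in auto)
    then have "sum_list (map (\<lambda>w. norm w) ws) = real (length ws)" by (simp only: sum_list_triv)
    then show ?thesis by (simp add: o_def sum_list_triv)
  qed
  ultimately show "\<exists>C. \<forall>x \<xi>. norm (iter_deriv ?us c (x, \<xi>)) \<le> C * (1 + norm \<xi>) powr (m - real (length ws))"
    by (auto simp: weight_bound_def)
qed

section \<open>Taylor expansion along a line\<close>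

text \<open>Ordered lists instead of multi-indices: each mixed derivative is counted once per
  ordering, so the Taylor coefficient is 1 / j! throughout and no multinomial coefficients
  appear.\<close>

definition basis_lists :: "nat \<Rightarrow> 'a::euclidean_space list set" where
  "basis_lists j = {vs. set vs \<subseteq> Basis \<and> length vs = j}"

definition list_monomial :: "'a::euclidean_space list \<Rightarrow> 'a \<Rightarrow> complex" where
  "list_monomial vs \<eta> = complex_of_real (\<Prod>v\<leftarrow>vs. \<eta> \<bullet> v)"

lemma list_monomial_simps [simp]:
  "list_monomial [] \<eta> = 1"
  "list_monomial (v # vs) \<eta> = complex_of_real (\<eta> \<bullet> v) * list_monomial vs \<eta>"
  by (simp_all add: list_monomial_def)

lemma finite_basis_lists [simp]: "finite (basis_lists j)"
  unfolding basis_lists_def by (rule finite_lists_length_eq) simp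

lemma basis_lists_0: "basis_lists 0 = {[]}"
  by (auto simp: basis_lists_def)

lemma sum_basis_lists_Suc:
  fixes g :: "'a::euclidean_space list \<Rightarrow> 'b::comm_monoid_add"
  shows
  "(\<Sum>us\<in>basis_lists (Suc j). g us) = (\<Sum>vs\<in>basis_lists j. \<Sum>b\<in>Basis. g (b # vs))"
proof -
  have "basis_lists (Suc j) = (\<lambda>(vs, b). b # vs) ` (basis_lists j \<times> (Basis :: 'a set))"
    by (auto simp: basis_lists_def length_Suc_conv image_iff)
  moreover have "inj_on (\<lambda>(vs, b). b # vs) (basis_lists j \<times> (Basis :: 'a set))"
    by (auto simp: inj_on_def)
  ultimately have "(\<Sum>us\<in>basis_lists (Suc j). g us) = (\<Sum>(vs, b)\<in>basis_lists j \<times> Basis. g (b # vs))"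
    by (simp add: sum.reindex split_beta' o_def)
  then show ?thesis by (simp add: sum.cartesian_product)
qed

lemma line_has_vector_derivative:
  fixes q :: "'a::euclidean_space \<Rightarrow> complex"
  assumes q: "smooth q"
  shows "((\<lambda>t. q (\<xi> + t *\<^sub>R \<eta>)) has_vector_derivative
     (\<Sum>b\<in>Basis. complex_of_real (\<eta> \<bullet> b) * partial_deriv b q (\<xi> + t *\<^sub>R \<eta>))) (at t)"
proof -
  have qd: "(q has_derivative (\<lambda>v. partial_deriv v q y)) (at y)" for y
    by (rule smooth_has_derivative[OF q])
  have "((\<lambda>t. q (\<xi> + t *\<^sub>R \<eta>)) has_derivative (\<lambda>h. partial_deriv (h *\<^sub>R \<eta>) q (\<xi> + t *\<^sub>R \<eta>))) (at t)"
    by (rule has_derivative_compose[where f = "\<lambda>t. \<xi> + t *\<^sub>R \<eta>" and g = q, OF _ qd])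
       (auto intro!: derivative_eq_intros)
  moreover have "partial_deriv (h *\<^sub>R \<eta>) q y = h *\<^sub>R (\<Sum>b\<in>Basis. complex_of_real (\<eta> \<bullet> b) * partial_deriv b q y)" for h y
    using linear_simps(5)[OF has_derivative_bounded_linear[OF qd]] has_derivative_partial_sum[OF qd, of \<eta> y]
    by (simp add: scaleR_conv_of_real)
  ultimately show ?thesis by (simp add: has_vector_derivative_def)
qed

text \<open>The one-dimensional Taylor formula with integral remainder for t -> q (\<xi> + t \<eta>)
  on the unit interval. The remainder stays a sum over lists, so that each term can be integrated
  against \<open>fourier a\<close> separately.\<close>

lemma taylor_line:
  fixes q :: "'a::euclidean_space \<Rightarrow> complex"
  assumes q: "smooth q"
  shows "q (\<xi> + \<eta>) = (\<Sum>j\<le>p. 1 / fact j * (\<Sum>vs\<in>basis_lists j. list_monomial vs \<eta> * iter_deriv vs q \<xi>)) +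
    (\<Sum>vs\<in>basis_lists (Suc p). 1 / fact p *
      (LINT t|lborel. complex_of_real (indicator {0..1} t * (1 - t) ^ p) * (list_monomial vs \<eta> * iter_deriv vs q (\<xi> + t *\<^sub>R \<eta>))))"
proof -
  define Df where "Df j t = (\<Sum>vs\<in>basis_lists j. list_monomial vs \<eta> * iter_deriv vs q (\<xi> + t *\<^sub>R \<eta>))" for j t
  have sm: "smooth (iter_deriv vs q)" if "vs \<in> basis_lists j" for vs j
    using that by (intro smooth_iter_deriv[OF q]) (auto simp: basis_lists_def)
  have der: "(Df j has_vector_derivative Df (Suc j) t) (at t within {0..1})" for j t
  proof -
    have "(Df j has_vector_derivative (\<Sum>vs\<in>basis_lists j. list_monomial vs \<eta> *
        (\<Sum>b\<in>Basis. complex_of_real (\<eta> \<bullet> b) * partial_deriv b (iter_deriv vs q) (\<xi> + t *\<^sub>R \<eta>)))) (at t)"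
      unfolding Df_def[abs_def]
      by (intro has_vector_derivative_sum has_vector_derivative_mult_right line_has_vector_derivative sm)
    also have "(\<Sum>vs\<in>basis_lists j. list_monomial vs \<eta> *
        (\<Sum>b\<in>Basis. complex_of_real (\<eta> \<bullet> b) * partial_deriv b (iter_deriv vs q) (\<xi> + t *\<^sub>R \<eta>))) = Df (Suc j) t"
      unfolding Df_def sum_basis_lists_Suc
      by (simp add: sum_distrib_left iter_deriv_Cons mult_ac del: iter_deriv.simps)
    finally show ?thesis by (rule has_vector_derivative_at_within)
  qed
  have "q (\<xi> + 1 *\<^sub>R \<eta>) = (\<Sum>i<Suc p. ((1 - 0) ^ i / fact i) *\<^sub>R Df i 0) +
      integral {0..1} (\<lambda>x. ((1 - x) ^ (Suc p - 1) / fact (Suc p - 1)) *\<^sub>R Df (Suc p) x)"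
    by (rule Taylor_integral[where f = "\<lambda>t. q (\<xi> + t *\<^sub>R \<eta>)"])
       (auto simp: der Df_def[of 0] basis_lists_0 fun_eq_iff)
  moreover have "(\<Sum>i<Suc p. ((1 - 0) ^ i / fact i) *\<^sub>R Df i 0) =
      (\<Sum>j\<le>p. 1 / fact j * (\<Sum>vs\<in>basis_lists j. list_monomial vs \<eta> * iter_deriv vs q \<xi>))"
    unfolding lessThan_Suc_atMost by (intro sum.cong) (auto simp: Df_def scaleR_conv_of_real)
  moreover have "integral {0..1} (\<lambda>x. ((1 - x) ^ (Suc p - 1) / fact (Suc p - 1)) *\<^sub>R Df (Suc p) x) =
    (\<Sum>vs\<in>basis_lists (Suc p). 1 / fact p *
      (LINT t|lborel. complex_of_real (indicator {0..1} t * (1 - t) ^ p) * (list_monomial vs \<eta> * iter_deriv vs q (\<xi> + t *\<^sub>R \<eta>))))"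
  proof -
    let ?g = "\<lambda>vs t. (1 - t) ^ p *\<^sub>R (list_monomial vs \<eta> * iter_deriv vs q (\<xi> + t *\<^sub>R \<eta>))"
    have si: "set_integrable lborel {0..1} (?g vs)" if "vs \<in> basis_lists (Suc p)" for vs
      by (intro borel_integrable_atLeastAtMost' continuous_intros
            continuous_on_compose2[OF smooth_continuous[OF sm[OF that]]]) auto
    have "integral {0..1} (\<lambda>x. ((1 - x) ^ (Suc p - 1) / fact (Suc p - 1)) *\<^sub>R Df (Suc p) x) =
       integral {0..1} (\<lambda>t. \<Sum>vs\<in>basis_lists (Suc p). (1 / fact p) *\<^sub>R ?g vs t)"
      by (rule arg_cong[where f = "integral {0..1}"])
         (simp add: Df_def fun_eq_iff scaleR_sum_right)
    also have "\<dots> = (\<Sum>vs\<in>basis_lists (Suc p). integral {0..1} (\<lambda>t. (1 / fact p) *\<^sub>R ?g vs t))"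
      by (intro Henstock_Kurzweil_Integration.integral_sum integrable_cmul set_borel_integral_eq_integral(1)[OF si]) auto
    also have "\<dots> = (\<Sum>vs\<in>basis_lists (Suc p). (1 / fact p) *\<^sub>R integral {0..1} (?g vs))"
      by (intro sum.cong refl Henstock_Kurzweil_Integration.integral_cmul)
    also have "\<dots> = (\<Sum>vs\<in>basis_lists (Suc p). 1 / fact p *
      (LINT t|lborel. complex_of_real (indicator {0..1} t * (1 - t) ^ p) * (list_monomial vs \<eta> * iter_deriv vs q (\<xi> + t *\<^sub>R \<eta>))))"
    proof (rule sum.cong[OF refl])
      fix vs :: "'a list" assume "vs \<in> basis_lists (Suc p)"
      from set_borel_integral_eq_integral(2)[OF si[OF this]]
      have "integral {0..1} (?g vs) = (LINT t|lborel. indicator {0..1} t *\<^sub>R ?g vs t)"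
        by (simp add: set_lebesgue_integral_def)
      also have "\<dots> = (LINT t|lborel. complex_of_real (indicator {0..1} t * (1 - t) ^ p) * (list_monomial vs \<eta> * iter_deriv vs q (\<xi> + t *\<^sub>R \<eta>)))"
        by (rule Bochner_Integration.integral_cong) (simp_all add: scaleR_conv_of_real mult.assoc)
      finally show "(1 / fact p) *\<^sub>R integral {0..1} (?g vs) = 1 / fact p *
         (LINT t|lborel. complex_of_real (indicator {0..1} t * (1 - t) ^ p) * (list_monomial vs \<eta> * iter_deriv vs q (\<xi> + t *\<^sub>R \<eta>)))"
        by (simp add: scaleR_conv_of_real)
    qed
    finally show ?thesis .
  qed
  ultimately show ?thesis by simp
qed

section \<open>The remainder of the symbol expansion\<close>

text \<open>The Taylor remainder under the inverse transform: u = (t, \<eta>) is integrated, z = (x,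
  \<xi>) is the parameter. \<beta> stands for a monomial times \<open>fourier a\<close> and r for an
  iterated derivative. Differentiation in x changes only \<beta>, differentiation in \<xi> only
  r.\<close>

definition osc_integrand :: "nat \<Rightarrow> ('a::euclidean_space \<Rightarrow> complex) \<Rightarrow> ('a \<Rightarrow> complex) \<Rightarrow> 'a \<times> 'a \<Rightarrow> real \<times> 'a \<Rightarrow> complex" where
  "osc_integrand p \<beta> r z u = complex_of_real (indicator {0..1} (fst u) * (1 - fst u) ^ p) *
     (cis (fst z \<bullet> snd u) * \<beta> (snd u) * r (snd z + fst u *\<^sub>R snd u))"

definition osc_integral :: "nat \<Rightarrow> ('a::euclidean_space \<Rightarrow> complex) \<Rightarrow> ('a \<Rightarrow> complex) \<Rightarrow> 'a \<times> 'a \<Rightarrow> complex" where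
  "osc_integral p \<beta> r z = (LINT u|(lborel \<Otimes>\<^sub>M lborel). osc_integrand p \<beta> r z u)"

definition osc_weight :: "('a::euclidean_space \<Rightarrow> complex) \<Rightarrow> real \<Rightarrow> real \<times> 'a \<Rightarrow> real" where
  "osc_weight \<beta> m u = indicator {0..1} (fst u) * (norm (\<beta> (snd u)) * (1 + norm (snd u)) powr m)"

lemma osc_weight_nonneg: "0 \<le> osc_weight \<beta> m u"
  by (simp add: osc_weight_def)

lemma integrable_osc_weight:
  fixes \<beta> :: "'a::euclidean_space \<Rightarrow> complex"
  assumes \<beta>: "rapid \<beta>"
  shows "integrable (lborel \<Otimes>\<^sub>M lborel) (osc_weight \<beta> m)"
proof -
  note [measurable] = rapid_measurable[OF \<beta>]
  obtain C where C: "C \<ge> 0" "\<And>\<eta>. norm (\<beta> \<eta>) \<le> C * (1 + norm \<eta>) powr (- real (2 * DIM('a)) - m)"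
    using rapid_bound[OF \<beta>, of "- real (2 * DIM('a)) - m"] by blast
  have "integrable lborel (\<lambda>\<eta>. complex_of_real (norm (\<beta> \<eta>) * (1 + norm \<eta>) powr m))"
  proof (rule weight_bound_integrable)
    fix \<eta> :: 'a
    have "norm (\<beta> \<eta>) * (1 + norm \<eta>) powr m \<le> (C * (1 + norm \<eta>) powr (- real (2 * DIM('a)) - m)) * (1 + norm \<eta>) powr m"
      by (intro mult_right_mono C) auto
    also have "\<dots> = C * ((1 + norm \<eta>) powr ((- real (2 * DIM('a)) - m) + m))"
      unfolding powr_add by (simp only: mult.assoc)
    finally show "norm (complex_of_real (norm (\<beta> \<eta>) * (1 + norm \<eta>) powr m)) \<le> C * (1 + norm \<eta>) powr (- real (2 * DIM('a)))"
      by (simp add: abs_mult del: of_real_mult)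
  qed measurable
  then have "integrable (lborel \<Otimes>\<^sub>M lborel) (\<lambda>(t, \<eta>). 1 * (complex_of_real (indicator {0..1::real} t) * complex_of_real (norm (\<beta> \<eta>) * (1 + norm \<eta>) powr m)))"
  proof (intro integrable_pair_mult[where B = 1 and k = "\<lambda>_. 1"])
    show "integrable lborel (\<lambda>t. complex_of_real (indicator {0..1::real} t))"
      by (intro integrable_of_real) simp
  qed auto
  from integrable_Re[OF this] show ?thesis
    by (simp add: osc_weight_def[abs_def] split_beta')
qed

lemma osc_measurable:
  assumes \<beta>: "rapid \<beta>" and r[measurable]: "r \<in> borel_measurable borel"
  shows "osc_integrand p \<beta> r z \<in> borel_measurable (lborel \<Otimes>\<^sub>M lborel)"
proof -
  note [measurable] = rapid_measurable[OF \<beta>]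
  show ?thesis unfolding osc_integrand_def[abs_def] by measurable
qed

text \<open>Peetre's inequality separates the growth of r at \<xi> + t \<eta> into a power of 1 +
  norm \<xi> of the same order and a power of 1 + norm \<eta>, which the decay of \<beta>
  absorbs.\<close>

lemma osc_integrand_bound:
  assumes r: "\<And>y. norm (r y) \<le> C * (1 + norm y) powr k" and C: "C \<ge> 0"
  shows "norm (osc_integrand p \<beta> r z u) \<le> C * (1 + norm (snd z)) powr k * osc_weight \<beta> \<bar>k\<bar> u"
proof (cases "fst u \<in> {0..1}")
  case True
  then have t: "0 \<le> fst u" "fst u \<le> 1" by auto
  have "norm (r (snd z + fst u *\<^sub>R snd u)) \<le> C * ((1 + norm (snd z)) powr k * (1 + norm (fst u *\<^sub>R snd u)) powr \<bar>k\<bar>)"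
    by (rule order.trans[OF r]) (intro mult_left_mono peetre C)
  also have "\<dots> \<le> C * ((1 + norm (snd z)) powr k * (1 + norm (snd u)) powr \<bar>k\<bar>)"
    using t by (intro mult_left_mono powr_mono2 add_left_mono C) (auto intro: mult_left_le_one_le)
  finally have 1: "norm (r (snd z + fst u *\<^sub>R snd u)) \<le> C * ((1 + norm (snd z)) powr k * (1 + norm (snd u)) powr \<bar>k\<bar>)" .
  have "norm (osc_integrand p \<beta> r z u) = (1 - fst u) ^ p * (norm (\<beta> (snd u)) * norm (r (snd z + fst u *\<^sub>R snd u)))"
  proof -
    have "norm (complex_of_real (indicator {0..1} (fst u) * (1 - fst u) ^ p)) = (1 - fst u) ^ p"
      using True t unfolding norm_of_real by simp
    then show ?thesis unfolding osc_integrand_def norm_mult by simp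
  qed
  also have "\<dots> \<le> 1 * (norm (\<beta> (snd u)) * (C * ((1 + norm (snd z)) powr k * (1 + norm (snd u)) powr \<bar>k\<bar>)))"
    using t by (intro mult_mono power_le_one mult_left_mono 1) auto
  finally show ?thesis using True by (simp add: osc_weight_def mult_ac)
qed (simp add: osc_integrand_def osc_weight_def)

lemma osc_integrable:
  assumes \<beta>: "rapid \<beta>" and m: "r \<in> borel_measurable borel"
    and r: "\<And>y. norm (r y) \<le> C * (1 + norm y) powr k" and C: "C \<ge> 0"
  shows "integrable (lborel \<Otimes>\<^sub>M lborel) (osc_integrand p \<beta> r z)"
proof (rule Bochner_Integration.integrable_bound)
  show "integrable (lborel \<Otimes>\<^sub>M lborel) (\<lambda>u. C * (1 + norm (snd z)) powr k * osc_weight \<beta> \<bar>k\<bar> u)"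
    by (intro integrable_mult_right integrable_osc_weight \<beta>)
  show "AE u in lborel \<Otimes>\<^sub>M lborel. norm (osc_integrand p \<beta> r z u) \<le> norm (C * (1 + norm (snd z)) powr k * osc_weight \<beta> \<bar>k\<bar> u)"
    by (rule AE_I2, rule order.trans[OF osc_integrand_bound[OF r C]]) simp
qed (rule osc_measurable[OF \<beta> m])

lemma partial_deriv_weight_bound:
  fixes r :: "'a::euclidean_space \<Rightarrow> complex"
  assumes r: "Sym (Suc 0) k r"
  obtains D where "D \<ge> 0" "\<And>h y. norm (partial_deriv h r y) \<le> norm h * (D * (1 + norm y) powr (k - 1))"
proof -
  have "\<exists>D. D \<ge> 0 \<and> (\<forall>y. norm (partial_deriv b r y) \<le> D * (1 + norm y) powr (k - 1))" if "b \<in> Basis" for b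
    using bounded_derivsD[OF bounded_derivs_partial[OF r that]] that by (metis norm_Basis weight_boundE)
  then obtain D where D: "\<And>b. b \<in> Basis \<Longrightarrow> D b \<ge> 0" "\<And>b y. b \<in> Basis \<Longrightarrow> norm (partial_deriv b r y) \<le> D b * (1 + norm y) powr (k - 1)"
    by metis
  have "norm (partial_deriv h r y) \<le> norm h * ((\<Sum>b\<in>Basis. D b) * (1 + norm y) powr (k - 1))" for h y
  proof -
    have "norm (partial_deriv h r y) \<le> (\<Sum>b\<in>Basis. norm ((h \<bullet> b) *\<^sub>R partial_deriv b r y))"
      unfolding has_derivative_partial_sum[OF bounded_derivs_has_derivative[OF r], of h] by (rule norm_sum)
    also have "\<dots> \<le> (\<Sum>b\<in>Basis. norm h * (D b * (1 + norm y) powr (k - 1)))"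
      unfolding norm_scaleR by (intro sum_mono mult_mono D) (auto simp: Basis_le_norm)
    finally show ?thesis by (simp add: sum_distrib_left sum_distrib_right)
  qed
  then show ?thesis using D by (intro that[of "\<Sum>b\<in>Basis. D b"]) (auto intro: sum_nonneg)
qed

lemma powr_ball_bound:
  fixes z z0 :: "'a::euclidean_space \<times> 'a"
  shows "dist z z0 < 1 \<Longrightarrow> (1 + norm (snd z)) powr k \<le> (1 + norm (snd z0)) powr k * 2 powr \<bar>k\<bar>"
proof -
  assume "dist z z0 < 1"
  moreover have "norm (snd (z - z0)) \<le> norm (z - z0)"
    using norm_snd_le[where x = "fst (z - z0)" and y = "snd (z - z0)"] by (simp only: prod.collapse)
  ultimately have "norm (snd z - snd z0) \<le> 1" by (simp add: dist_norm)
  then have "(1 + norm (snd z - snd z0)) powr \<bar>k\<bar> \<le> 2 powr \<bar>k\<bar>" by (intro powr_mono2) auto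
  then have "(1 + norm (snd z0)) powr k * (1 + norm (snd z - snd z0)) powr \<bar>k\<bar> \<le> (1 + norm (snd z0)) powr k * 2 powr \<bar>k\<bar>"
    by (intro mult_left_mono) auto
  then show ?thesis
    using peetre[of "snd z0" "snd z - snd z0" k] by simp
qed

lemma osc_has_derivative:
  fixes \<beta> r :: "'a::euclidean_space \<Rightarrow> complex"
  assumes \<beta>: "rapid \<beta>" and r: "\<And>n. Sym n k r"
  shows "(osc_integral p \<beta> r has_derivative (\<lambda>h. LINT u|(lborel \<Otimes>\<^sub>M lborel).
     \<i> * complex_of_real (fst h \<bullet> snd u) * osc_integrand p \<beta> r z u + osc_integrand p \<beta> (partial_deriv (snd h) r) z u)) (at z)"
proof -
  have sr: "smooth r" by (rule Sym_smooth[OF r])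
  have rd: "(r has_derivative (\<lambda>v. partial_deriv v r y)) (at y)" for y
    by (rule smooth_has_derivative[OF sr])
  have rm: "r \<in> borel_measurable borel" by (intro borel_measurable_continuous_onI smooth_continuous sr)
  have prm: "partial_deriv v r \<in> borel_measurable borel" for v
  proof -
    have "(\<lambda>y. \<Sum>b\<in>Basis. (v \<bullet> b) *\<^sub>R partial_deriv b r y) \<in> borel_measurable borel"
      by (intro borel_measurable_sum borel_measurable_scaleR borel_measurable_const
          borel_measurable_continuous_onI smooth_continuous smooth_partial_deriv sr)
    then show ?thesis using has_derivative_partial_sum[OF rd, of v] by (simp cong: measurable_cong)
  qed
  obtain C where C: "C \<ge> 0" "\<And>y. norm (r y) \<le> C * (1 + norm y) powr k"
    using bounded_derivsD[OF r] by (meson weight_boundE)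
  obtain D where D: "D \<ge> 0" "\<And>h y. norm (partial_deriv h r y) \<le> norm h * (D * (1 + norm y) powr (k - 1))"
    using partial_deriv_weight_bound[OF r] by blast
  let ?E = "C * ((1 + norm (snd z)) powr k * 2 powr \<bar>k\<bar>)" and ?F = "D * ((1 + norm (snd z)) powr (k - 1) * 2 powr \<bar>k - 1\<bar>)"
  show ?thesis
    unfolding osc_integral_def[abs_def]
  proof (rule has_derivative_integral[where r = 1
      and f' = "\<lambda>z u h. \<i> * complex_of_real (fst h \<bullet> snd u) * osc_integrand p \<beta> r z u + osc_integrand p \<beta> (partial_deriv (snd h) r) z u"
      and g = "\<lambda>u. ?E * osc_weight \<beta> (\<bar>k\<bar> + 1) u + ?F * osc_weight \<beta> \<bar>k - 1\<bar> u"])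
    show "integrable (lborel \<Otimes>\<^sub>M lborel) (osc_integrand p \<beta> r x)" for x
      by (rule osc_integrable[OF \<beta> rm C(2,1)])
    show "integrable (lborel \<Otimes>\<^sub>M lborel) (\<lambda>u. ?E * osc_weight \<beta> (\<bar>k\<bar> + 1) u + ?F * osc_weight \<beta> \<bar>k - 1\<bar> u)"
      by (intro Bochner_Integration.integrable_add integrable_mult_right integrable_osc_weight \<beta>)
    show "(\<lambda>u. \<i> * complex_of_real (fst h \<bullet> snd u) * osc_integrand p \<beta> r z u + osc_integrand p \<beta> (partial_deriv (snd h) r) z u)
        \<in> borel_measurable (lborel \<Otimes>\<^sub>M lborel)" for h
      by (intro borel_measurable_add borel_measurable_times osc_measurable \<beta> rm prm) measurable
    fix x :: "'a \<times> 'a" and u :: "real \<times> 'a" assume x: "dist x z < 1"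
    let ?W = "complex_of_real (indicator {0..1} (fst u) * (1 - fst u) ^ p)"
    let ?y = "snd x + fst u *\<^sub>R snd u"
    have d1: "((\<lambda>x. cis (fst x \<bullet> snd u)) has_derivative
        (\<lambda>h. \<i> * complex_of_real (fst h \<bullet> snd u) * cis (fst x \<bullet> snd u))) (at x)"
      by (rule has_derivative_cis_compose) (auto intro!: derivative_eq_intros)
    have d2: "((\<lambda>x. r (snd x + fst u *\<^sub>R snd u)) has_derivative (\<lambda>h. partial_deriv (snd h) r ?y)) (at x)"
      by (rule has_derivative_compose[where f = "\<lambda>x. snd x + fst u *\<^sub>R snd u" and g = r, OF _ rd])
         (auto intro!: derivative_eq_intros)
    have "((\<lambda>x. ?W * (cis (fst x \<bullet> snd u) * \<beta> (snd u) * r (snd x + fst u *\<^sub>R snd u))) has_derivative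
      (\<lambda>h. ?W * (cis (fst x \<bullet> snd u) * \<beta> (snd u) * partial_deriv (snd h) r ?y +
         \<i> * complex_of_real (fst h \<bullet> snd u) * cis (fst x \<bullet> snd u) * \<beta> (snd u) * r ?y))) (at x)"
      by (rule has_derivative_mult_right[OF has_derivative_mult[OF has_derivative_mult_left[OF d1] d2]])
    then show "((\<lambda>x. osc_integrand p \<beta> r x u) has_derivative
       (\<lambda>h. \<i> * complex_of_real (fst h \<bullet> snd u) * osc_integrand p \<beta> r x u + osc_integrand p \<beta> (partial_deriv (snd h) r) x u)) (at x)"
      unfolding osc_integrand_def by (rule has_derivative_eq_rhs) (auto simp: fun_eq_iff algebra_simps)
    fix h :: "'a \<times> 'a"
    have "norm (\<i> * complex_of_real (fst h \<bullet> snd u) * osc_integrand p \<beta> r x u) \<le>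
        (norm h * (1 + norm (snd u))) * (C * (1 + norm (snd x)) powr k * osc_weight \<beta> \<bar>k\<bar> u)"
    proof -
      have "\<bar>fst h \<bullet> snd u\<bar> \<le> norm (fst h) * norm (snd u)" by (rule Cauchy_Schwarz_ineq2)
      also have "\<dots> \<le> norm h * (1 + norm (snd u))"
        using norm_fst_le[where x = "fst h" and y = "snd h"] by (intro mult_mono) auto
      finally have "\<bar>fst h \<bullet> snd u\<bar> * norm (osc_integrand p \<beta> r x u) \<le>
          (norm h * (1 + norm (snd u))) * (C * (1 + norm (snd x)) powr k * osc_weight \<beta> \<bar>k\<bar> u)"
        using osc_integrand_bound[OF C(2,1), of p \<beta> x u] by (rule mult_mono) auto
      then show ?thesis by (simp add: norm_mult)
    qed
    also have "\<dots> \<le> (norm h * (1 + norm (snd u))) * (?E * osc_weight \<beta> \<bar>k\<bar> u)"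
      by (intro mult_left_mono mult_right_mono powr_ball_bound[OF x] C osc_weight_nonneg) auto
    also have "\<dots> = ?E * osc_weight \<beta> (\<bar>k\<bar> + 1) u * norm h"
      by (simp add: osc_weight_def powr_add)
    finally have 1: "norm (\<i> * complex_of_real (fst h \<bullet> snd u) * osc_integrand p \<beta> r x u) \<le> ?E * osc_weight \<beta> (\<bar>k\<bar> + 1) u * norm h" .
    have "norm (osc_integrand p \<beta> (partial_deriv (snd h) r) x u) \<le>
        (norm (snd h) * D) * (1 + norm (snd x)) powr (k - 1) * osc_weight \<beta> \<bar>k - 1\<bar> u"
      by (rule osc_integrand_bound) (use D in \<open>auto simp: mult.assoc\<close>)
    also have "\<dots> \<le> (norm h * D) * ((1 + norm (snd z)) powr (k - 1) * 2 powr \<bar>k - 1\<bar>) * osc_weight \<beta> \<bar>k - 1\<bar> u"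
      using norm_snd_le[where x = "fst h" and y = "snd h"] D(1)
      by (intro mult_right_mono mult_mono powr_ball_bound[OF x] osc_weight_nonneg) auto
    finally have 2: "norm (osc_integrand p \<beta> (partial_deriv (snd h) r) x u) \<le> ?F * osc_weight \<beta> \<bar>k - 1\<bar> u * norm h"
      by (simp add: mult_ac)
    show "norm (\<i> * complex_of_real (fst h \<bullet> snd u) * osc_integrand p \<beta> r x u + osc_integrand p \<beta> (partial_deriv (snd h) r) x u)
      \<le> (?E * osc_weight \<beta> (\<bar>k\<bar> + 1) u + ?F * osc_weight \<beta> \<bar>k - 1\<bar> u) * norm h"
      unfolding distrib_right by (rule norm_triangle_mono[OF 1 2])
  qed auto
qed

text \<open>A derivative in x multiplies \<beta> by i times a coordinate, which keeps it rapidly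
  decreasing; a derivative in \<xi> replaces r by a function of order k - 1. The integral is of the
  same form either way, so the induction runs with \<beta>, r and k general.\<close>

lemma Sym2_osc_integral:
  fixes \<beta> r :: "'a::euclidean_space \<Rightarrow> complex"
  assumes \<beta>: "rapid \<beta>" and r: "\<And>n. Sym n k r"
  shows "Sym2 n k (osc_integral p \<beta> r)"
  using assms
proof (induction n arbitrary: \<beta> r k)
  have bd: "weight_bound (\<lambda>z. 1 + norm (snd z)) k (osc_integral p \<beta> r)"
    if \<beta>: "rapid \<beta>" and r: "\<And>n. Sym n k r" for \<beta> r :: "'a \<Rightarrow> complex" and k
  proof -
    obtain C where C: "C \<ge> 0" "\<And>y. norm (r y) \<le> C * (1 + norm y) powr k"
      using bounded_derivsD[OF r] by (meson weight_boundE)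
    have "norm (osc_integral p \<beta> r z) \<le> C * (LINT u|(lborel \<Otimes>\<^sub>M lborel). osc_weight \<beta> \<bar>k\<bar> u) * (1 + norm (snd z)) powr k" for z
    proof -
      have "norm (osc_integral p \<beta> r z) \<le> (LINT u|(lborel \<Otimes>\<^sub>M lborel). C * (1 + norm (snd z)) powr k * osc_weight \<beta> \<bar>k\<bar> u)"
        unfolding osc_integral_def
        by (rule order.trans[OF integral_norm_bound], intro integral_mono integrable_norm integrable_mult_right
              integrable_osc_weight \<beta> osc_integrable[OF \<beta> _ C(2,1)] osc_integrand_bound[OF C(2,1)])
           (rule borel_measurable_continuous_onI[OF smooth_continuous[OF Sym_smooth[OF r]]])
      then show ?thesis by (simp add: mult_ac)
    qed
    then show ?thesis unfolding weight_bound_def by blast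
  qed
  {
    case 0
    then show ?case using bd by simp
  next
    case (Suc n)
    show ?case
    proof (rule bounded_derivs_SucI)
      show "weight_bound (\<lambda>z. 1 + norm (snd z)) k (osc_integral p \<beta> r)" by (rule bd[OF Suc.prems])
      show "(osc_integral p \<beta> r has_derivative (\<lambda>h. LINT u|(lborel \<Otimes>\<^sub>M lborel).
        \<i> * complex_of_real (fst h \<bullet> snd u) * osc_integrand p \<beta> r z u + osc_integrand p \<beta> (partial_deriv (snd h) r) z u)) (at z)" for z
        by (rule osc_has_derivative[OF Suc.prems])
      have rd: "(r has_derivative (\<lambda>v. partial_deriv v r y)) (at y)" for y
        by (rule bounded_derivs_has_derivative[OF Suc.prems(2)])
      fix v :: "'a \<times> 'a" assume "v \<in> Basis"
      then consider w where "v = (w, 0)" "w \<in> Basis" | w where "v = (0, w)" "w \<in> Basis"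
        by (auto simp: Basis_prod_def)
      then show "Sym2 n (k - norm (snd v)) (\<lambda>z. LINT u|(lborel \<Otimes>\<^sub>M lborel).
        \<i> * complex_of_real (fst v \<bullet> snd u) * osc_integrand p \<beta> r z u + osc_integrand p \<beta> (partial_deriv (snd v) r) z u)"
      proof cases
        case 1
        have "Sym2 n k (osc_integral p (\<lambda>\<eta>. \<i> * (complex_of_real (\<eta> \<bullet> w) * \<beta> \<eta>)) r)"
          by (intro Suc.IH rapid_cmult rapid_inner Suc.prems)
        also have "osc_integral p (\<lambda>\<eta>. \<i> * (complex_of_real (\<eta> \<bullet> w) * \<beta> \<eta>)) r = (\<lambda>z. LINT u|(lborel \<Otimes>\<^sub>M lborel).
          \<i> * complex_of_real (fst v \<bullet> snd u) * osc_integrand p \<beta> r z u + osc_integrand p \<beta> (partial_deriv (snd v) r) z u)"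
          unfolding osc_integral_def[abs_def]
          by (intro ext Bochner_Integration.integral_cong refl)
             (simp add: osc_integrand_def 1 partial_deriv_zero[OF rd] inner_commute mult_ac)
        finally show ?thesis using 1 by simp
      next
        case 2
        have "Sym2 n (k - norm w) (osc_integral p \<beta> (partial_deriv w r))"
          by (intro Suc.IH Suc.prems bounded_derivs_partial[OF Suc.prems(2)] 2)
        then show ?thesis using 2 by (simp add: osc_integral_def[abs_def])
      qed
    qed
  }
qed

section \<open>Convolution operators with variable coefficients\<close>

lemma fubini_pair:
  fixes f :: "'a::euclidean_space \<times> 'b::euclidean_space \<Rightarrow> complex"
  assumes f: "integrable (lborel \<Otimes>\<^sub>M lborel) f"
  shows "integrable lborel (\<lambda>y. LINT x|lborel. f (x, y))"
    and "(LINT y|lborel. LINT x|lborel. f (x, y)) = (LINT u|(lborel \<Otimes>\<^sub>M lborel). f u)"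
proof -
  have "integrable (lborel \<Otimes>\<^sub>M lborel) (\<lambda>(y, x). f (x, y))"
    by (rule lborel_pair.integrable_product_swap[OF f])
  from lborel_pair.integrable_fst'[OF this]
  show "integrable lborel (\<lambda>y. LINT x|lborel. f (x, y))" by simp
  have "(LINT y|lborel. LINT x|lborel. f (x, y)) = (LINT x|lborel. LINT y|lborel. f (x, y))"
    using lborel_pair.Fubini_integral[of "\<lambda>x y. f (x, y)"] f by simp
  also have "\<dots> = (LINT u|(lborel \<Otimes>\<^sub>M lborel). f u)"
    by (rule lborel_pair.integral_fst'[OF f])
  finally show "(LINT y|lborel. LINT x|lborel. f (x, y)) = (LINT u|(lborel \<Otimes>\<^sub>M lborel). f u)" .
qed

lemma inv_fourier_cmult: "inv_fourier (\<lambda>\<xi>. c * f \<xi>) x = c * inv_fourier f x"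
proof -
  have "(LINT \<xi>|lborel. cis (x \<bullet> \<xi>) * (c * f \<xi>)) = (LINT \<xi>|lborel. c * (cis (x \<bullet> \<xi>) * f \<xi>))"
    by (simp add: mult_ac)
  then show ?thesis by (simp add: inv_fourier_def)
qed

lemma rapid_list_monomial: "rapid f \<Longrightarrow> rapid (\<lambda>\<eta>. list_monomial vs \<eta> * f \<eta>)"
proof (induction vs)
  case (Cons v vs)
  from rapid_inner[OF Cons.IH[OF Cons.prems], of v] show ?case by (simp add: mult.assoc)
qed simp

lemma fourier_iter_deriv:
  "rapid f \<Longrightarrow> set vs \<subseteq> Basis \<Longrightarrow> fourier (iter_deriv vs f) \<xi> = \<i> ^ length vs * (list_monomial vs \<xi> * fourier f \<xi>)"
proof (induction vs)
  case (Cons v vs)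
  then have "fourier (partial_deriv v (iter_deriv vs f)) \<xi> = \<i> * complex_of_real (\<xi> \<bullet> v) * fourier (iter_deriv vs f) \<xi>"
    by (intro fourier_partial iter_deriv_rapid) auto
  with Cons show ?case by (simp add: iter_deriv_Cons del: iter_deriv.simps(2))
qed simp

lemma inv_fourier_list_monomial:
  assumes f: "rapid f" and vs: "set vs \<subseteq> Basis"
  shows "inv_fourier (\<lambda>\<eta>. list_monomial vs \<eta> * fourier f \<eta>) x = (- \<i>) ^ length vs * iter_deriv vs f x"
proof -
  have 1: "(- \<i>) ^ length vs * \<i> ^ length vs = 1"
    by (simp add: power_mult_distrib[symmetric])
  have "(\<lambda>\<eta>. list_monomial vs \<eta> * fourier f \<eta>) = (\<lambda>\<eta>. (- \<i>) ^ length vs * fourier (iter_deriv vs f) \<eta>)"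
    unfolding fourier_iter_deriv[OF f vs] mult.assoc[symmetric] 1 by simp
  then show ?thesis
    by (simp add: inv_fourier_cmult fourier_inversion[OF iter_deriv_rapid[OF f vs]])
qed

lemma iter_deriv_diff:
  assumes f: "smooth f" and g: "smooth g" and vs: "set vs \<subseteq> Basis"
  shows "iter_deriv vs (\<lambda>x. f x - g x) = (\<lambda>x. iter_deriv vs f x - iter_deriv vs g x)"
  using vs
proof (induction vs)
  case (Cons v vs)
  have IH: "iter_deriv vs (\<lambda>x. f x - g x) = (\<lambda>x. iter_deriv vs f x - iter_deriv vs g x)"
    using Cons by simp
  show ?case unfolding iter_deriv_Cons IH
    by (rule ext, rule partial_deriv_eq, intro has_derivative_diff smooth_has_derivative smooth_iter_deriv f g)
       (use Cons.prems in auto)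
qed simp

text \<open>a (x - z) is written by Fourier inversion as a superposition of phases and the integrals
  are exchanged. Thus k need only be integrable, and its regularity is seen through
  \<open>fourier k\<close> alone.\<close>

lemma fourier_times_translate:
  fixes a k :: "'a::euclidean_space \<Rightarrow> complex"
  assumes a: "rapid a" and k: "integrable lborel k"
  shows "fourier (\<lambda>z. a (x - z) * k z) \<xi> = inv_fourier (\<lambda>\<eta>. fourier a \<eta> * fourier k (\<xi> + \<eta>)) x"
proof -
  let ?c = "complex_of_real (1 / (2 * pi) ^ DIM('a))"
  have A: "integrable lborel (fourier a)" by (intro rapid_integrable rapid_fourier a)
  have "inv_fourier (\<lambda>\<eta>. fourier a \<eta> * fourier k (\<xi> + \<eta>)) x =
    ?c * (LINT \<eta>|lborel. fourier a \<eta> * (LINT z|lborel. cis (x \<bullet> \<eta> - z \<bullet> (\<xi> + \<eta>)) * k z))"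
    unfolding inv_fourier_def
  proof (rule arg_cong[where f = "\<lambda>y. ?c * y"], rule Bochner_Integration.integral_cong[OF refl])
    fix \<eta>
    have "cis (x \<bullet> \<eta>) * fourier k (\<xi> + \<eta>) = (LINT z|lborel. cis (x \<bullet> \<eta>) * (cis (- (z \<bullet> (\<xi> + \<eta>))) * k z))"
      unfolding fourier_def by simp
    also have "\<dots> = (LINT z|lborel. cis (x \<bullet> \<eta> - z \<bullet> (\<xi> + \<eta>)) * k z)"
      by (rule Bochner_Integration.integral_cong[OF refl]) (simp add: cis_mult flip: mult.assoc)
    finally show "cis (x \<bullet> \<eta>) * (fourier a \<eta> * fourier k (\<xi> + \<eta>)) =
        fourier a \<eta> * (LINT z|lborel. cis (x \<bullet> \<eta> - z \<bullet> (\<xi> + \<eta>)) * k z)"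
      by (metis mult.left_commute)
  qed
  also have "(LINT \<eta>|lborel. fourier a \<eta> * (LINT z|lborel. cis (x \<bullet> \<eta> - z \<bullet> (\<xi> + \<eta>)) * k z)) =
      (LINT z|lborel. (LINT \<eta>|lborel. cis (x \<bullet> \<eta> - z \<bullet> (\<xi> + \<eta>)) * fourier a \<eta>) * k z)"
    using fubini_mult[OF A k, of "\<lambda>(\<eta>, z). cis (x \<bullet> \<eta> - z \<bullet> (\<xi> + \<eta>))" 1] by (simp add: split_beta')
  also have "?c * \<dots> = (LINT z|lborel. ?c * ((LINT \<eta>|lborel. cis (x \<bullet> \<eta> - z \<bullet> (\<xi> + \<eta>)) * fourier a \<eta>) * k z))"
    by simp
  also have "\<dots> = (LINT z|lborel. cis (- (z \<bullet> \<xi>)) * (a (x - z) * k z))"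
  proof (rule Bochner_Integration.integral_cong[OF refl])
    fix z
    have "(LINT \<eta>|lborel. cis (x \<bullet> \<eta> - z \<bullet> (\<xi> + \<eta>)) * fourier a \<eta>) =
      (LINT \<eta>|lborel. cis (- (z \<bullet> \<xi>)) * (cis ((x - z) \<bullet> \<eta>) * fourier a \<eta>))"
      by (rule Bochner_Integration.integral_cong[OF refl], simp only: mult.assoc[symmetric] cis_mult)
         (simp add: inner_diff_left inner_add_right algebra_simps)
    also have "\<dots> = cis (- (z \<bullet> \<xi>)) * (LINT \<eta>|lborel. cis ((x - z) \<bullet> \<eta>) * fourier a \<eta>)" by simp
    finally have "?c * (LINT \<eta>|lborel. cis (x \<bullet> \<eta> - z \<bullet> (\<xi> + \<eta>)) * fourier a \<eta>) =
        cis (- (z \<bullet> \<xi>)) * inv_fourier (fourier a) (x - z)"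
      by (simp add: inv_fourier_def)
    then show "?c * ((LINT \<eta>|lborel. cis (x \<bullet> \<eta> - z \<bullet> (\<xi> + \<eta>)) * fourier a \<eta>) * k z) = cis (- (z \<bullet> \<xi>)) * (a (x - z) * k z)"
      by (simp add: fourier_inversion[OF a] flip: mult.assoc)
  qed
  finally show ?thesis by (simp add: fourier_def)
qed

text \<open>Under the inverse transform in \<eta>, monomials times \<open>fourier a\<close> become
  derivatives of a at x, each coordinate contributing - \<i>; the integral remainder becomes an
  \<open>osc_integral\<close> of order m - (p + 1).\<close>

lemma symbol_taylor:
  fixes a q :: "'a::euclidean_space \<Rightarrow> complex"
  assumes a: "rapid a" and q: "\<And>n. Sym n m q"
  shows "inv_fourier (\<lambda>\<eta>. fourier a \<eta> * q (\<xi> + \<eta>)) x =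
    (\<Sum>j\<le>p. 1 / fact j * (\<Sum>vs\<in>basis_lists j. ((- \<i>) ^ j * iter_deriv vs a x) * iter_deriv vs q \<xi>)) +
    (\<Sum>vs\<in>basis_lists (Suc p). complex_of_real (1 / (2 * pi) ^ DIM('a)) * (1 / fact p) *
      osc_integral p (\<lambda>\<eta>. list_monomial vs \<eta> * fourier a \<eta>) (iter_deriv vs q) (x, \<xi>))"
proof -
  let ?c = "complex_of_real (1 / (2 * pi) ^ DIM('a))"
  let ?\<beta> = "\<lambda>vs \<eta>. list_monomial vs \<eta> * fourier a \<eta>"
  let ?o = "\<lambda>vs. osc_integrand p (?\<beta> vs) (iter_deriv vs q) (x, \<xi>)"
  have sq: "smooth q" unfolding smooth_iff_Ck using bounded_derivs_imp_Ck[OF q] by blast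
  have bl: "set vs \<subseteq> Basis" "length vs = j" if "vs \<in> basis_lists j" for vs :: "'a list" and j
    using that by (auto simp: basis_lists_def)
  have \<beta>: "rapid (?\<beta> vs)" for vs by (intro rapid_list_monomial rapid_fourier a)
  have o: "integrable (lborel \<Otimes>\<^sub>M lborel) (?o vs)" if "vs \<in> basis_lists j" for vs j
  proof -
    have "weight_bound (\<lambda>x. 1 + norm x) (m - sum_list (map norm vs)) (iter_deriv vs q)"
      by (rule bounded_derivsD[OF bounded_derivs_iter_deriv[OF q bl(1)[OF that]]])
    then obtain C where "C \<ge> 0" "\<And>y. norm (iter_deriv vs q y) \<le> C * (1 + norm y) powr (m - sum_list (map norm vs))"
      by (meson weight_boundE)
    moreover have "iter_deriv vs q \<in> borel_measurable borel"
      by (intro borel_measurable_continuous_onI smooth_continuous smooth_iter_deriv sq bl(1)[OF that])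
    ultimately show ?thesis by (intro osc_integrable[OF \<beta>]) auto
  qed
  have i1: "integrable lborel (\<lambda>\<eta>. cis (x \<bullet> \<eta>) * ?\<beta> vs \<eta>)" for vs
    by (intro integrable_cis_mult rapid_integrable \<beta>) auto
  have "cis (x \<bullet> \<eta>) * (fourier a \<eta> * q (\<xi> + \<eta>)) =
     (\<Sum>j\<le>p. \<Sum>vs\<in>basis_lists j. (1 / fact j * iter_deriv vs q \<xi>) * (cis (x \<bullet> \<eta>) * ?\<beta> vs \<eta>)) +
     (\<Sum>vs\<in>basis_lists (Suc p). 1 / fact p * (LINT t|lborel. ?o vs (t, \<eta>)))" for \<eta>
  proof -
    have "(LINT t|lborel. ?o vs (t, \<eta>)) = cis (x \<bullet> \<eta>) * fourier a \<eta> * (LINT t|lborel. complex_of_real (indicator {0..1} t * (1 - t) ^ p) *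
         (list_monomial vs \<eta> * iter_deriv vs q (\<xi> + t *\<^sub>R \<eta>)))" for vs
      unfolding integral_mult_right_zero[symmetric]
      by (rule Bochner_Integration.integral_cong) (simp_all add: osc_integrand_def mult_ac)
    then show ?thesis
      unfolding taylor_line[OF sq, of \<xi> \<eta> p] by (simp add: distrib_left sum_distrib_left mult_ac)
  qed
  then have "inv_fourier (\<lambda>\<eta>. fourier a \<eta> * q (\<xi> + \<eta>)) x = ?c * (LINT \<eta>|lborel.
     (\<Sum>j\<le>p. \<Sum>vs\<in>basis_lists j. (1 / fact j * iter_deriv vs q \<xi>) * (cis (x \<bullet> \<eta>) * ?\<beta> vs \<eta>)) +
     (\<Sum>vs\<in>basis_lists (Suc p). 1 / fact p * (LINT t|lborel. ?o vs (t, \<eta>))))"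
    unfolding inv_fourier_def by simp
  also have "(LINT \<eta>|lborel.
     (\<Sum>j\<le>p. \<Sum>vs\<in>basis_lists j. (1 / fact j * iter_deriv vs q \<xi>) * (cis (x \<bullet> \<eta>) * ?\<beta> vs \<eta>)) +
     (\<Sum>vs\<in>basis_lists (Suc p). 1 / fact p * (LINT t|lborel. ?o vs (t, \<eta>)))) =
     (LINT \<eta>|lborel. (\<Sum>j\<le>p. \<Sum>vs\<in>basis_lists j. (1 / fact j * iter_deriv vs q \<xi>) * (cis (x \<bullet> \<eta>) * ?\<beta> vs \<eta>))) +
     (LINT \<eta>|lborel. (\<Sum>vs\<in>basis_lists (Suc p). 1 / fact p * (LINT t|lborel. ?o vs (t, \<eta>))))"
    by (intro Bochner_Integration.integral_add Bochner_Integration.integrable_sum integrable_mult_right i1 fubini_pair(1) o)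
  also have "(LINT \<eta>|lborel. (\<Sum>j\<le>p. \<Sum>vs\<in>basis_lists j. (1 / fact j * iter_deriv vs q \<xi>) * (cis (x \<bullet> \<eta>) * ?\<beta> vs \<eta>))) =
     (\<Sum>j\<le>p. LINT \<eta>|lborel. (\<Sum>vs\<in>basis_lists j. (1 / fact j * iter_deriv vs q \<xi>) * (cis (x \<bullet> \<eta>) * ?\<beta> vs \<eta>)))"
    by (intro Bochner_Integration.integral_sum Bochner_Integration.integrable_sum integrable_mult_right i1)
  also have "\<dots> = (\<Sum>j\<le>p. \<Sum>vs\<in>basis_lists j. LINT \<eta>|lborel. (1 / fact j * iter_deriv vs q \<xi>) * (cis (x \<bullet> \<eta>) * ?\<beta> vs \<eta>))"
    by (intro sum.cong refl Bochner_Integration.integral_sum integrable_mult_right i1)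
  also have "(LINT \<eta>|lborel. (\<Sum>vs\<in>basis_lists (Suc p). 1 / fact p * (LINT t|lborel. ?o vs (t, \<eta>)))) =
    (\<Sum>vs\<in>basis_lists (Suc p). LINT \<eta>|lborel. 1 / fact p * (LINT t|lborel. ?o vs (t, \<eta>)))"
    by (intro Bochner_Integration.integral_sum integrable_mult_right fubini_pair(1) o)
  also have "\<dots> = (\<Sum>vs\<in>basis_lists (Suc p). 1 / fact p * osc_integral p (?\<beta> vs) (iter_deriv vs q) (x, \<xi>))"
    by (intro sum.cong refl) (simp add: osc_integral_def fubini_pair(2)[OF o])
  also have "(\<Sum>j\<le>p. \<Sum>vs\<in>basis_lists j. LINT \<eta>|lborel. (1 / fact j * iter_deriv vs q \<xi>) * (cis (x \<bullet> \<eta>) * ?\<beta> vs \<eta>)) =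
    (\<Sum>j\<le>p. \<Sum>vs\<in>basis_lists j. (1 / fact j * iter_deriv vs q \<xi>) * (LINT \<eta>|lborel. cis (x \<bullet> \<eta>) * ?\<beta> vs \<eta>))"
    by simp
  finally have "inv_fourier (\<lambda>\<eta>. fourier a \<eta> * q (\<xi> + \<eta>)) x =
     (\<Sum>j\<le>p. \<Sum>vs\<in>basis_lists j. (1 / fact j * iter_deriv vs q \<xi>) * inv_fourier (?\<beta> vs) x) +
     (\<Sum>vs\<in>basis_lists (Suc p). ?c * (1 / fact p) * osc_integral p (?\<beta> vs) (iter_deriv vs q) (x, \<xi>))"
    by (simp only: distrib_left sum_distrib_left inv_fourier_def mult_ac)
  also have "(\<Sum>j\<le>p. \<Sum>vs\<in>basis_lists j. (1 / fact j * iter_deriv vs q \<xi>) * inv_fourier (?\<beta> vs) x) =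
     (\<Sum>j\<le>p. 1 / fact j * (\<Sum>vs\<in>basis_lists j. ((- \<i>) ^ j * iter_deriv vs a x) * iter_deriv vs q \<xi>))"
  proof (rule sum.cong[OF refl])
    fix j
    have "(1 / fact j * iter_deriv vs q \<xi>) * inv_fourier (?\<beta> vs) x =
        1 / fact j * (((- \<i>) ^ j * iter_deriv vs a x) * iter_deriv vs q \<xi>)" if "vs \<in> basis_lists j" for vs
      using inv_fourier_list_monomial[OF a bl(1)[OF that]] bl(2)[OF that] by simp
    then show "(\<Sum>vs\<in>basis_lists j. (1 / fact j * iter_deriv vs q \<xi>) * inv_fourier (?\<beta> vs) x) =
       1 / fact j * (\<Sum>vs\<in>basis_lists j. ((- \<i>) ^ j * iter_deriv vs a x) * iter_deriv vs q \<xi>)"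
      unfolding sum_distrib_left by (rule sum.cong[OF refl])
  qed
  finally show ?thesis .
qed

text \<open>q0 is the exactly homogeneous model of \<open>fourier k\<close>. The terms of the
  expansion are built from q0; since the difference is rapidly decreasing, replacing one by the
  other in a Taylor term leaves an error of every order.\<close>

theorem classical_symbol_convolution:
  fixes a k q0 :: "'a::euclidean_space \<Rightarrow> complex"
  assumes a: "rapid a" and k: "integrable lborel k"
    and q0: "\<And>n. Sym n m q0" and kq: "rapid (\<lambda>\<xi>. fourier k \<xi> - q0 \<xi>)"
    and hom: "\<And>\<xi> t. norm \<xi> > 1 / 2 \<Longrightarrow> t \<ge> 1 \<Longrightarrow> q0 (t *\<^sub>R \<xi>) = complex_of_real (t powr m) * q0 \<xi>"
    and p: "\<And>x \<xi>. norm \<xi> \<ge> 1 \<Longrightarrow> p x \<xi> = a x * a x * q0 \<xi>"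
  shows "classical_symbol m p (\<lambda>(x, \<xi>). a x * fourier (\<lambda>z. a (x - z) * k z) \<xi>)"
proof -
  let ?q = "fourier k"
  let ?c = "\<lambda>(x, \<xi>). a x * fourier (\<lambda>z. a (x - z) * k z) \<xi>"
  have q: "Sym n m ?q" for n
    using Sym.add[OF q0 rapidD[OF kq], of n] by simp
  have sq: "smooth ?q" "smooth q0" unfolding smooth_iff_Ck using bounded_derivs_imp_Ck[OF q] bounded_derivs_imp_Ck[OF q0] by blast+
  have bl: "set vs \<subseteq> Basis" "length vs = j" if "vs \<in> basis_lists j" for vs :: "'a list" and j
    using that by (auto simp: basis_lists_def)
  have Sym_iter: "Sym n (m - real j) (iter_deriv vs r)" if r: "\<And>n. Sym n m r" and vs: "vs \<in> basis_lists j" for n vs j and r :: "'a \<Rightarrow> complex"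
  proof -
    have "sum_list (map norm vs) = sum_list (map (\<lambda>_. 1) vs)"
      by (rule arg_cong[where f = sum_list], rule map_cong) (use bl(1)[OF vs] in auto)
    also have "\<dots> = real j" unfolding sum_list_triv using bl(2)[OF vs] by simp
    finally show ?thesis using bounded_derivs_iter_deriv[OF r bl(1)[OF vs], of n] by simp
  qed
  define b where "b j vs x = a x * ((- \<i>) ^ j * iter_deriv vs a x)" for j vs x
  have b: "rapid (b j vs)" if "vs \<in> basis_lists j" for j vs
    unfolding b_def by (intro rapid_mult_Sym[OF rapidD[OF a, where m = 0]] rapid_cmult iter_deriv_rapid a bl(1)[OF that])
  define cs where "cs j z = 1 / fact j * (\<Sum>vs\<in>basis_lists j. b j vs (fst z) * iter_deriv vs q0 (snd z))" for j z
  have cs: "Sym2 n (m - real j) (cs j)" for n j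
  proof -
    have "Sym2 n (0 + (m - real j)) (\<lambda>z. b j vs (fst z) * iter_deriv vs q0 (snd z))" if "vs \<in> basis_lists j" for vs
      by (intro Sym2.mult Sym2_fst Sym2_snd b Sym_iter q0 that)
    then show ?thesis unfolding cs_def[abs_def] by (intro Sym2.cmult Sym2.sum) auto
  qed
  \<comment> \<open>A Taylor expansion to order P has P + 1 terms and a remainder with P + 1
    derivatives, so this covers all positive numbers of subtracted terms.\<close>
  have rem: "Sym2 n (m - real (Suc P)) (\<lambda>z. ?c z - (\<Sum>j<Suc P. cs j z))" for n P
  proof -
    let ?M = "m - real (Suc P)"
    let ?R = "\<lambda>z. (\<Sum>j\<le>P. 1 / fact j * (\<Sum>vs\<in>basis_lists j. b j vs (fst z) * iter_deriv vs (\<lambda>\<xi>. ?q \<xi> - q0 \<xi>) (snd z))) +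
      (\<Sum>vs\<in>basis_lists (Suc P). a (fst z) * (complex_of_real (1 / (2 * pi) ^ DIM('a)) * (1 / fact P) *
         osc_integral P (\<lambda>\<eta>. list_monomial vs \<eta> * fourier a \<eta>) (iter_deriv vs ?q) z))"
    have "?c z - (\<Sum>j<Suc P. cs j z) = ?R z" for z
    proof -
      obtain x \<xi> where z: "z = (x, \<xi>)" by force
      have "?c z = (\<Sum>j\<le>P. 1 / fact j * (\<Sum>vs\<in>basis_lists j. b j vs x * iter_deriv vs ?q \<xi>)) +
      (\<Sum>vs\<in>basis_lists (Suc P). a x * (complex_of_real (1 / (2 * pi) ^ DIM('a)) * (1 / fact P) *
         osc_integral P (\<lambda>\<eta>. list_monomial vs \<eta> * fourier a \<eta>) (iter_deriv vs ?q) (x, \<xi>)))"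
        unfolding z prod.case fourier_times_translate[OF a k] symbol_taylor[OF a q, of \<xi> x P] b_def
        by (simp only: distrib_left sum_distrib_left mult_ac)
      moreover have "(\<Sum>j<Suc P. cs j z) = (\<Sum>j\<le>P. 1 / fact j * (\<Sum>vs\<in>basis_lists j. b j vs x * iter_deriv vs q0 \<xi>))"
        unfolding lessThan_Suc_atMost z cs_def by simp
      moreover have "(\<Sum>j\<le>P. 1 / fact j * (\<Sum>vs\<in>basis_lists j. b j vs x * iter_deriv vs ?q \<xi>)) -
          (\<Sum>j\<le>P. 1 / fact j * (\<Sum>vs\<in>basis_lists j. b j vs x * iter_deriv vs q0 \<xi>)) =
          (\<Sum>j\<le>P. 1 / fact j * (\<Sum>vs\<in>basis_lists j. b j vs x * iter_deriv vs (\<lambda>\<xi>. ?q \<xi> - q0 \<xi>) \<xi>))"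
        unfolding sum_subtractf[symmetric] right_diff_distrib[symmetric]
        by (intro sum.cong refl arg_cong2[where f = "(*)"])
           (simp add: iter_deriv_diff[OF sq] bl right_diff_distrib)
      ultimately show ?thesis by (simp add: z)
    qed
    moreover have "Sym2 n ?M ?R"
    proof (rule Sym2.add)
      have "Sym2 n (0 + ?M) (\<lambda>z. b j vs (fst z) * iter_deriv vs (\<lambda>\<xi>. ?q \<xi> - q0 \<xi>) (snd z))"
        if "vs \<in> basis_lists j" for vs j
        by (intro Sym2.mult Sym2_fst Sym2_snd b that rapidD iter_deriv_rapid kq bl(1)[OF that])
      then show "Sym2 n ?M (\<lambda>z. \<Sum>j\<le>P. 1 / fact j * (\<Sum>vs\<in>basis_lists j. b j vs (fst z) * iter_deriv vs (\<lambda>\<xi>. ?q \<xi> - q0 \<xi>) (snd z)))"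
        by (intro Sym2.sum Sym2.cmult) auto
      have "Sym2 n (0 + ?M) (\<lambda>z. a (fst z) * (complex_of_real (1 / (2 * pi) ^ DIM('a)) * (1 / fact P) *
         osc_integral P (\<lambda>\<eta>. list_monomial vs \<eta> * fourier a \<eta>) (iter_deriv vs ?q) z))"
        if "vs \<in> basis_lists (Suc P)" for vs
        by (intro Sym2.mult Sym2_fst a Sym2.cmult Sym2_osc_integral rapid_list_monomial rapid_fourier Sym_iter q that)
      then show "Sym2 n ?M (\<lambda>z. \<Sum>vs\<in>basis_lists (Suc P). a (fst z) * (complex_of_real (1 / (2 * pi) ^ DIM('a)) * (1 / fact P) *
         osc_integral P (\<lambda>\<eta>. list_monomial vs \<eta> * fourier a \<eta>) (iter_deriv vs ?q) z))"
        by (intro Sym2.sum) auto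
    qed
    ultimately show ?thesis by presburger
  qed
  show ?thesis
    unfolding classical_symbol_def
  proof (intro exI[of _ cs] conjI allI impI)
    show "cs 0 (x, \<xi>) = p x \<xi>" if "1 \<le> norm \<xi>" for x \<xi>
      using p[OF that] by (simp add: cs_def basis_lists_0 b_def)
    show "cs j \<in> symbol_class (m - real j)" for j
      by (rule symbol_classI[OF cs])
    show "cs j (x, t *\<^sub>R \<xi>) = complex_of_real (t powr (m - real j)) * cs j (x, \<xi>)"
      if "1 \<le> norm \<xi>" "1 \<le> t" for j x \<xi> t
    proof -
      have "iter_deriv vs q0 (t *\<^sub>R \<xi>) = complex_of_real (t powr (m - real j)) * iter_deriv vs q0 \<xi>" if "vs \<in> basis_lists j" for vs
      proof -
        have "iter_deriv vs q0 (t *\<^sub>R \<xi>) = complex_of_real (t powr (m - real (length vs))) * iter_deriv vs q0 \<xi>"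
          by (rule homogeneous_iter_deriv[where r = "1 / 2"])
             (use sq(2) hom bl(1)[OF that] \<open>1 \<le> norm \<xi>\<close> \<open>1 \<le> t\<close> in auto)
        then show ?thesis using bl(2)[OF that] by simp
      qed
      then show ?thesis by (simp add: cs_def sum_distrib_left mult_ac)
    qed
    show "(\<lambda>z. ?c z - (\<Sum>j<N. cs j z)) \<in> symbol_class (m - real N)" for N
    proof (rule symbol_classI)
      show "Sym2 n (m - real N) (\<lambda>z. ?c z - (\<Sum>j<N. cs j z))" for n
      proof (cases N)
        \<comment> \<open>With no term subtracted, the bound of order m follows by adding the
          leading term back to the remainder of order m - 1.\<close>
        case 0
        have "Sym2 n m (\<lambda>z. (?c z - (\<Sum>j<Suc 0. cs j z)) + cs 0 z)"
          using Sym2.mono[OF rem[of n 0], of m] cs[of n 0] by (intro Sym2.add) auto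
        then show ?thesis using 0 by simp
      next
        case (Suc P)
        then show ?thesis using rem by blast
      qed
    qed
  qed
qed

text \<open>For fixed x the symbol is a(x) times the transform of z -> a (x - z) * k z. Exchanging
  integrals and inverting \<open>fourier \<psi>\<close> yields a convolution, and the reflection y =
  x - z brings it to kernel form.\<close>

lemma pdo_convolution:
  fixes a k \<psi> :: "'a::euclidean_space \<Rightarrow> complex"
  assumes a: "rapid a" and k: "integrable lborel k" and \<psi>: "rapid \<psi>"
  shows "pdo (\<lambda>(x, \<xi>). a x * fourier (\<lambda>z. a (x - z) * k z) \<xi>) \<psi> x =
    a x * (LINT y|lborel. k (x - y) * (a y * \<psi> y))"
proof -
  let ?c = "complex_of_real (1 / (2 * pi) ^ DIM('a))"
  let ?\<kappa> = "\<lambda>z. a (x - z) * k z"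
  note [measurable] = rapid_measurable[OF a] rapid_measurable[OF \<psi>] borel_measurable_integrable[OF k, simplified]
  obtain B where B: "B \<ge> 0" "\<And>x. norm (a x) \<le> B" using rapid_bounded[OF a] by blast
  have \<kappa>: "integrable lborel ?\<kappa>"
  proof (rule Bochner_Integration.integrable_bound)
    show "integrable lborel (\<lambda>z. B * norm (k z))" using k by auto
    show "AE z in lborel. norm (a (x - z) * k z) \<le> norm (B * norm (k z))"
      using B by (intro AE_I2) (auto simp: norm_mult abs_mult intro!: mult_right_mono)
  qed measurable
  have P: "integrable lborel (fourier \<psi>)" by (intro rapid_integrable rapid_fourier \<psi>)
  have "pdo (\<lambda>(x, \<xi>). a x * fourier (\<lambda>z. a (x - z) * k z) \<xi>) \<psi> x =
     a x * (?c * (LINT \<xi>|lborel. fourier \<psi> \<xi> * (LINT z|lborel. cis ((x - z) \<bullet> \<xi>) * ?\<kappa> z)))"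
  proof -
    have "cis (x \<bullet> \<xi>) * (a x * fourier ?\<kappa> \<xi> * fourier \<psi> \<xi>) = a x * (fourier \<psi> \<xi> * (LINT z|lborel. cis ((x - z) \<bullet> \<xi>) * ?\<kappa> z))" for \<xi>
    proof -
      have "cis (x \<bullet> \<xi>) * fourier ?\<kappa> \<xi> = (LINT z|lborel. cis (x \<bullet> \<xi>) * (cis (- (z \<bullet> \<xi>)) * ?\<kappa> z))"
        unfolding fourier_def by simp
      also have "\<dots> = (LINT z|lborel. cis ((x - z) \<bullet> \<xi>) * ?\<kappa> z)"
        by (rule Bochner_Integration.integral_cong[OF refl], simp only: mult.assoc[symmetric] cis_mult) (simp add: inner_diff_left)
      finally show ?thesis by (simp only: mult_ac)
    qed
    then show ?thesis
      unfolding pdo_def inv_fourier_def prod.case by (simp only: integral_mult_right_zero mult.left_commute[of _ "a x"])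
  qed
  also have "(LINT \<xi>|lborel. fourier \<psi> \<xi> * (LINT z|lborel. cis ((x - z) \<bullet> \<xi>) * ?\<kappa> z)) =
     (LINT z|lborel. (LINT \<xi>|lborel. cis ((x - z) \<bullet> \<xi>) * fourier \<psi> \<xi>) * ?\<kappa> z)"
    using fubini_mult[OF P \<kappa>, of "\<lambda>(\<xi>, z). cis ((x - z) \<bullet> \<xi>)" 1] by (simp add: split_beta')
  also have "?c * \<dots> = (LINT z|lborel. ?c * ((LINT \<xi>|lborel. cis ((x - z) \<bullet> \<xi>) * fourier \<psi> \<xi>) * ?\<kappa> z))"
    by simp
  also have "\<dots> = (LINT z|lborel. inv_fourier (fourier \<psi>) (x - z) * ?\<kappa> z)"
    by (simp add: inv_fourier_def mult.assoc)
  also have "\<dots> = (LINT z|lborel. k (x - (x - z)) * (a (x - z) * \<psi> (x - z)))"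
    by (simp add: fourier_inversion[OF \<psi>] mult_ac)
  also have "\<dots> = (LINT y|lborel. k (x - y) * (a y * \<psi> y))"
    by (rule lborel_integral_reflect[of "\<lambda>y. k (x - y) * (a y * \<psi> y)" x]) measurable
  finally show ?thesis .
qed

section \<open>The covariance form in frequency and in space\<close>

section \<open>Singular integrals\<close>

lemma gamma_tail_measurable [measurable]: "gamma_tail \<sigma> \<in> borel_measurable borel"
  unfolding gamma_tail_def[abs_def] by measurable

lemma gamma_head_measurable [measurable]: "gamma_head \<sigma> \<in> borel_measurable borel"
  unfolding gamma_head_def[abs_def] by measurable

text \<open>Polar coordinates are avoided: for b > 0 the power is, up to a factor, tail plus head
  with \<sigma> = b / 2. The tail is integrable by \<open>fourier_gamma_tail\<close>, whose
  condition is b < d here, and the head is continuous.\<close>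

lemma integrable_norm_powr_cball:
  assumes b: "b < real DIM('a)"
  shows "integrable lborel (\<lambda>x::'a::euclidean_space. indicator (cball 0 1) x * norm x powr (- b))"
proof (cases "b > 0")
  case True
  define \<sigma> where "\<sigma> = b / 2"
  have \<sigma>: "\<sigma> > 0" "real DIM('a) / 2 - \<sigma> > 0" using True b by (auto simp: \<sigma>_def)
  let ?t = "\<lambda>x::'a. gamma_tail \<sigma> ((norm x)\<^sup>2 / 4)" and ?h = "\<lambda>x::'a. gamma_head \<sigma> ((norm x)\<^sup>2 / 4)"
  have "integrable lborel (\<lambda>x. complex_of_real (?t x))"
    using fourier_gamma_tail(1)[OF \<sigma>(2), where 'a = 'a] by simp
  from integrable_Re[OF this] have t: "integrable lborel ?t" by simp
  have "integrable lborel (\<lambda>x. ?t x * indicator (cball 0 1) x)"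
    by (rule integrable_real_mult_indicator[OF _ t]) simp
  then have t': "integrable lborel (\<lambda>x. indicator (cball 0 1) x * ?t x)"
    by (simp only: mult.commute)
  have "isCont (gamma_head \<sigma>) r" for r
    using gamma_head_has_derivative[of \<sigma> r] \<sigma>(1) by (intro DERIV_isCont) auto
  then have "continuous_on UNIV (gamma_head \<sigma>)" by (simp add: continuous_at_imp_continuous_on)
  then have "continuous_on UNIV ?h"
    by (rule continuous_on_compose2) (auto intro!: continuous_intros)
  then have h: "integrable lborel (\<lambda>x. indicator (cball 0 1) x *\<^sub>R ?h x)"
    by (rule borel_integrable_compact[OF compact_cball continuous_on_subset[OF _ subset_UNIV]])
  have "integrable lborel (\<lambda>x. (1 / (Gamma \<sigma> * 4 powr \<sigma>)) * (indicator (cball 0 1) x * ?t x + indicator (cball 0 1) x *\<^sub>R ?h x))"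
    by (intro integrable_mult_right Bochner_Integration.integrable_add h t')
  moreover have "AE x in lborel. (1 / (Gamma \<sigma> * 4 powr \<sigma>)) * (indicator (cball 0 1) x * ?t x + indicator (cball 0 1) x *\<^sub>R ?h x)
     = indicator (cball 0 1) x * norm x powr (- b)"
    using AE_lborel_singleton[of "0::'a"]
  proof eventually_elim
    case (elim x)
    then have n: "norm x > 0" "(norm x)\<^sup>2 / 4 > 0" by auto
    have "((norm x)\<^sup>2 / 4) powr (- \<sigma>) = ((norm x)\<^sup>2) powr (- \<sigma>) / 4 powr (- \<sigma>)" by (rule powr_divide)
    also have "((norm x)\<^sup>2) powr (- \<sigma>) = norm x powr (- b)"
      using n(1) powr_powr[of "norm x" 2 "- \<sigma>"] by (simp add: \<sigma>_def)
    also have "norm x powr (- b) / 4 powr (- \<sigma>) = norm x powr (- b) * 4 powr \<sigma>" by (simp add: powr_minus field_simps)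
    finally have "?t x + ?h x = Gamma \<sigma> * 4 powr \<sigma> * norm x powr (- b)"
      using gamma_tail_plus_head_pos[OF \<sigma>(1) n(2)] by simp
    moreover have "Gamma \<sigma> > 0" using \<sigma>(1) by (rule Gamma_real_pos)
    ultimately show ?case by (simp add: indicator_def)
  qed
  moreover have "(\<lambda>x::'a. indicator (cball 0 1) x * norm x powr (- b)) \<in> borel_measurable lborel"
    by (intro borel_measurable_times borel_measurable_indicator) (simp, measurable)
  ultimately show ?thesis
    using integrable_cong_AE[OF borel_measurable_integrable] by blast
next
  case False
  have "integrable lborel (indicator (cball 0 1) :: 'a \<Rightarrow> real)"
    by (intro integrable_real_indicator) (use emeasure_bounded_finite[OF bounded_cball[of "0::'a" 1]] in auto)
  then show ?thesis
  proof (rule Bochner_Integration.integrable_bound)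
    show "AE x in lborel. norm (indicator (cball 0 1) x * norm (x::'a) powr (- b)) \<le> norm (indicator (cball 0 1) x :: real)"
      using False by (intro AE_I2) (auto simp: indicator_def powr_le1)
    show "(\<lambda>x::'a. indicator (cball 0 1) x * norm x powr (- b)) \<in> borel_measurable lborel"
      by (intro borel_measurable_times borel_measurable_indicator) (simp, measurable)
  qed
qed

lemma integrable_singular:
  fixes f :: "'a::euclidean_space \<Rightarrow> 'b::{banach, second_countable_topology}"
  assumes f: "f \<in> borel_measurable borel" and b: "b < real DIM('a)" and C: "C \<ge> 0"
    and near: "\<And>x. x \<noteq> 0 \<Longrightarrow> norm x \<le> 1 \<Longrightarrow> norm (f x) \<le> C * norm x powr (- b)"
    and far: "\<And>x. norm x \<ge> 1 \<Longrightarrow> norm (f x) \<le> C * (1 + norm x) powr (- real (2 * DIM('a)))"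
  shows "integrable lborel f"
proof (rule Bochner_Integration.integrable_bound)
  show "integrable lborel (\<lambda>x::'a. C * (indicator (cball 0 1) x * norm x powr (- b)) + C * (1 + norm x) powr (- real (2 * DIM('a))))"
    by (intro Bochner_Integration.integrable_add integrable_mult_right integrable_norm_powr_cball b integrable_weight)
  show "AE x in lborel. norm (f x) \<le> norm (C * (indicator (cball 0 1) x * norm x powr (- b)) + C * (1 + norm x) powr (- real (2 * DIM('a))))"
    using AE_lborel_singleton[of "0::'a"]
  proof eventually_elim
    case (elim x)
    have nn: "0 \<le> C * norm x powr (- b)" "0 \<le> C * (1 + norm x) powr (- real (2 * DIM('a)))" using C by auto
    show ?case
    proof (cases "norm x \<le> 1")
      case True
      then show ?thesis using near[OF elim True] nn by (simp add: indicator_def)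
    next
      case False
      then show ?thesis using far[of x] nn by (simp add: indicator_def)
    qed
  qed
qed (use f in simp)

text \<open>Doubling the radius does not change the integral of \<open>norm x powr (- DIM('a))\<close>.\<close>

lemma nn_integral_norm_powr_ball:
  assumes \<delta>: "0 < \<delta>" "\<delta> \<le> 1" and b: "b \<ge> real DIM('a)"
  shows "(\<integral>\<^sup>+x. ennreal (indicator (ball 0 \<delta>) x * norm (x::'a::euclidean_space) powr (- b)) \<partial>lborel) = \<infinity>"
proof -
  let ?d = "real DIM('a)"
  have [measurable]: "ball (0::'a) r \<in> sets borel" for r by simp
  define I where "I r = (\<integral>\<^sup>+x. ennreal (indicator (ball 0 r) x * norm (x::'a) powr (- ?d)) \<partial>lborel)" for r
  have scale: "I \<delta> = I (2 * \<delta>)"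
  proof -
    define f where "f x = ennreal (indicator (ball 0 \<delta>) x * norm x powr (- ?d))" for x :: 'a
    define T where "T x = 0 + (1/2) *\<^sub>R x" for x :: 'a
    define c where "c = ennreal (\<bar>1/2\<bar> ^ DIM('a))"
    have f[measurable]: "f \<in> borel_measurable borel" unfolding f_def[abs_def]
      by (intro measurable_compose[OF _ measurable_ennreal] borel_measurable_times borel_measurable_indicator) (simp, measurable)
    have T[measurable]: "T \<in> borel \<rightarrow>\<^sub>M borel" unfolding T_def[abs_def] by measurable
    have L: "(lborel :: 'a measure) = density (distr lborel borel T) (\<lambda>_. c)"
      unfolding T_def[abs_def] c_def by (rule lborel_affine) simp
    have "I \<delta> = integral\<^sup>N lborel f" by (simp add: I_def f_def[abs_def])
    also have "\<dots> = integral\<^sup>N (density (distr lborel borel T) (\<lambda>_. c)) f"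
      by (rule arg_cong[where f = "\<lambda>M. integral\<^sup>N M f"], rule L)
    also have "\<dots> = (\<integral>\<^sup>+x. c * f x \<partial>distr lborel borel T)"
      by (rule nn_integral_density) auto
    also have "\<dots> = (\<integral>\<^sup>+x. c * f (T x) \<partial>lborel)"
      by (rule nn_integral_distr) auto
    also have "\<dots> = I (2 * \<delta>)"
      unfolding I_def
    proof (rule nn_integral_cong)
      fix x :: 'a
      have "(1/2) ^ DIM('a) * (norm x / 2) powr (- ?d) = norm x powr (- ?d)"
      proof (cases "x = 0")
        case False
        have "(norm x / 2) powr (- ?d) = norm x powr (- ?d) * 2 powr ?d"
          by (subst powr_divide) (simp add: powr_minus field_simps)
        moreover have "(2::real) powr ?d = 2 ^ DIM('a)" by (simp add: powr_realpow)
        ultimately show ?thesis by (simp add: power_one_over)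
      qed simp
      then show "c * f (T x) = ennreal (indicator (ball 0 (2 * \<delta>)) x * norm x powr (- ?d))"
        unfolding c_def f_def T_def by (subst ennreal_mult[symmetric]) (auto simp: indicator_def mult.left_commute)
    qed
    finally show ?thesis .
  qed
  \<comment> \<open>If the integral were finite, its invariance under doubling the radius would make
    the shell contribute nothing; the shell would be a null set and the two balls would have equal
    volume.\<close>
  have "I \<delta> = \<infinity>"
  proof (rule ccontr)
    assume fin: "I \<delta> \<noteq> \<infinity>"
    define J where "J = (\<integral>\<^sup>+x. ennreal (indicator (ball 0 (2 * \<delta>) - ball 0 \<delta>) x * norm (x::'a) powr (- ?d)) \<partial>lborel)"
    have "I (2 * \<delta>) = I \<delta> + J"
      unfolding I_def J_def
      by (subst nn_integral_add[symmetric]) (use \<delta> in \<open>auto intro!: nn_integral_cong simp: indicator_def\<close>)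
    then have "J = 0" using scale fin by (simp add: ennreal_add_left_cancel[of "I \<delta>" 0 J, simplified])
    then have "AE x in lborel. ennreal (indicator (ball 0 (2 * \<delta>) - ball 0 \<delta>) x * norm (x::'a) powr (- ?d)) = 0"
      unfolding J_def by (subst (asm) nn_integral_0_iff_AE) auto
    then have "AE x::'a in lborel. x \<notin> ball 0 (2 * \<delta>) - ball 0 \<delta>"
      by eventually_elim (use \<delta> in \<open>auto simp: indicator_def split: if_splits\<close>)
    then have "emeasure lborel (ball 0 (2 * \<delta>) :: 'a set) \<le> emeasure lborel (ball 0 \<delta> :: 'a set)"
      by (intro emeasure_mono_AE) auto
    then have "unit_ball_vol ?d * (2 * \<delta>) ^ DIM('a) \<le> unit_ball_vol ?d * \<delta> ^ DIM('a)"
      using \<delta> by (simp add: emeasure_ball)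
    then have "(2 * \<delta>) ^ DIM('a) \<le> \<delta> ^ DIM('a)" by simp
    moreover have "\<delta> ^ DIM('a) < (2 * \<delta>) ^ DIM('a)" by (rule power_strict_mono) (use \<delta> in auto)
    ultimately show False by (meson not_le)
  qed
  moreover have "I \<delta> \<le> (\<integral>\<^sup>+x. ennreal (indicator (ball 0 \<delta>) x * norm (x::'a) powr (- b)) \<partial>lborel)"
    unfolding I_def
  proof (rule nn_integral_mono)
    fix x :: 'a
    have "norm x powr (- ?d) \<le> norm x powr (- b)" if "x \<in> ball 0 \<delta>"
      using that \<delta> b by (intro powr_mono') auto
    then show "ennreal (indicator (ball 0 \<delta>) x * norm x powr (- ?d)) \<le> ennreal (indicator (ball 0 \<delta>) x * norm x powr (- b))"
      by (auto simp: indicator_def intro: ennreal_leI)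
  qed
  ultimately show ?thesis by (simp add: top_unique)
qed

section \<open>The quadratic form of the Riesz kernel\<close>

text \<open>Integrates over t the Gaussian averages of U, separately for t \<ge> 1 and t < 1. The
  regularizing constant of the head contributes a multiple of the integral of U, which vanishes
  whenever the constant is present.\<close>

lemma gamma_superposition:
  fixes U :: "'x::euclidean_space \<Rightarrow> complex" and \<rho> :: "'x \<Rightarrow> real"
  assumes \<sigma>: "\<sigma> > - 1" and U: "integrable lborel U"
    and [measurable]: "\<rho> \<in> borel_measurable borel" and \<rho>0: "\<And>p. 0 \<le> \<rho> p" and pos: "AE p in lborel. 0 < \<rho> p"
    and T: "integrable lborel (\<lambda>p. U p * complex_of_real (gamma_tail \<sigma> (\<rho> p)))"
    and H: "integrable lborel (\<lambda>p. U p * complex_of_real (gamma_head \<sigma> (\<rho> p)))"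
    and zero: "\<sigma> \<le> 0 \<Longrightarrow> (LINT p|lborel. U p) = 0"
  shows "has_bochner_integral lborel
    (\<lambda>t. complex_of_real (indicator {0<..} t * t powr (\<sigma> - 1)) * (LINT p|lborel. U p * complex_of_real (exp (- t * \<rho> p))))
    (LINT p|lborel. U p * complex_of_real (gamma_tail \<sigma> (\<rho> p) + gamma_head \<sigma> (\<rho> p)))"
proof -
  have Um[measurable]: "U \<in> borel_measurable borel" using borel_measurable_integrable[OF U] by simp
  define c :: real where "c = (if \<sigma> \<le> 0 then 1 else 0)"
  let ?T = "\<lambda>t p. indicator {1..} t * (t powr (\<sigma> - 1) * exp (- t * \<rho> p))"
  let ?H = "\<lambda>t p. indicator {0<..<1} t * (t powr (\<sigma> - 1) * (exp (- t * \<rho> p) - c))"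
  let ?S = "\<lambda>t. LINT p|lborel. U p * complex_of_real (exp (- t * \<rho> p))"
  have gH: "gamma_head \<sigma> (\<rho> p) = (LINT t|lborel. ?H t p)" for p by (simp add: gamma_head_def c_def)
  \<comment> \<open>F has a constant sign e, so its absolute t-integral is its t-integral up to
    sign, and the absolute integrability demanded by Fubini's theorem reduces to assumption
    \<open>n\<close>.\<close>
  have fub: "has_bochner_integral lborel (\<lambda>t. LINT p|lborel. complex_of_real (F t p) * U p) (LINT p|lborel. U p * complex_of_real (LINT t|lborel. F t p))"
    if m: "(\<lambda>(p, t). F t p) \<in> borel_measurable (borel \<Otimes>\<^sub>M borel)" and i: "AE p in lborel. integrable lborel (\<lambda>t. F t p)"
      and sgn: "\<And>t p. \<bar>F t p\<bar> = e * F t p"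
      and n: "integrable lborel (\<lambda>p. U p * complex_of_real (LINT t|lborel. F t p))" for F :: "real \<Rightarrow> 'x \<Rightarrow> real" and e
  proof -
    let ?f = "\<lambda>(p, t). complex_of_real (F t p) * U p"
    have [measurable]: "(\<lambda>(p, t). F t p) \<in> borel_measurable (lborel \<Otimes>\<^sub>M lborel)"
      using m by (subst measurable_cong_sets[OF sets_pair_measure_cong[OF sets_lborel sets_lborel] refl])
    have int: "integrable (lborel \<Otimes>\<^sub>M lborel) ?f"
    proof (rule lborel_pair.Fubini_integrable)
      show "?f \<in> borel_measurable (lborel \<Otimes>\<^sub>M lborel)"
      proof -
        have "(\<lambda>u. complex_of_real ((\<lambda>(p, t). F t p) u) * U (fst u)) \<in> borel_measurable (lborel \<Otimes>\<^sub>M lborel)" by measurable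
        then show ?thesis by (simp add: split_beta')
      qed
      show "AE p in lborel. integrable lborel (\<lambda>t. ?f (p, t))"
        using i by eventually_elim (simp add: integrable_of_real)
      have "(LINT t|lborel. norm (?f (p, t))) = norm (U p) * (e * (LINT t|lborel. F t p))" for p
        by (simp add: norm_mult sgn)
      moreover have "norm (U p) * (e * (LINT t|lborel. F t p)) = norm (U p * complex_of_real (LINT t|lborel. F t p))" for p
      proof -
        have "e * (LINT t|lborel. F t p) = (LINT t|lborel. \<bar>F t p\<bar>)" by (simp add: sgn)
        moreover have "(LINT t|lborel. \<bar>F t p\<bar>) = \<bar>LINT t|lborel. F t p\<bar>"
        proof -
          have "0 \<le> (LINT t|lborel. \<bar>F t p\<bar>)" by simp
          then have *: "0 \<le> e * (LINT t|lborel. F t p)" by (simp add: sgn)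
          have "e * F t p \<ge> 0" "\<bar>e * F t p\<bar> = \<bar>e\<bar> * \<bar>F t p\<bar>" for t using sgn[of t p] by (auto simp: abs_mult)
          then have "\<bar>F t p\<bar> = \<bar>e\<bar> * \<bar>F t p\<bar>" for t using sgn[of t p] by simp
          then have "\<bar>e\<bar> = 1 \<or> (\<forall>t. F t p = 0)" by (metis abs_0_eq mult_cancel_right1 mult.commute)
          then show ?thesis
          proof
            assume "\<bar>e\<bar> = 1"
            then have "\<bar>LINT t|lborel. F t p\<bar> = \<bar>e * (LINT t|lborel. F t p)\<bar>" by (simp add: abs_mult)
            also have "\<dots> = (LINT t|lborel. \<bar>F t p\<bar>)" using * by (simp add: sgn)
            finally show ?thesis ..
          qed simp
        qed
        ultimately show ?thesis by (simp add: norm_mult)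
      qed
      ultimately show "integrable lborel (\<lambda>p. LINT t|lborel. norm (?f (p, t)))"
        using integrable_norm[OF n] by simp
    qed
    have inner: "(LINT t|lborel. ?f (p, t)) = U p * complex_of_real (LINT t|lborel. F t p)" for p
      by (simp add: mult.commute)
    have "(LINT t|lborel. LINT p|lborel. ?f (p, t)) = (LINT p|lborel. LINT t|lborel. ?f (p, t))"
      by (rule trans[OF fubini_pair(2)[OF int] lborel_pair.integral_fst'[OF int, symmetric]])
    then have "(LINT t|lborel. LINT p|lborel. complex_of_real (F t p) * U p) = (LINT p|lborel. U p * complex_of_real (LINT t|lborel. F t p))"
      unfolding inner by simp
    then show ?thesis using fubini_pair(1)[OF int] by (simp add: has_bochner_integral_iff)
  qed
  have 1: "has_bochner_integral lborel (\<lambda>t. LINT p|lborel. complex_of_real (?T t p) * U p) (LINT p|lborel. U p * complex_of_real (gamma_tail \<sigma> (\<rho> p)))"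
    unfolding gamma_tail_def
  proof (rule fub[where e = 1 and F = ?T])
    show "AE p in lborel. integrable lborel (\<lambda>t. ?T t p)"
      using pos by eventually_elim (rule integrable_gamma_tail)
  qed (use T in \<open>auto simp: gamma_tail_def indicator_def\<close>)
  have 2: "has_bochner_integral lborel (\<lambda>t. LINT p|lborel. complex_of_real (?H t p) * U p) (LINT p|lborel. U p * complex_of_real (gamma_head \<sigma> (\<rho> p)))"
    unfolding gH
  \<comment> \<open>For \<sigma> \<le> 0 the regularized integrand exp (- t * \<rho> p) - 1 is
    nonpositive, otherwise the integrand is nonnegative.\<close>
  proof (rule fub[where e = "if \<sigma> \<le> 0 then - 1 else 1" and F = ?H])
    show "AE p in lborel. integrable lborel (\<lambda>t. ?H t p)"
      using integrable_gamma_head[OF \<sigma>] by (simp add: c_def)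
    have "exp (- t * \<rho> p) \<le> 1" if "t > 0" for t p using that \<rho>0[of p] by simp
    then show "\<bar>?H t p\<bar> = (if \<sigma> \<le> 0 then - 1 else 1) * ?H t p" for t p
      by (auto simp: indicator_def c_def abs_mult)
  qed (use H in \<open>auto simp: gH\<close>)
  have Ue: "integrable lborel (\<lambda>p. U p * complex_of_real (exp (- t * \<rho> p)))" if "t > 0" for t
  proof (rule Bochner_Integration.integrable_bound[OF U])
    have "exp (- t * \<rho> p) \<le> 1" for p using that \<rho>0[of p] by simp
    then show "AE p in lborel. norm (U p * complex_of_real (exp (- t * \<rho> p))) \<le> norm (U p)"
      by (intro AE_I2) (auto simp: norm_mult intro: mult_right_le_one_le)
  qed simp
  have "(LINT p|lborel. complex_of_real (?T t p) * U p) + (LINT p|lborel. complex_of_real (?H t p) * U p)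
     = complex_of_real (indicator {0<..} t * t powr (\<sigma> - 1)) * ?S t" for t
  proof -
    consider "t \<ge> 1" | "0 < t" "t < 1" | "t \<le> 0" by linarith
    then show ?thesis
    proof cases
      case 1
      have "(LINT p|lborel. complex_of_real (?T t p) * U p) = (LINT p|lborel. complex_of_real (t powr (\<sigma> - 1)) * (U p * complex_of_real (exp (- t * \<rho> p))))"
        using 1 by (simp add: mult_ac)
      then show ?thesis using 1 by simp
    next
      case 2
      have "(LINT p|lborel. complex_of_real (?H t p) * U p) = (LINT p|lborel. complex_of_real (t powr (\<sigma> - 1)) * (U p * complex_of_real (exp (- t * \<rho> p)) - complex_of_real c * U p))"
        using 2 by (simp add: algebra_simps)
      also have "\<dots> = complex_of_real (t powr (\<sigma> - 1)) * (LINT p|lborel. U p * complex_of_real (exp (- t * \<rho> p)) - complex_of_real c * U p)"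
        by (rule integral_mult_right_zero)
      also have "(LINT p|lborel. U p * complex_of_real (exp (- t * \<rho> p)) - complex_of_real c * U p) = ?S t - complex_of_real c * (LINT p|lborel. U p)"
        using Ue[OF 2(1)] U by (subst Bochner_Integration.integral_diff) auto
      also have "complex_of_real c * (LINT p|lborel. U p) = 0" using zero by (simp add: c_def)
      finally show ?thesis using 2 by simp
    qed simp
  qed
  moreover have "(LINT p|lborel. U p * complex_of_real (gamma_tail \<sigma> (\<rho> p))) + (LINT p|lborel. U p * complex_of_real (gamma_head \<sigma> (\<rho> p)))
     = (LINT p|lborel. U p * complex_of_real (gamma_tail \<sigma> (\<rho> p) + gamma_head \<sigma> (\<rho> p)))"
    by (subst Bochner_Integration.integral_add[OF T H, symmetric]) (simp add: distrib_left)
  ultimately show ?thesis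
    using has_bochner_integral_add[OF 1 2] by simp
qed

text \<open>Parseval's identity damped in frequency by a Gaussian of parameter t; on the other side
  stands the heat kernel, written as a Gaussian of parameter 1 / t in (norm (x - y))^2 / 4 to match
  the superposition of the kernel.\<close>

lemma gaussian_parseval:
  fixes u v :: "'a::euclidean_space \<Rightarrow> complex"
  assumes u: "integrable lborel u" and v: "integrable lborel v" and t: "t > 0"
    and F: "integrable lborel (fourier u)"
  shows "(LINT \<xi>|lborel. fourier u \<xi> * cnj (fourier v \<xi>) * complex_of_real (exp (- t * (norm \<xi>)\<^sup>2))) =
    complex_of_real ((2 * pi) ^ DIM('a) * (4 * pi * t) powr (- real DIM('a) / 2)) *
    (LINT x|lborel. LINT y|lborel. u y * cnj (v x) * complex_of_real (exp (- (1 / t) * ((norm (x - y))\<^sup>2 / 4))))"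
proof -
  let ?g = "\<lambda>\<xi>. complex_of_real (exp (- t * (norm \<xi>)\<^sup>2)) * fourier u \<xi>"
  let ?C = "complex_of_real ((2 * pi) ^ DIM('a))"
  have um[measurable]: "fourier u \<in> borel_measurable borel" by (rule fourier_measurable[OF u])
  have g: "integrable lborel ?g"
    by (rule Bochner_Integration.integrable_bound[OF F])
       (use t in \<open>auto simp: norm_mult intro!: mult_left_le_one_le\<close>)
  have vc: "integrable lborel (\<lambda>x. cnj (v x))" using v by simp
  have cF: "cnj (fourier v \<xi>) = (LINT x|lborel. cis (x \<bullet> \<xi>) * cnj (v x))" for \<xi>
  proof -
    have "cnj (fourier v \<xi>) = (LINT x|lborel. cnj (cis (- (x \<bullet> \<xi>)) * v x))"
      unfolding fourier_def by (rule Bochner_Integration.integral_cnj[symmetric])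
    then show ?thesis by (simp add: cis_cnj del: Bochner_Integration.integral_cnj)
  qed
  have "fourier u \<xi> * cnj (fourier v \<xi>) * complex_of_real (exp (- t * (norm \<xi>)\<^sup>2)) = ?g \<xi> * (LINT x|lborel. cis (x \<bullet> \<xi>) * cnj (v x))" for \<xi>
    unfolding cF by (simp only: mult_ac)
  then have "(LINT \<xi>|lborel. fourier u \<xi> * cnj (fourier v \<xi>) * complex_of_real (exp (- t * (norm \<xi>)\<^sup>2))) =
     (LINT \<xi>|lborel. ?g \<xi> * (LINT x|lborel. cis (x \<bullet> \<xi>) * cnj (v x)))" by (simp only:)
  also have "\<dots> = (LINT x|lborel. (LINT \<xi>|lborel. cis (x \<bullet> \<xi>) * ?g \<xi>) * cnj (v x))"
    using fubini_mult[OF g vc, of "\<lambda>(\<xi>, x). cis (x \<bullet> \<xi>)" 1] by (simp add: split_beta')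
  also have "\<dots> = (LINT x|lborel. ?C * complex_of_real ((4 * pi * t) powr (- real DIM('a) / 2)) *
     (LINT y|lborel. u y * cnj (v x) * complex_of_real (exp (- (1 / t) * ((norm (x - y))\<^sup>2 / 4)))))"
  proof (rule Bochner_Integration.integral_cong[OF refl])
    fix x
    let ?k = "(4 * pi * t) powr (- real DIM('a) / 2)"
    have "(LINT y|lborel. complex_of_real (?k * exp (- (norm (x - y))\<^sup>2 / (4 * t))) * u y) * cnj (v x) =
        (LINT y|lborel. complex_of_real ?k * (u y * cnj (v x) * complex_of_real (exp (- (1 / t) * ((norm (x - y))\<^sup>2 / 4)))))"
      unfolding integral_mult_left_zero[symmetric]
      by (rule Bochner_Integration.integral_cong[OF refl]) (simp add: mult_ac)
    also have "\<dots> = complex_of_real ?k * (LINT y|lborel. u y * cnj (v x) * complex_of_real (exp (- (1 / t) * ((norm (x - y))\<^sup>2 / 4))))"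
      by (rule integral_mult_right_zero)
    finally show "(LINT \<xi>|lborel. cis (x \<bullet> \<xi>) * ?g \<xi>) * cnj (v x) = ?C * complex_of_real ?k *
     (LINT y|lborel. u y * cnj (v x) * complex_of_real (exp (- (1 / t) * ((norm (x - y))\<^sup>2 / 4))))"
      using gaussian_regularization[OF u t, of x] by (simp only: mult.assoc)
  qed
  finally show ?thesis by simp
qed

lemma measurable_cnj [measurable]: "cnj \<in> borel_measurable borel"
  by (intro borel_measurable_continuous_onI continuous_intros)

lemma kernel_pair_integrable:
  fixes \<kappa> u v :: "'a::euclidean_space \<Rightarrow> complex"
  assumes \<kappa>: "integrable lborel \<kappa>" and u[measurable]: "u \<in> borel_measurable borel" and B: "\<And>x. norm (u x) \<le> B"
    and v: "integrable lborel v"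
  shows "integrable (lborel \<Otimes>\<^sub>M lborel) (\<lambda>(x, y). \<kappa> (x - y) * (u y * v x))"
proof (rule lborel_pair.Fubini_integrable)
  have [measurable]: "\<kappa> \<in> borel_measurable borel" "v \<in> borel_measurable borel"
    using borel_measurable_integrable[OF \<kappa>] borel_measurable_integrable[OF v] by simp_all
  show "(\<lambda>(x, y). \<kappa> (x - y) * (u y * v x)) \<in> borel_measurable (lborel \<Otimes>\<^sub>M lborel)"
    by measurable
  have B0: "B \<ge> 0" using order.trans[OF norm_ge_zero B] by blast
  have \<kappa>x: "integrable lborel (\<lambda>y. \<kappa> (x - y))" for x
    by (rule lborel_integrable_reflect[OF \<kappa>])
  have le: "norm (\<kappa> (x - y) * (u y * v x)) \<le> B * norm (v x) * norm (\<kappa> (x - y))" for x y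
  proof -
    have "norm (\<kappa> (x - y)) * (norm (u y) * norm (v x)) \<le> norm (\<kappa> (x - y)) * (B * norm (v x))"
      by (intro mult_left_mono mult_right_mono B) auto
    then show ?thesis by (simp add: norm_mult mult_ac)
  qed
  have int: "integrable lborel (\<lambda>y. \<kappa> (x - y) * (u y * v x))" for x
  proof (rule Bochner_Integration.integrable_bound)
    show "integrable lborel (\<lambda>y. B * norm (v x) * norm (\<kappa> (x - y)))"
      by (intro integrable_mult_right integrable_norm \<kappa>x)
    show "AE y in lborel. norm (\<kappa> (x - y) * (u y * v x)) \<le> norm (B * norm (v x) * norm (\<kappa> (x - y)))"
      by (intro AE_I2 order.trans[OF le]) simp
  qed measurable
  then show "AE x in lborel. integrable lborel (\<lambda>y. case (x, y) of (x, y) \<Rightarrow> \<kappa> (x - y) * (u y * v x))" by simp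
  show "integrable lborel (\<lambda>x. LINT y|lborel. norm (case (x, y) of (x, y) \<Rightarrow> \<kappa> (x - y) * (u y * v x)))"
  proof (rule Bochner_Integration.integrable_bound)
    show "integrable lborel (\<lambda>x. B * (LINT z|lborel. norm (\<kappa> z)) * norm (v x))"
      by (intro integrable_mult_right integrable_norm v)
    show "AE x in lborel. norm (LINT y|lborel. norm (case (x, y) of (x, y) \<Rightarrow> \<kappa> (x - y) * (u y * v x)))
        \<le> norm (B * (LINT z|lborel. norm (\<kappa> z)) * norm (v x))"
    proof (rule AE_I2)
      fix x
      have "(LINT y|lborel. norm (\<kappa> (x - y) * (u y * v x))) \<le> (LINT y|lborel. B * norm (v x) * norm (\<kappa> (x - y)))"
        by (intro integral_mono integrable_norm int integrable_mult_right \<kappa>x le)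
      also have "\<dots> = B * norm (v x) * (LINT y|lborel. norm (\<kappa> (x - y)))"
        by (rule integral_mult_right_zero)
      also have "(LINT y|lborel. norm (\<kappa> (x - y))) = (LINT z|lborel. norm (\<kappa> z))"
        by (rule lborel_integral_reflect) measurable
      finally show "norm (LINT y|lborel. norm (case (x, y) of (x, y) \<Rightarrow> \<kappa> (x - y) * (u y * v x)))
        \<le> norm (B * (LINT z|lborel. norm (\<kappa> z)) * norm (v x))"
        using B0 by (simp add: mult_ac)
    qed
  qed measurable
qed

lemma gamma_head_nonneg: "\<sigma> > 0 \<Longrightarrow> 0 \<le> gamma_head \<sigma> r"
  unfolding gamma_head_def by (intro integral_nonneg_AE AE_I2) (auto simp: indicator_def)

text \<open>The diagonal is a null set: the Gaussian representation of the kernel, valid only off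
  the diagonal, then holds almost everywhere for pairs.\<close>

lemma AE_fst_neq_snd: "AE p in lborel. fst p \<noteq> (snd p :: 'a::euclidean_space)"
proof -
  have "AE p in lborel \<Otimes>\<^sub>M lborel. fst p \<noteq> (snd p :: 'a)"
  proof (rule lborel_pair.AE_pair_measure)
    have "{p. fst p \<noteq> (snd p :: 'a)} = (\<lambda>p. fst p - snd p) -` (- {0})" by auto
    moreover have "open ((\<lambda>p::'a \<times> 'a. fst p - snd p) -` (- {0}))"
      by (intro open_vimage continuous_intros)
    ultimately have "{p. fst p \<noteq> (snd p :: 'a)} \<in> sets borel" by simp
    then show "{p \<in> space (lborel \<Otimes>\<^sub>M lborel). fst p \<noteq> (snd p :: 'a)} \<in> sets (lborel \<Otimes>\<^sub>M lborel)"
      unfolding lborel_prod by simp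
    show "AE x in lborel. AE y in lborel. fst (x, y) \<noteq> (snd (x, y) :: 'a)"
    proof (rule AE_I2)
      fix x :: 'a
      show "AE y in lborel. fst (x, y) \<noteq> (snd (x, y) :: 'a)"
        using AE_lborel_singleton[of x] by eventually_elim auto
    qed
  qed
  then show ?thesis unfolding lborel_prod .
qed

text \<open>Both quadratic forms are integrals over t of Gaussian averages, \<open>Bt\<close> in
  space and \<open>D\<close> in frequency. The damped Parseval identity relates \<open>D\<close> at
  1 / t to \<open>Bt\<close> at t, and the substitution t -> 1 / t matches the two
  integrals.\<close>

lemma riesz_form:
  fixes u v :: "real ^ 'd \<Rightarrow> complex"
  assumes s: "0 < s" "s < real CARD('d) / 2 + 1"
    and u: "rapid u" and v: "rapid v" and uR: "\<And>x. norm x > R \<Longrightarrow> u x = 0" and vR: "\<And>x. norm x > R \<Longrightarrow> v x = 0"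
    and zero: "real CARD('d) / 2 \<le> s \<Longrightarrow> (LINT x|lborel. u x) = 0"
    and G: "integrable lborel (\<lambda>\<xi>. fourier u \<xi> * cnj (fourier v \<xi>) * complex_of_real (norm \<xi> powr (- 2 * s)))"
  shows "integrable (lborel \<Otimes>\<^sub>M lborel) (\<lambda>(x, y). complex_of_real (fgf_kernel s x y) * (u y * cnj (v x)))" (is ?int)
    and "Re (LINT \<xi>|lborel. fourier u \<xi> * cnj (fourier v \<xi>) * complex_of_real (norm \<xi> powr (- 2 * s))) =
     (2 * pi) ^ CARD('d) * Re (LINT p|(lborel \<Otimes>\<^sub>M lborel). complex_of_real (fgf_kernel s (fst p) (snd p)) * (u (snd p) * cnj (v (fst p))))" (is ?eq)
proof -
  let ?d = "real CARD('d)"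
  define \<sigma> where "\<sigma> = ?d / 2 - s"
  define A where "A = riesz_const TYPE('d) s"
  have \<sigma>: "\<sigma> > - 1" using s by (simp add: \<sigma>_def)
  have Gs: "Gamma s > 0" using s(1) by (rule Gamma_real_pos)
  obtain c where c: "s < ?d / 2 \<longrightarrow> c = 0" "\<And>x y :: real ^ 'd. x \<noteq> y \<Longrightarrow> fgf_kernel s x y =
    A * (gamma_tail \<sigma> ((norm (x - y))\<^sup>2 / 4) + gamma_head \<sigma> ((norm (x - y))\<^sup>2 / 4)) + c"
    using fgf_kernel_eq_gamma[OF s] unfolding \<sigma>_def A_def by blast
  note [measurable] = rapid_measurable[OF u] rapid_measurable[OF v]
  have vc: "integrable lborel (\<lambda>x. cnj (v x))" using rapid_integrable[OF v] by simp
  define U where "U p = u (snd p) * cnj (v (fst p))" for p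
  define \<rho> where "\<rho> p = (norm (fst p - snd p :: real ^ 'd))\<^sup>2 / 4" for p
  have [measurable]: "\<rho> \<in> borel_measurable borel" unfolding \<rho>_def[abs_def] borel_prod[symmetric] by measurable
  have \<rho>_pos: "AE p in lborel. 0 < \<rho> p"
    using AE_fst_neq_snd by eventually_elim (simp add: \<rho>_def)
  have U: "integrable lborel U"
  proof -
    have "integrable (lborel \<Otimes>\<^sub>M lborel) (\<lambda>(x, y). 1 * (cnj (v x) * u y))"
      by (rule integrable_pair_mult[OF vc rapid_integrable[OF u], where B = 1 and k = "\<lambda>_. 1"]) auto
    then show ?thesis by (simp add: U_def[abs_def] split_beta' lborel_prod mult.commute)
  qed
  have Um[measurable]: "U \<in> borel_measurable borel" using borel_measurable_integrable[OF U] by simp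
  have T: "integrable lborel (\<lambda>p. U p * complex_of_real (gamma_tail \<sigma> (\<rho> p)))"
  proof -
    obtain B where "\<And>x. norm (u x) \<le> B" using rapid_bounded[OF u] by blast
    moreover have "integrable lborel (\<lambda>z :: real ^ 'd. complex_of_real (gamma_tail \<sigma> ((norm z)\<^sup>2 / 4)))"
      using fourier_gamma_tail(1)[OF s(1), where 'a = "real ^ 'd"] by (simp add: \<sigma>_def)
    ultimately have "integrable (lborel \<Otimes>\<^sub>M lborel) (\<lambda>(x, y). complex_of_real (gamma_tail \<sigma> ((norm (x - y))\<^sup>2 / 4)) * (u y * cnj (v x)))"
      by (intro kernel_pair_integrable[where \<kappa> = "\<lambda>z. complex_of_real (gamma_tail \<sigma> ((norm z)\<^sup>2 / 4))"] vc) auto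
    then show ?thesis by (simp add: U_def \<rho>_def split_beta' lborel_prod mult.commute)
  qed
  \<comment> \<open>The supports confine both points to the ball of radius R, where \<rho> p \<le>
    (2 * R)^2 / 4 = R^2; on that interval the continuous head is bounded.\<close>
  have H: "integrable lborel (\<lambda>p. U p * complex_of_real (gamma_head \<sigma> (\<rho> p)))"
  proof -
    have "isCont (gamma_head \<sigma>) r" for r
      using gamma_head_has_derivative[OF \<sigma>, of r] by (rule DERIV_isCont)
    then have "continuous_on {0..R\<^sup>2} (gamma_head \<sigma>)" by (simp add: continuous_at_imp_continuous_on)
    then have "bounded (gamma_head \<sigma> ` {0..R\<^sup>2})" by (intro compact_imp_bounded compact_continuous_image) auto
    then obtain C where C: "\<forall>r\<in>{0..R\<^sup>2}. norm (gamma_head \<sigma> r) \<le> C" unfolding bounded_iff by blast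
    show ?thesis
    proof (rule Bochner_Integration.integrable_bound)
      show "integrable lborel (\<lambda>p. C * norm (U p))" using U by simp
      show "AE p in lborel. norm (U p * complex_of_real (gamma_head \<sigma> (\<rho> p))) \<le> norm (C * norm (U p))"
      proof (rule AE_I2)
        fix p
        show "norm (U p * complex_of_real (gamma_head \<sigma> (\<rho> p))) \<le> norm (C * norm (U p))"
        proof (cases "norm (fst p) \<le> R \<and> norm (snd p) \<le> R")
          case True
          have "norm (fst p - snd p) \<le> 2 * R" using True norm_triangle_ineq4[of "fst p" "snd p"] by linarith
          then have "(norm (fst p - snd p))\<^sup>2 \<le> (2 * R)\<^sup>2" by (intro power_mono) auto
          then have "\<rho> p \<in> {0..R\<^sup>2}" by (simp add: \<rho>_def power_mult_distrib)
          then have "\<bar>gamma_head \<sigma> (\<rho> p)\<bar> \<le> \<bar>C\<bar>" using C by force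
          then show ?thesis by (simp add: norm_mult abs_mult mult.commute[of "\<bar>C\<bar>"] mult_left_mono)
        next
          case False
          then have "U p = 0" using uR[of "snd p"] vR[of "fst p"] by (auto simp: U_def)
          then show ?thesis by simp
        qed
      qed
    qed measurable
  qed
  have U0: "(LINT p|lborel. U p) = 0" if "?d / 2 \<le> s"
  proof -
    have "integrable (lborel \<Otimes>\<^sub>M lborel) U" using U by (simp add: lborel_prod)
    from lborel_pair.integral_fst'[OF this]
    have "(LINT p|lborel. U p) = (LINT x|lborel. LINT y|lborel. u y * cnj (v x))"
      by (simp add: U_def[abs_def] lborel_prod)
    then show ?thesis using zero[OF that] by simp
  qed
  define Bt where "Bt t = (LINT p|lborel. U p * complex_of_real (exp (- t * \<rho> p)))" for t
  define I1 where "I1 = (LINT p|lborel. U p * complex_of_real (gamma_tail \<sigma> (\<rho> p) + gamma_head \<sigma> (\<rho> p)))"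
  have S1: "has_bochner_integral lborel (\<lambda>t. complex_of_real (indicator {0<..} t * t powr (\<sigma> - 1)) * Bt t) I1"
    unfolding Bt_def I1_def
  proof (rule gamma_superposition[OF \<sigma> U _ _ \<rho>_pos T H])
    show "0 \<le> \<rho> p" for p by (simp add: \<rho>_def)
    show "\<sigma> \<le> 0 \<Longrightarrow> (LINT p|lborel. U p) = 0" by (rule U0) (simp add: \<sigma>_def)
  qed measurable
  define V where "V \<xi> = fourier u \<xi> * cnj (fourier v \<xi>)" for \<xi>
  have Fu: "rapid (fourier u)" "rapid (fourier v)" by (intro rapid_fourier u v)+
  note [measurable] = rapid_measurable[OF Fu(1)] rapid_measurable[OF Fu(2)]
  have Vm[measurable]: "V \<in> borel_measurable borel" unfolding V_def[abs_def] by measurable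
  obtain Cv where Cv: "Cv \<ge> 0" "\<And>\<xi>. norm (fourier v \<xi>) \<le> Cv" using rapid_bounded[OF Fu(2)] by blast
  have V: "integrable lborel V"
  proof (rule Bochner_Integration.integrable_bound)
    show "integrable lborel (\<lambda>\<xi>. Cv * norm (fourier u \<xi>))" using rapid_integrable[OF Fu(1)] by simp
    show "AE \<xi> in lborel. norm (V \<xi>) \<le> norm (Cv * norm (fourier u \<xi>))"
      using Cv by (intro AE_I2) (auto simp: V_def norm_mult abs_mult mult.commute[of Cv] intro!: mult_left_mono)
  qed measurable
  have n0: "AE \<xi> :: real ^ 'd in lborel. 0 < (norm \<xi>)\<^sup>2"
    using AE_lborel_singleton[of 0] by eventually_elim simp
  have gs: "gamma_tail s ((norm \<xi>)\<^sup>2) + gamma_head s ((norm \<xi>)\<^sup>2) = Gamma s * norm \<xi> powr (- 2 * s)"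
    if "0 < (norm \<xi>)\<^sup>2" for \<xi> :: "real ^ 'd"
  proof -
    have "((norm \<xi>)\<^sup>2) powr (- s) = norm \<xi> powr (- 2 * s)"
      using that powr_powr[of "norm \<xi>" 2 "- s"] by simp
    then show ?thesis using gamma_tail_plus_head_pos[OF s(1) that] by simp
  qed
  \<comment> \<open>Head and tail are nonnegative and each is bounded by their sum, a multiple of
    the power of the norm for which integrability is assumed.\<close>
  have VG: "integrable lborel (\<lambda>\<xi>. V \<xi> * complex_of_real (g ((norm \<xi>)\<^sup>2)))"
    if g[measurable]: "g \<in> borel_measurable borel" and le: "\<And>r. 0 \<le> g r" "\<And>r. g r \<le> gamma_tail s r + gamma_head s r" for g
  proof (rule Bochner_Integration.integrable_bound)
    show "integrable lborel (\<lambda>\<xi>. complex_of_real (Gamma s) * (V \<xi> * complex_of_real (norm \<xi> powr (- 2 * s))))"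
      unfolding V_def by (intro integrable_mult_right G)
    show "AE \<xi> in lborel. norm (V \<xi> * complex_of_real (g ((norm \<xi>)\<^sup>2))) \<le> norm (complex_of_real (Gamma s) * (V \<xi> * complex_of_real (norm \<xi> powr (- 2 * s))))"
      using n0
    proof eventually_elim
      case (elim \<xi>)
      have "norm (V \<xi>) * g ((norm \<xi>)\<^sup>2) \<le> norm (V \<xi>) * (Gamma s * norm \<xi> powr (- 2 * s))"
        using le(2)[of "(norm \<xi>)\<^sup>2"] gs[OF elim] by (intro mult_left_mono) auto
      then show ?case using le(1) Gs by (simp add: norm_mult mult_ac)
    qed
  qed measurable
  define D where "D t = (LINT \<xi>|lborel. V \<xi> * complex_of_real (exp (- t * (norm \<xi>)\<^sup>2)))" for t
  define I2 where "I2 = (LINT \<xi>|lborel. V \<xi> * complex_of_real (gamma_tail s ((norm \<xi>)\<^sup>2) + gamma_head s ((norm \<xi>)\<^sup>2)))"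
  have S2: "has_bochner_integral lborel (\<lambda>t. complex_of_real (indicator {0<..} t * t powr (s - 1)) * D t) I2"
    unfolding D_def I2_def
  proof (rule gamma_superposition[OF _ V _ _ n0])
    show "integrable lborel (\<lambda>\<xi>. V \<xi> * complex_of_real (gamma_tail s ((norm \<xi>)\<^sup>2)))"
      by (rule VG) (use gamma_tail_nonneg[of s] gamma_head_nonneg[OF s(1)] in auto)
    show "integrable lborel (\<lambda>\<xi>. V \<xi> * complex_of_real (gamma_head s ((norm \<xi>)\<^sup>2)))"
      by (rule VG) (use gamma_tail_nonneg[of s] gamma_head_nonneg[OF s(1)] in auto)
  qed (use s in auto)
  have I2: "I2 = complex_of_real (Gamma s) * (LINT \<xi>|lborel. V \<xi> * complex_of_real (norm \<xi> powr (- 2 * s)))"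
  proof -
    have "I2 = (LINT \<xi>|lborel. complex_of_real (Gamma s) * (V \<xi> * complex_of_real (norm \<xi> powr (- 2 * s))))"
      unfolding I2_def
    proof (rule integral_cong_AE)
      show "AE \<xi> in lborel. V \<xi> * complex_of_real (gamma_tail s ((norm \<xi>)\<^sup>2) + gamma_head s ((norm \<xi>)\<^sup>2)) =
          complex_of_real (Gamma s) * (V \<xi> * complex_of_real (norm \<xi> powr (- 2 * s)))"
        using n0
      proof eventually_elim
        case (elim \<xi>)
        show ?case unfolding gs[OF elim] of_real_mult by (simp only: mult_ac)
      qed
    qed measurable
    then show ?thesis by simp
  qed
  define c0 where "c0 = (2 * pi) ^ CARD('d) * (4 * pi) powr (- ?d / 2)"
  have c0: "c0 > 0" by (simp add: c0_def)
  \<comment> \<open>The powers of t combine to - 2 - (s - 1) + d/2 = \<sigma> - 1: the Jacobian, the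
    density in frequency and the heat kernel factor give the density in space.\<close>
  have DB: "1 / t\<^sup>2 * ((1 / t) powr (s - 1) * Re (D (1 / t))) = c0 * (t powr (\<sigma> - 1) * Re (Bt t))" if t: "t > 0" for t
  proof -
    have "integrable (lborel \<Otimes>\<^sub>M lborel) (\<lambda>p. U p * complex_of_real (exp (- t * \<rho> p)))"
      unfolding lborel_prod
    proof (rule Bochner_Integration.integrable_bound[OF U])
      have "exp (- t * \<rho> p) \<le> 1" for p using t by (simp add: \<rho>_def)
      then show "AE p in lborel. norm (U p * complex_of_real (exp (- t * \<rho> p))) \<le> norm (U p)"
        by (intro AE_I2) (auto simp: norm_mult intro: mult_right_le_one_le)
    qed measurable
    from lborel_pair.integral_fst'[OF this]
    have "Bt t = (LINT x|lborel. LINT y|lborel. u y * cnj (v x) * complex_of_real (exp (- t * ((norm (x - y))\<^sup>2 / 4))))"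
      by (simp add: Bt_def lborel_prod U_def \<rho>_def)
    then have "D (1 / t) = complex_of_real ((2 * pi) ^ CARD('d) * (4 * pi * (1 / t)) powr (- ?d / 2)) * Bt t"
      using gaussian_parseval[OF rapid_integrable[OF u] rapid_integrable[OF v] _ rapid_integrable[OF Fu(1)], of "1 / t"] t
      unfolding D_def V_def by simp
    then have "Re (D (1 / t)) = (2 * pi) ^ CARD('d) * (4 * pi * (1 / t)) powr (- ?d / 2) * Re (Bt t)"
      by (simp only: times_complex.sel complex_of_real_def complex.sel mult_zero_left diff_zero)
    also have "(4 * pi * (1 / t)) powr (- ?d / 2) = (4 * pi) powr (- ?d / 2) * (1 / t) powr (- ?d / 2)"
      by (rule powr_mult)
    finally have 1: "Re (D (1 / t)) = c0 * ((1 / t) powr (- ?d / 2) * Re (Bt t))" by (simp add: c0_def mult_ac)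
    have "1 / t\<^sup>2 * ((1 / t) powr (s - 1) * (1 / t) powr (- ?d / 2)) = t powr (\<sigma> - 1)"
    proof -
      have p: "(1 / t) powr a = t powr (- a)" for a using t by (simp add: powr_divide powr_minus_divide)
      have "1 / t\<^sup>2 = t powr (- 2)" using t by (simp add: powr_minus_divide)
      then have "1 / t\<^sup>2 * ((1 / t) powr (s - 1) * (1 / t) powr (- ?d / 2)) = t powr (- 2 + (- (s - 1) + - (- ?d / 2)))"
        unfolding p powr_add by simp
      also have "- 2 + (- (s - 1) + - (- ?d / 2)) = \<sigma> - 1" by (simp add: \<sigma>_def)
      finally show ?thesis .
    qed
    then show ?thesis unfolding 1 by (metis (no_types, lifting) mult.assoc mult.left_commute)
  qed
  \<comment> \<open>Real parts are taken because the substitution rule for t -> 1 / t concerns real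
    integrands.\<close>
  have R1: "has_bochner_integral lborel (\<lambda>t. c0 * (indicator {0<..} t * (t powr (\<sigma> - 1) * Re (Bt t)))) (c0 * Re I1)"
    using has_bochner_integral_mult_right[OF has_bochner_integral_bounded_linear[OF bounded_linear_Re S1], of c0]
    by (simp add: mult.assoc)
  have Dm: "(\<lambda>t. t powr (s - 1) * Re (D t)) \<in> borel_measurable borel"
    unfolding D_def by measurable
  have "has_bochner_integral lborel (\<lambda>t. indicator {0<..} t * (t powr (s - 1) * Re (D t))) (Re I2)"
    using has_bochner_integral_bounded_linear[OF bounded_linear_Re S2] by (simp add: mult.assoc)
  then have "has_bochner_integral lborel (\<lambda>t. indicator {0<..} t * (1 / t\<^sup>2 * ((1 / t) powr (s - 1) * Re (D (1 / t))))) (Re I2)"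
    by (subst (asm) has_bochner_integral_inverse_substitution[OF Dm])
  also have "(\<lambda>t. indicator {0<..} t * (1 / t\<^sup>2 * ((1 / t) powr (s - 1) * Re (D (1 / t))))) = (\<lambda>t. c0 * (indicator {0<..} t * (t powr (\<sigma> - 1) * Re (Bt t))))"
  proof (rule ext)
    fix t :: real
    show "indicator {0<..} t * (1 / t\<^sup>2 * ((1 / t) powr (s - 1) * Re (D (1 / t)))) = c0 * (indicator {0<..} t * (t powr (\<sigma> - 1) * Re (Bt t)))"
      using DB[of t] by (cases "t > 0") auto
  qed
  finally have I12: "Re I2 = c0 * Re I1"
    using R1 has_bochner_integral_eq by blast
  have "AE p in lborel. complex_of_real A * (U p * complex_of_real (gamma_tail \<sigma> (\<rho> p)) + U p * complex_of_real (gamma_head \<sigma> (\<rho> p))) + complex_of_real c * U p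
     = complex_of_real (fgf_kernel s (fst p) (snd p)) * (u (snd p) * cnj (v (fst p)))"
    using AE_fst_neq_snd
  proof eventually_elim
    case (elim p)
    show ?case unfolding c(2)[OF elim] by (simp add: U_def \<rho>_def algebra_simps)
  qed
  moreover have K: "has_bochner_integral lborel (\<lambda>p. complex_of_real A * (U p * complex_of_real (gamma_tail \<sigma> (\<rho> p)) + U p * complex_of_real (gamma_head \<sigma> (\<rho> p))) + complex_of_real c * U p)
     (complex_of_real A * I1)"
  proof -
    \<comment> \<open>Either s < d/2 and the additive constant of the kernel is 0, or the integral
      of u, and with it that of U, vanishes.\<close>
    have "complex_of_real c * (LINT p|lborel. U p) = 0" using c(1) U0 by (cases "s < ?d / 2") auto
    moreover have "I1 = (LINT p|lborel. U p * complex_of_real (gamma_tail \<sigma> (\<rho> p))) + (LINT p|lborel. U p * complex_of_real (gamma_head \<sigma> (\<rho> p)))"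
      unfolding I1_def by (subst Bochner_Integration.integral_add[OF T H, symmetric]) (simp add: distrib_left)
    ultimately show ?thesis using T H U by (simp add: has_bochner_integral_iff)
  qed
  moreover have "(\<lambda>p. complex_of_real (fgf_kernel s (fst p) (snd p)) * (u (snd p) * cnj (v (fst p)))) \<in> borel_measurable (lborel :: ((real ^ 'd) \<times> (real ^ 'd)) measure)"
  proof -
    have "(\<lambda>p. complex_of_real (fgf_kernel s (fst p) (snd p)) * (u (snd p) * cnj (v (fst p)))) \<in> borel_measurable (lborel \<Otimes>\<^sub>M lborel)"
      unfolding fgf_kernel_def Let_def by measurable
    then show ?thesis by (simp add: lborel_prod)
  qed
  ultimately have KU: "has_bochner_integral lborel (\<lambda>p. complex_of_real (fgf_kernel s (fst p) (snd p)) * (u (snd p) * cnj (v (fst p)))) (complex_of_real A * I1)"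
    using has_bochner_integral_cong_AE[THEN iffD1, OF _ _ _ K] borel_measurable_has_bochner_integral[OF K] by blast
  then show ?int by (simp add: has_bochner_integral_iff lborel_prod split_beta')
  have "(LINT p|(lborel \<Otimes>\<^sub>M lborel). complex_of_real (fgf_kernel s (fst p) (snd p)) * (u (snd p) * cnj (v (fst p)))) = complex_of_real A * I1"
    using KU by (simp add: has_bochner_integral_iff lborel_prod)
  moreover have "Re (LINT \<xi>|lborel. V \<xi> * complex_of_real (norm \<xi> powr (- 2 * s))) = (2 * pi) ^ CARD('d) * (A * Re I1)"
  proof -
    have "Gamma s * Re (LINT \<xi>|lborel. V \<xi> * complex_of_real (norm \<xi> powr (- 2 * s))) = c0 * Re I1"
      using I12 unfolding I2 by simp
    moreover have "c0 = Gamma s * ((2 * pi) ^ CARD('d) * A)"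
      using Gs by (simp add: c0_def A_def riesz_const_def)
    ultimately show ?thesis using Gs by (simp add: mult.assoc)
  qed
  ultimately show ?eq unfolding V_def by simp
qed

section \<open>Plancherel theorem and roots of the Riesz potential\<close>

lemma inv_fourier_eq_fourier: "inv_fourier f x = complex_of_real (1 / (2 * pi) ^ DIM('a)) * fourier f (0 - (x::'a::euclidean_space))"
  unfolding inv_fourier_def fourier_def by (simp add: inner_commute)

lemma inv_fourier_measurable:
  assumes "integrable lborel f"
  shows "inv_fourier f \<in> borel_measurable borel"
proof -
  have [measurable]: "fourier f \<in> borel_measurable borel" by (rule fourier_measurable[OF assms])
  show ?thesis unfolding inv_fourier_eq_fourier[abs_def] by measurable
qed

lemma inv_fourier_bounded:
  assumes "integrable lborel f"
  obtains C where "C \<ge> 0" "\<And>x. norm (inv_fourier f x) \<le> C"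
proof
  let ?C = "1 / (2 * pi) ^ DIM('a) * (LINT x|lborel. norm (f x))"
  show "?C \<ge> 0" by simp
  show "norm (inv_fourier f x) \<le> ?C" for x
    unfolding inv_fourier_eq_fourier norm_mult norm_of_real
    by (intro mult_mono norm_fourier_le) auto
qed

lemma integrable_inv_fourier:
  assumes "rapid f"
  shows "integrable lborel (inv_fourier f)"
  unfolding inv_fourier_eq_fourier[abs_def]
  by (intro integrable_mult_right lborel_integrable_reflect rapid_integrable rapid_fourier assms)

lemma fourier_inv_fourier:
  assumes f: "rapid f"
  shows "fourier (inv_fourier f) \<xi> = f \<xi>"
proof -
  have m: "fourier f \<in> borel_measurable borel" by (intro rapid_measurable rapid_fourier f)
  note [measurable] = m
  have "fourier (inv_fourier f) \<xi> = complex_of_real (1 / (2 * pi) ^ DIM('a)) * fourier (\<lambda>x. fourier f (0 - x)) \<xi>"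
    unfolding inv_fourier_eq_fourier[abs_def] by (rule fourier_cmult)
  also have "fourier (\<lambda>x. fourier f (0 - x)) \<xi> = (LINT x|lborel. cis ((0 - x) \<bullet> \<xi>) * fourier f (0 - x))"
    unfolding fourier_def[of "\<lambda>x. fourier f (0 - x)"] by simp
  also have "\<dots> = (LINT x|lborel. cis (x \<bullet> \<xi>) * fourier f x)"
    by (rule lborel_integral_reflect) measurable
  also have "complex_of_real (1 / (2 * pi) ^ DIM('a)) * \<dots> = inv_fourier (fourier f) \<xi>"
    unfolding inv_fourier_def by (simp add: inner_commute)
  finally show ?thesis using fourier_inversion[OF f] by simp
qed

lemma cnj_fourier: "cnj (fourier f \<xi>) = (LINT x|lborel. cis (x \<bullet> \<xi>) * cnj (f x))"
  unfolding fourier_def by (subst Bochner_Integration.integral_cnj[symmetric]) (simp add: cis_cnj)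

text \<open>One factor is only integrable, the other rapidly decreasing. This asymmetry allows a
  singular transform to be paired with its regular approximations.\<close>

lemma inv_fourier_parseval:
  fixes f h :: "'a::euclidean_space \<Rightarrow> complex"
  assumes f: "integrable lborel f" and h: "rapid h"
  shows "(LINT x|lborel. inv_fourier f x * cnj (inv_fourier h x)) =
    complex_of_real (1 / (2 * pi) ^ DIM('a)) * (LINT \<xi>|lborel. f \<xi> * cnj (h \<xi>))"
proof -
  let ?c = "complex_of_real (1 / (2 * pi) ^ DIM('a))"
  have g: "integrable lborel (\<lambda>x. cnj (inv_fourier h x))"
    using integrable_inv_fourier[OF h] by simp
  have k: "(\<lambda>(x, y). cis (x \<bullet> y)) \<in> borel_measurable (borel \<Otimes>\<^sub>M (borel :: 'a measure))"
    by measurable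
  have "(LINT x|lborel. inv_fourier f x * cnj (inv_fourier h x)) =
      (LINT x|lborel. ?c * (cnj (inv_fourier h x) * (LINT \<xi>|lborel. cis (x \<bullet> \<xi>) * f \<xi>)))"
    unfolding inv_fourier_def[of f] by (simp only: mult_ac)
  also have "\<dots> = ?c * (LINT x|lborel. cnj (inv_fourier h x) * (LINT \<xi>|lborel. cis (x \<bullet> \<xi>) * f \<xi>))"
    by (rule integral_mult_right_zero)
  also have "(LINT x|lborel. cnj (inv_fourier h x) * (LINT \<xi>|lborel. cis (x \<bullet> \<xi>) * f \<xi>)) =
      (LINT \<xi>|lborel. (LINT x|lborel. cis (x \<bullet> \<xi>) * cnj (inv_fourier h x)) * f \<xi>)"
    using fubini_mult[OF g f k, of 1] by simp
  also have "\<dots> = (LINT \<xi>|lborel. f \<xi> * cnj (h \<xi>))"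
    unfolding cnj_fourier[symmetric] fourier_inv_fourier[OF h] by (simp only: mult.commute)
  finally show ?thesis .
qed

lemma cnj_mult_self: "z * cnj z = complex_of_real ((norm z)\<^sup>2)"
  by (rule complex_norm_square[symmetric])

text \<open>G may be singular at the origin, so it is approximated from below in norm by rapidly
  decreasing functions. Fatou's lemma gives one inequality and pairing G with its approximants the
  other.\<close>

lemma inv_fourier_plancherel:
  fixes G :: "'a::euclidean_space \<Rightarrow> complex"
  assumes G: "integrable lborel G" and G2: "integrable lborel (\<lambda>\<xi>. (norm (G \<xi>))\<^sup>2)"
    and Gn: "\<And>n. rapid (Gn n)" and le: "\<And>n \<xi>. norm (Gn n \<xi>) \<le> norm (G \<xi>)"
    and lim: "AE \<xi> in lborel. (\<lambda>n. Gn n \<xi>) \<longlonglongrightarrow> G \<xi>"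
  shows "integrable lborel (\<lambda>x. (norm (inv_fourier G x))\<^sup>2)" (is ?int)
    and "(LINT x|lborel. (norm (inv_fourier G x))\<^sup>2) = 1 / (2 * pi) ^ DIM('a) * (LINT \<xi>|lborel. (norm (G \<xi>))\<^sup>2)" (is ?eq)
proof -
  define c where "c = 1 / (2 * pi) ^ DIM('a)"
  have c: "c > 0" by (simp add: c_def)
  define I where "I = (LINT \<xi>|lborel. (norm (G \<xi>))\<^sup>2)"
  have Gm[measurable]: "G \<in> borel_measurable borel" using borel_measurable_integrable[OF G] by simp
  have Gnm[measurable]: "Gn n \<in> borel_measurable borel" for n by (rule rapid_measurable[OF Gn])
  have gm[measurable]: "inv_fourier G \<in> borel_measurable borel" "inv_fourier (Gn n) \<in> borel_measurable borel" for n
    by (intro inv_fourier_measurable G rapid_integrable Gn)+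
  have le2: "(norm (Gn n \<xi>))\<^sup>2 \<le> (norm (G \<xi>))\<^sup>2" for n \<xi>
    using le by (intro power_mono) auto
  have Gn2: "integrable lborel (\<lambda>\<xi>. (norm (Gn n \<xi>))\<^sup>2)" for n
    by (rule Bochner_Integration.integrable_bound[OF G2]) (use le2 in auto)
  have gn2: "integrable lborel (\<lambda>x. (norm (inv_fourier (Gn n) x))\<^sup>2)" for n
  proof -
    obtain C where C: "\<And>x. norm (inv_fourier (Gn n) x) \<le> C"
      using inv_fourier_bounded[OF rapid_integrable[OF Gn]] by blast
    show ?thesis
    proof (rule Bochner_Integration.integrable_bound)
      show "integrable lborel (\<lambda>x. C * norm (inv_fourier (Gn n) x))"
        by (intro integrable_mult_right integrable_norm integrable_inv_fourier Gn)
      show "AE x in lborel. norm ((norm (inv_fourier (Gn n) x))\<^sup>2) \<le> norm (C * norm (inv_fourier (Gn n) x))"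
      proof (rule AE_I2)
        fix x
        have "norm (inv_fourier (Gn n) x) * norm (inv_fourier (Gn n) x) \<le> C * norm (inv_fourier (Gn n) x)"
          by (intro mult_right_mono C) simp
        then show "norm ((norm (inv_fourier (Gn n) x))\<^sup>2) \<le> norm (C * norm (inv_fourier (Gn n) x))"
          unfolding power2_eq_square real_norm_def by (simp only: abs_of_nonneg[OF mult_nonneg_nonneg[OF norm_ge_zero norm_ge_zero]] order.trans[OF _ abs_ge_self])
      qed
    qed measurable
  qed
  have En: "(LINT x|lborel. (norm (inv_fourier (Gn n) x))\<^sup>2) = c * (LINT \<xi>|lborel. (norm (Gn n \<xi>))\<^sup>2)" for n
  proof -
    have "complex_of_real (LINT x|lborel. (norm (inv_fourier (Gn n) x))\<^sup>2) =
        complex_of_real (c * (LINT \<xi>|lborel. (norm (Gn n \<xi>))\<^sup>2))"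
      using inv_fourier_parseval[OF rapid_integrable[OF Gn] Gn, of n n]
      unfolding cnj_mult_self integral_complex_of_real c_def of_real_mult .
    then show ?thesis by (simp only: of_real_eq_iff)
  qed
  have upper: "(LINT x|lborel. (norm (inv_fourier (Gn n) x))\<^sup>2) \<le> c * I" for n
    unfolding En I_def using c by (intro mult_left_mono integral_mono Gn2 G2 le2) auto
  have glim: "(\<lambda>n. inv_fourier (Gn n) x) \<longlonglongrightarrow> inv_fourier G x" for x
    unfolding inv_fourier_def
  proof (intro tendsto_mult tendsto_const integral_dominated_convergence[where w = "\<lambda>\<xi>. norm (G \<xi>)"])
    show "AE \<xi> in lborel. (\<lambda>n. cis (x \<bullet> \<xi>) * Gn n \<xi>) \<longlonglongrightarrow> cis (x \<bullet> \<xi>) * G \<xi>"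
      using lim by eventually_elim (rule tendsto_mult_left)
  qed (use G le in \<open>auto simp: norm_mult\<close>)
  have fatou: "(\<integral>\<^sup>+x. ennreal ((norm (inv_fourier G x))\<^sup>2) \<partial>lborel) \<le> ennreal (c * I)"
  proof -
    have "(\<integral>\<^sup>+x. ennreal ((norm (inv_fourier G x))\<^sup>2) \<partial>lborel) =
        (\<integral>\<^sup>+x. liminf (\<lambda>n. ennreal ((norm (inv_fourier (Gn n) x))\<^sup>2)) \<partial>lborel)"
    proof (rule nn_integral_cong)
      fix x
      have "(\<lambda>n. ennreal ((norm (inv_fourier (Gn n) x))\<^sup>2)) \<longlonglongrightarrow> ennreal ((norm (inv_fourier G x))\<^sup>2)"
        by (intro tendsto_ennrealI tendsto_power tendsto_norm glim)
      then show "ennreal ((norm (inv_fourier G x))\<^sup>2) = liminf (\<lambda>n. ennreal ((norm (inv_fourier (Gn n) x))\<^sup>2))"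
        by (intro lim_imp_Liminf[symmetric]) simp_all
    qed
    also have "\<dots> \<le> liminf (\<lambda>n. \<integral>\<^sup>+x. ennreal ((norm (inv_fourier (Gn n) x))\<^sup>2) \<partial>lborel)"
      by (rule nn_integral_liminf) measurable
    also have "\<dots> \<le> ennreal (c * I)"
    proof (rule Liminf_le)
      show "\<forall>\<^sub>F n in sequentially. (\<integral>\<^sup>+x. ennreal ((norm (inv_fourier (Gn n) x))\<^sup>2) \<partial>lborel) \<le> ennreal (c * I)"
        using upper by (intro always_eventually allI) (simp add: nn_integral_eq_integral[OF gn2] ennreal_leI)
    qed simp
    finally show ?thesis .
  qed
  show int: ?int
  proof (rule integrableI_nonneg)
    show "(\<integral>\<^sup>+x. ennreal ((norm (inv_fourier G x))\<^sup>2) \<partial>lborel) < \<infinity>"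
      using fatou by (simp add: order_le_less_trans)
  qed auto
  define A where "A = (LINT x|lborel. (norm (inv_fourier G x))\<^sup>2)"
  have I0: "0 \<le> c * I" using c by (simp add: I_def)
  have "A \<le> c * I"
    using fatou nn_integral_eq_integral[OF int] I0 by (simp add: A_def)
  \<comment> \<open>Parseval's identity for G and \<open>Gn n\<close>, estimated by norm (z * cnj w)
    \<le> (norm z)^2 / 2 + (norm w)^2 / 2, yields in the limit c * I \<le> A / 2 + c * I / 2, that
    is, c * I \<le> A.\<close>
  moreover have "c * I \<le> A / 2 + c * I / 2"
  proof (rule LIMSEQ_le_const2)
    have L: "(\<lambda>n. LINT \<xi>|lborel. G \<xi> * cnj (Gn n \<xi>)) \<longlonglongrightarrow> (LINT \<xi>|lborel. G \<xi> * cnj (G \<xi>))"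
    proof (rule integral_dominated_convergence[where w = "\<lambda>\<xi>. (norm (G \<xi>))\<^sup>2"])
      show "AE \<xi> in lborel. (\<lambda>n. G \<xi> * cnj (Gn n \<xi>)) \<longlonglongrightarrow> G \<xi> * cnj (G \<xi>)"
        using lim by eventually_elim (intro tendsto_mult tendsto_const tendsto_cnj)
      show "AE \<xi> in lborel. norm (G \<xi> * cnj (Gn n \<xi>)) \<le> (norm (G \<xi>))\<^sup>2" for n
        using le by (intro AE_I2) (auto simp: norm_mult power2_eq_square intro!: mult_left_mono)
    qed (use G2 in auto)
    have "Re (LINT \<xi>|lborel. G \<xi> * cnj (G \<xi>)) = I"
      unfolding cnj_mult_self integral_complex_of_real I_def by simp
    then show "(\<lambda>n. c * Re (LINT \<xi>|lborel. G \<xi> * cnj (Gn n \<xi>))) \<longlonglongrightarrow> c * I"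
      using tendsto_mult_left[OF tendsto_Re[OF L], of c] by simp
    have "c * Re (LINT \<xi>|lborel. G \<xi> * cnj (Gn n \<xi>)) \<le> A / 2 + c * I / 2" for n
    proof -
      let ?g = "inv_fourier G" and ?h = "inv_fourier (Gn n)"
      have P: "norm (z * cnj w) \<le> (norm z)\<^sup>2 / 2 + (norm w)\<^sup>2 / 2" for z w :: complex
        using sum_squares_bound[of "norm z" "norm w"] by (simp add: norm_mult)
      have S: "integrable lborel (\<lambda>x. (norm (?g x))\<^sup>2 / 2 + (norm (?h x))\<^sup>2 / 2)"
        using int gn2 by (intro Bochner_Integration.integrable_add integrable_divide)
      have pi: "integrable lborel (\<lambda>x. ?g x * cnj (?h x))"
      proof (rule Bochner_Integration.integrable_bound[OF S])
        show "AE x in lborel. norm (?g x * cnj (?h x)) \<le> norm ((norm (?g x))\<^sup>2 / 2 + (norm (?h x))\<^sup>2 / 2)"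
          using P by (intro AE_I2) (auto intro: order.trans)
      qed measurable
      have "c * Re (LINT \<xi>|lborel. G \<xi> * cnj (Gn n \<xi>)) = Re (LINT x|lborel. ?g x * cnj (?h x))"
        unfolding inv_fourier_parseval[OF G Gn] c_def by simp
      also have "\<dots> \<le> norm (LINT x|lborel. ?g x * cnj (?h x))" by (rule complex_Re_le_cmod)
      also have "\<dots> \<le> (LINT x|lborel. norm (?g x * cnj (?h x)))" by (rule integral_norm_bound)
      also have "\<dots> \<le> (LINT x|lborel. (norm (?g x))\<^sup>2 / 2 + (norm (?h x))\<^sup>2 / 2)"
        by (intro integral_mono integrable_norm pi S P)
      also have "\<dots> = A / 2 + (LINT x|lborel. (norm (?h x))\<^sup>2) / 2"
        unfolding A_def using int gn2[of n] by (simp add: Bochner_Integration.integral_add)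
      also have "\<dots> \<le> A / 2 + c * I / 2" using upper[of n] by simp
      finally show ?thesis .
    qed
    then show "\<exists>N. \<forall>n\<ge>N. c * Re (LINT \<xi>|lborel. G \<xi> * cnj (Gn n \<xi>)) \<le> A / 2 + c * I / 2" by blast
  qed
  ultimately have "A = c * I" by linarith
  then show ?eq unfolding A_def c_def I_def .
qed

text \<open>The derivative of the transform is bounded by the first absolute moment of u, so a zero
  at the origin gains a factor norm \<xi>.\<close>

lemma fourier_Lipschitz_zero:
  assumes u: "rapid u" and z: "fourier u 0 = 0"
  obtains D where "D \<ge> 0" "\<And>\<xi>. norm (fourier u \<xi>) \<le> D * norm \<xi>"
proof -
  define D where "D = (LINT x|lborel. norm x * norm (u x))"
  note i = rapid_norm_integrable[OF u]
  have D: "D \<ge> 0" by (simp add: D_def)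
  have "norm (fourier u \<xi> - fourier u 0) \<le> D * norm (\<xi> - 0)" for \<xi>
  proof (rule differentiable_bound[where S = UNIV and f' = "\<lambda>\<eta> h. fourier (\<lambda>x. - \<i> * complex_of_real (x \<bullet> h) * u x) \<eta>"])
    fix \<eta> :: 'a
    show "(fourier u has_derivative (\<lambda>h. fourier (\<lambda>x. - \<i> * complex_of_real (x \<bullet> h) * u x) \<eta>)) (at \<eta> within UNIV)"
      using fourier_has_derivative[OF rapid_integrable[OF u] i] by simp
    show "onorm (\<lambda>h. fourier (\<lambda>x. - \<i> * complex_of_real (x \<bullet> h) * u x) \<eta>) \<le> D"
    proof (rule onorm_bound)
      show "0 \<le> D" by (rule D)
      fix h
      note norm_fourier_le[of "\<lambda>x. - \<i> * complex_of_real (x \<bullet> h) * u x" \<eta>]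
      also have "(LINT x|lborel. norm (- \<i> * complex_of_real (x \<bullet> h) * u x)) \<le> (LINT x|lborel. norm h * (norm x * norm (u x)))"
      proof (rule integral_mono_AE')
        show "integrable lborel (\<lambda>x. norm h * (norm x * norm (u x)))" using i by simp
        show "AE x in lborel. norm (- \<i> * complex_of_real (x \<bullet> h) * u x) \<le> norm h * (norm x * norm (u x))"
        proof (rule AE_I2)
          fix x
          have "\<bar>x \<bullet> h\<bar> * norm (u x) \<le> norm x * norm h * norm (u x)"
            by (intro mult_right_mono Cauchy_Schwarz_ineq2) simp
          then show "norm (- \<i> * complex_of_real (x \<bullet> h) * u x) \<le> norm h * (norm x * norm (u x))"
            by (simp add: norm_mult mult_ac)
        qed
      qed simp_all
      also have "\<dots> = D * norm h" by (simp add: D_def)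
      finally show "norm (fourier (\<lambda>x. - \<i> * complex_of_real (x \<bullet> h) * u x) \<eta>) \<le> D * norm h" .
    qed
  qed auto
  then show thesis by (intro that[OF D]) (simp add: z)
qed

text \<open>The Fourier transform of (-\<Delta>) to the power -s/2 applied to u.\<close>

definition riesz_fourier :: "real \<Rightarrow> ('a::euclidean_space \<Rightarrow> complex) \<Rightarrow> 'a \<Rightarrow> complex" where
  "riesz_fourier s u \<xi> = complex_of_real (norm \<xi> powr (- s)) * fourier u \<xi>"

text \<open>Conditions making \<open>riesz_fourier s u\<close> integrable and square integrable: the
  zero of the transform together with s < d/2 + 1 controls the origin, rapid decrease with s \<ge> 0
  controls infinity.\<close>

locale riesz_admissible =
  fixes s :: real and u :: "'a::euclidean_space \<Rightarrow> complex"
  assumes s0: "0 \<le> s" and s1: "s < real DIM('a) / 2 + 1" and u: "rapid u"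
    and zero: "real DIM('a) / 2 \<le> s \<Longrightarrow> fourier u 0 = 0"
begin

lemma Fm: "fourier u \<in> borel_measurable borel"
  by (intro rapid_measurable rapid_fourier u)

lemma measurable_riesz_fourier: "riesz_fourier s u \<in> borel_measurable borel"
proof -
  note [measurable] = Fm
  show ?thesis unfolding riesz_fourier_def[abs_def] by measurable
qed

text \<open>Below d/2 the exponent is b = s; from d/2 on the zero of the transform gains one power
  and b = s - 1. In both cases 2 * b < d, which is square integrability at the origin.\<close>

lemma near_bound:
  obtains b C where "b < real DIM('a) / 2" "C \<ge> 0"
    "\<And>\<xi>. \<xi> \<noteq> 0 \<Longrightarrow> norm (riesz_fourier s u \<xi>) \<le> C * norm \<xi> powr (- b)"
proof (cases "s < real DIM('a) / 2")
  case True
  obtain C where C: "C \<ge> 0" "\<And>\<xi>. norm (fourier u \<xi>) \<le> C" using rapid_bounded[OF rapid_fourier[OF u]] by blast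
  have "norm (riesz_fourier s u \<xi>) \<le> C * norm \<xi> powr (- s)" for \<xi>
    unfolding riesz_fourier_def norm_mult using C(2)[of \<xi>] by (simp add: mult.commute[of C] mult_left_mono)
  with True C(1) show ?thesis by (intro that) auto
next
  case False
  obtain C where C: "C \<ge> 0" "\<And>\<xi>. norm (fourier u \<xi>) \<le> C * norm \<xi>"
    using fourier_Lipschitz_zero[OF u] zero False by (metis linorder_not_less)
  have "norm (riesz_fourier s u \<xi>) \<le> C * norm \<xi> powr (- (s - 1))" if "\<xi> \<noteq> 0" for \<xi>
  proof -
    have "norm (riesz_fourier s u \<xi>) \<le> norm \<xi> powr (- s) * (C * norm \<xi> powr 1)"
      unfolding riesz_fourier_def norm_mult using C(2)[of \<xi>] that by (simp add: mult_left_mono)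
    also have "\<dots> = C * (norm \<xi> powr (- s) * norm \<xi> powr 1)" by (simp only: mult_ac)
    also have "norm \<xi> powr (- s) * norm \<xi> powr 1 = norm \<xi> powr (- (s - 1))"
      unfolding powr_add[symmetric] by simp
    finally show ?thesis .
  qed
  with C(1) s1 show ?thesis by (intro that[of "s - 1" C]) auto
qed

lemma riesz_fourier_integrable: "integrable lborel (riesz_fourier s u)" (is ?A)
  and riesz_fourier_square_integrable: "integrable lborel (\<lambda>\<xi>. (norm (riesz_fourier s u \<xi>))\<^sup>2)" (is ?B)
proof -
  let ?w = "\<lambda>\<xi>::'a. (1 + norm \<xi>) powr (- real (2 * DIM('a)))"
  obtain b C1 where b: "b < real DIM('a) / 2" and C1: "C1 \<ge> 0"
    "\<And>\<xi>. \<xi> \<noteq> 0 \<Longrightarrow> norm (riesz_fourier s u \<xi>) \<le> C1 * norm \<xi> powr (- b)"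
    using near_bound by blast
  obtain C2 where C2: "C2 \<ge> 0" "\<And>\<xi>. norm (fourier u \<xi>) \<le> C2 * ?w \<xi>"
    using rapid_bound[OF rapid_fourier[OF u]] by blast
  define C where "C = max C1 C2"
  have C: "C \<ge> 0" "C1 \<le> C" "C2 \<le> C" using C1 by (auto simp: C_def)
  have near: "norm (riesz_fourier s u \<xi>) \<le> C * norm \<xi> powr (- b)" if "\<xi> \<noteq> 0" for \<xi>
    using C1(2)[OF that] mult_right_mono[OF C(2), of "norm \<xi> powr (- b)"] by simp
  have far: "norm (riesz_fourier s u \<xi>) \<le> C * ?w \<xi>" if "norm \<xi> \<ge> 1" for \<xi>
  proof -
    have "norm \<xi> powr (- s) \<le> 1" using that s0 powr_mono[of "- s" 0 "norm \<xi>"] by (cases "\<xi> = 0") auto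
    then have "norm (riesz_fourier s u \<xi>) \<le> 1 * (C2 * ?w \<xi>)"
      unfolding riesz_fourier_def norm_mult using C2 by (intro mult_mono) auto
    also have "\<dots> \<le> C * ?w \<xi>" using C by (simp add: mult_right_mono)
    finally show ?thesis .
  qed
  have d: "real DIM('a) > 0" by simp
  show ?A
  proof (rule integrable_singular[OF measurable_riesz_fourier _ C(1)])
    show "b < real DIM('a)" using b d by linarith
  qed (use near far in auto)
  show ?B
  proof (rule integrable_singular)
    show "2 * b < real DIM('a)" using b by simp
    show "C\<^sup>2 \<ge> 0" by simp
    note [measurable] = measurable_riesz_fourier
    show "(\<lambda>\<xi>. (norm (riesz_fourier s u \<xi>))\<^sup>2) \<in> borel_measurable borel" by measurable
    show "norm ((norm (riesz_fourier s u \<xi>))\<^sup>2) \<le> C\<^sup>2 * norm \<xi> powr (- (2 * b))" if "\<xi> \<noteq> 0" for \<xi>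
    proof -
      have "(norm (riesz_fourier s u \<xi>))\<^sup>2 \<le> (C * norm \<xi> powr (- b))\<^sup>2" using near[OF that] by (intro power_mono) auto
      also have "(norm \<xi> powr (- b))\<^sup>2 = norm \<xi> powr (- (2 * b))"
        by (simp add: power2_eq_square powr_add[symmetric])
      then have "(C * norm \<xi> powr (- b))\<^sup>2 = C\<^sup>2 * norm \<xi> powr (- (2 * b))" by (simp add: power_mult_distrib)
      finally show ?thesis by simp
    qed
    show "norm ((norm (riesz_fourier s u \<xi>))\<^sup>2) \<le> C\<^sup>2 * ?w \<xi>" if "1 \<le> norm \<xi>" for \<xi>
    proof -
      have "(norm (riesz_fourier s u \<xi>))\<^sup>2 \<le> (C * ?w \<xi>)\<^sup>2" using far[OF that] by (intro power_mono) auto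
      also have "(C * ?w \<xi>)\<^sup>2 = C\<^sup>2 * (?w \<xi> * ?w \<xi>)" by (simp add: power2_eq_square)
      also have "?w \<xi> * ?w \<xi> \<le> ?w \<xi> * 1"
        by (intro mult_left_mono) (use powr_mono[of "- real (2 * DIM('a))" 0 "1 + norm \<xi>"] add_pos_nonneg[of 1 "norm \<xi>"] in auto)
      then have "C\<^sup>2 * (?w \<xi> * ?w \<xi>) \<le> C\<^sup>2 * ?w \<xi>" by (simp add: mult_left_mono)
      finally show ?thesis by simp
    qed
  qed
qed

text \<open>The only singularity is at the origin, so removing ever smaller balls by smooth cutoffs
  gives rapidly decreasing approximants of smaller norm.\<close>

lemma riesz_fourier_approx:
  obtains Gn where "\<And>n. rapid (Gn n)" "\<And>n \<xi>. norm (Gn n \<xi>) \<le> norm (riesz_fourier s u \<xi>)"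
    "AE \<xi> in lborel. (\<lambda>n. Gn n \<xi>) \<longlonglongrightarrow> riesz_fourier s u \<xi>"
proof -
  let ?r = "\<lambda>n. 1 / real (Suc n)"
  define Gn where "Gn n \<xi> = complex_of_real (annular_step (?r n) \<xi>) * complex_of_real (norm \<xi> powr (- s)) * fourier u \<xi>" for n and \<xi> :: 'a
  have "rapid (Gn n)" for n
    unfolding Gn_def
  proof (rule rapid_mult_Sym[OF _ rapid_fourier[OF u], where k = "0 + - s"])
    fix m
    show "Sym m (0 + - s) (\<lambda>x::'a. complex_of_real (annular_step (?r n) x) * complex_of_real (norm x powr (- s)))"
    proof (rule Sym_times_norm_powr[where r = "?r n"])
      show "Sym m 0 (\<lambda>x::'a. complex_of_real (annular_step (?r n) x))" for m by (rule Sym_annular_step) simp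
      show "complex_of_real (annular_step (?r n) x) = 0" if "norm x < ?r n" for x :: 'a
        using annular_step_0[of x "?r n"] that by simp
    qed auto
  qed
  moreover have "norm (Gn n \<xi>) \<le> norm (riesz_fourier s u \<xi>)" for n \<xi>
    unfolding Gn_def riesz_fourier_def norm_mult mult.assoc
    using annular_step_range[of "?r n" \<xi>] by (intro mult_left_le_one_le) auto
  moreover have "AE \<xi> in lborel. (\<lambda>n. Gn n \<xi>) \<longlonglongrightarrow> riesz_fourier s u \<xi>"
    using AE_lborel_singleton[of "0::'a"]
  proof eventually_elim
    case (elim \<xi>)
    obtain N where N: "1 / real (Suc N) < norm \<xi> / 2" using reals_Archimedean[of "norm \<xi> / 2"] elim by (auto simp: inverse_eq_divide)
    have "Gn n \<xi> = riesz_fourier s u \<xi>" if "n \<ge> N" for n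
    proof -
      have "?r n \<le> ?r N" using that by (intro divide_left_mono) auto
      then have "annular_step (?r n) \<xi> = 1" using N by (intro annular_step_1) auto
      then show ?thesis by (simp add: Gn_def riesz_fourier_def)
    qed
    then show ?case by (intro tendsto_eventually eventually_sequentiallyI)
  qed
  ultimately show thesis by (rule that)
qed

text \<open>For real u, up to a null set, the function at which \<open>fgf\<close> evaluates the
  white noise. The real part makes it real by type and loses nothing for such u.\<close>

definition riesz_root :: "'a \<Rightarrow> real" where
  "riesz_root x = Re (inv_fourier (riesz_fourier s u) x)"

lemma riesz_root_measurable: "riesz_root \<in> borel_measurable borel"
proof -
  note [measurable] = inv_fourier_measurable[OF riesz_fourier_integrable]
  show ?thesis unfolding riesz_root_def[abs_def] by measurable
qed

text \<open>For real u the transform G satisfies cnj (G \<xi>) = G (- \<xi>), so its inverse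
  transform is real.\<close>

lemma inv_fourier_eq_riesz_root:
  assumes real: "\<And>x. cnj (u x) = u x"
  shows "inv_fourier (riesz_fourier s u) x = complex_of_real (riesz_root x)"
proof -
  let ?G = "riesz_fourier s u" and ?c = "complex_of_real (1 / (2 * pi) ^ DIM('a))"
  note [measurable] = measurable_riesz_fourier
  have G: "cnj (?G \<xi>) = ?G (0 - \<xi>)" for \<xi>
  proof -
    have "cnj (fourier u \<xi>) = fourier u (0 - \<xi>)"
      unfolding cnj_fourier real by (simp add: fourier_def)
    then show ?thesis by (simp add: riesz_fourier_def)
  qed
  have "cnj (inv_fourier ?G x) = ?c * cnj (fourier ?G (0 - x))"
    unfolding inv_fourier_eq_fourier by simp
  also have "cnj (fourier ?G (0 - x)) = (LINT \<xi>|lborel. cis ((0 - \<xi>) \<bullet> x) * ?G (0 - \<xi>))"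
    unfolding cnj_fourier G by simp
  also have "\<dots> = (LINT \<xi>|lborel. cis (\<xi> \<bullet> x) * ?G \<xi>)"
    by (rule lborel_integral_reflect) measurable
  also have "?c * \<dots> = inv_fourier ?G x" unfolding inv_fourier_def by (simp add: inner_commute)
  finally have "Im (inv_fourier ?G x) = 0" by (simp add: complex_eq_iff)
  then show ?thesis unfolding riesz_root_def by (simp add: complex_eq_iff)
qed

lemma riesz_root_plancherel:
  assumes real: "\<And>x. cnj (u x) = u x"
  shows "integrable lborel (\<lambda>x. (riesz_root x)\<^sup>2)"
    and "(LINT x|lborel. (riesz_root x)\<^sup>2) = 1 / (2 * pi) ^ DIM('a) * (LINT \<xi>|lborel. (norm (riesz_fourier s u \<xi>))\<^sup>2)"
proof -
  obtain Gn where Gn: "\<And>n. rapid (Gn n)" "\<And>n \<xi>. norm (Gn n \<xi>) \<le> norm (riesz_fourier s u \<xi>)"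
    "AE \<xi> in lborel. (\<lambda>n. Gn n \<xi>) \<longlonglongrightarrow> riesz_fourier s u \<xi>"
    using riesz_fourier_approx by blast
  have sq: "(norm (inv_fourier (riesz_fourier s u) x))\<^sup>2 = (riesz_root x)\<^sup>2" for x
    unfolding inv_fourier_eq_riesz_root[OF real] by simp
  note P = inv_fourier_plancherel[OF riesz_fourier_integrable riesz_fourier_square_integrable Gn]
  show "integrable lborel (\<lambda>x. (riesz_root x)\<^sup>2)" using P(1) unfolding sq .
  show "(LINT x|lborel. (riesz_root x)\<^sup>2) = 1 / (2 * pi) ^ DIM('a) * (LINT \<xi>|lborel. (norm (riesz_fourier s u \<xi>))\<^sup>2)"
    using P(2) unfolding sq .
qed

lemma riesz_root_L2: "(\<And>x. cnj (u x) = u x) \<Longrightarrow> riesz_root \<in> L2"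
  unfolding L2_def using riesz_root_plancherel(1) riesz_root_measurable by simp

end

lemma fourier_schwartz:
  assumes f: "integrable lborel f" and \<theta>: "\<theta> \<in> schwartz"
  shows "integrable lborel (\<lambda>\<xi>. fourier f \<xi> * \<theta> \<xi>)"
    and "(LINT x|lborel. f x * fourier \<theta> x) = (LINT \<xi>|lborel. fourier f \<xi> * \<theta> \<xi>)"
proof -
  note \<theta>i = schwartz_integrable[OF \<theta>]
  note [measurable] = fourier_measurable[OF f] schwartz_measurable[OF \<theta>]
  define C where "C = (LINT x|lborel. norm (f x))"
  have C: "norm (fourier f \<xi>) \<le> C" for \<xi> unfolding C_def by (rule norm_fourier_le)
  have C0: "C \<ge> 0" by (simp add: C_def)
  show "integrable lborel (\<lambda>\<xi>. fourier f \<xi> * \<theta> \<xi>)"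
  proof (rule Bochner_Integration.integrable_bound)
    show "integrable lborel (\<lambda>\<xi>. C * norm (\<theta> \<xi>))" using \<theta>i by simp
    show "AE \<xi> in lborel. norm (fourier f \<xi> * \<theta> \<xi>) \<le> norm (C * norm (\<theta> \<xi>))"
      using C C0 by (intro AE_I2) (auto simp: norm_mult abs_mult intro!: mult_right_mono)
  qed measurable
  have k: "(\<lambda>(x, y). cis (- (y \<bullet> x))) \<in> borel_measurable (borel \<Otimes>\<^sub>M (borel :: 'a measure))"
    by measurable
  show "(LINT x|lborel. f x * fourier \<theta> x) = (LINT \<xi>|lborel. fourier f \<xi> * \<theta> \<xi>)"
    using fubini_mult[OF f \<theta>i k, of 1] by (simp add: fourier_def inner_commute)
qed

lemma represents_fourier:
  assumes u: "rapid u"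
  shows "represents (fourier u) (distr_fourier (distr_of u))"
  unfolding represents_def distr_fourier_def distr_of_def
  using fourier_schwartz[OF rapid_integrable[OF u]] fourier_measurable[OF rapid_integrable[OF u]] by simp

text \<open>The function picked by \<open>SOME\<close> agrees with \<open>fourier u\<close> almost
  everywhere, and Fubini's theorem moves the inverse transform from the test function to the
  multiplier times \<open>fourier u\<close>.\<close>

lemma frac_laplacian_eq:
  assumes u: "rapid u" and i: "integrable lborel (riesz_fourier s u)" and \<theta>: "\<theta> \<in> schwartz"
  shows "frac_laplacian (- s / 2) (distr_of u) \<theta> = (LINT x|lborel. inv_fourier (riesz_fourier s u) x * \<theta> x)"
    and "integrable lborel (\<lambda>x. inv_fourier (riesz_fourier s u) x * \<theta> x)"
proof -
  let ?G = "riesz_fourier s u" and ?c = "complex_of_real (1 / (2 * pi) ^ DIM('a))"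
  define v where "v = (SOME v. represents v (distr_fourier (distr_of u)))"
  have r: "represents v (distr_fourier (distr_of u))"
    unfolding v_def by (rule someI[of "\<lambda>v. represents v (distr_fourier (distr_of u))", OF represents_fourier[OF u]])
  have [measurable]: "v \<in> borel_measurable borel" using r by (simp add: represents_def)
  note \<theta>i = schwartz_integrable[OF \<theta>]
  note [measurable] = inv_fourier_measurable[OF \<theta>i] schwartz_measurable[OF \<theta>] inv_fourier_measurable[OF i]
  have [measurable]: "?G \<in> borel_measurable borel" using borel_measurable_integrable[OF i] by simp
  have "frac_laplacian (- s / 2) (distr_of u) \<theta> =
      (LINT \<xi>|lborel. complex_of_real (norm \<xi> powr (2 * (- s / 2))) * v \<xi> * inv_fourier \<theta> \<xi>)"
    unfolding frac_laplacian_def distr_inv_fourier_def distr_of_def[of "\<lambda>\<xi>. complex_of_real (norm \<xi> powr (2 * (- s / 2))) * _ \<xi>"] v_def ..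
  also have "\<dots> = (LINT \<xi>|lborel. ?G \<xi> * inv_fourier \<theta> \<xi>)"
  proof (rule integral_cong_AE)
    show "AE \<xi> in lborel. complex_of_real (norm \<xi> powr (2 * (- s / 2))) * v \<xi> * inv_fourier \<theta> \<xi> = ?G \<xi> * inv_fourier \<theta> \<xi>"
      using represents_unique[OF r represents_fourier[OF u]]
      by eventually_elim (simp add: riesz_fourier_def)
  qed measurable
  also have "\<dots> = (LINT \<xi>|lborel. ?c * (?G \<xi> * (LINT x|lborel. cis (\<xi> \<bullet> x) * \<theta> x)))"
    unfolding inv_fourier_def by (simp only: mult_ac)
  also have "\<dots> = ?c * (LINT \<xi>|lborel. ?G \<xi> * (LINT x|lborel. cis (\<xi> \<bullet> x) * \<theta> x))"
    by (rule integral_mult_right_zero)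
  also have "(LINT \<xi>|lborel. ?G \<xi> * (LINT x|lborel. cis (\<xi> \<bullet> x) * \<theta> x)) =
      (LINT x|lborel. (LINT \<xi>|lborel. cis (\<xi> \<bullet> x) * ?G \<xi>) * \<theta> x)"
  proof -
    have k: "(\<lambda>(x, y). cis (x \<bullet> y)) \<in> borel_measurable (borel \<Otimes>\<^sub>M (borel :: 'a measure))"
      by measurable
    show ?thesis using fubini_mult[OF i \<theta>i k, of 1] by simp
  qed
  also have "?c * \<dots> = (LINT x|lborel. ?c * ((LINT \<xi>|lborel. cis (\<xi> \<bullet> x) * ?G \<xi>) * \<theta> x))"
    by (rule integral_mult_right_zero[symmetric])
  also have "\<dots> = (LINT x|lborel. inv_fourier ?G x * \<theta> x)"
    unfolding inv_fourier_def by (simp only: mult.assoc inner_commute)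
  finally show "frac_laplacian (- s / 2) (distr_of u) \<theta> = (LINT x|lborel. inv_fourier ?G x * \<theta> x)" .
  obtain C where C: "C \<ge> 0" "\<And>x. norm (inv_fourier ?G x) \<le> C" using inv_fourier_bounded[OF i] by blast
  show "integrable lborel (\<lambda>x. inv_fourier ?G x * \<theta> x)"
  proof (rule Bochner_Integration.integrable_bound)
    show "integrable lborel (\<lambda>x. C * norm (\<theta> x))" using \<theta>i by simp
    show "AE x in lborel. norm (inv_fourier ?G x * \<theta> x) \<le> norm (C * norm (\<theta> x))"
      using C by (intro AE_I2) (auto simp: norm_mult abs_mult intro!: mult_right_mono)
  qed measurable
qed

text \<open>\<open>riesz_root\<close> witnesses that the choice in \<open>fgf\<close> is possible,
  and uniqueness compares it with the chosen g. As W is applied to functions and not to classes, g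
  itself is kept and equality is only almost everywhere.\<close>

lemma fgf_eq:
  fixes u :: "real ^ 'd \<Rightarrow> complex"
  assumes adm: "riesz_admissible s u" and real: "\<And>x. cnj (u x) = u x"
  obtains g where "g \<in> L2" "AE x in lborel. g x = riesz_admissible.riesz_root s u x" "fgf W s (distr_of u) = W g"
proof -
  interpret riesz_admissible s u by (rule adm)
  let ?P = "\<lambda>g. g \<in> L2 \<and> represents (\<lambda>x. complex_of_real (g x)) (frac_laplacian (- s / 2) (distr_of u))"
  have root: "?P riesz_root"
  proof
    show "represents (\<lambda>x. complex_of_real (riesz_root x)) (frac_laplacian (- s / 2) (distr_of u))"
      unfolding represents_def inv_fourier_eq_riesz_root[OF real, symmetric]
      using frac_laplacian_eq[OF u riesz_fourier_integrable] inv_fourier_measurable[OF riesz_fourier_integrable]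
      by (simp add: distr_of_def)
  qed (rule riesz_root_L2[OF real])
  define g where "g = (SOME g. ?P g)"
  have g: "?P g" unfolding g_def by (rule someI[of ?P, OF root])
  show thesis
  proof
    show "g \<in> L2" using g by blast
    show "AE x in lborel. g x = riesz_root x"
      using represents_unique[OF conjunct2[OF g] conjunct2[OF root]] by simp
    show "fgf W s (distr_of u) = W g" unfolding fgf_def g_def ..
  qed
qed

text \<open>Polarization of the Plancherel identity, applied to u + v and u - v.\<close>

lemma riesz_root_covariance:
  fixes u v :: "'a::euclidean_space \<Rightarrow> complex"
  assumes u: "riesz_admissible s u" and v: "riesz_admissible s v"
    and ur: "\<And>x. cnj (u x) = u x" and vr: "\<And>x. cnj (v x) = v x"
  defines "V \<equiv> \<lambda>\<xi>. fourier u \<xi> * cnj (fourier v \<xi>) * complex_of_real (norm \<xi> powr (- 2 * s))"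
  shows "integrable lborel V"
    and "(LINT x|lborel. riesz_admissible.riesz_root s u x * riesz_admissible.riesz_root s v x) =
      1 / (2 * pi) ^ DIM('a) * Re (LINT \<xi>|lborel. V \<xi>)"
proof -
  interpret u: riesz_admissible s u by (rule u)
  interpret v: riesz_admissible s v by (rule v)
  let ?c = "1 / (2 * pi) ^ DIM('a)"
  have V: "V \<xi> = riesz_fourier s u \<xi> * cnj (riesz_fourier s v \<xi>)" for \<xi>
  proof -
    have "norm \<xi> powr (- 2 * s) = norm \<xi> powr (- s) * norm \<xi> powr (- s)" by (simp add: powr_add[symmetric])
    then show ?thesis by (simp add: V_def riesz_fourier_def)
  qed
  note [measurable] = u.measurable_riesz_fourier v.measurable_riesz_fourier
  show Vi: "integrable lborel V"
  proof (rule Bochner_Integration.integrable_bound)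
    show "integrable lborel (\<lambda>\<xi>. (norm (riesz_fourier s u \<xi>))\<^sup>2 / 2 + (norm (riesz_fourier s v \<xi>))\<^sup>2 / 2)"
      by (intro Bochner_Integration.integrable_add integrable_divide u.riesz_fourier_square_integrable v.riesz_fourier_square_integrable)
    have "norm (z * cnj w) \<le> norm ((norm z)\<^sup>2 / 2 + (norm w)\<^sup>2 / 2)" for z w :: complex
      using sum_squares_bound[of "norm z" "norm w"] by (simp add: norm_mult)
    then show "AE \<xi> in lborel. norm (V \<xi>) \<le> norm ((norm (riesz_fourier s u \<xi>))\<^sup>2 / 2 + (norm (riesz_fourier s v \<xi>))\<^sup>2 / 2)"
      unfolding V by blast
    show "V \<in> borel_measurable lborel" unfolding V[abs_def] by measurable
  qed
  \<comment> \<open>The condition on e says that it is real, so the combination stays real-valued; e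
    = 1 and e = -1 are the cases polarized below.\<close>
  have combo: "riesz_admissible s (\<lambda>x. u x + e * v x)" (is ?adm)
    and combo_fourier: "riesz_fourier s (\<lambda>x. u x + e * v x) \<xi> = riesz_fourier s u \<xi> + e * riesz_fourier s v \<xi>"
    and combo_root: "riesz_admissible.riesz_root s (\<lambda>x. u x + e * v x) x = u.riesz_root x + Re e * v.riesz_root x"
    if e: "cnj e = e" for e \<xi> x
  proof -
    have F: "fourier (\<lambda>x. u x + e * v x) \<xi> = fourier u \<xi> + e * fourier v \<xi>" for \<xi>
      using fourier_add[OF rapid_integrable[OF u.u] rapid_integrable[OF rapid_cmult[OF v.u]]] by (simp add: fourier_cmult)
    show adm: ?adm
    proof
      show "rapid (\<lambda>x. u x + e * v x)" by (intro rapid_add rapid_cmult u.u v.u)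
      show "real DIM('a) / 2 \<le> s \<Longrightarrow> fourier (\<lambda>x. u x + e * v x) 0 = 0" using u.zero v.zero by (simp add: F)
    qed (fact u.s0 u.s1)+
    have RF: "riesz_fourier s (\<lambda>x. u x + e * v x) = (\<lambda>\<xi>. riesz_fourier s u \<xi> + e * riesz_fourier s v \<xi>)"
      by (rule ext) (simp add: riesz_fourier_def F distrib_left)
    then show "riesz_fourier s (\<lambda>x. u x + e * v x) \<xi> = riesz_fourier s u \<xi> + e * riesz_fourier s v \<xi>" by simp
    interpret w: riesz_admissible s "\<lambda>x. u x + e * v x" by (rule adm)
    have "inv_fourier (riesz_fourier s (\<lambda>x. u x + e * v x)) x = inv_fourier (riesz_fourier s u) x + e * inv_fourier (riesz_fourier s v) x"
      unfolding RF inv_fourier_eq_fourier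
      using fourier_add[OF u.riesz_fourier_integrable integrable_mult_right[OF v.riesz_fourier_integrable], of e "0 - x"]
      by (simp add: fourier_cmult algebra_simps)
    then show "w.riesz_root x = u.riesz_root x + Re e * v.riesz_root x"
      unfolding w.riesz_root_def u.inv_fourier_eq_riesz_root[OF ur] v.inv_fourier_eq_riesz_root[OF vr]
      by simp
  qed
  have P: "integrable lborel (\<lambda>x. (u.riesz_root x + e * v.riesz_root x)\<^sup>2)"
    "(LINT x|lborel. (u.riesz_root x + e * v.riesz_root x)\<^sup>2) =
      ?c * (LINT \<xi>|lborel. (norm (riesz_fourier s u \<xi> + complex_of_real e * riesz_fourier s v \<xi>))\<^sup>2)"
    "integrable lborel (\<lambda>\<xi>. (norm (riesz_fourier s u \<xi> + complex_of_real e * riesz_fourier s v \<xi>))\<^sup>2)" for e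
  proof -
    have e: "cnj (complex_of_real e) = complex_of_real e" by simp
    have r: "cnj (u x + complex_of_real e * v x) = u x + complex_of_real e * v x" for x by (simp add: ur vr)
    note R = riesz_admissible.riesz_root_plancherel[OF combo[OF e] r, unfolded combo_root[OF e] combo_fourier[OF e] Re_complex_of_real]
    show "integrable lborel (\<lambda>x. (u.riesz_root x + e * v.riesz_root x)\<^sup>2)"
      "(LINT x|lborel. (u.riesz_root x + e * v.riesz_root x)\<^sup>2) =
      ?c * (LINT \<xi>|lborel. (norm (riesz_fourier s u \<xi> + complex_of_real e * riesz_fourier s v \<xi>))\<^sup>2)"
      by (fact R)+
    show "integrable lborel (\<lambda>\<xi>. (norm (riesz_fourier s u \<xi> + complex_of_real e * riesz_fourier s v \<xi>))\<^sup>2)"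
      using riesz_admissible.riesz_fourier_square_integrable[OF combo[OF e]] unfolding combo_fourier[OF e] .
  qed
  have "(LINT x|lborel. u.riesz_root x * v.riesz_root x) =
      (LINT x|lborel. ((u.riesz_root x + 1 * v.riesz_root x)\<^sup>2 - (u.riesz_root x + (- 1) * v.riesz_root x)\<^sup>2) / 4)"
    by (intro Bochner_Integration.integral_cong refl) (simp add: power2_eq_square algebra_simps)
  also have "\<dots> = ((LINT x|lborel. (u.riesz_root x + 1 * v.riesz_root x)\<^sup>2) - (LINT x|lborel. (u.riesz_root x + (- 1) * v.riesz_root x)\<^sup>2)) / 4"
    by (simp only: integral_divide_zero Bochner_Integration.integral_diff[OF P(1) P(1)])
  also have "\<dots> = ?c * (((LINT \<xi>|lborel. (norm (riesz_fourier s u \<xi> + complex_of_real 1 * riesz_fourier s v \<xi>))\<^sup>2) -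
      (LINT \<xi>|lborel. (norm (riesz_fourier s u \<xi> + complex_of_real (- 1) * riesz_fourier s v \<xi>))\<^sup>2)) / 4)"
    unfolding P(2) right_diff_distrib[symmetric] times_divide_eq_right ..
  also have "((LINT \<xi>|lborel. (norm (riesz_fourier s u \<xi> + complex_of_real 1 * riesz_fourier s v \<xi>))\<^sup>2) -
      (LINT \<xi>|lborel. (norm (riesz_fourier s u \<xi> + complex_of_real (- 1) * riesz_fourier s v \<xi>))\<^sup>2)) / 4 =
      (LINT \<xi>|lborel. ((norm (riesz_fourier s u \<xi> + complex_of_real 1 * riesz_fourier s v \<xi>))\<^sup>2 -
       (norm (riesz_fourier s u \<xi> + complex_of_real (- 1) * riesz_fourier s v \<xi>))\<^sup>2) / 4)"
    by (simp only: integral_divide_zero Bochner_Integration.integral_diff[OF P(3) P(3)])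
  also have "\<dots> = (LINT \<xi>|lborel. Re (V \<xi>))"
    unfolding V cmod_power2 by (intro Bochner_Integration.integral_cong refl) (simp add: power2_eq_square algebra_simps)
  also have "\<dots> = Re (LINT \<xi>|lborel. V \<xi>)" by (rule integral_Re[OF Vi])
  finally show "(LINT x|lborel. u.riesz_root x * v.riesz_root x) = ?c * Re (LINT \<xi>|lborel. V \<xi>)" .
qed

section \<open>Support, covariance and symbol of the random field\<close>

section \<open>The fractional Gaussian field\<close>

lemma isCont_fourier:
  assumes f: "integrable lborel f"
  shows "isCont (fourier f) \<xi>"
  unfolding continuous_at_sequentially
proof (intro allI impI)
  fix x :: "nat \<Rightarrow> 'a"
  assume x: "x \<longlonglongrightarrow> \<xi>"
  note [measurable] = borel_measurable_integrable[OF f]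
  have "(\<lambda>n. LINT y|lborel. cis (- (y \<bullet> x n)) * f y) \<longlonglongrightarrow> (LINT y|lborel. cis (- (y \<bullet> \<xi>)) * f y)"
  proof (rule integral_dominated_convergence[where w = "\<lambda>y. norm (f y)"])
    have "(\<lambda>n. cis (- (y \<bullet> x n)) * f y) \<longlonglongrightarrow> cis (- (y \<bullet> \<xi>)) * f y" for y
      unfolding cis_conv_exp by (intro tendsto_intros x)
    then show "AE y in lborel. (\<lambda>n. cis (- (y \<bullet> x n)) * f y) \<longlonglongrightarrow> cis (- (y \<bullet> \<xi>)) * f y" by simp
  qed (use f in \<open>auto simp: norm_mult\<close>)
  then show "(fourier f \<circ> x) \<longlonglongrightarrow> fourier f \<xi>" by (simp add: fourier_def comp_def)
qed

lemma fourier_at_0: "fourier f 0 = (LINT x|lborel. f x)"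
  by (simp add: fourier_def)

lemma T_space_fourier_zero:
  fixes u :: "real ^ 'd \<Rightarrow> complex"
  assumes u: "rapid u" and T: "distr_of u \<in> T_space s" and s: "real CARD('d) / 2 \<le> s"
  shows "fourier u 0 = 0"
proof (rule ccontr)
  assume z: "fourier u 0 \<noteq> 0"
  define c where "c = norm (fourier u 0) / 2"
  have c: "c > 0" using z by (simp add: c_def)
  \<comment> \<open>The distance turns out to be infinite, so a single approximant at distance less
    than 1 is contradictory.\<close>
  obtain v \<phi> where v: "represents v (distr_fourier (distr_of u))"
    and \<phi>: "\<phi> \<in> schwartz_moments (s - real CARD('d) / 2)"
    and lt: "(\<integral>\<^sup>+\<xi>. ennreal ((norm \<xi> powr (- s) * norm (v \<xi> - fourier (\<lambda>x. complex_of_real (\<phi> x)) \<xi>))\<^sup>2) \<partial>lborel) < ennreal (1\<^sup>2)"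
  proof -
    obtain v where "represents v (distr_fourier (distr_of u))"
      "\<forall>\<epsilon>>0. \<exists>\<phi>\<in>schwartz_moments (s - real CARD('d) / 2).
        (\<integral>\<^sup>+\<xi>. ennreal ((norm \<xi> powr (- s) * norm (v \<xi> - fourier (\<lambda>x. complex_of_real (\<phi> x)) \<xi>))\<^sup>2) \<partial>lborel) < ennreal (\<epsilon>\<^sup>2)"
      using T unfolding T_space_def mem_Collect_eq by (elim exE conjE)
    from this(1) this(2)[rule_format, OF zero_less_one] show thesis by (elim bexE) (rule that)
  qed
  define h where "h \<xi> = fourier u \<xi> - fourier (\<lambda>x. complex_of_real (\<phi> x)) \<xi>" for \<xi>
  have \<phi>i: "integrable lborel (\<lambda>x. complex_of_real (\<phi> x))"
    using \<phi> by (intro integrable_of_real schwartz_integrable) (simp add: schwartz_moments_def)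
  \<comment> \<open>The zero multi-index satisfies the bound because s - d/2 \<ge> 0; its moment is
    the integral of \<phi>.\<close>
  have "(LINT x|lborel. (\<Prod>i\<in>UNIV. (x $ i) ^ (0::nat)) * \<phi> x) = 0"
  proof -
    have "\<forall>\<alpha> :: 'd \<Rightarrow> nat. real (\<Sum>i\<in>UNIV. \<alpha> i) \<le> s - real CARD('d) / 2 \<longrightarrow> (LINT x|lborel. (\<Prod>i\<in>UNIV. (x $ i) ^ \<alpha> i) * \<phi> x) = 0"
      using \<phi> unfolding schwartz_moments_def mem_Collect_eq by (rule conjunct2)
    from this[rule_format, of "\<lambda>_. 0"] s show ?thesis by simp
  qed
  then have \<phi>0: "fourier (\<lambda>x. complex_of_real (\<phi> x)) 0 = 0"
    by (simp add: fourier_at_0)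
  have "isCont h 0" unfolding h_def[abs_def]
    by (intro continuous_diff isCont_fourier[OF rapid_integrable[OF u]] isCont_fourier[OF \<phi>i])
  moreover have "h 0 = fourier u 0" by (simp add: h_def \<phi>0)
  ultimately obtain \<delta>0 where \<delta>0: "\<delta>0 > 0" "\<And>\<xi>. dist \<xi> 0 < \<delta>0 \<Longrightarrow> dist (h \<xi>) (fourier u 0) < c"
    using c unfolding continuous_at_eps_delta by metis
  define \<delta> where "\<delta> = min 1 \<delta>0"
  have \<delta>: "0 < \<delta>" "\<delta> \<le> 1" using \<delta>0(1) by (auto simp: \<delta>_def)
  have h: "c \<le> norm (h \<xi>)" if "\<xi> \<in> ball 0 \<delta>" for \<xi>
  proof -
    have "dist (h \<xi>) (fourier u 0) < c" using that \<delta>0(2)[of \<xi>] by (simp add: \<delta>_def dist_commute)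
    then show ?thesis using norm_triangle_sub[of "fourier u 0" "h \<xi>"] by (simp add: c_def dist_norm norm_minus_commute)
  qed
  \<comment> \<open>Near the origin the difference of the transforms has norm at least c, so the
    squared distance dominates c^2 times the integral of norm \<xi> powr (- 2 * s) over a ball,
    infinite because 2 * s \<ge> d.\<close>
  have "\<infinity> = ennreal (c\<^sup>2) * (\<integral>\<^sup>+\<xi>. ennreal (indicator (ball 0 \<delta>) \<xi> * norm (\<xi> :: real ^ 'd) powr (- (2 * s))) \<partial>lborel)"
    using nn_integral_norm_powr_ball[OF \<delta>, of "2 * s", where 'a = "real ^ 'd"] s c by (simp add: ennreal_mult_top)
  also have "\<dots> = (\<integral>\<^sup>+\<xi>. ennreal (c\<^sup>2) * ennreal (indicator (ball 0 \<delta>) \<xi> * norm (\<xi> :: real ^ 'd) powr (- (2 * s))) \<partial>lborel)"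
  proof (rule nn_integral_cmult[symmetric])
    have [measurable]: "ball (0 :: real ^ 'd) \<delta> \<in> sets borel" by simp
    show "(\<lambda>\<xi> :: real ^ 'd. ennreal (indicator (ball 0 \<delta>) \<xi> * norm \<xi> powr (- (2 * s)))) \<in> borel_measurable lborel"
      by measurable
  qed
  also have "\<dots> \<le> (\<integral>\<^sup>+\<xi>. ennreal ((norm \<xi> powr (- s) * norm (v \<xi> - fourier (\<lambda>x. complex_of_real (\<phi> x)) \<xi>))\<^sup>2) \<partial>lborel)"
  proof (rule nn_integral_mono_AE)
    show "AE \<xi> in lborel. ennreal (c\<^sup>2) * ennreal (indicator (ball 0 \<delta>) \<xi> * norm \<xi> powr (- (2 * s)))
        \<le> ennreal ((norm \<xi> powr (- s) * norm (v \<xi> - fourier (\<lambda>x. complex_of_real (\<phi> x)) \<xi>))\<^sup>2)"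
      using represents_unique[OF v represents_fourier[OF u]]
    proof eventually_elim
      case (elim \<xi>)
      have v: "v \<xi> - fourier (\<lambda>x. complex_of_real (\<phi> x)) \<xi> = h \<xi>" by (simp add: elim h_def)
      show ?case
      proof (cases "\<xi> \<in> ball 0 \<delta>")
        case True
        have "c\<^sup>2 * norm \<xi> powr (- (2 * s)) = (norm \<xi> powr (- s) * c)\<^sup>2"
          by (simp add: power_mult_distrib power2_eq_square powr_add[symmetric])
        also have "\<dots> \<le> (norm \<xi> powr (- s) * norm (h \<xi>))\<^sup>2"
          using h[OF True] c by (intro power_mono mult_left_mono) auto
        finally show ?thesis unfolding v using True by (simp add: ennreal_mult[symmetric] ennreal_leI)
      qed simp
    qed
  qed
  finally show False using lt by (simp add: top_unique)
qed

lemma smooth_of_real: "smooth f \<Longrightarrow> smooth (\<lambda>x. complex_of_real (f x))"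
  unfolding smooth_iff_Ck by (blast intro: bounded_derivs_bounded_linear[OF bounded_linear_of_real])

lemma smooth_mult_real:
  fixes f g :: "'a::euclidean_space \<Rightarrow> real"
  assumes "smooth f" "smooth g"
  shows "smooth (\<lambda>x. f x * g x)"
proof -
  have "smooth (\<lambda>x. complex_of_real (f x) * complex_of_real (g x))"
    by (intro smooth_mult_complex smooth_of_real assms)
  from bounded_derivs_bounded_linear[OF bounded_linear_Re _ smooth_imp_Ck[OF this]]
  show ?thesis unfolding smooth_iff_Ck by simp
qed

lemma zero_outside_supp: "x \<notin> supp f \<Longrightarrow> f x = 0"
  unfolding supp_def using closure_subset[of "{x. f x \<noteq> 0}"] by blast

lemma test_functions_of_real:
  "f \<in> test_functions U \<Longrightarrow> (\<lambda>x. complex_of_real (f x)) \<in> test_functions U"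
  by (simp add: test_functions_def supp_def smooth_of_real)

lemma test_functions_mult:
  fixes f g :: "'a::euclidean_space \<Rightarrow> real"
  assumes f: "f \<in> test_functions U" and g: "smooth g"
  shows "(\<lambda>x. f x * g x) \<in> test_functions U"
proof -
  have "supp (\<lambda>x. f x * g x) \<subseteq> supp f" unfolding supp_def by (intro closure_mono) auto
  moreover have "closed (supp (\<lambda>x. f x * g x))" by (simp add: supp_def)
  ultimately have "compact (supp (\<lambda>x. f x * g x))"
    using f compact_Int_closed[of "supp f" "supp (\<lambda>x. f x * g x)"] by (simp add: test_functions_def Int_absorb1)
  with \<open>supp (\<lambda>x. f x * g x) \<subseteq> supp f\<close> show ?thesis
    using f g by (auto simp: test_functions_def smooth_mult_real)
qed

lemma test_functions_vanish:
  assumes "f \<in> test_functions U"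
  obtains R where "R > 0" "\<And>x. norm x > R \<Longrightarrow> f x = 0"
proof -
  have "bounded (supp f)" using assms by (simp add: test_functions_def compact_imp_bounded)
  then obtain R where R: "R > 0" "\<And>x. x \<in> supp f \<Longrightarrow> norm x \<le> R" by (auto simp: bounded_pos)
  show thesis
  proof (rule that[OF R(1)])
    fix x :: 'a
    assume "norm x > R"
    then have "x \<notin> supp f" using R(2) by force
    then show "f x = 0" by (rule zero_outside_supp)
  qed
qed

lemma iter_deriv_zero: "iter_deriv vs (\<lambda>_. 0) = (\<lambda>_. 0)"
  by (induction vs) (simp_all add: iter_deriv_Cons del: iter_deriv.simps(2))

lemma zero_in_schwartz_moments: "(\<lambda>_. 0) \<in> schwartz_moments r"
  by (simp add: schwartz_moments_def schwartz_def smooth_def iter_deriv_zero)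

lemma centered_gaussian_square_integrable:
  assumes "centered_gaussian M X"
  shows "integrable M (\<lambda>\<omega>. (X \<omega>)\<^sup>2)"
proof -
  have Xm[measurable]: "X \<in> borel_measurable M" using assms by (simp add: centered_gaussian_def)
  consider "AE \<omega> in M. X \<omega> = 0" | \<sigma> where "\<sigma> > 0" "distributed M lborel X (normal_density 0 \<sigma>)"
    using assms by (auto simp: centered_gaussian_def)
  then show ?thesis
  proof cases
    case 1
    then have "AE \<omega> in M. 0 = (X \<omega>)\<^sup>2" by eventually_elim simp
    then show ?thesis
      by (rule integrable_cong_AE_imp[rotated -1]) auto
  next
    case 2
    have "integrable lborel (\<lambda>x. normal_density 0 \<sigma> x * x\<^sup>2)"
      using integrable_normal_moment[OF 2(1), of 0 2] by simp
    then show ?thesis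
      using distributed_integrable[OF 2(2), of "\<lambda>x. x\<^sup>2"] by simp
  qed
qed

lemma white_noise_L2:
  assumes W: "white_noise M W" and g: "g \<in> L2" and h: "h \<in> L2"
  shows "integrable M (\<lambda>\<omega>. W g \<omega> * W h \<omega>)"
    and "(LINT \<omega>|M. W g \<omega> * W h \<omega>) = (LINT x|lborel. g x * h x)"
proof -
  have G: "centered_gaussian M (W g)" "centered_gaussian M (W h)"
    using W g h by (auto simp: white_noise_def)
  have [measurable]: "W g \<in> borel_measurable M" "W h \<in> borel_measurable M"
    using G by (simp_all add: centered_gaussian_def)
  show "integrable M (\<lambda>\<omega>. W g \<omega> * W h \<omega>)"
  proof (rule Bochner_Integration.integrable_bound)
    show "integrable M (\<lambda>\<omega>. (W g \<omega>)\<^sup>2 / 2 + (W h \<omega>)\<^sup>2 / 2)"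
      by (intro Bochner_Integration.integrable_add integrable_divide centered_gaussian_square_integrable G)
    have "norm (a * b) \<le> norm (a\<^sup>2 / 2 + b\<^sup>2 / 2)" for a b :: real
      using sum_squares_bound[of "\<bar>a\<bar>" "\<bar>b\<bar>"] by (simp add: abs_mult)
    then show "AE \<omega> in M. norm (W g \<omega> * W h \<omega>) \<le> norm ((W g \<omega>)\<^sup>2 / 2 + (W h \<omega>)\<^sup>2 / 2)" by blast
  qed measurable
  show "(LINT \<omega>|M. W g \<omega> * W h \<omega>) = (LINT x|lborel. g x * h x)"
    using W g h by (simp add: white_noise_def)
qed

lemma mult_field_dom_admissible:
  fixes a :: "real ^ 'd \<Rightarrow> real"
  assumes a: "a \<in> test_functions UNIV" and s: "0 \<le> s" "s < real CARD('d) / 2 + 1"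
    and \<phi>: "\<phi> \<in> mult_field_dom a (T_space s)"
  shows "riesz_admissible s (\<lambda>x. complex_of_real (a x * \<phi> x))"
proof
  have sm: "smooth \<phi>" and T: "distr_of (\<lambda>x. complex_of_real (a x * \<phi> x)) \<in> T_space s"
    using \<phi> by (auto simp: mult_field_dom_def test_functions_def)
  show r: "rapid (\<lambda>x. complex_of_real (a x * \<phi> x))"
    using test_functions_rapid[OF test_functions_of_real[OF test_functions_mult[OF a sm]]] .
  show "0 \<le> s" by (rule s)
  show "s < real DIM(real ^ 'd) / 2 + 1" using s by simp
  show "real DIM(real ^ 'd) / 2 \<le> s \<Longrightarrow> fourier (\<lambda>x. complex_of_real (a x * \<phi> x)) 0 = 0"
    using T_space_fourier_zero[OF r T] by simp
qed

text \<open>For every test function supported off supp a the product with a is identically 0, so all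
  of them give the same random variable W g. A single null set therefore serves this uncountable
  family.\<close>

lemma field_support_subset:
  fixes a :: "real ^ 'd \<Rightarrow> real"
  assumes W: "white_noise M W" and a: "a \<in> test_functions UNIV" and s: "0 \<le> s" "s < real CARD('d) / 2 + 1"
  shows "AE \<omega> in M. field_support (mult_field_dom a (T_space s)) (\<lambda>\<phi>. mult_field a (fgf W s) \<phi> \<omega>) \<subseteq> supp a"
proof -
  let ?z = "\<lambda>_ :: real ^ 'd. 0 :: complex"
  have U: "open (- supp a)" by (simp add: supp_def open_Compl)
  have az: "(\<lambda>x. complex_of_real (a x * \<phi> x)) = ?z" if "\<phi> \<in> test_functions (- supp a)" for \<phi>
  proof (rule ext)
    fix x
    show "complex_of_real (a x * \<phi> x) = 0"
    proof (cases "x \<in> supp a")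
      case True
      then have "x \<notin> supp \<phi>" using that by (auto simp: test_functions_def)
      then show ?thesis by (simp add: zero_outside_supp)
    qed (simp add: zero_outside_supp)
  qed
  have rz: "rapid ?z"
  proof -
    have "rapid (\<lambda>x. 0 * complex_of_real (a x))"
      by (intro rapid_cmult test_functions_rapid[OF test_functions_of_real[OF a]])
    then show ?thesis by simp
  qed
  have Fz: "fourier ?z = ?z" by (rule ext) (simp add: fourier_def)
  \<comment> \<open>\<open>field_support\<close> also demands that the field be defined on these
    test functions; the zero function meets every moment condition and approximates the zero
    distribution exactly.\<close>
  have Tz: "distr_of ?z \<in> T_space s"
    unfolding T_space_def mem_Collect_eq
  proof (intro exI[of _ ?z] conjI allI impI)
    show "represents ?z (distr_fourier (distr_of ?z))" using represents_fourier[OF rz] by (simp only: Fz)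
    fix \<epsilon> :: real
    assume "\<epsilon> > 0"
    then show "\<exists>\<phi>\<in>schwartz_moments (s - real CARD('d) / 2).
        (\<integral>\<^sup>+\<xi>. ennreal ((norm \<xi> powr (- s) * norm (0 - fourier (\<lambda>x :: real ^ 'd. complex_of_real (\<phi> x)) \<xi>))\<^sup>2) \<partial>lborel) < ennreal (\<epsilon>\<^sup>2)"
      by (intro bexI[OF _ zero_in_schwartz_moments]) (simp add: Fz)
  qed
  have adm: "riesz_admissible s ?z"
    using s rz by unfold_locales (auto simp: Fz)
  obtain g where g: "g \<in> L2" "AE x in lborel. g x = riesz_admissible.riesz_root s ?z x" "fgf W s (distr_of ?z) = W g"
    using fgf_eq[OF adm, of W] by auto
  have "riesz_admissible.riesz_root s ?z x = 0" for x
    unfolding riesz_admissible.riesz_root_def[OF adm] by (simp add: inv_fourier_def riesz_fourier_def[abs_def] Fz)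
  with g(2) have g0: "AE x in lborel. g x * g x = 0" by simp
  \<comment> \<open>The second moment of W g is the squared norm of g, which vanishes almost
    everywhere; hence W g is almost surely 0.\<close>
  have "(LINT \<omega>|M. W g \<omega> * W g \<omega>) = 0"
    unfolding white_noise_L2(2)[OF W g(1) g(1)] using g0 by (rule integral_eq_zero_AE)
  then have "AE \<omega> in M. W g \<omega> * W g \<omega> = 0"
    using integral_nonneg_eq_0_iff_AE[OF white_noise_L2(1)[OF W g(1) g(1)]] by simp
  then show ?thesis
  proof eventually_elim
    case (elim \<omega>)
    have "\<phi> \<in> mult_field_dom a (T_space s) \<and> mult_field a (fgf W s) \<phi> \<omega> = 0" if "\<phi> \<in> test_functions (- supp a)" for \<phi>
      using that az[OF that] Tz elim g(3) by (simp add: mult_field_dom_def mult_field_def test_functions_def)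
    with U show ?case unfolding field_support_def by auto
  qed
qed

text \<open>White noise turns the covariance into the inner product of the two roots,
  \<open>riesz_root_covariance\<close> into a frequency integral, and \<open>riesz_form\<close> into
  the double integral of the kernel.\<close>

lemma fgf_covariance:
  fixes a :: "real ^ 'd \<Rightarrow> real"
  assumes W: "white_noise M W" and a: "a \<in> test_functions UNIV" and s: "0 \<le> s" "s < real CARD('d) / 2 + 1"
  shows "covariance_operator M (mult_field_dom a (T_space s)) (mult_field a (fgf W s)) (cov_op a s)"
  unfolding covariance_operator_def Let_def
proof (intro ballI)
  fix \<phi> \<psi>
  assume \<phi>: "\<phi> \<in> mult_field_dom a (T_space s)" and \<psi>: "\<psi> \<in> mult_field_dom a (T_space s)"
  define u where "u x = complex_of_real (a x * \<psi> x)" for x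
  define v where "v x = complex_of_real (a x * \<phi> x)" for x
  have u: "riesz_admissible s u" unfolding u_def[abs_def] by (rule mult_field_dom_admissible[OF a s \<psi>])
  have v: "riesz_admissible s v" unfolding v_def[abs_def] by (rule mult_field_dom_admissible[OF a s \<phi>])
  have ur: "rapid u" and vr: "rapid v" using u v by (simp_all add: riesz_admissible_def)
  have uc: "cnj (u x) = u x" and vc: "cnj (v x) = v x" for x by (simp_all add: u_def v_def)
  let ?V = "\<lambda>\<xi>. fourier u \<xi> * cnj (fourier v \<xi>) * complex_of_real (norm \<xi> powr (- 2 * s))"
  let ?Q = "cov_op a s (\<lambda>y. complex_of_real (\<psi> y))"
  let ?c = "1 / (2 * pi) ^ CARD('d)"
  obtain g where g: "g \<in> L2" "AE x in lborel. g x = riesz_admissible.riesz_root s u x" "fgf W s (distr_of u) = W g"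
    using fgf_eq[OF u uc, of W] by blast
  obtain h where h: "h \<in> L2" "AE x in lborel. h x = riesz_admissible.riesz_root s v x" "fgf W s (distr_of v) = W h"
    using fgf_eq[OF v vc, of W] by blast
  have f: "mult_field a (fgf W s) \<psi> = W g" "mult_field a (fgf W s) \<phi> = W h"
    unfolding mult_field_def g(3)[symmetric] h(3)[symmetric] u_def v_def by simp_all
  have cov: "(LINT \<omega>|M. W h \<omega> * W g \<omega>) = ?c * Re (LINT \<xi>|lborel. ?V \<xi>)"
  proof -
    have m: "g \<in> borel_measurable borel" "h \<in> borel_measurable borel"
      "riesz_admissible.riesz_root s u \<in> borel_measurable borel" "riesz_admissible.riesz_root s v \<in> borel_measurable borel"
      using g(1) h(1) riesz_admissible.riesz_root_measurable[OF u] riesz_admissible.riesz_root_measurable[OF v]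
      by (auto simp: L2_def)
    note [measurable] = m
    have "(LINT x|lborel. h x * g x) = (LINT x|lborel. riesz_admissible.riesz_root s u x * riesz_admissible.riesz_root s v x)"
    proof (rule integral_cong_AE)
      show "AE x in lborel. h x * g x = riesz_admissible.riesz_root s u x * riesz_admissible.riesz_root s v x"
        using g(2) h(2) by eventually_elim simp
    qed measurable
    also have "\<dots> = ?c * Re (LINT \<xi>|lborel. ?V \<xi>)"
      using riesz_root_covariance(2)[OF u v uc vc] by simp
    finally show ?thesis unfolding white_noise_L2(2)[OF W h(1) g(1)] .
  qed
  have kernel: "integrable lborel (\<lambda>x. complex_of_real (\<phi> x) * ?Q x) \<and>
      (LINT x|lborel. complex_of_real (\<phi> x) * ?Q x) = complex_of_real (?c * Re (LINT \<xi>|lborel. ?V \<xi>))"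
  proof (cases "s = 0")
    \<comment> \<open>For s = 0 the kernel operator is the identity, and the claim is Parseval's
      identity for u and v.\<close>
    case True
    have Q: "complex_of_real (\<phi> x) * ?Q x = inv_fourier (fourier u) x * cnj (inv_fourier (fourier v) x)" for x
      unfolding fourier_inversion[OF ur] fourier_inversion[OF vr] using True
      by (simp add: cov_op_def fgf_kernel_op_def u_def v_def)
    have Q': "complex_of_real (\<phi> x) * ?Q x = v x * u x" for x
      using True by (simp add: cov_op_def fgf_kernel_op_def u_def v_def)
    have V: "(LINT \<xi>|lborel. ?V \<xi>) = (LINT \<xi>|lborel. fourier u \<xi> * cnj (fourier v \<xi>))"
    proof (rule integral_cong_AE)
      \<comment> \<open>\<open>0 powr 0\<close> is 0, so the integrands may differ at the origin and
        agree only almost everywhere.\<close>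
      show "AE \<xi> in lborel. ?V \<xi> = fourier u \<xi> * cnj (fourier v \<xi>)"
        using AE_lborel_singleton[of 0] by eventually_elim (simp add: True)
    qed (use rapid_measurable[OF rapid_fourier[OF ur]] rapid_measurable[OF rapid_fourier[OF vr]] in measurable)
    obtain B where B: "B \<ge> 0" "\<And>x. norm (v x) \<le> B" using rapid_bounded[OF vr] by blast
    have i: "integrable lborel (\<lambda>x. v x * u x)"
    proof (rule Bochner_Integration.integrable_bound)
      show "integrable lborel (\<lambda>x. B * norm (u x))" using rapid_integrable[OF ur] by simp
      show "AE x in lborel. norm (v x * u x) \<le> norm (B * norm (u x))"
        using B by (intro AE_I2) (auto simp: norm_mult abs_mult intro!: mult_right_mono)
    qed (use rapid_measurable[OF ur] rapid_measurable[OF vr] in measurable)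
    have "(LINT x|lborel. v x * u x) = complex_of_real (LINT x|lborel. a x * \<phi> x * (a x * \<psi> x))"
      unfolding integral_complex_of_real[symmetric] by (simp add: u_def v_def)
    moreover have "(LINT x|lborel. v x * u x) = complex_of_real ?c * (LINT \<xi>|lborel. ?V \<xi>)"
      unfolding Q'[symmetric] Q V using inv_fourier_parseval[OF rapid_integrable[OF rapid_fourier[OF ur]] rapid_fourier[OF vr]] by simp
    ultimately have "(LINT x|lborel. v x * u x) = complex_of_real (?c * Re (LINT \<xi>|lborel. ?V \<xi>))"
      by (simp add: complex_eq_iff)
    with i show ?thesis unfolding Q' by blast
  next
    case False
    with s have s': "0 < s" by simp
    obtain R where R: "R > 0" "\<And>x. norm x > R \<Longrightarrow> a x = 0" using test_functions_vanish[OF a] by blast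
    have z: "real CARD('d) / 2 \<le> s \<Longrightarrow> (LINT x|lborel. u x) = 0"
      using riesz_admissible.zero[OF u] by (simp add: fourier_at_0)
    have R': "norm x > R \<Longrightarrow> u x = 0" "norm x > R \<Longrightarrow> v x = 0" for x
      using R(2) by (simp_all add: u_def v_def)
    have Vi: "integrable lborel ?V" by (rule riesz_root_covariance(1)[OF u v uc vc])
    let ?K = "\<lambda>p. complex_of_real (fgf_kernel s (fst p) (snd p)) * (u (snd p) * cnj (v (fst p)))"
    have Ki: "integrable (lborel \<Otimes>\<^sub>M lborel) ?K"
      using riesz_form(1)[OF s' s(2) ur vr _ _ _ Vi, of R] R' z by (simp add: split_beta')
    have F: "Re (LINT \<xi>|lborel. ?V \<xi>) = (2 * pi) ^ CARD('d) * Re (LINT p|(lborel \<Otimes>\<^sub>M lborel). ?K p)"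
      by (rule riesz_form(2)[OF s' s(2) ur vr _ _ _ Vi, of R]) (fact R' z)+
    have Q: "(LINT y|lborel. ?K (x, y)) = complex_of_real (\<phi> x) * ?Q x" for x
    proof -
      have "(LINT y|lborel. ?K (x, y)) = (LINT y|lborel. v x * (complex_of_real (fgf_kernel s x y) * u y))"
        unfolding vc by (simp only: fst_conv snd_conv mult_ac)
      also have "\<dots> = v x * (LINT y|lborel. complex_of_real (fgf_kernel s x y) * u y)"
        by (rule integral_mult_right_zero)
      also have "\<dots> = complex_of_real (\<phi> x) * ?Q x"
        unfolding cov_op_def fgf_kernel_op_def using False by (simp add: u_def v_def mult_ac)
      finally show ?thesis .
    qed
    have I: "(LINT x|lborel. complex_of_real (\<phi> x) * ?Q x) = (LINT p|(lborel \<Otimes>\<^sub>M lborel). ?K p)"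
      using lborel_pair.integral_fst'[OF Ki] unfolding Q .
    \<comment> \<open>u and v are real-valued, so the double integral is real and the identity of
      real parts in \<open>riesz_form\<close> determines it.\<close>
    have "(LINT p|(lborel \<Otimes>\<^sub>M lborel). ?K p) =
        complex_of_real (LINT p|(lborel \<Otimes>\<^sub>M lborel). fgf_kernel s (fst p) (snd p) * (a (snd p) * \<psi> (snd p) * (a (fst p) * \<phi> (fst p))))"
      unfolding integral_complex_of_real[symmetric] by (simp add: u_def v_def)
    then have "(LINT p|(lborel \<Otimes>\<^sub>M lborel). ?K p) = complex_of_real (Re (LINT p|(lborel \<Otimes>\<^sub>M lborel). ?K p))"
      by simp
    also have "Re (LINT p|(lborel \<Otimes>\<^sub>M lborel). ?K p) = ?c * Re (LINT \<xi>|lborel. ?V \<xi>)"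
      unfolding F by simp
    finally show ?thesis
      using I lborel_pair.integrable_fst'[OF Ki] unfolding Q by simp
  qed
  show "integrable M (\<lambda>\<omega>. mult_field a (fgf W s) \<phi> \<omega> * mult_field a (fgf W s) \<psi> \<omega>) \<and>
      integrable lborel (\<lambda>x. complex_of_real (\<phi> x) * ?Q x) \<and>
      complex_of_real (LINT \<omega>|M. mult_field a (fgf W s) \<phi> \<omega> * mult_field a (fgf W s) \<psi> \<omega>) =
        (LINT x|lborel. complex_of_real (\<phi> x) * ?Q x)"
    unfolding f cov using white_noise_L2(1)[OF W h(1) g(1)] kernel by auto
qed

text \<open>Between points where a is nonzero the kernel may be cut off without changing the
  operator, which makes it integrable. For s = 0 the operator is multiplication by a^2, whose symbol
  does not depend on \<xi>.\<close>

lemma cov_op_classical: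
  fixes a :: "real ^ 'd \<Rightarrow> real"
  assumes a: "a \<in> test_functions UNIV" and s: "0 \<le> s" "s < real CARD('d) / 2 + 1"
  shows "classical_pdo (- 2 * s) (\<lambda>x \<xi>. complex_of_real ((a x)\<^sup>2 * norm \<xi> powr (- 2 * s))) (cov_op a s)"
    (is "classical_pdo _ ?p _")
proof (cases "s = 0")
  case True
  define b where "b x = complex_of_real (a x * a x)" for x
  have b: "rapid b" unfolding b_def[abs_def]
    using a by (intro test_functions_rapid[OF test_functions_of_real[OF test_functions_mult[OF a]]]) (simp add: test_functions_def)
  define c where "c = (\<lambda>z :: (real ^ 'd) \<times> (real ^ 'd). b (fst z))"
  have c: "c \<in> symbol_class 0" unfolding c_def by (intro symbol_classI Sym2_fst b)
  have z: "(\<lambda>_ :: (real ^ 'd) \<times> (real ^ 'd). 0) \<in> symbol_class m" for m by (intro symbol_classI Sym2.zero)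
  have "classical_symbol (- 2 * s) ?p c"
    unfolding classical_symbol_def
  \<comment> \<open>The expansion consists of c alone: the remainder is c for N = 0 and 0
    afterwards.\<close>
  proof (intro exI[of _ "\<lambda>j. if j = 0 then c else (\<lambda>_. 0)"] conjI allI impI)
    fix x \<xi> :: "real ^ 'd" and t :: real and j N :: nat
    show "(if j = 0 then c else (\<lambda>_. 0)) \<in> symbol_class (- 2 * s - real j)" using True c z by simp
    show "(if j = 0 then c else (\<lambda>_. 0)) (x, t *\<^sub>R \<xi>) =
        complex_of_real (t powr (- 2 * s - real j)) * (if j = 0 then c else (\<lambda>_. 0)) (x, \<xi>)" if "1 \<le> t"
      using that True by (simp add: c_def)
    show "(if (0::nat) = 0 then c else (\<lambda>_. 0)) (x, \<xi>) = ?p x \<xi>" if "1 \<le> norm \<xi>"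
      using that True by (auto simp: c_def b_def power2_eq_square)
    have "(\<Sum>j<N. (if j = 0 then c else (\<lambda>_. 0)) z) = (if N = 0 then 0 else c z)" for z
      by (induction N) auto
    then show "(\<lambda>w. c w - (\<Sum>j<N. (if j = 0 then c else (\<lambda>_. 0)) w)) \<in> symbol_class (- 2 * s - real N)"
      using True c z by (cases "N = 0") auto
  qed
  moreover have "cov_op a s \<psi> x = pdo c \<psi> x" if "\<psi> \<in> test_functions UNIV" for \<psi> x
    using fourier_inversion[OF test_functions_rapid[OF that], of x] True
    by (simp add: cov_op_def fgf_kernel_op_def pdo_def c_def inv_fourier_cmult b_def)
  ultimately show ?thesis unfolding classical_pdo_def by blast
next
  case False
  with s have s': "0 < s" by simp
  obtain R where R: "R > 0" "\<And>x. norm x > R \<Longrightarrow> a x = 0" using test_functions_vanish[OF a] by blast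
  define A where "A x = complex_of_real (a x)" for x
  \<comment> \<open>If a x and a y are nonzero then norm (x - y) \<le> 2 * R, and the step function
    of inner radius 2 * R vanishes there.\<close>
  define k where "k z = complex_of_real (fgf_kernel s z 0 * (1 - annular_step (2 * R) z))" for z :: "real ^ 'd"
  define c where "c = (\<lambda>(x, \<xi>). A x * fourier (\<lambda>z. A (x - z) * k z) \<xi>)"
  have A: "rapid A" unfolding A_def[abs_def] by (rule test_functions_rapid[OF test_functions_of_real[OF a]])
  have "2 * R > 0" using R(1) by simp
  note K = fgf_kernel_cutoff[OF s' s(2) this, folded k_def]
  have "classical_symbol (- 2 * s) ?p c"
    unfolding c_def
  proof (rule classical_symbol_convolution[OF A K(1) Sym_hom_symbol K(2)])
    fix x \<xi> :: "real ^ 'd" and t :: real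
    show "hom_symbol (- 2 * s) (t *\<^sub>R \<xi>) = complex_of_real (t powr (- 2 * s)) * hom_symbol (- 2 * s) \<xi>" if "norm \<xi> > 1 / 2" "t \<ge> 1"
    proof -
      have "1 * norm \<xi> \<le> t * norm \<xi>" using that by (intro mult_right_mono) auto
      then have "norm (t *\<^sub>R \<xi>) \<ge> 1 / 2" using that by simp
      then show ?thesis using that by (simp add: hom_symbol_eq powr_mult)
    qed
    show "?p x \<xi> = A x * A x * hom_symbol (- 2 * s) \<xi>" if "norm \<xi> \<ge> 1"
      using that by (simp add: hom_symbol_eq A_def power2_eq_square)
  qed
  moreover have "cov_op a s \<psi> x = pdo c \<psi> x" if "\<psi> \<in> test_functions UNIV" for \<psi> x
  proof (cases "a x = 0")
    case False
    have "complex_of_real (fgf_kernel s x y) * (A y * \<psi> y) = k (x - y) * (A y * \<psi> y)" for y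
    proof (cases "a y = 0")
      case False
      have "norm x \<le> R" "norm y \<le> R" using R(2)[of x] R(2)[of y] False \<open>a x \<noteq> 0\<close> by force+
      then have "norm (x - y) \<le> 2 * R" using norm_triangle_ineq4[of x y] by linarith
      moreover have "fgf_kernel s (x - y) 0 = fgf_kernel s x y" unfolding fgf_kernel_def diff_zero ..
      ultimately show ?thesis by (simp add: k_def annular_step_0)
    qed (simp add: A_def)
    then have "(LINT y|lborel. complex_of_real (fgf_kernel s x y) * (A y * \<psi> y)) = (LINT y|lborel. k (x - y) * (A y * \<psi> y))"
      by (intro Bochner_Integration.integral_cong refl)
    then show ?thesis
      unfolding c_def pdo_convolution[OF A K(1) test_functions_rapid[OF that]]
      using \<open>s \<noteq> 0\<close> by (simp add: cov_op_def fgf_kernel_op_def A_def)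
  next
    case True
    then show ?thesis
      unfolding c_def pdo_convolution[OF A K(1) test_functions_rapid[OF that]] by (simp add: cov_op_def A_def)
  qed
  ultimately show ?thesis unfolding classical_pdo_def by blast
qed

theorem proposition2p5:
  fixes M :: "'w measure"
    and W :: "(real ^ 'd \<Rightarrow> real) \<Rightarrow> 'w \<Rightarrow> real"
    and s :: real
    and D :: "(real ^ 'd) set"
    and a :: "real ^ 'd \<Rightarrow> real"
  assumes "prob_space M" and "complete_measure M"
    and "white_noise M W"
    and "CARD('d) \<in> {2, 3}"
    and "0 \<le> s" and "s < real CARD('d) / 2 + 1"
    and "open D" and "connected D" and "D \<noteq> {}" and "bounded D"
    and "a \<in> test_functions UNIV" and "supp a \<subseteq> D"
  shows "let f = mult_field a (fgf W s);
             A = mult_field_dom a (T_space s);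
             Q = cov_op a s;
             \<mu> = (\<lambda>x. (a x)\<^sup>2)
         in (AE \<omega> in M. compact (field_support A (\<lambda>\<phi>. f \<phi> \<omega>)) \<and>
                        field_support A (\<lambda>\<phi>. f \<phi> \<omega>) \<subseteq> D) \<and>
            covariance_operator M A f Q \<and>
            classical_pdo (- 2 * s)
              (\<lambda>x \<xi>. complex_of_real (\<mu> x * norm \<xi> powr (- 2 * s))) Q \<and>
            \<mu> \<in> test_functions D \<and> (\<forall>x. \<mu> x \<ge> 0)"
  unfolding Let_def
proof (intro conjI)
  let ?S = "\<lambda>\<omega>. field_support (mult_field_dom a (T_space s)) (\<lambda>\<phi>. mult_field a (fgf W s) \<phi> \<omega>)"
  have S: "compact (supp a)" "smooth a" using \<open>a \<in> test_functions UNIV\<close> by (simp_all add: test_functions_def)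
  \<comment> \<open>The complement of the support is a union of open sets; a closed subset of the
    compact set supp a is then compact.\<close>
  have closed: "closed (?S \<omega>)" for \<omega> unfolding field_support_def closed_def by auto
  show "AE \<omega> in M. compact (?S \<omega>) \<and> ?S \<omega> \<subseteq> D"
    using field_support_subset[OF \<open>white_noise M W\<close> \<open>a \<in> test_functions UNIV\<close> \<open>0 \<le> s\<close> \<open>s < real CARD('d) / 2 + 1\<close>]
  proof eventually_elim
    case (elim \<omega>)
    have "compact (supp a \<inter> ?S \<omega>)" by (rule compact_Int_closed[OF S(1) closed])
    with elim \<open>supp a \<subseteq> D\<close> show ?case by (simp add: Int_absorb1)
  qed
  show "covariance_operator M (mult_field_dom a (T_space s)) (mult_field a (fgf W s)) (cov_op a s)"
    by (intro fgf_covariance assms)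
  show "classical_pdo (- 2 * s) (\<lambda>x \<xi>. complex_of_real ((a x)\<^sup>2 * norm \<xi> powr (- 2 * s))) (cov_op a s)"
    by (intro cov_op_classical assms)
  have "a \<in> test_functions D" using assms by (simp add: test_functions_def)
  from test_functions_mult[OF this S(2)] show "(\<lambda>x. (a x)\<^sup>2) \<in> test_functions D"
    by (simp add: power2_eq_square)
qed simp

end
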